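(* Let $d \in \mathbb{N}$ and $\alpha>0$. Then every maximizer $Q \in H^{d/2}(\mathbb{R}^d)$ for $$S_d(\alpha) := \sup_{u \in H^{d/2}(\mathbb{R}^d),\ \|u\|_{H^{d/2}}\le 1} \int_{\mathbb{R}^d} \left(e^{\alpha|u|^2}-1\right) dx$$ has the form $$Q(x) = e^{i\beta} Q^\sharp(x-x_0) \quad \text{for a.e. } x \in \mathbb{R}^d,$$ with some constants $\beta \in \mathbb{R}$ and $x_0 \in \mathbb{R}^d$. In particular, $Q$ is radially symmetric and real-valued (up to translation and constant phase).
   Context: Functions are complex-valued. The norm on $H^{d/2}(\mathbb{R}^d)$ is $\|u\|_{H^{d/2}}^2 = \|(-\Delta)^{d/4}u\|_{L^2}^2 + \|u\|_{L^2}^2$. A maximizer is a function $Q$ with $\|Q\|_{H^{d/2}}\le 1$ that attains the supremum $S_d(\alpha)$. The Fourier transform is $\widehat{f}(\xi) = (\mathcal{F} f)(\xi) = \int_{\mathbb{R}^d} e^{-2\pi i x\cdot \xi} f(x)\,dx$, and $(-\Delta)^{d/4}$ has Fourier multiplier $|2\pi\xi|^{d/2}$. For a measurable $g : \mathbb{R}^d \to \mathbb{C}$ vanishing at infinity (i.e. $\{|g|>t\}$ has finite Lebesgue measure for every $t>0$), its symmetric-decreasing rearrangement is $g^*(x) = \int_0^\infty \mathbf{1}_{\{|g|>t\}^*}(x)\,dt$, where for a measurable set $A$ of finite measure $A^*=B_R(0)$ is the open ball centered at the origin with $|B_R(0)| = |A|$ ($A^*=\emptyset$ if $|A|=0$).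 The Fourier rearrangement of $f \in L^2(\mathbb{R}^d)$ is $f^\sharp = \mathcal{F}^{-1}\{(\mathcal{F} f)^*\}$. *)

theory Defs
  imports "HOL-Analysis.Analysis"
begin

text \<open>
  Elements of \<open>L\<^sup>2\<close> are represented by Lebesgue measurable functions, not by equivalence classes.
  Operators that are only determined up to null sets (the Plancherel transform, its inverse, and
  whatever is built from them) select some representative; every notion below is insensitive to
  which one is selected.
\<close>

definition L2_fun :: "((real, 'n::finite) vec \<Rightarrow> complex) set" where
  "L2_fun = {f. f \<in> borel_measurable lebesgue \<and> integrable lebesgue (\<lambda>x. (cmod (f x))\<^sup>2)}"

definition L2_nrm :: "((real, 'n::finite) vec \<Rightarrow> complex) \<Rightarrow> real" where
  "L2_nrm f = sqrt (\<integral>x. (cmod (f x))\<^sup>2 \<partial>lebesgue)"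

definition fourier_int :: "((real, 'n::finite) vec \<Rightarrow> complex) \<Rightarrow> (real, 'n) vec \<Rightarrow> complex" where
  "fourier_int f \<xi> = (\<integral>x. cis (- 2 * pi * (x \<bullet> \<xi>)) * f x \<partial>lebesgue)"

text \<open>
  The Plancherel transform is the continuous extension of \<^term>\<open>fourier_int\<close> from
  \<open>L\<^sup>1 \<inter> L\<^sup>2\<close> to \<open>L\<^sup>2\<close>; its graph is the \<open>L\<^sup>2\<close>-closure of the graph of the integral transform.
\<close>

definition is_fourier ::
  "((real, 'n::finite) vec \<Rightarrow> complex) \<Rightarrow> ((real, 'n) vec \<Rightarrow> complex) \<Rightarrow> bool" where
  "is_fourier f g \<longleftrightarrow> f \<in> L2_fun \<and> g \<in> L2_fun \<and>
     (\<exists>F :: nat \<Rightarrow> (real, 'n) vec \<Rightarrow> complex.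
        (\<forall>k. F k \<in> L2_fun \<and> integrable lebesgue (F k) \<and> fourier_int (F k) \<in> L2_fun) \<and>
        (\<lambda>k. L2_nrm (\<lambda>x. F k x - f x)) \<longlonglongrightarrow> 0 \<and>
        (\<lambda>k. L2_nrm (\<lambda>\<xi>. fourier_int (F k) \<xi> - g \<xi>)) \<longlonglongrightarrow> 0)"

definition fourier :: "((real, 'n::finite) vec \<Rightarrow> complex) \<Rightarrow> (real, 'n) vec \<Rightarrow> complex" where
  "fourier f = (SOME g. is_fourier f g)"

definition fourier_inv :: "((real, 'n::finite) vec \<Rightarrow> complex) \<Rightarrow> (real, 'n) vec \<Rightarrow> complex" where
  "fourier_inv g = (SOME f. is_fourier f g)"

definition frac_symbol ::
  "real \<Rightarrow> ((real, 'n::finite) vec \<Rightarrow> complex) \<Rightarrow> (real, 'n) vec \<Rightarrow> complex" where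
  "frac_symbol s u = (\<lambda>\<xi>. of_real (norm ((2 * pi) *\<^sub>R \<xi>) powr s) * fourier u \<xi>)"

text \<open>The operator \<open>(-\<Delta>)\<close> to the power \<open>s / 2\<close>, so that \<open>s = d / 2\<close> gives the power \<open>d / 4\<close>.\<close>

definition frac_laplacian ::
  "real \<Rightarrow> ((real, 'n::finite) vec \<Rightarrow> complex) \<Rightarrow> (real, 'n) vec \<Rightarrow> complex" where
  "frac_laplacian s u = fourier_inv (frac_symbol s u)"

definition sobolev :: "real \<Rightarrow> ((real, 'n::finite) vec \<Rightarrow> complex) set" where
  "sobolev s = {u \<in> L2_fun. frac_symbol s u \<in> L2_fun}"

definition sobolev_nrm :: "real \<Rightarrow> ((real, 'n::finite) vec \<Rightarrow> complex) \<Rightarrow> real" where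
  "sobolev_nrm s u = sqrt ((L2_nrm (frac_laplacian s u))\<^sup>2 + (L2_nrm u)\<^sup>2)"

text \<open>For a null set the radius is \<open>0\<close> and the open ball is empty.\<close>

definition rearr_set :: "(real, 'n::finite) vec set \<Rightarrow> (real, 'n) vec set" where
  "rearr_set A =
     ball 0 (THE R. R \<ge> 0 \<and> emeasure lebesgue (ball (0 :: (real, 'n) vec) R) = emeasure lebesgue A)"

text \<open>
  If \<open>g\<close> vanishes at infinity then the integral below is finite for all \<open>x \<noteq> 0\<close>. For essentially
  unbounded \<open>g\<close> it diverges at \<open>x = 0\<close>, where the Bochner integral returns \<open>0\<close> instead; this
  affects a single point only.
\<close>

definition rearr :: "((real, 'n::finite) vec \<Rightarrow> complex) \<Rightarrow> (real, 'n) vec \<Rightarrow> real" where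
  "rearr g x = (LINT t:{0<..}|lborel. indicator (rearr_set {y. cmod (g y) > t}) x)"

definition fourier_rearr ::
  "((real, 'n::finite) vec \<Rightarrow> complex) \<Rightarrow> (real, 'n) vec \<Rightarrow> complex" where
  "fourier_rearr f = fourier_inv (\<lambda>\<xi>. of_real (rearr (fourier f) \<xi>))"

definition exp_functional :: "real \<Rightarrow> ((real, 'n::finite) vec \<Rightarrow> complex) \<Rightarrow> ennreal" where
  "exp_functional \<alpha> u = (\<integral>\<^sup>+x. ennreal (exp (\<alpha> * (cmod (u x))\<^sup>2) - 1) \<partial>lebesgue)"

definition admissible :: "((real, 'n::finite) vec \<Rightarrow> complex) set" where
  "admissible = {u \<in> sobolev (real CARD('n) / 2). sobolev_nrm (real CARD('n) / 2) u \<le> 1}"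

text \<open>The supremum may be infinite; the first argument only carries the dimension.\<close>

definition S_sup :: "'n::finite itself \<Rightarrow> real \<Rightarrow> ennreal" where
  "S_sup _ \<alpha> = (SUP u \<in> (admissible :: ((real, 'n) vec \<Rightarrow> complex) set). exp_functional \<alpha> u)"

definition maximizer :: "real \<Rightarrow> ((real, 'n::finite) vec \<Rightarrow> complex) \<Rightarrow> bool" where
  "maximizer \<alpha> Q \<longleftrightarrow> Q \<in> admissible \<and> exp_functional \<alpha> Q = S_sup TYPE('n) \<alpha>"

definition radially_symmetric :: "((real, 'n::finite) vec \<Rightarrow> complex) \<Rightarrow> bool" where
  "radially_symmetric f \<longleftrightarrow> (\<exists>\<phi> :: real \<Rightarrow> complex. AE x in lebesgue. f x = \<phi> (norm x))"

definition real_valued :: "((real, 'n::finite) vec \<Rightarrow> complex) \<Rightarrow> bool" where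
  "real_valued f \<longleftrightarrow> (AE x in lebesgue. f x \<in> \<real>)"

end

theory Submission
  imports Defs "HOL-Probability.Probability"
begin

text \<open>
  Expanding the exponential, the functional is a positive combination of the squared \<open>L\<^sup>2\<close> norms of the
  powers \<open>Q\<^sup>k\<close>, that is, of the \<open>k\<close>-fold convolutions of the transform \<open>g\<close> of \<open>Q\<close>.  By Riesz's inequality on lines these do not
  decrease when \<open>|g|\<close> is replaced by its Steiner symmetrization in any direction, whereas the weighted
  norm \<open>\<integral> (1 + |2 \<pi> \<xi>|\<^sup>d) |g|\<^sup>2\<close>, which is the Sobolev norm, strictly decreases unless \<open>|g|\<close> is already
  symmetric.  Since the value of a single function is finite (although the supremum need not be), a
  maximizer has \<open>|g|\<close> symmetric in every direction, hence radially decreasing and equal to its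
  rearrangement.  Replacing \<open>g\<close> by \<open>|g|\<close> must not increase the functional either, so \<open>|g * g| = |g| * |g|\<close>
  almost everywhere.  On the ball where \<open>g \<noteq> 0\<close> the phase of \<open>g y * g z\<close> therefore depends on \<open>y + z\<close> only,
  and a local version of Cauchy's equation makes the phase of \<open>g\<close> affine; this is the translation and
  the constant phase of \<open>Q\<close>.
\<close>

section \<open>Riesz rearrangement on the real line\<close>

text \<open>No limit of iterated symmetrizations is taken. Invariance under each single direction,
  up to null sets, already forces the superlevel sets to be balls, so only one Steiner
  symmetrization is ever compared with |g|. Riesz's inequality is used in its weak form alone; its
  equality cases are delicate, and they are bypassed because all strictness comes from the weight 1
  + |2 \<pi> \<xi>|^d, which increases strictly with |\<xi>|. A smaller norm contradicts maximality
  only through rescaling: enlarging the symmetrized function to the unit ball multiplies its value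
  by a factor above 1, and this is a contradiction only for a value that is neither infinite nor 0.
  Finiteness is the reason for the Trudinger bounds; it has to be proved for every \<alpha> > 0, so
  a large \<alpha> is handled by splitting off a bounded part of the function. In the comparison of
  g with |g| finiteness serves again, since it allows equality of the sums to be read term by term;
  the term of Q^2 is enough to determine the phase.\<close>

lemma quantile_exists:
  fixes A :: "real set" and m :: real
  assumes A[measurable]: "A \<in> sets borel" and m: "emeasure lborel A = ennreal m" and "m > 0"
  obtains \<phi> :: "real \<Rightarrow> real" where "\<phi> \<in> borel_measurable borel"
    "\<And>x y. 0 < x \<Longrightarrow> x \<le> y \<Longrightarrow> y < m \<Longrightarrow> \<phi> x \<le> \<phi> y"
    "\<And>h. h \<in> borel_measurable borel \<Longrightarrow>
       (\<integral>\<^sup>+x. indicator A x * h x \<partial>lborel) = (\<integral>\<^sup>+s. indicator {0<..<m} s * h (\<phi> s) \<partial>lborel)"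
proof -
  \<comment> \<open>Inverse transform sampling: the quantile function of the uniform distribution on
    \<open>A\<close>, stretched from (0, 1) to (0, m), is monotone and carries Lebesgue measure on
    the interval to Lebesgue measure on \<open>A\<close>.\<close>
  define M where "M = distr (uniform_measure lborel A) borel (\<lambda>x. x)"
  have "prob_space (uniform_measure lborel A)"
    by (rule prob_space_uniform_measure) (use m \<open>m > 0\<close> in auto)
  then have ps: "prob_space M"
    unfolding M_def by (rule prob_space.prob_space_distr) simp
  have "real_distribution M"
    using ps by (simp add: real_distribution_def real_distribution_axioms_def M_def)
  then interpret M: cdf_distribution M
    unfolding cdf_distribution_def .
  \<comment> \<open>The quantile function is measurable on (0, 1) only; extending it by 0 gives a
    Borel function on the line.\<close>
  define J where "J = (\<lambda>s. if s \<in> {0<..<1} then M.I s else 0)"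
  have J[measurable]: "J \<in> borel_measurable borel"
  proof -
    have "{s. s \<in> {0<..<1}} = {0<..<1::real}" by auto
    then show ?thesis
      unfolding J_def using M.measurable_CI by (subst measurable_If_restrict_space_iff) (simp_all del: greaterThanLessThan_iff)
  qed
  define \<phi> where "\<phi> s = J (s / m)" for s
  show ?thesis
  proof
    show [measurable]: "\<phi> \<in> borel_measurable borel" unfolding \<phi>_def by measurable
    show "\<phi> x \<le> \<phi> y" if "0 < x" "x \<le> y" "y < m" for x y
      using monotone_onD[OF M.mono_I, of "x/m" "y/m"] that \<open>m > 0\<close>
      unfolding \<phi>_def J_def by (auto simp: field_simps)
    fix h :: "real \<Rightarrow> ennreal" assume h[measurable]: "h \<in> borel_measurable borel"
    have "(\<integral>\<^sup>+x. indicator A x * h x \<partial>lborel) = ennreal m * (\<integral>\<^sup>+x. h x \<partial>M)"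
    proof -
      have "(\<integral>\<^sup>+x. h x \<partial>M) = (\<integral>\<^sup>+x. h x \<partial>uniform_measure lborel A)"
        unfolding M_def by (subst nn_integral_distr) auto
      also have "\<dots> = (\<integral>\<^sup>+x. h x * indicator A x \<partial>lborel) / ennreal m"
        using m \<open>m > 0\<close> by (subst nn_integral_uniform_measure) auto
      finally have "ennreal m * (\<integral>\<^sup>+x. h x \<partial>M) = (\<integral>\<^sup>+x. h x * indicator A x \<partial>lborel) * ennreal m / ennreal m"
        by (simp add: ennreal_times_divide mult.commute)
      also have "\<dots> = (\<integral>\<^sup>+x. h x * indicator A x \<partial>lborel)"
        using \<open>m > 0\<close> by (intro ennreal_mult_divide_eq) auto
      finally show ?thesis by (simp add: mult.commute)
    qed
    also have "(\<integral>\<^sup>+x. h x \<partial>M) = (\<integral>\<^sup>+x. h x \<partial>distr (restrict_space lborel {0<..<1::real}) borel M.I)"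
      by (simp only: M.distr_I_eq_M)
    also have "\<dots> = (\<integral>\<^sup>+s. h (M.I s) \<partial>restrict_space lborel {0<..<1::real})"
      using M.measurable_CI by (subst nn_integral_distr) auto
    also have "\<dots> = (\<integral>\<^sup>+s. h (M.I s) * indicator {0<..<1} s \<partial>lborel)"
      by (subst nn_integral_restrict_space) auto
    also have "\<dots> = (\<integral>\<^sup>+s. indicator {0<..<1} s * h (J s) \<partial>lborel)"
      by (intro nn_integral_cong) (auto simp: J_def indicator_def)
    also have "\<dots> = (1/m) * (\<integral>\<^sup>+s. indicator {0<..<1} (s/m) * h (J (s/m)) \<partial>lborel)"
      using \<open>m > 0\<close> by (subst nn_integral_real_affine[where c="1/m" and t=0]) auto
    also have "ennreal m * (ennreal (1/m) * (\<integral>\<^sup>+s. indicator {0<..<1} (s/m) * h (J (s/m)) \<partial>lborel))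
      = (\<integral>\<^sup>+s. indicator {0<..<1} (s/m) * h (J (s/m)) \<partial>lborel)"
      using \<open>m > 0\<close> by (simp add: mult.assoc[symmetric] ennreal_mult'[symmetric])
    also have "\<dots> = (\<integral>\<^sup>+s. indicator {0<..<m} s * h (\<phi> s) \<partial>lborel)"
      using \<open>m > 0\<close> by (intro nn_integral_cong) (auto simp: \<phi>_def indicator_def field_simps)
    finally show "(\<integral>\<^sup>+x. indicator A x * h x \<partial>lborel)
       = (\<integral>\<^sup>+s. indicator {0<..<m} s * h (\<phi> s) \<partial>lborel)" .
  qed
qed

text \<open>The common point \<open>p\<close> is a null set. Both half-lines are closed because the
  two legs of a hook meet at its corner and only weak inequalities are known along them.\<close>

lemma emeasure_split_point:
  fixes D :: "real set"
  assumes [measurable]: "D \<in> sets borel"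
  shows "emeasure lborel (D \<inter> {..p}) + emeasure lborel (D \<inter> {p..}) = emeasure lborel D"
proof -
  have "emeasure lborel (D \<inter> {p..}) = emeasure lborel (D \<inter> {p<..})"
    using AE_lborel_singleton[of p] by (intro emeasure_eq_AE) (auto simp: less_le)
  moreover have "emeasure lborel (D \<inter> {..p}) + emeasure lborel (D \<inter> {p<..})
    = emeasure lborel ((D \<inter> {..p}) \<union> (D \<inter> {p<..}))"
    by (rule plus_emeasure) auto
  moreover have "(D \<inter> {..p}) \<union> (D \<inter> {p<..}) = D" by auto
  ultimately show ?thesis by simp
qed

lemma nn_integral_shift:
  fixes f :: "'a::euclidean_space \<Rightarrow> ennreal"
  assumes [measurable]: "f \<in> borel_measurable borel"
  shows "(\<integral>\<^sup>+x. f (a + x) \<partial>lborel) = (\<integral>\<^sup>+x. f x \<partial>lborel)"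
  by (subst (2) lborel_distr_plus[of a, symmetric]) (simp add: nn_integral_distr)

text \<open>The rectangle \<open>(0, m) \<times> (0, n)\<close> is cut into hooks: the vertical segment over \<open>s\<close> of height
  \<open>n - s\<close>, followed by the horizontal segment at height \<open>n - s\<close>.  Along a hook the sum
  \<open>\<phi> x + \<psi> y\<close> is monotone, so a hook meets each point of \<open>D\<close> at most once.\<close>

lemma riesz_hook_bound:
  fixes A B D :: "real set" and m n :: real
  assumes [measurable]: "A \<in> sets borel" "B \<in> sets borel" "D \<in> sets borel"
    and m: "emeasure lborel A = ennreal m" "m > 0"
    and n: "emeasure lborel B = ennreal n" "n > 0"
  shows "(\<integral>\<^sup>+a. \<integral>\<^sup>+b. indicator A a * indicator B b * indicator D (a + b) \<partial>lborel \<partial>lborel)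
    \<le> (\<integral>\<^sup>+s. indicator {0<..<min m n} s * min (emeasure lborel D) (ennreal (m + n - 2 * s)) \<partial>lborel)"
    (is "?T \<le> _")
proof -
  obtain \<phi> where [measurable]: "\<phi> \<in> borel_measurable borel"
    and \<phi>_mono: "\<And>x y. 0 < x \<Longrightarrow> x \<le> y \<Longrightarrow> y < m \<Longrightarrow> \<phi> x \<le> \<phi> y"
    and \<phi>: "\<And>h. h \<in> borel_measurable borel \<Longrightarrow>
       (\<integral>\<^sup>+x. indicator A x * h x \<partial>lborel) = (\<integral>\<^sup>+s. indicator {0<..<m} s * h (\<phi> s) \<partial>lborel)"
    using quantile_exists[OF assms(1) m] by blast
  obtain \<psi> where [measurable]: "\<psi> \<in> borel_measurable borel"
    and \<psi>_mono: "\<And>x y. 0 < x \<Longrightarrow> x \<le> y \<Longrightarrow> y < n \<Longrightarrow> \<psi> x \<le> \<psi> y"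
    and \<psi>: "\<And>h. h \<in> borel_measurable borel \<Longrightarrow>
       (\<integral>\<^sup>+x. indicator B x * h x \<partial>lborel) = (\<integral>\<^sup>+s. indicator {0<..<n} s * h (\<psi> s) \<partial>lborel)"
    using quantile_exists[OF assms(2) n] by blast
  define I where "I x y = (indicator {0<..<m} x * indicator {0<..<n} y * indicator D (\<phi> x + \<psi> y) :: ennreal)" for x y
  have [measurable]: "(\<lambda>p. I (fst p) (snd p)) \<in> borel_measurable (borel \<Otimes>\<^sub>M borel)"
    unfolding I_def by measurable
  have "?T = (\<integral>\<^sup>+a. indicator A a * (\<integral>\<^sup>+b. indicator B b * indicator D (a + b) \<partial>lborel) \<partial>lborel)"
    by (simp add: mult.assoc nn_integral_cmult)
  also have "\<dots> = (\<integral>\<^sup>+x. indicator {0<..<m} x * (\<integral>\<^sup>+b. indicator B b * indicator D (\<phi> x + b) \<partial>lborel) \<partial>lborel)"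
    by (rule \<phi>) measurable
  also have "\<dots> = (\<integral>\<^sup>+x. indicator {0<..<m} x * (\<integral>\<^sup>+y. indicator {0<..<n} y * indicator D (\<phi> x + \<psi> y) \<partial>lborel) \<partial>lborel)"
    by (subst \<psi>) auto
  also have "\<dots> = (\<integral>\<^sup>+x. \<integral>\<^sup>+y. I x y \<partial>lborel \<partial>lborel)"
    unfolding I_def by (simp add: mult.assoc nn_integral_cmult)
  also have "\<dots> = (\<integral>\<^sup>+x. \<integral>\<^sup>+y. I x y * indicator {..<n-x} y + I x y * indicator {n-x..} y \<partial>lborel \<partial>lborel)"
    by (intro nn_integral_cong) (auto simp: indicator_def)
  also have "\<dots> = (\<integral>\<^sup>+x. (\<integral>\<^sup>+y. I x y * indicator {..<n-x} y \<partial>lborel) + (\<integral>\<^sup>+y. I x y * indicator {n-x..} y \<partial>lborel) \<partial>lborel)"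
    by (intro nn_integral_cong nn_integral_add) (auto simp: I_def)
  also have "\<dots> = (\<integral>\<^sup>+x. \<integral>\<^sup>+y. I x y * indicator {..<n-x} y \<partial>lborel \<partial>lborel) + (\<integral>\<^sup>+x. \<integral>\<^sup>+y. I x y * indicator {n-x..} y \<partial>lborel \<partial>lborel)"
    by (rule nn_integral_add) (measurable; simp add: I_def indicator_def[of "{..<_}"] indicator_def[of "{_..}"])+
  also have "(\<integral>\<^sup>+x. \<integral>\<^sup>+y. I x y * indicator {n-x..} y \<partial>lborel \<partial>lborel)
     = (\<integral>\<^sup>+y. \<integral>\<^sup>+x. I x y * indicator {n-x..} y \<partial>lborel \<partial>lborel)"
    by (rule lborel_pair.Fubini') (simp add: I_def split_beta' indicator_def[of "{_..}"])
  \<comment> \<open>Substituting y = n - s labels the horizontal pieces by the hook they belong to,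
    so that both legs can be added under one integral over \<open>s\<close>.\<close>
  also have "\<dots> = (\<integral>\<^sup>+s. \<integral>\<^sup>+x. I x (n - s) * indicator {s..} x \<partial>lborel \<partial>lborel)"
    by (subst nn_integral_real_affine[where c="-1" and t=n])
       (auto simp: I_def indicator_def[of "{_..}"] intro!: nn_integral_cong)
  also have "(\<integral>\<^sup>+x. \<integral>\<^sup>+y. I x y * indicator {..<n-x} y \<partial>lborel \<partial>lborel)
    + (\<integral>\<^sup>+s. \<integral>\<^sup>+x. I x (n - s) * indicator {s..} x \<partial>lborel \<partial>lborel)
    = (\<integral>\<^sup>+s. (\<integral>\<^sup>+y. I s y * indicator {..<n-s} y \<partial>lborel) + (\<integral>\<^sup>+x. I x (n - s) * indicator {s..} x \<partial>lborel) \<partial>lborel)"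
    by (rule nn_integral_add[symmetric]) (simp_all add: I_def indicator_def[of "{..<_}"] indicator_def[of "{_..}"])
  also have "\<dots> \<le> (\<integral>\<^sup>+s. indicator {0<..<min m n} s * min (emeasure lborel D) (ennreal (m + n - 2 * s)) \<partial>lborel)"
  proof (rule nn_integral_mono)
    fix s :: real
    let ?\<alpha> = "\<integral>\<^sup>+y. I s y * indicator {..<n-s} y \<partial>lborel"
    let ?\<beta> = "\<integral>\<^sup>+x. I x (n - s) * indicator {s..} x \<partial>lborel"
    show "?\<alpha> + ?\<beta> \<le> indicator {0<..<min m n} s * min (emeasure lborel D) (ennreal (m + n - 2 * s))"
    proof (cases "s \<in> {0<..<min m n}")
      case False
      have "I s y * indicator {..<n-s} y = 0" "I x (n - s) * indicator {s..} x = 0" for x y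
        using False unfolding I_def indicator_def by auto
      then show ?thesis by (simp only: nn_integral_const) simp
    next
      case True
      have "?\<alpha> \<le> (\<integral>\<^sup>+y. indicator {0<..<n-s} y \<partial>lborel)"
        by (intro nn_integral_mono) (auto simp: I_def indicator_def)
      also have "\<dots> = ennreal (n - s)" using True by simp
      finally have 1: "?\<alpha> \<le> ennreal (n - s)" .
      have "?\<beta> \<le> (\<integral>\<^sup>+y. indicator {s..<m} y \<partial>lborel)"
        by (intro nn_integral_mono) (auto simp: I_def indicator_def)
      also have "\<dots> = ennreal (m - s)" using True by simp
      finally have "?\<beta> \<le> ennreal (m - s)" .
      with 1 have "?\<alpha> + ?\<beta> \<le> ennreal (n - s) + ennreal (m - s)" by (rule add_mono)
      also have "\<dots> = ennreal (m + n - 2 * s)" using True by (simp flip: ennreal_plus add: algebra_simps)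
      finally have le1: "?\<alpha> + ?\<beta> \<le> ennreal (m + n - 2 * s)" .
      \<comment> \<open>The value of the sum at the corner of the hook. Monotonicity keeps the
        vertical leg below \<open>?p\<close> and the horizontal leg above it, so the two legs
        together account for at most the measure of \<open>D\<close>; the other bound, m + n - 2 s,
        is the total length of the hook.\<close>
      let ?p = "\<phi> s + \<psi> (n - s)"
      have "?\<alpha> \<le> (\<integral>\<^sup>+y. indicator {0<..<n} y * (indicator {..?p} (\<phi> s + \<psi> y) * indicator D (\<phi> s + \<psi> y)) \<partial>lborel)"
        using True by (intro nn_integral_mono) (auto simp: I_def indicator_def intro!: \<psi>_mono)
      also have "\<dots> = (\<integral>\<^sup>+y. indicator B y * (indicator {..?p} (\<phi> s + y) * indicator D (\<phi> s + y)) \<partial>lborel)"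
        by (rule \<psi>[symmetric]) measurable
      also have "\<dots> \<le> (\<integral>\<^sup>+y. indicator (D \<inter> {..?p}) (\<phi> s + y) \<partial>lborel)"
        by (intro nn_integral_mono) (auto simp: indicator_def)
      also have "\<dots> = emeasure lborel (D \<inter> {..?p})" by (subst nn_integral_shift) auto
      finally have 2: "?\<alpha> \<le> emeasure lborel (D \<inter> {..?p})" .
      have "?\<beta> \<le> (\<integral>\<^sup>+x. indicator {0<..<m} x * (indicator {?p..} (\<phi> x + \<psi> (n - s)) * indicator D (\<phi> x + \<psi> (n - s))) \<partial>lborel)"
        using True by (intro nn_integral_mono) (auto simp: I_def indicator_def intro!: \<phi>_mono)
      also have "\<dots> = (\<integral>\<^sup>+x. indicator A x * (indicator {?p..} (x + \<psi> (n - s)) * indicator D (x + \<psi> (n - s))) \<partial>lborel)"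
        by (rule \<phi>[symmetric]) measurable
      also have "\<dots> \<le> (\<integral>\<^sup>+x. indicator (D \<inter> {?p..}) (\<psi> (n - s) + x) \<partial>lborel)"
        by (intro nn_integral_mono) (auto simp: indicator_def add.commute)
      also have "\<dots> = emeasure lborel (D \<inter> {?p..})" by (subst nn_integral_shift) auto
      finally have "?\<beta> \<le> emeasure lborel (D \<inter> {?p..})" .
      with 2 have "?\<alpha> + ?\<beta> \<le> emeasure lborel (D \<inter> {..?p}) + emeasure lborel (D \<inter> {?p..})" by (rule add_mono)
      also have "\<dots> = emeasure lborel D" by (rule emeasure_split_point) simp
      finally show ?thesis using le1 True by simp
    qed
  qed
  finally show ?thesis .
qed

section \<open>Centered intervals and the layer cake formula\<close>

definition conv :: "('a::euclidean_space \<Rightarrow> ennreal) \<Rightarrow> ('a \<Rightarrow> ennreal) \<Rightarrow> 'a \<Rightarrow> ennreal" where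
  "conv f g x = (\<integral>\<^sup>+y. f y * g (x - y) \<partial>lborel)"

lemma conv_measurable[measurable]:
  assumes [measurable]: "f \<in> borel_measurable borel" "g \<in> borel_measurable borel"
  shows "conv f g \<in> borel_measurable borel"
  unfolding conv_def by measurable

text \<open>The open interval of length \<open>c\<close> about 0, written so that an infinite
  \<open>c\<close> gives the whole line without a case distinction.\<close>

definition centered :: "ennreal \<Rightarrow> real set" where
  "centered c = {s. ennreal (2 * \<bar>s\<bar>) < c}"

lemma centered_measurable[measurable]: "centered c \<in> sets borel"
  unfolding centered_def by measurable

lemma centered_real: "r \<ge> 0 \<Longrightarrow> centered (ennreal r) = {-r/2<..<r/2}"
  by (auto simp: centered_def ennreal_less_iff)

lemma emeasure_centered[simp]: "emeasure lborel (centered c) = c"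
proof (cases c)
  case (real r)
  then show ?thesis by (simp add: centered_real)
next
  case top
  then have "centered c = UNIV" by (simp add: centered_def)
  then show ?thesis using top by simp
qed

lemma centered_mono: "c \<le> d \<Longrightarrow> centered c \<subseteq> centered d"
  by (auto simp: centered_def)

lemma centered_Int: "centered c \<inter> centered d = centered (min c d)"
  by (auto simp: centered_def)

text \<open>The integrand of the layer cake formula. The height \<open>t\<close> is real while
  \<open>x\<close> may be infinite, so that infinite function values are covered by the same
  formula.\<close>

definition layer :: "ennreal \<Rightarrow> real \<Rightarrow> ennreal" where
  "layer x t = (if 0 < t \<and> ennreal t < x then 1 else 0)"

lemma layer_measurable[measurable]:
  assumes [measurable]: "f \<in> borel_measurable M" "g \<in> borel_measurable M"
  shows "(\<lambda>x. layer (f x) (g x)) \<in> borel_measurable M"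
  unfolding layer_def by measurable

lemma nn_integral_layer[simp]: "(\<integral>\<^sup>+t. layer x t \<partial>lborel) = x"
proof (cases x)
  case (real r)
  then have "(\<integral>\<^sup>+t. layer x t \<partial>lborel) = (\<integral>\<^sup>+t. indicator {0<..<r} t \<partial>lborel)"
    by (intro nn_integral_cong) (auto simp: layer_def indicator_def ennreal_less_iff)
  then show ?thesis using real by simp
next
  case top
  then have "(\<integral>\<^sup>+t. layer x t \<partial>lborel) = (\<integral>\<^sup>+t. indicator {0<..} t \<partial>(lborel::real measure))"
    by (intro nn_integral_cong) (auto simp: layer_def indicator_def)
  also have "\<dots> = emeasure lborel {0::real<..}" by simp
  also have "\<dots> = \<infinity>"
  proof -
    have "ennreal (real n) \<le> emeasure lborel {0::real<..}" for n
    proof -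
      have "ennreal (real n) = emeasure lborel {0<..<real n}" by simp
      also have "\<dots> \<le> emeasure lborel {0::real<..}" by (rule emeasure_mono) auto
      finally show ?thesis .
    qed
    then show ?thesis
      by (metis ennreal_of_nat_eq_real_of_nat infinity_ennreal_def ennreal_SUP_of_nat_eq_top SUP_least top.extremum_unique)
  qed
  finally show ?thesis using top by simp
qed

lemma nn_integral_layer_ge:
  "\<tau> \<ge> 0 \<Longrightarrow> (\<integral>\<^sup>+t. indicator {\<tau><..} t * layer x t \<partial>lborel) = x - ennreal \<tau>"
proof -
  assume "\<tau> \<ge> 0"
  have "(\<integral>\<^sup>+t. indicator {\<tau><..} t * layer x t \<partial>lborel) = (\<integral>\<^sup>+t. indicator {\<tau><..} (\<tau> + t) * layer x (\<tau> + t) \<partial>lborel)"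
    by (rule nn_integral_shift[symmetric]) measurable
  also have "\<dots> = (\<integral>\<^sup>+t. layer (x - ennreal \<tau>) t \<partial>lborel)"
    using \<open>\<tau> \<ge> 0\<close> by (intro nn_integral_cong) (cases x; auto simp: layer_def indicator_def ennreal_less_iff ennreal_minus simp flip: ennreal_plus)
  finally show ?thesis by simp
qed

text \<open>Exhaustion by balls. It is used where an estimate must first be made on a set of finite
  measure, so that equal terms can be cancelled in extended arithmetic.\<close>

lemma nn_integral_le_bounded:
  fixes f :: "'a::euclidean_space \<Rightarrow> ennreal"
  assumes [measurable]: "f \<in> borel_measurable borel"
    and le: "\<And>n::nat. (\<integral>\<^sup>+x. indicator (cball 0 (real n)) x * f x \<partial>lborel) \<le> c"
  shows "(\<integral>\<^sup>+x. f x \<partial>lborel) \<le> c"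
proof -
  have "f x = (SUP n. indicator (cball 0 (real n)) x * f x)" for x
  proof (rule antisym)
    obtain n where "norm x \<le> real n" using real_arch_simple by blast
    then show "f x \<le> (SUP n. indicator (cball 0 (real n)) x * f x)"
      by (intro SUP_upper2[of n]) auto
  qed (auto intro!: SUP_least simp: indicator_def)
  then have "(\<integral>\<^sup>+x. f x \<partial>lborel) = (\<integral>\<^sup>+x. (SUP n. indicator (cball 0 (real n)) x * f x) \<partial>lborel)"
    by simp
  also have "\<dots> = (SUP n. \<integral>\<^sup>+x. indicator (cball 0 (real n)) x * f x \<partial>lborel)"
    by (intro nn_integral_monotone_convergence_SUP) (auto simp: incseq_def le_fun_def indicator_def)
  also have "\<dots> \<le> c" using le by (intro SUP_least)
  finally show ?thesis .
qed

section \<open>Symmetric decreasing functions and domination under convolution\<close>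

definition symdec :: "(real \<Rightarrow> ennreal) \<Rightarrow> bool" where
  "symdec H \<longleftrightarrow> H \<in> borel_measurable borel \<and> (\<forall>s t. \<bar>s\<bar> \<le> \<bar>t\<bar> \<longrightarrow> H t \<le> H s)"

lemma symdecD: "symdec H \<Longrightarrow> \<bar>s\<bar> \<le> \<bar>t\<bar> \<Longrightarrow> H t \<le> H s"
  and symdec_measurable: "symdec H \<Longrightarrow> H \<in> borel_measurable borel"
  by (auto simp: symdec_def)

lemma symdec_even: "symdec H \<Longrightarrow> H (- t) = H t"
  by (intro antisym symdecD[of H]) auto

text \<open>Unlike equimeasurability, this relation is stable under convolution, so that Riesz's inequality
  extends to convolution powers.\<close>

definition dominated :: "(real \<Rightarrow> ennreal) \<Rightarrow> (real \<Rightarrow> ennreal) \<Rightarrow> bool" where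
  "dominated h H \<longleftrightarrow> (\<forall>C\<in>sets borel. (\<integral>\<^sup>+s. indicator C s * h s \<partial>lborel)
     \<le> (\<integral>\<^sup>+s. indicator (centered (emeasure lborel C)) s * H s \<partial>lborel))"

lemma dominatedD:
  "dominated h H \<Longrightarrow> C \<in> sets borel \<Longrightarrow> (\<integral>\<^sup>+s. indicator C s * h s \<partial>lborel)
     \<le> (\<integral>\<^sup>+s. indicator (centered (emeasure lborel C)) s * H s \<partial>lborel)"
  by (auto simp: dominated_def)

lemma dominatedI_finite:
  assumes [measurable]: "h \<in> borel_measurable borel"
    and le: "\<And>C. C \<in> sets borel \<Longrightarrow> emeasure lborel C < \<infinity> \<Longrightarrow> (\<integral>\<^sup>+s. indicator C s * h s \<partial>lborel)
     \<le> (\<integral>\<^sup>+s. indicator (centered (emeasure lborel C)) s * H s \<partial>lborel)"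
  shows "dominated h H"
  unfolding dominated_def
proof safe
  fix C :: "real set" assume [measurable]: "C \<in> sets borel"
  show "(\<integral>\<^sup>+s. indicator C s * h s \<partial>lborel)
     \<le> (\<integral>\<^sup>+s. indicator (centered (emeasure lborel C)) s * H s \<partial>lborel)"
  proof (rule nn_integral_le_bounded)
    fix n
    let ?C = "C \<inter> cball 0 (real n)"
    have "(\<integral>\<^sup>+s. indicator (cball 0 (real n)) s * (indicator C s * h s) \<partial>lborel) = (\<integral>\<^sup>+s. indicator ?C s * h s \<partial>lborel)"
      by (intro nn_integral_cong) (auto simp: indicator_def)
    also have "\<dots> \<le> (\<integral>\<^sup>+s. indicator (centered (emeasure lborel ?C)) s * H s \<partial>lborel)"
    proof (rule le)
      have "emeasure lborel ?C \<le> emeasure lborel (cball 0 (real n) :: real set)" by (rule emeasure_mono) auto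
      also have "\<dots> < \<infinity>" by (rule emeasure_lborel_cball_finite)
      finally show "emeasure lborel ?C < \<infinity>" .
    qed measurable
    also have "\<dots> \<le> (\<integral>\<^sup>+s. indicator (centered (emeasure lborel C)) s * H s \<partial>lborel)"
      using centered_mono[OF emeasure_mono[of ?C C lborel]]
      by (intro nn_integral_mono mult_right_mono) (auto simp: indicator_def)
    finally show "(\<integral>\<^sup>+s. indicator (cball 0 (real n)) s * (indicator C s * h s) \<partial>lborel)
      \<le> (\<integral>\<^sup>+s. indicator (centered (emeasure lborel C)) s * H s \<partial>lborel)" .
  qed measurable
qed

text \<open>The convolution of the two centered intervals is the trapezoid min(m, n, (m + n) / 2 -
  |t|), cut off at 0. Its superlevel set at height s < min(m, n) is the centered interval of length
  m + n - 2 s, so the hook bound is the integral of the trapezoid over the centered interval of the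
  measure of \<open>D\<close>, sliced by height.\<close>

lemma riesz_sets:
  fixes A B :: "real set"
  assumes [measurable]: "A \<in> sets borel" "B \<in> sets borel"
    and fin: "emeasure lborel A < \<infinity>" "emeasure lborel B < \<infinity>"
  shows "dominated (conv (indicator A) (indicator B))
     (conv (indicator (centered (emeasure lborel A))) (indicator (centered (emeasure lborel B))))"
  unfolding dominated_def
proof safe
  fix D :: "real set" assume [measurable]: "D \<in> sets borel"
  obtain m where m: "emeasure lborel A = ennreal m" "m \<ge> 0"
    using fin(1) by (cases "emeasure lborel A") auto
  obtain n where n: "emeasure lborel B = ennreal n" "n \<ge> 0"
    using fin(2) by (cases "emeasure lborel B") auto
  let ?d = "emeasure lborel D"
  let ?A = "centered (ennreal m)" and ?B = "centered (ennreal n)"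
  have eq: "(\<integral>\<^sup>+t. indicator D t * conv (indicator A) (indicator B) t \<partial>lborel)
     = (\<integral>\<^sup>+a. \<integral>\<^sup>+b. indicator A a * indicator B b * indicator D (a + b) \<partial>lborel \<partial>lborel)"
  proof -
    have "(\<integral>\<^sup>+t. indicator D t * conv (indicator A) (indicator B) t \<partial>lborel)
      = (\<integral>\<^sup>+t. \<integral>\<^sup>+a. indicator D t * (indicator A a * indicator B (t - a)) \<partial>lborel \<partial>lborel)"
      unfolding conv_def by (subst nn_integral_cmult) auto
    also have "\<dots> = (\<integral>\<^sup>+a. \<integral>\<^sup>+t. indicator D t * (indicator A a * indicator B (t - a)) \<partial>lborel \<partial>lborel)"
      by (rule lborel_pair.Fubini') measurable
    also have "\<dots> = (\<integral>\<^sup>+a. \<integral>\<^sup>+b. indicator D (a + b) * (indicator A a * indicator B ((a + b) - a)) \<partial>lborel \<partial>lborel)"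
      by (intro nn_integral_cong nn_integral_shift[symmetric]) measurable
    finally show ?thesis by (simp add: mult_ac)
  qed
  show "(\<integral>\<^sup>+t. indicator D t * conv (indicator A) (indicator B) t \<partial>lborel)
    \<le> (\<integral>\<^sup>+t. indicator (centered ?d) t * conv (indicator (centered (emeasure lborel A))) (indicator (centered (emeasure lborel B))) t \<partial>lborel)"
  proof (cases "m = 0 \<or> n = 0")
    case True
    then have "(\<integral>\<^sup>+a. \<integral>\<^sup>+b. indicator A a * indicator B b * indicator D (a + b) \<partial>lborel \<partial>lborel) = (\<integral>\<^sup>+a. 0 \<partial>(lborel::real measure))"
    proof
      assume "m = 0"
      then have "AE a in lborel. a \<notin> A" using m by (intro AE_not_in) (auto simp: null_sets_def)
      then show ?thesis by (intro nn_integral_cong_AE) (auto elim!: eventually_mono)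
    next
      assume "n = 0"
      then have "AE b in lborel. b \<notin> B" using n by (intro AE_not_in) (auto simp: null_sets_def)
      then have "(\<integral>\<^sup>+b. indicator A a * indicator B b * indicator D (a + b) \<partial>lborel) = (\<integral>\<^sup>+b. 0 \<partial>(lborel::real measure))" for a
        by (intro nn_integral_cong_AE) (erule eventually_mono, simp)
      then show ?thesis by simp
    qed
    then show ?thesis using eq by simp
  next
    case False
    then have "m > 0" "n > 0" using m n by auto
    have hook: "(\<integral>\<^sup>+a. \<integral>\<^sup>+b. indicator A a * indicator B b * indicator D (a + b) \<partial>lborel \<partial>lborel)
      \<le> (\<integral>\<^sup>+s. indicator {0<..<min m n} s * min ?d (ennreal (m + n - 2 * s)) \<partial>lborel)"
      using m n \<open>m > 0\<close> \<open>n > 0\<close> by (intro riesz_hook_bound) auto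
    define J where "J s t = (indicator {0<..<min m n} s * indicator (centered ?d) t * (if 2 * \<bar>t\<bar> < m + n - 2 * s then 1 else 0) :: ennreal)" for s t :: real
    have "(\<integral>\<^sup>+s. indicator {0<..<min m n} s * min ?d (ennreal (m + n - 2 * s)) \<partial>lborel)
       = (\<integral>\<^sup>+s. indicator {0<..<min m n} s * emeasure lborel (centered ?d \<inter> centered (ennreal (m + n - 2 * s))) \<partial>lborel)"
      by (simp add: centered_Int)
    also have "\<dots> = (\<integral>\<^sup>+s. indicator {0<..<min m n} s * (\<integral>\<^sup>+t. indicator (centered ?d \<inter> centered (ennreal (m + n - 2 * s))) t \<partial>lborel) \<partial>lborel)"
      by simp
    also have "\<dots> = (\<integral>\<^sup>+s. \<integral>\<^sup>+t. indicator {0<..<min m n} s * indicator (centered ?d \<inter> centered (ennreal (m + n - 2 * s))) t \<partial>lborel \<partial>lborel)"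
      by (intro nn_integral_cong nn_integral_cmult[symmetric]) measurable
    also have "\<dots> = (\<integral>\<^sup>+s. \<integral>\<^sup>+t. J s t \<partial>lborel \<partial>lborel)"
      by (intro nn_integral_cong) (auto simp: J_def indicator_def centered_def[of "ennreal _"] ennreal_less_iff)
    also have "\<dots> = (\<integral>\<^sup>+t. \<integral>\<^sup>+s. J s t \<partial>lborel \<partial>lborel)"
      unfolding J_def by (rule lborel_pair.Fubini') measurable
    also have "\<dots> = (\<integral>\<^sup>+t. indicator (centered ?d) t * (\<integral>\<^sup>+s. indicator {0<..<min m n} s * (if 2 * \<bar>t\<bar> < m + n - 2 * s then 1 else 0) \<partial>lborel) \<partial>lborel)"
      unfolding J_def by (subst nn_integral_cmult[symmetric]) (auto simp: mult_ac)
    also have "\<dots> \<le> (\<integral>\<^sup>+t. indicator (centered ?d) t * conv (indicator ?A) (indicator ?B) t \<partial>lborel)"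
    proof (intro nn_integral_mono mult_left_mono)
      fix t :: real
      \<comment> \<open>\<open>?u\<close> is the height of the trapezoid at \<open>t\<close>, while
        \<open>?l\<close> and \<open>?r\<close> are the ends of the overlap of the first interval
        with the shifted second one; the height is bounded by the length of the overlap.\<close>
      let ?u = "min (min m n) ((m + n) / 2 - \<bar>t\<bar>)"
      let ?l = "max (-m/2) (t - n/2)" and ?r = "min (m/2) (t + n/2)"
      have "(\<integral>\<^sup>+s. indicator {0<..<min m n} s * (if 2 * \<bar>t\<bar> < m + n - 2 * s then 1 else 0) \<partial>lborel)
        = (\<integral>\<^sup>+s. indicator {0<..<?u} s \<partial>lborel)"
      proof (rule nn_integral_cong)
        fix s :: real
        have "2 * \<bar>t\<bar> < m + n - 2 * s \<longleftrightarrow> s < (m + n) / 2 - \<bar>t\<bar>" by argo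
        then show "indicator {0<..<min m n} s * (if 2 * \<bar>t\<bar> < m + n - 2 * s then 1 else 0) = (indicator {0<..<?u} s :: ennreal)"
          by (auto simp: indicator_def)
      qed
      also have "\<dots> = emeasure lborel {0<..<?u}" by simp
      also have "\<dots> \<le> emeasure lborel {?l<..<?r}"
      proof (cases "0 \<le> ?u")
        case True
        then have "emeasure lborel {0<..<?u} = ennreal ?u" by simp
        also have "?u \<le> ?r - ?l" using m n by (auto simp: min_def max_def abs_if field_simps)
        also have "ennreal (?r - ?l) = emeasure lborel {?l<..<?r}" using True \<open>?u \<le> ?r - ?l\<close> by (intro emeasure_lborel_Ioo[symmetric]) linarith
        finally show ?thesis by (simp add: ennreal_leI)
      next
        case False
        then have "{0<..<?u} = {}" by (intro greaterThanLessThan_empty) linarith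
        then show ?thesis by (simp only: emeasure_empty zero_le)
      qed
      also have "\<dots> = (\<integral>\<^sup>+s. indicator {?l<..<?r} s \<partial>lborel)" by simp
      also have "\<dots> = conv (indicator ?A) (indicator ?B) t"
        unfolding conv_def using m n by (intro nn_integral_cong) (auto simp: indicator_def centered_real)
      finally show "(\<integral>\<^sup>+s. indicator {0<..<min m n} s * (if 2 * \<bar>t\<bar> < m + n - 2 * s then 1 else 0) \<partial>lborel)
        \<le> conv (indicator ?A) (indicator ?B) t" .
    qed simp
    finally show ?thesis using eq hook m n by simp
  qed
qed

lemma ennreal_diff_eq_0: "a \<le> ennreal b \<Longrightarrow> a - ennreal b = 0"
  by (rule diff_eq_0_ennreal) (auto intro: le_less_trans)

lemma ennreal_le_add_diff: "x \<le> a + (x - a)" for a x :: ennreal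
  by (cases "a \<le> x") (auto simp: add_diff_inverse_ennreal not_le intro: add_increasing2)

text \<open>Domination is tested on the part of a ball where \<open>w\<close> exceeds
  \<open>\<tau>\<close>. This set and its centered interval have the same finite measure, so
  \<open>\<tau>\<close> times that measure appears on both sides and cancels.\<close>

lemma dominated_excess:
  assumes [measurable]: "w \<in> borel_measurable borel" and W: "symdec W" and dom: "dominated w W" and "\<tau> \<ge> 0"
  shows "(\<integral>\<^sup>+s. w s - ennreal \<tau> \<partial>lborel) \<le> (\<integral>\<^sup>+s. W s - ennreal \<tau> \<partial>lborel)"
proof (rule nn_integral_le_bounded)
  have [measurable]: "W \<in> borel_measurable borel" using W by (rule symdec_measurable)
  fix n
  have [measurable]: "cball (0::real) (real n) \<in> sets borel" by simp
  define C where "C = {s. ennreal \<tau> < w s} \<inter> cball 0 (real n)"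
  have [measurable]: "C \<in> sets borel" unfolding C_def by measurable
  have "emeasure lborel C \<le> emeasure lborel (cball 0 (real n) :: real set)"
    unfolding C_def by (rule emeasure_mono) auto
  also have "\<dots> < \<infinity>" by (rule emeasure_lborel_cball_finite)
  finally have fin: "ennreal \<tau> * emeasure lborel C \<noteq> \<top>" by (simp add: ennreal_mult_eq_top_iff)
  let ?C = "centered (emeasure lborel C)"
  have "ennreal \<tau> * emeasure lborel C + (\<integral>\<^sup>+s. indicator (cball 0 (real n)) s * (w s - ennreal \<tau>) \<partial>lborel)
     = (\<integral>\<^sup>+s. ennreal \<tau> * indicator C s \<partial>lborel) + (\<integral>\<^sup>+s. indicator (cball 0 (real n)) s * (w s - ennreal \<tau>) \<partial>lborel)"
    by (simp add: nn_integral_cmult)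
  also have "\<dots> = (\<integral>\<^sup>+s. ennreal \<tau> * indicator C s + indicator (cball 0 (real n)) s * (w s - ennreal \<tau>) \<partial>lborel)"
    by (rule nn_integral_add[symmetric]) measurable
  also have "\<dots> = (\<integral>\<^sup>+s. indicator C s * w s \<partial>lborel)"
    by (intro nn_integral_cong)
      (auto simp: C_def indicator_def add_diff_inverse_ennreal not_less ennreal_diff_eq_0)
  also have "\<dots> \<le> (\<integral>\<^sup>+s. indicator ?C s * W s \<partial>lborel)"
    by (rule dominatedD[OF dom]) measurable
  also have "\<dots> \<le> (\<integral>\<^sup>+s. ennreal \<tau> * indicator ?C s + (W s - ennreal \<tau>) \<partial>lborel)"
    by (intro nn_integral_mono) (auto simp: indicator_def ennreal_le_add_diff)
  also have "\<dots> = (\<integral>\<^sup>+s. ennreal \<tau> * indicator ?C s \<partial>lborel) + (\<integral>\<^sup>+s. W s - ennreal \<tau> \<partial>lborel)"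
    by (rule nn_integral_add) measurable
  also have "\<dots> = ennreal \<tau> * emeasure lborel C + (\<integral>\<^sup>+s. W s - ennreal \<tau> \<partial>lborel)"
    by (simp add: nn_integral_cmult)
  finally show "(\<integral>\<^sup>+s. indicator (cball 0 (real n)) s * (w s - ennreal \<tau>) \<partial>lborel) \<le> (\<integral>\<^sup>+s. W s - ennreal \<tau> \<partial>lborel)"
    using fin by (simp add: ennreal_add_left_cancel_le)
qed measurable

lemma emeasure_layer:
  assumes [measurable]: "w \<in> borel_measurable borel"
  shows "0 < t \<Longrightarrow> emeasure lborel {s::real. ennreal t < w s} = (\<integral>\<^sup>+s. layer (w s) t \<partial>lborel)"
proof -
  assume "0 < t"
  have "emeasure lborel {s. ennreal t < w s} = (\<integral>\<^sup>+s. indicator {s. ennreal t < w s} s \<partial>lborel)" by simp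
  also have "\<dots> = (\<integral>\<^sup>+s. layer (w s) t \<partial>lborel)"
    using \<open>0 < t\<close> by (intro nn_integral_cong) (auto simp: layer_def indicator_def)
  finally show ?thesis .
qed

text \<open>The left side bounds what \<open>w\<close> can contribute on a set of measure
  \<open>c\<close>. The heights are cut at the value of \<open>W\<close> at the end c / 2 of the
  centered interval: below it each layer counts at most \<open>c\<close>, above it the excess of
  \<open>w\<close> is compared with that of \<open>W\<close>. For \<open>W\<close> these two bounds
  are sharp, because it lies above the cut inside the interval and below it outside.\<close>

lemma bathtub:
  assumes [measurable]: "w \<in> borel_measurable borel" and W: "symdec W" and dom: "dominated w W"
  shows "(\<integral>\<^sup>+t. indicator {0<..} t * min (emeasure lborel {s. ennreal t < w s}) c \<partial>lborel)
     \<le> (\<integral>\<^sup>+s. indicator (centered c) s * W s \<partial>lborel)"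
proof (cases c)
  have [measurable]: "W \<in> borel_measurable borel" using W by (rule symdec_measurable)
  have Wgt: "(\<integral>\<^sup>+t. indicator {\<tau><..} t * emeasure lborel {s. ennreal t < w s} \<partial>lborel) = (\<integral>\<^sup>+s. w s - ennreal \<tau> \<partial>lborel)" if "\<tau> \<ge> 0" for \<tau>
  proof -
    have "(\<integral>\<^sup>+t. indicator {\<tau><..} t * emeasure lborel {s. ennreal t < w s} \<partial>lborel)
      = (\<integral>\<^sup>+t. indicator {\<tau><..} t * (\<integral>\<^sup>+s. layer (w s) t \<partial>lborel) \<partial>lborel)"
      using that by (intro nn_integral_cong) (auto simp: indicator_def emeasure_layer)
    also have "\<dots> = (\<integral>\<^sup>+t. \<integral>\<^sup>+s. indicator {\<tau><..} t * layer (w s) t \<partial>lborel \<partial>lborel)"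
      by (simp add: nn_integral_cmult)
    also have "\<dots> = (\<integral>\<^sup>+s. \<integral>\<^sup>+t. indicator {\<tau><..} t * layer (w s) t \<partial>lborel \<partial>lborel)"
      by (rule lborel_pair.Fubini') measurable
    also have "\<dots> = (\<integral>\<^sup>+s. w s - ennreal \<tau> \<partial>lborel)"
      using that by (simp add: nn_integral_layer_ge)
    finally show ?thesis .
  qed
  {
    case top
    have "(\<integral>\<^sup>+t. indicator {0<..} t * min (emeasure lborel {s. ennreal t < w s}) c \<partial>lborel) = (\<integral>\<^sup>+s. w s \<partial>lborel)"
      using Wgt[of 0] top by simp
    also have "\<dots> \<le> (\<integral>\<^sup>+s. W s \<partial>lborel)"
      using dominatedD[OF dom, of UNIV] by (simp add: centered_def)
    finally show ?thesis using top by (simp add: centered_def)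
  next
    case (real r)
    show ?thesis
    proof (cases "r = 0")
      case True
      then show ?thesis using real by simp
    next
      case False
      then have "r > 0" using real by simp
      show ?thesis
      proof (cases "W (r / 2)")
        case top
        have "(\<integral>\<^sup>+s. indicator (centered c) s * W s \<partial>lborel) \<ge> (\<integral>\<^sup>+s. \<infinity> * indicator (centered c) s \<partial>lborel)"
        proof (rule nn_integral_mono)
          fix s
          show "\<infinity> * indicator (centered c) s \<le> indicator (centered c) s * W s"
            using symdecD[OF W, of s "r/2"] top real by (auto simp: indicator_def centered_real top.extremum_unique)
        qed
        also have "(\<integral>\<^sup>+s. \<infinity> * indicator (centered c) s \<partial>lborel) = \<infinity>"
          using real \<open>r > 0\<close> by (subst nn_integral_cmult) (auto simp: ennreal_top_mult)
        finally show ?thesis by (simp add: top.extremum_unique)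
      next
        case (real \<tau>)
        have "(\<integral>\<^sup>+t. indicator {0<..} t * min (emeasure lborel {s. ennreal t < w s}) c \<partial>lborel)
          \<le> (\<integral>\<^sup>+t. c * indicator {0<..\<tau>} t + indicator {\<tau><..} t * emeasure lborel {s. ennreal t < w s} \<partial>lborel)"
          using real by (intro nn_integral_mono) (auto simp: indicator_def)
        also have "\<dots> = (\<integral>\<^sup>+t. c * indicator {0<..\<tau>} t \<partial>lborel) + (\<integral>\<^sup>+t. indicator {\<tau><..} t * emeasure lborel {s. ennreal t < w s} \<partial>lborel)"
          by (intro nn_integral_add) measurable
        also have "\<dots> = ennreal \<tau> * c + (\<integral>\<^sup>+s. w s - ennreal \<tau> \<partial>lborel)"
          using real Wgt by (simp add: nn_integral_cmult mult.commute)
        also have "\<dots> \<le> ennreal \<tau> * c + (\<integral>\<^sup>+s. W s - ennreal \<tau> \<partial>lborel)"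
          by (intro add_left_mono dominated_excess[OF _ W dom]) (use real in auto)
        also have "ennreal \<tau> * c = (\<integral>\<^sup>+s. ennreal \<tau> * indicator (centered c) s \<partial>lborel)"
          by (simp add: nn_integral_cmult)
        also have "(\<integral>\<^sup>+s. ennreal \<tau> * indicator (centered c) s \<partial>lborel) + (\<integral>\<^sup>+s. W s - ennreal \<tau> \<partial>lborel)
          = (\<integral>\<^sup>+s. ennreal \<tau> * indicator (centered c) s + (W s - ennreal \<tau>) \<partial>lborel)"
          by (rule nn_integral_add[symmetric]) measurable
        also have "\<dots> = (\<integral>\<^sup>+s. indicator (centered c) s * W s \<partial>lborel)"
        proof (rule nn_integral_cong)
          fix s
          show "ennreal \<tau> * indicator (centered c) s + (W s - ennreal \<tau>) = indicator (centered c) s * W s"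
          proof (cases "s \<in> centered c")
            case True
            then have "ennreal \<tau> \<le> W s"
              using symdecD[OF W, of s "r/2"] real \<open>c = ennreal r\<close> \<open>r > 0\<close> by (auto simp: centered_real)
            then show ?thesis using True by (simp add: add_diff_inverse_ennreal)
          next
            case False
            then have "W s \<le> ennreal \<tau>"
              using symdecD[OF W, of "r/2" s] real \<open>c = ennreal r\<close> \<open>r > 0\<close> by (auto simp: centered_real)
            then show ?thesis using False by (simp add: ennreal_diff_eq_0)
          qed
        qed
        finally show ?thesis .
      qed
    qed
  }
qed

text \<open>The layer cake formula is applied twice. Domination of \<open>h\<close> turns the
  superlevel sets of \<open>w\<close> into centered intervals under \<open>H\<close>; slicing
  \<open>H\<close> as well leaves the minimum of the two level measures, an expression in which both
  functions stand on an equal footing, and the bathtub estimate for \<open>w\<close> then replaces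
  \<open>w\<close> by \<open>W\<close>.\<close>

lemma dominated_integral_mult:
  assumes [measurable]: "h \<in> borel_measurable borel" "w \<in> borel_measurable borel"
    and H: "symdec H" and W: "symdec W" and h: "dominated h H" and w: "dominated w W"
  shows "(\<integral>\<^sup>+s. h s * w s \<partial>lborel) \<le> (\<integral>\<^sup>+s. H s * W s \<partial>lborel)"
proof -
  have [measurable]: "W \<in> borel_measurable borel" "H \<in> borel_measurable borel"
    using W H by (auto intro: symdec_measurable)
  define m where "m t = emeasure lborel {s. ennreal t < w s}" for t
  have [measurable]: "m \<in> borel_measurable borel" unfolding m_def by measurable
  define c where "c r = emeasure lborel {s. ennreal r < H s}" for r
  have [measurable]: "c \<in> borel_measurable borel" unfolding c_def by measurable
  \<comment> \<open>A superlevel set of \<open>H\<close> is an interval about 0, hence it contains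
    the open centered interval of its own measure.\<close>
  have c_sub: "indicator (centered (c r)) s \<le> layer (H s) r" if "r > 0" for r s
  proof (cases "ennreal r < H s")
    case False
    have "{u. ennreal r < H u} \<subseteq> {-\<bar>s\<bar>..\<bar>s\<bar>}"
    proof
      fix u assume "u \<in> {u. ennreal r < H u}"
      then have "\<not> H u \<le> H s" using False by auto
      then have "\<not> \<bar>s\<bar> \<le> \<bar>u\<bar>" using symdecD[OF H] by blast
      then show "u \<in> {-\<bar>s\<bar>..\<bar>s\<bar>}" by auto
    qed
    then have "c r \<le> emeasure lborel {-\<bar>s\<bar>..\<bar>s\<bar>}" unfolding c_def by (rule emeasure_mono) simp
    also have "\<dots> = ennreal (2 * \<bar>s\<bar>)" by simp
    finally have "s \<notin> centered (c r)" by (simp add: centered_def not_less)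
    then show ?thesis by simp
  qed (use that in \<open>auto simp: layer_def indicator_def\<close>)
  have "(\<integral>\<^sup>+s. h s * w s \<partial>lborel) = (\<integral>\<^sup>+s. \<integral>\<^sup>+t. h s * layer (w s) t \<partial>lborel \<partial>lborel)"
    by (simp add: nn_integral_cmult)
  also have "\<dots> = (\<integral>\<^sup>+t. \<integral>\<^sup>+s. h s * layer (w s) t \<partial>lborel \<partial>lborel)"
    by (rule lborel_pair.Fubini') measurable
  also have "\<dots> \<le> (\<integral>\<^sup>+t. \<integral>\<^sup>+s. indicator {0<..} t * indicator (centered (m t)) s * H s \<partial>lborel \<partial>lborel)"
  proof (rule nn_integral_mono)
    fix t :: real
    show "(\<integral>\<^sup>+s. h s * layer (w s) t \<partial>lborel) \<le> (\<integral>\<^sup>+s. indicator {0<..} t * indicator (centered (m t)) s * H s \<partial>lborel)"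
    proof (cases "t > 0")
      case True
      have "(\<integral>\<^sup>+s. h s * layer (w s) t \<partial>lborel) = (\<integral>\<^sup>+s. indicator {s. ennreal t < w s} s * h s \<partial>lborel)"
        using True by (intro nn_integral_cong) (auto simp: layer_def)
      also have "\<dots> \<le> (\<integral>\<^sup>+s. indicator (centered (m t)) s * H s \<partial>lborel)"
        unfolding m_def by (rule dominatedD[OF h]) measurable
      finally show ?thesis using True by simp
    qed (simp add: layer_def)
  qed
  also have "\<dots> = (\<integral>\<^sup>+t. \<integral>\<^sup>+s. \<integral>\<^sup>+r. indicator {0<..} t * indicator (centered (m t)) s * layer (H s) r \<partial>lborel \<partial>lborel \<partial>lborel)"
    by (subst nn_integral_cmult) auto
  also have "\<dots> = (\<integral>\<^sup>+t. \<integral>\<^sup>+r. \<integral>\<^sup>+s. indicator {0<..} t * indicator (centered (m t)) s * layer (H s) r \<partial>lborel \<partial>lborel \<partial>lborel)"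
    by (intro nn_integral_cong lborel_pair.Fubini') (unfold centered_def, measurable)
  also have "\<dots> \<le> (\<integral>\<^sup>+t. \<integral>\<^sup>+r. indicator {0<..} r * (indicator {0<..} t * min (m t) (c r)) \<partial>lborel \<partial>lborel)"
  proof (intro nn_integral_mono)
    fix t r :: real
    show "(\<integral>\<^sup>+s. indicator {0<..} t * indicator (centered (m t)) s * layer (H s) r \<partial>lborel)
       \<le> indicator {0<..} r * (indicator {0<..} t * min (m t) (c r))"
    proof (cases "t > 0 \<and> r > 0")
      case True
      have "(\<integral>\<^sup>+s. indicator (centered (m t)) s * layer (H s) r \<partial>lborel) \<le> (\<integral>\<^sup>+s. indicator (centered (m t)) s \<partial>lborel)"
        by (intro nn_integral_mono) (auto simp: layer_def)
      moreover have "(\<integral>\<^sup>+s. indicator (centered (m t)) s * layer (H s) r \<partial>lborel) \<le> (\<integral>\<^sup>+s. layer (H s) r \<partial>lborel)"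
        by (intro nn_integral_mono) (auto simp: layer_def indicator_def)
      moreover have "(\<integral>\<^sup>+s. layer (H s) r \<partial>lborel) = c r"
        unfolding c_def using True by (intro emeasure_layer[symmetric]) auto
      ultimately show ?thesis using True by simp
    qed (auto simp: layer_def)
  qed
  also have "\<dots> = (\<integral>\<^sup>+r. \<integral>\<^sup>+t. indicator {0<..} r * (indicator {0<..} t * min (m t) (c r)) \<partial>lborel \<partial>lborel)"
    by (rule lborel_pair.Fubini') measurable
  also have "\<dots> = (\<integral>\<^sup>+r. indicator {0<..} r * (\<integral>\<^sup>+t. indicator {0<..} t * min (m t) (c r) \<partial>lborel) \<partial>lborel)"
    by (intro nn_integral_cong nn_integral_cmult) measurable
  also have "\<dots> \<le> (\<integral>\<^sup>+r. indicator {0<..} r * (\<integral>\<^sup>+s. indicator (centered (c r)) s * W s \<partial>lborel) \<partial>lborel)"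
    unfolding m_def by (intro nn_integral_mono mult_left_mono bathtub W w) auto
  also have "\<dots> \<le> (\<integral>\<^sup>+r. (\<integral>\<^sup>+s. layer (H s) r * W s \<partial>lborel) \<partial>lborel)"
    by (rule nn_integral_mono) (auto simp: indicator_def[of "{0<..}"] intro!: nn_integral_mono mult_right_mono c_sub)
  also have "\<dots> = (\<integral>\<^sup>+s. (\<integral>\<^sup>+r. layer (H s) r * W s \<partial>lborel) \<partial>lborel)"
    by (rule lborel_pair.Fubini') measurable
  also have "\<dots> = (\<integral>\<^sup>+s. H s * W s \<partial>lborel)"
    by (simp add: nn_integral_multc)
  finally show ?thesis .
qed

lemma nn_integral_reflect:
  fixes f :: "real \<Rightarrow> ennreal"
  assumes [measurable]: "f \<in> borel_measurable borel"
  shows "(\<integral>\<^sup>+x. f (a - x) \<partial>lborel) = (\<integral>\<^sup>+x. f x \<partial>lborel)"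
  by (subst (2) nn_integral_real_affine[where c="-1" and t=a]) auto

lemma ennreal_rearrange_two:
  fixes h1 h2 k1 k2 :: ennreal
  assumes "h2 \<le> h1" "k2 \<le> k1"
  shows "h1 * k2 + h2 * k1 \<le> h1 * k1 + h2 * k2"
proof -
  obtain d where d: "h1 = h2 + d" using assms(1) by (auto simp: le_iff_add)
  have "d * k2 \<le> d * k1" using assms(2) by (rule mult_left_mono) simp
  then have "(h2 * k1 + h2 * k2) + d * k2 \<le> (h2 * k1 + h2 * k2) + d * k1" by (rule add_left_mono)
  then show ?thesis unfolding d by (simp add: distrib_right add_ac)
qed

text \<open>The integrand is averaged with its reflection s -> t1 + t2 - s, which exchanges the
  shifts by t1 and by t2 in the even function \<open>K\<close>. On each pair of reflected points the
  larger value of \<open>H\<close> meets the larger value of \<open>K\<close> in the convolution at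
  t1, the point closer to 0, so the inequality holds pointwise under the integral.\<close>

lemma symdec_conv:
  assumes H: "symdec H" and K: "symdec K"
  shows "symdec (conv H K)"
proof -
  have [measurable]: "H \<in> borel_measurable borel" "K \<in> borel_measurable borel"
    using K H by (auto intro: symdec_measurable)
  have even: "conv H K (- t) = conv H K t" for t
  proof -
    have "conv H K (-t) = (\<integral>\<^sup>+s. H (0 - s) * K (- t - (0 - s)) \<partial>lborel)"
      unfolding conv_def by (rule nn_integral_reflect[symmetric]) measurable
    also have "\<dots> = conv H K t"
      unfolding conv_def using symdec_even[OF H] symdec_even[OF K, of "t - s" for s]
      by (intro nn_integral_cong) (simp add: algebra_simps)
    finally show ?thesis .
  qed
  have dec: "conv H K t2 \<le> conv H K t1" if "0 \<le> t1" "t1 \<le> t2" for t1 t2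
  proof -
    let ?r = "\<lambda>s. t1 + t2 - s"
    have sym: "(\<integral>\<^sup>+s. H s * K (t - s) + H (?r s) * K (t - ?r s) \<partial>lborel) = 2 * conv H K t" for t
    proof -
      have "(\<integral>\<^sup>+s. H (?r s) * K (t - ?r s) \<partial>lborel) = conv H K t"
        unfolding conv_def by (rule nn_integral_reflect) measurable
      then show ?thesis by (subst nn_integral_add) (auto simp: conv_def mult_2)
    qed
    have "2 * conv H K t2 \<le> 2 * conv H K t1"
      unfolding sym[symmetric]
    proof (rule nn_integral_mono)
      fix s :: real
      have e1: "K (t1 - ?r s) = K (t2 - s)" "K (t2 - ?r s) = K (t1 - s)"
        using symdec_even[OF K, of "t2 - s"] symdec_even[OF K, of "t1 - s"] by (simp_all add: algebra_simps)
      show "H s * K (t2 - s) + H (?r s) * K (t2 - ?r s) \<le> H s * K (t1 - s) + H (?r s) * K (t1 - ?r s)"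
      proof (cases "s \<le> (t1 + t2) / 2")
        case True
        have "H (?r s) \<le> H s" "K (t2 - s) \<le> K (t1 - s)"
          using True that by (auto intro!: symdecD[OF H] symdecD[OF K])
        then show ?thesis unfolding e1 by (rule ennreal_rearrange_two)
      next
        case False
        have "H s \<le> H (?r s)" "K (t1 - s) \<le> K (t2 - s)"
          using False that by (auto intro!: symdecD[OF H] symdecD[OF K])
        then show ?thesis unfolding e1 by (subst (1 2) add.commute) (rule ennreal_rearrange_two)
      qed
    qed
    then show ?thesis by (subst (asm) ennreal_mult_le_mult_iff) auto
  qed
  have abs: "conv H K \<bar>t\<bar> = conv H K t" for t using even[of t] by (cases "t \<ge> 0") auto
  show ?thesis unfolding symdec_def
    using dec[of "\<bar>s\<bar>" "\<bar>t\<bar>" for s t] by (auto simp: abs)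
qed

lemma centered_closer: "t \<in> centered c \<Longrightarrow> \<bar>s\<bar> \<le> \<bar>t\<bar> \<Longrightarrow> s \<in> centered c"
  unfolding centered_def mem_Collect_eq by (erule le_less_trans[OF ennreal_leI, rotated]) simp

lemma symdec_indicator_centered: "symdec (indicator (centered c))"
  unfolding symdec_def by (auto simp: indicator_def dest: centered_closer)

text \<open>Exchanges a factor of the convolution with the test function. This is what lets an
  estimate for the integral of a product be turned into one for a convolution.\<close>

lemma conv_swap_test:
  fixes a b c :: "real \<Rightarrow> ennreal"
  assumes [measurable]: "a \<in> borel_measurable borel" "b \<in> borel_measurable borel" "c \<in> borel_measurable borel"
  shows "(\<integral>\<^sup>+t. c t * conv a b t \<partial>lborel) = (\<integral>\<^sup>+s. a s * conv c (\<lambda>u. b (- u)) s \<partial>lborel)"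
proof -
  have "(\<integral>\<^sup>+t. c t * conv a b t \<partial>lborel) = (\<integral>\<^sup>+t. \<integral>\<^sup>+s. c t * (a s * b (t - s)) \<partial>lborel \<partial>lborel)"
    unfolding conv_def by (simp add: nn_integral_cmult)
  also have "\<dots> = (\<integral>\<^sup>+s. \<integral>\<^sup>+t. c t * (a s * b (t - s)) \<partial>lborel \<partial>lborel)"
    by (rule lborel_pair.Fubini') measurable
  also have "\<dots> = (\<integral>\<^sup>+s. a s * conv c (\<lambda>u. b (- u)) s \<partial>lborel)"
    unfolding conv_def by (subst nn_integral_cmult[symmetric]) (auto simp: mult_ac)
  finally show ?thesis .
qed

lemma dominated_reflect:
  assumes [measurable]: "b \<in> borel_measurable borel" and "dominated b B"
  shows "dominated (\<lambda>u. b (- u)) B"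
  unfolding dominated_def
proof safe
  fix C :: "real set" assume [measurable]: "C \<in> sets borel"
  let ?C = "{u. - u \<in> C}"
  have [measurable]: "?C \<in> sets borel" by measurable
  have eq: "emeasure lborel ?C = emeasure lborel C"
    using nn_integral_reflect[of "indicator C" 0] by (simp add: indicator_vimage[symmetric] vimage_def)
  have "(\<integral>\<^sup>+s. indicator C s * b (- s) \<partial>lborel) = (\<integral>\<^sup>+s. indicator C (0 - s) * b (- (0 - s)) \<partial>lborel)"
    by (rule nn_integral_reflect[symmetric]) measurable
  also have "\<dots> = (\<integral>\<^sup>+s. indicator ?C s * b s \<partial>lborel)"
    by (intro nn_integral_cong) (auto simp: indicator_def)
  also have "\<dots> \<le> (\<integral>\<^sup>+s. indicator (centered (emeasure lborel ?C)) s * B s \<partial>lborel)"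
    by (rule dominatedD[OF assms(2)]) measurable
  finally show "(\<integral>\<^sup>+s. indicator C s * b (- s) \<partial>lborel) \<le> (\<integral>\<^sup>+s. indicator (centered (emeasure lborel C)) s * B s \<partial>lborel)"
    unfolding eq .
qed

text \<open>The passage from sets to functions is made one factor at a time. Exchanging
  \<open>b\<close> with the test set leaves \<open>b\<close> integrated against a convolution of two
  indicators, to which Riesz for sets applies; the same exchange then serves for two general
  factors.\<close>

lemma dominated_conv_indicator:
  assumes [measurable]: "b \<in> borel_measurable borel" and B: "symdec B" and b: "dominated b B"
    and [measurable]: "C \<in> sets borel" and fin: "emeasure lborel C < \<infinity>"
  shows "dominated (conv (indicator C) b) (conv (indicator (centered (emeasure lborel C))) B)"
proof (rule dominatedI_finite)
  have [measurable]: "B \<in> borel_measurable borel" using B by (rule symdec_measurable)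
  fix E :: "real set" assume [measurable]: "E \<in> sets borel" and finE: "emeasure lborel E < \<infinity>"
  let ?C = "centered (emeasure lborel C)" and ?E = "centered (emeasure lborel E)"
  have comm: "conv f g = conv g f" if "f \<in> borel_measurable borel" "g \<in> borel_measurable borel" for f g :: "real \<Rightarrow> ennreal"
  proof
    note that[measurable]
    fix t
    have "conv f g t = (\<integral>\<^sup>+s. f (t - s) * g (t - (t - s)) \<partial>lborel)"
      unfolding conv_def by (rule nn_integral_reflect[symmetric]) measurable
    then show "conv f g t = conv g f t" unfolding conv_def by (simp add: mult.commute)
  qed
  let ?C' = "{u. - u \<in> C}"
  have [measurable]: "?C' \<in> sets borel" by measurable
  have eq: "emeasure lborel ?C' = emeasure lborel C"
    using nn_integral_reflect[of "indicator C" 0] by (simp add: indicator_vimage[symmetric] vimage_def)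
  have ref: "(\<lambda>u. indicator C (- u)) = (indicator ?C' :: _ \<Rightarrow> ennreal)" by (auto simp: indicator_def)
  have ref2: "(\<lambda>u. indicator ?C (- u)) = (indicator ?C :: _ \<Rightarrow> ennreal)" by (auto simp: indicator_def centered_def)
  have "(\<integral>\<^sup>+s. indicator E s * conv (indicator C) b s \<partial>lborel) = (\<integral>\<^sup>+s. indicator E s * conv b (indicator C) s \<partial>lborel)"
    by (subst comm) auto
  also have "\<dots> = (\<integral>\<^sup>+s. b s * conv (indicator E) (indicator ?C') s \<partial>lborel)"
    by (subst conv_swap_test) (auto simp: ref)
  also have "\<dots> \<le> (\<integral>\<^sup>+s. B s * conv (indicator ?E) (indicator ?C) s \<partial>lborel)"
    using riesz_sets[of E ?C'] fin finE eq
    by (intro dominated_integral_mult B b symdec_conv symdec_indicator_centered) auto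
  also have "\<dots> = (\<integral>\<^sup>+s. indicator ?E s * conv B (indicator ?C) s \<partial>lborel)"
    by (subst conv_swap_test) (auto simp: ref2)
  also have "\<dots> = (\<integral>\<^sup>+s. indicator ?E s * conv (indicator ?C) B s \<partial>lborel)"
    by (subst comm) auto
  finally show "(\<integral>\<^sup>+s. indicator E s * conv (indicator C) b s \<partial>lborel) \<le> (\<integral>\<^sup>+s. indicator ?E s * conv (indicator ?C) B s \<partial>lborel)" .
qed measurable

lemma dominated_conv:
  assumes [measurable]: "a \<in> borel_measurable borel" "b \<in> borel_measurable borel"
    and A: "symdec A" and B: "symdec B" and a: "dominated a A" and b: "dominated b B"
  shows "dominated (conv a b) (conv A B)"
proof (rule dominatedI_finite)
  have [measurable]: "B \<in> borel_measurable borel" "A \<in> borel_measurable borel"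
    using A B by (auto intro: symdec_measurable)
  fix C :: "real set" assume [measurable]: "C \<in> sets borel" and fin: "emeasure lborel C < \<infinity>"
  let ?C = "centered (emeasure lborel C)"
  have "(\<integral>\<^sup>+s. indicator C s * conv a b s \<partial>lborel) = (\<integral>\<^sup>+s. a s * conv (indicator C) (\<lambda>u. b (- u)) s \<partial>lborel)"
    by (rule conv_swap_test) measurable
  also have "\<dots> \<le> (\<integral>\<^sup>+s. A s * conv (indicator ?C) B s \<partial>lborel)"
    by (intro dominated_integral_mult A B a b symdec_conv symdec_indicator_centered dominated_conv_indicator dominated_reflect fin) measurable
  also have "\<dots> = (\<integral>\<^sup>+s. indicator ?C s * conv A B s \<partial>lborel)"
    using symdec_even[OF B] by (subst conv_swap_test) auto
  finally show "(\<integral>\<^sup>+s. indicator C s * conv a b s \<partial>lborel) \<le> (\<integral>\<^sup>+s. indicator ?C s * conv A B s \<partial>lborel)" .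
qed measurable

section \<open>Steiner symmetrization\<close>

definition hproj :: "'a::euclidean_space \<Rightarrow> 'a \<Rightarrow> 'a" where
  "hproj e x = x - (x \<bullet> e) *\<^sub>R e"

lemma hproj_measurable[measurable]: "hproj e \<in> borel_measurable borel"
  unfolding hproj_def by measurable

lemma hproj_diff: "hproj e (x - y) = hproj e x - hproj e y"
  by (simp add: hproj_def algebra_simps)

lemma hproj_decomp: "hproj e x + (x \<bullet> e) *\<^sub>R e = x"
  by (simp add: hproj_def)

lemma hproj_line:
  assumes "norm e = 1"
  shows "(hproj e x + s *\<^sub>R e) \<bullet> e = s" "hproj e (hproj e x + s *\<^sub>R e) = hproj e x"
proof -
  have "e \<bullet> e = 1" using assms by (simp add: norm_eq_1)
  then show 1: "(hproj e x + s *\<^sub>R e) \<bullet> e = s" by (simp add: hproj_def algebra_simps)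
  show "hproj e (hproj e x + s *\<^sub>R e) = hproj e x"
    unfolding hproj_def[of e "hproj e x + s *\<^sub>R e"] 1 by simp
qed

lemma norm_line:
  assumes "norm e = 1"
  shows "(norm (hproj e x + s *\<^sub>R e))\<^sup>2 = (norm (hproj e x))\<^sup>2 + s\<^sup>2"
proof -
  have "e \<bullet> e = 1" using assms by (simp add: norm_eq_1)
  moreover from this have "hproj e x \<bullet> e = 0" by (simp add: hproj_def algebra_simps)
  ultimately show ?thesis
    unfolding power2_norm_eq_inner by (simp add: algebra_simps inner_commute power2_eq_square)
qed

lemma nn_integral_translate:
  fixes f :: "'a::euclidean_space \<Rightarrow> ennreal"
  assumes [measurable]: "f \<in> borel_measurable borel"
  shows "(\<integral>\<^sup>+x. f (x + a) \<partial>lborel) = (\<integral>\<^sup>+x. f x \<partial>lborel)"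
  using nn_integral_shift[of f a] by (simp add: add.commute)

text \<open>Integration over the lines in direction \<open>e\<close>; averaging the base point of the line over the slab
  \<open>0 < y \<bullet> e < 1\<close> replaces the splitting of the space as a product.\<close>

lemma nn_integral_lines:
  fixes F :: "'a::euclidean_space \<Rightarrow> ennreal"
  assumes [measurable]: "F \<in> borel_measurable borel" and "norm e = 1"
  shows "(\<integral>\<^sup>+x. F x \<partial>lborel)
    = (\<integral>\<^sup>+y. indicator {0<..<1} (y \<bullet> e) * (\<integral>\<^sup>+s. F (hproj e y + s *\<^sub>R e) \<partial>lborel) \<partial>lborel)"
proof -
  have "e \<bullet> e = 1" using assms by (simp add: norm_eq_1)
  \<comment> \<open>Translating \<open>s\<close> by \<open>y \<bullet> e\<close> replaces the base
    point \<open>hproj e y\<close> by \<open>y\<close> itself. After Fubini and a translation in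
    \<open>y\<close>, every point carries the thickness 1 of the slab as its weight.\<close>
  have "(\<integral>\<^sup>+y. indicator {0<..<1} (y \<bullet> e) * (\<integral>\<^sup>+s. F (hproj e y + s *\<^sub>R e) \<partial>lborel) \<partial>lborel)
    = (\<integral>\<^sup>+y. indicator {0<..<1} (y \<bullet> e) * (\<integral>\<^sup>+s. F (hproj e y + (y \<bullet> e + s) *\<^sub>R e) \<partial>lborel) \<partial>lborel)"
    by (subst nn_integral_shift) auto
  also have "\<dots> = (\<integral>\<^sup>+y. \<integral>\<^sup>+s. indicator {0<..<1} (y \<bullet> e) * F (y + s *\<^sub>R e) \<partial>lborel \<partial>lborel)"
    by (subst nn_integral_cmult[symmetric]) (auto simp: hproj_def algebra_simps)
  also have "\<dots> = (\<integral>\<^sup>+s. \<integral>\<^sup>+y. indicator {0<..<1} (y \<bullet> e) * F (y + s *\<^sub>R e) \<partial>lborel \<partial>lborel)"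
    by (rule lborel_pair.Fubini') measurable
  also have "\<dots> = (\<integral>\<^sup>+s. \<integral>\<^sup>+y. indicator {0<..<1} ((y + s *\<^sub>R e) \<bullet> e - s) * F (y + s *\<^sub>R e) \<partial>lborel \<partial>lborel)"
    using \<open>e \<bullet> e = 1\<close> by (simp add: algebra_simps)
  also have "\<dots> = (\<integral>\<^sup>+s. \<integral>\<^sup>+y. indicator {0<..<1} (y \<bullet> e - s) * F y \<partial>lborel \<partial>lborel)"
    by (intro nn_integral_cong nn_integral_translate) measurable
  also have "\<dots> = (\<integral>\<^sup>+y. \<integral>\<^sup>+s. indicator {0<..<1} (y \<bullet> e - s) * F y \<partial>lborel \<partial>lborel)"
    by (rule lborel_pair.Fubini') measurable
  also have "\<dots> = (\<integral>\<^sup>+y. F y \<partial>lborel)"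
    by (simp add: nn_integral_multc nn_integral_reflect)
  finally show ?thesis by simp
qed

definition line_level :: "'a::euclidean_space \<Rightarrow> ('a \<Rightarrow> ennreal) \<Rightarrow> 'a \<Rightarrow> real \<Rightarrow> ennreal" where
  "line_level e f x \<sigma> = emeasure lborel {s. ennreal \<sigma> < f (hproj e x + s *\<^sub>R e)}"

lemma line_level_measurable[measurable]:
  assumes [measurable]: "f \<in> borel_measurable borel" "g \<in> borel_measurable M" "h \<in> borel_measurable M"
  shows "(\<lambda>x. line_level e f (g x) (h x)) \<in> borel_measurable M"
  unfolding line_level_def by measurable

text \<open>The layer cake form of Steiner symmetrization: at each height the slice of the
  superlevel set by the line through \<open>x\<close> is replaced by the centered interval of the
  same length. Slices of infinite length are allowed.\<close>

definition steiner :: "'a::euclidean_space \<Rightarrow> ('a \<Rightarrow> ennreal) \<Rightarrow> 'a \<Rightarrow> ennreal" where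
  "steiner e f x = (\<integral>\<^sup>+\<sigma>. indicator {0<..} \<sigma> * indicator (centered (line_level e f x \<sigma>)) (x \<bullet> e) \<partial>lborel)"

lemma indicator_centered_measurable[measurable]:
  assumes [measurable]: "f \<in> borel_measurable M" "g \<in> borel_measurable M"
  shows "(\<lambda>x. indicator (centered (f x)) (g x) :: ennreal) \<in> borel_measurable M"
  unfolding centered_def by measurable

lemma steiner_measurable[measurable]:
  assumes [measurable]: "f \<in> borel_measurable borel"
  shows "steiner e f \<in> borel_measurable borel"
  unfolding steiner_def by measurable

lemma line_level_line: "norm e = 1 \<Longrightarrow> line_level e f (hproj e x + s *\<^sub>R e) = line_level e f x"
  by (simp add: line_level_def fun_eq_iff hproj_line)

lemma line_level_antimono:
  assumes [measurable]: "f \<in> borel_measurable borel" and "\<sigma> \<le> \<tau>"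
  shows "line_level e f x \<tau> \<le> line_level e f x \<sigma>"
  unfolding line_level_def using assms(2)
  by (intro emeasure_mono) (auto intro: le_less_trans[OF ennreal_leI])

text \<open>The superlevel sets at the heights \<open>\<sigma> + 1 / real (Suc n)\<close> increase
  to the one at \<open>\<sigma>\<close>, so a strict lower bound on the measure already holds at
  some larger height.\<close>

lemma line_level_right_cont:
  assumes [measurable]: "f \<in> borel_measurable borel" and "c < line_level e f x \<sigma>" and "\<sigma> \<ge> 0"
  obtains \<tau> where "\<tau> > \<sigma>" "c < line_level e f x \<tau>"
proof -
  let ?A = "\<lambda>n. {s. ennreal (\<sigma> + 1 / real (Suc n)) < f (hproj e x + s *\<^sub>R e)}"
  have "(\<Union>n. ?A n) = {s. ennreal \<sigma> < f (hproj e x + s *\<^sub>R e)}"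
  proof safe
    fix s n assume "ennreal (\<sigma> + 1 / real (Suc n)) < f (hproj e x + s *\<^sub>R e)"
    then show "ennreal \<sigma> < f (hproj e x + s *\<^sub>R e)"
      by (rule le_less_trans[OF ennreal_leI, rotated]) simp
  next
    fix s assume "ennreal \<sigma> < f (hproj e x + s *\<^sub>R e)"
    then obtain q where q: "ennreal \<sigma> < q" "q < f (hproj e x + s *\<^sub>R e)" using dense by blast
    then obtain r where r: "ennreal \<sigma> < ennreal r" "ennreal r < f (hproj e x + s *\<^sub>R e)" "r \<ge> 0"
      by (cases q) auto
    then have "\<sigma> < r" using \<open>\<sigma> \<ge> 0\<close> by (simp add: ennreal_less_iff)
    then obtain n where "1 / real (Suc n) < r - \<sigma>" using nat_approx_posE[of "r - \<sigma>"] by auto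
    then have "ennreal (\<sigma> + 1 / real (Suc n)) \<le> ennreal r" by (intro ennreal_leI) simp
    then have "ennreal (\<sigma> + 1 / real (Suc n)) < f (hproj e x + s *\<^sub>R e)" using r(2) by (rule le_less_trans)
    then show "s \<in> (\<Union>n. ?A n)" by blast
  qed
  moreover have "(SUP n. emeasure lborel (?A n)) = emeasure lborel (\<Union>n. ?A n)"
  proof (rule SUP_emeasure_incseq)
    show "incseq ?A"
    proof (rule incseq_SucI)
      fix n
      have "\<sigma> + 1 / real (Suc (Suc n)) \<le> \<sigma> + 1 / real (Suc n)" by (simp add: field_simps)
      then have "ennreal (\<sigma> + 1 / real (Suc (Suc n))) \<le> ennreal (\<sigma> + 1 / real (Suc n))" by (rule ennreal_leI)
      then show "?A n \<le> ?A (Suc n)" by (auto simp del: of_nat_Suc dest: le_less_trans)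
    qed
  qed auto
  ultimately have "c < (SUP n. emeasure lborel (?A n))" using assms(2) by (simp add: line_level_def)
  then obtain n where "c < emeasure lborel (?A n)" by (auto simp: less_SUP_iff)
  then show ?thesis by (intro that[of "\<sigma> + 1 / real (Suc n)"]) (auto simp: line_level_def)
qed

text \<open>The heights at which \<open>x\<close> lies in its centered interval form an initial
  segment of the positive reals, by monotonicity of \<open>line_level\<close>, and
  \<open>steiner e f x\<close> is its length. Right continuity excludes the upper end, so strict
  superlevel sets correspond exactly to open intervals.\<close>

lemma less_steiner_iff:
  assumes [measurable]: "f \<in> borel_measurable borel" and "\<sigma> > 0"
  shows "ennreal \<sigma> < steiner e f x \<longleftrightarrow> x \<bullet> e \<in> centered (line_level e f x \<sigma>)"
proof
  assume less: "ennreal \<sigma> < steiner e f x"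
  show "x \<bullet> e \<in> centered (line_level e f x \<sigma>)"
  proof (rule ccontr)
    assume no: "x \<bullet> e \<notin> centered (line_level e f x \<sigma>)"
    have "steiner e f x \<le> (\<integral>\<^sup>+\<tau>. indicator {0..\<sigma>} \<tau> \<partial>lborel)"
      unfolding steiner_def
    proof (rule nn_integral_mono)
      fix \<tau>
      show "indicator {0<..} \<tau> * indicator (centered (line_level e f x \<tau>)) (x \<bullet> e) \<le> (indicator {0..\<sigma>} \<tau> :: ennreal)"
        using no centered_mono[OF line_level_antimono[of f \<sigma> \<tau> e x]]
        by (cases "\<sigma> \<le> \<tau>") (auto simp: indicator_def)
    qed
    then show False using less \<open>\<sigma> > 0\<close> by simp
  qed
next
  assume "x \<bullet> e \<in> centered (line_level e f x \<sigma>)"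
  then have "ennreal (2 * \<bar>x \<bullet> e\<bar>) < line_level e f x \<sigma>" by (simp add: centered_def)
  then obtain \<tau> where \<tau>: "\<tau> > \<sigma>" "ennreal (2 * \<bar>x \<bullet> e\<bar>) < line_level e f x \<tau>"
    by (rule line_level_right_cont[rotated]) (use \<open>\<sigma> > 0\<close> in auto)
  have "ennreal \<sigma> < ennreal \<tau>" using \<tau> \<open>\<sigma> > 0\<close> by (simp add: ennreal_less_iff)
  also have "ennreal \<tau> = (\<integral>\<^sup>+t. indicator {0<..\<tau>} t \<partial>lborel)" using \<tau> \<open>\<sigma> > 0\<close> by simp
  also have "\<dots> \<le> steiner e f x"
    unfolding steiner_def
  proof (rule nn_integral_mono)
    fix t
    show "indicator {0<..\<tau>} t \<le> (indicator {0<..} t * indicator (centered (line_level e f x t)) (x \<bullet> e) :: ennreal)"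
      using \<tau> line_level_antimono[of f t \<tau> e x] by (auto simp: indicator_def centered_def intro: less_le_trans)
  qed
  finally show "ennreal \<sigma> < steiner e f x" .
qed

lemma layer_steiner:
  assumes "f \<in> borel_measurable borel"
  shows "layer (steiner e f x) \<sigma> = indicator {0<..} \<sigma> * indicator (centered (line_level e f x \<sigma>)) (x \<bullet> e)"
  using less_steiner_iff[OF assms, of \<sigma> e x] by (auto simp: layer_def indicator_def)

text \<open>Demanded on every line parallel to \<open>e\<close> and not on almost every one, so that
  no exceptional sets have to be followed through repeated convolutions.\<close>

definition line_dominated :: "'a::euclidean_space \<Rightarrow> ('a \<Rightarrow> ennreal) \<Rightarrow> ('a \<Rightarrow> ennreal) \<Rightarrow> bool" where
  "line_dominated e F H \<longleftrightarrow> F \<in> borel_measurable borel \<and> H \<in> borel_measurable borel \<and>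
     (\<forall>z. symdec (\<lambda>s. H (hproj e z + s *\<^sub>R e)) \<and>
       dominated (\<lambda>s. F (hproj e z + s *\<^sub>R e)) (\<lambda>s. H (hproj e z + s *\<^sub>R e)))"

text \<open>A layer restricted to \<open>C\<close> has at most the smaller of the two measures
  involved. Centered intervals are nested, so for the symmetrized layer this minimum is
  attained.\<close>

lemma line_dominated_steiner:
  assumes [measurable]: "f \<in> borel_measurable borel" and e: "norm e = 1"
  shows "line_dominated e f (steiner e f)"
  unfolding line_dominated_def
proof safe
  fix z
  have st: "steiner e f (hproj e z + s *\<^sub>R e) = (\<integral>\<^sup>+\<sigma>. indicator {0<..} \<sigma> * indicator (centered (line_level e f z \<sigma>)) s \<partial>lborel)" for s
    unfolding steiner_def by (simp add: hproj_line[OF e] line_level_line[OF e])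
  show "symdec (\<lambda>s. steiner e f (hproj e z + s *\<^sub>R e))"
    unfolding symdec_def
  proof safe
    fix s t :: real assume "\<bar>s\<bar> \<le> \<bar>t\<bar>"
    then show "steiner e f (hproj e z + t *\<^sub>R e) \<le> steiner e f (hproj e z + s *\<^sub>R e)"
      unfolding st by (intro nn_integral_mono mult_left_mono) (auto simp: indicator_def dest: centered_closer)
  qed measurable
  show "dominated (\<lambda>s. f (hproj e z + s *\<^sub>R e)) (\<lambda>s. steiner e f (hproj e z + s *\<^sub>R e))"
    unfolding dominated_def
  proof safe
    fix C :: "real set" assume [measurable]: "C \<in> sets borel"
    let ?C = "centered (emeasure lborel C)"
    let ?f = "\<lambda>s. f (hproj e z + s *\<^sub>R e)"
    have "(\<integral>\<^sup>+s. indicator C s * ?f s \<partial>lborel) = (\<integral>\<^sup>+s. \<integral>\<^sup>+\<sigma>. indicator C s * layer (?f s) \<sigma> \<partial>lborel \<partial>lborel)"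
      by (simp add: nn_integral_cmult)
    also have "\<dots> = (\<integral>\<^sup>+\<sigma>. \<integral>\<^sup>+s. indicator C s * layer (?f s) \<sigma> \<partial>lborel \<partial>lborel)"
      by (rule lborel_pair.Fubini') measurable
    also have "\<dots> \<le> (\<integral>\<^sup>+\<sigma>. \<integral>\<^sup>+s. indicator ?C s * (indicator {0<..} \<sigma> * indicator (centered (line_level e f z \<sigma>)) s) \<partial>lborel \<partial>lborel)"
    proof (rule nn_integral_mono)
      fix \<sigma> :: real
      show "(\<integral>\<^sup>+s. indicator C s * layer (?f s) \<sigma> \<partial>lborel) \<le> (\<integral>\<^sup>+s. indicator ?C s * (indicator {0<..} \<sigma> * indicator (centered (line_level e f z \<sigma>)) s) \<partial>lborel)"
      proof (cases "\<sigma> > 0")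
        case True
        have "(\<integral>\<^sup>+s. indicator C s * layer (?f s) \<sigma> \<partial>lborel) \<le> (\<integral>\<^sup>+s. indicator C s \<partial>lborel)"
          by (intro nn_integral_mono) (auto simp: layer_def)
        moreover have "(\<integral>\<^sup>+s. indicator C s * layer (?f s) \<sigma> \<partial>lborel) \<le> (\<integral>\<^sup>+s. layer (?f s) \<sigma> \<partial>lborel)"
          by (intro nn_integral_mono) (auto simp: indicator_def)
        moreover have "(\<integral>\<^sup>+s. layer (?f s) \<sigma> \<partial>lborel) = line_level e f z \<sigma>"
          unfolding line_level_def using True by (intro emeasure_layer[symmetric]) auto
        ultimately have "(\<integral>\<^sup>+s. indicator C s * layer (?f s) \<sigma> \<partial>lborel) \<le> min (emeasure lborel C) (line_level e f z \<sigma>)"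
          by simp
        also have "\<dots> = emeasure lborel (?C \<inter> centered (line_level e f z \<sigma>))" by (simp add: centered_Int)
        also have "\<dots> = (\<integral>\<^sup>+s. indicator ?C s * indicator (centered (line_level e f z \<sigma>)) s \<partial>lborel)"
          by (simp flip: indicator_inter_arith)
        finally show ?thesis using True by simp
      qed (simp add: layer_def)
    qed
    also have "\<dots> = (\<integral>\<^sup>+s. \<integral>\<^sup>+\<sigma>. indicator ?C s * (indicator {0<..} \<sigma> * indicator (centered (line_level e f z \<sigma>)) s) \<partial>lborel \<partial>lborel)"
      by (rule lborel_pair.Fubini') measurable
    also have "\<dots> = (\<integral>\<^sup>+s. indicator ?C s * steiner e f (hproj e z + s *\<^sub>R e) \<partial>lborel)"
      unfolding st by (intro nn_integral_cong nn_integral_cmult) measurable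
    finally show "(\<integral>\<^sup>+s. indicator C s * ?f s \<partial>lborel) \<le> (\<integral>\<^sup>+s. indicator ?C s * steiner e f (hproj e z + s *\<^sub>R e) \<partial>lborel)" .
  qed
qed measurable

lemma conv_lines:
  fixes F G :: "'a::euclidean_space \<Rightarrow> ennreal"
  assumes [measurable]: "F \<in> borel_measurable borel" "G \<in> borel_measurable borel" and e: "norm e = 1"
  shows "conv F G (hproj e z + t *\<^sub>R e) = (\<integral>\<^sup>+y. indicator {0<..<1} (y \<bullet> e) *
    conv (\<lambda>s. F (hproj e y + s *\<^sub>R e)) (\<lambda>s. G (hproj e (z - y) + s *\<^sub>R e)) t \<partial>lborel)"
  unfolding conv_def hproj_diff
  by (subst nn_integral_lines[OF _ e]) (auto simp: algebra_simps)

text \<open>On a line a convolution in space is an integral, over base points \<open>y\<close>, of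
  one-dimensional convolutions of the restrictions to the lines through \<open>y\<close> and
  \<open>z - y\<close>. Both symmetric decrease and domination pass to such integrals.\<close>

lemma line_dominated_conv:
  assumes F: "line_dominated e F H" and G: "line_dominated e G K" and e: "norm e = 1"
  shows "line_dominated e (conv F G) (conv H K)"
  unfolding line_dominated_def
proof safe
  have [measurable]: "F \<in> borel_measurable borel" "H \<in> borel_measurable borel" "G \<in> borel_measurable borel" "K \<in> borel_measurable borel"
    using F G by (auto simp: line_dominated_def)
  show "conv F G \<in> borel_measurable borel" "conv H K \<in> borel_measurable borel" by measurable
  fix z
  let ?L = "\<lambda>F y s. F (hproj e y + s *\<^sub>R e)"
  let ?I = "\<lambda>y. indicator {0<..<1} (y \<bullet> e) :: ennreal"
  have [measurable]: "(\<lambda>(y, t). conv (?L F y) (?L G (z - y)) t) \<in> borel_measurable (borel \<Otimes>\<^sub>M borel)" 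
    "(\<lambda>(y, t). conv (?L H y) (?L K (z - y)) t) \<in> borel_measurable (borel \<Otimes>\<^sub>M borel)" 
    unfolding conv_def by measurable
  have sd: "symdec (conv (?L H y) (?L K (z - y)))" for y
    using F G unfolding line_dominated_def by (intro symdec_conv) auto
  have dom: "dominated (conv (?L F y) (?L G (z - y))) (conv (?L H y) (?L K (z - y)))" for y
    using F G unfolding line_dominated_def by (intro dominated_conv) auto
  show "symdec (\<lambda>s. conv H K (hproj e z + s *\<^sub>R e))"
    unfolding symdec_def
  proof safe
    fix s t :: real assume "\<bar>s\<bar> \<le> \<bar>t\<bar>"
    then show "conv H K (hproj e z + t *\<^sub>R e) \<le> conv H K (hproj e z + s *\<^sub>R e)"
      by (simp add: conv_lines[OF _ _ e] nn_integral_mono mult_left_mono symdecD[OF sd])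
  qed measurable
  show "dominated (\<lambda>s. conv F G (hproj e z + s *\<^sub>R e)) (\<lambda>s. conv H K (hproj e z + s *\<^sub>R e))"
    unfolding dominated_def
  proof safe
    fix C :: "real set" assume [measurable]: "C \<in> sets borel"
    let ?C = "centered (emeasure lborel C)"
    have "(\<integral>\<^sup>+s. indicator C s * conv F G (hproj e z + s *\<^sub>R e) \<partial>lborel)
      = (\<integral>\<^sup>+s. \<integral>\<^sup>+y. indicator C s * (?I y * conv (?L F y) (?L G (z - y)) s) \<partial>lborel \<partial>lborel)"
      by (subst conv_lines[OF _ _ e]) (auto simp: nn_integral_cmult)
    also have "\<dots> = (\<integral>\<^sup>+y. \<integral>\<^sup>+s. indicator C s * (?I y * conv (?L F y) (?L G (z - y)) s) \<partial>lborel \<partial>lborel)"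
      by (rule lborel_pair.Fubini') measurable
    also have "\<dots> = (\<integral>\<^sup>+y. ?I y * (\<integral>\<^sup>+s. indicator C s * conv (?L F y) (?L G (z - y)) s \<partial>lborel) \<partial>lborel)"
      by (subst nn_integral_cmult[symmetric]) (auto simp: mult_ac)
    also have "\<dots> \<le> (\<integral>\<^sup>+y. ?I y * (\<integral>\<^sup>+s. indicator ?C s * conv (?L H y) (?L K (z - y)) s \<partial>lborel) \<partial>lborel)"
      by (intro nn_integral_mono mult_left_mono dominatedD[OF dom]) auto
    also have "\<dots> = (\<integral>\<^sup>+y. \<integral>\<^sup>+s. indicator ?C s * (?I y * conv (?L H y) (?L K (z - y)) s) \<partial>lborel \<partial>lborel)"
      by (subst nn_integral_cmult[symmetric]) (auto simp: mult_ac)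
    also have "\<dots> = (\<integral>\<^sup>+s. \<integral>\<^sup>+y. indicator ?C s * (?I y * conv (?L H y) (?L K (z - y)) s) \<partial>lborel \<partial>lborel)"
      by (rule lborel_pair.Fubini') measurable
    also have "\<dots> = (\<integral>\<^sup>+s. indicator ?C s * conv H K (hproj e z + s *\<^sub>R e) \<partial>lborel)"
      by (subst conv_lines[OF _ _ e]) (auto simp: nn_integral_cmult)
    finally show "(\<integral>\<^sup>+s. indicator C s * conv F G (hproj e z + s *\<^sub>R e) \<partial>lborel) \<le> (\<integral>\<^sup>+s. indicator ?C s * conv H K (hproj e z + s *\<^sub>R e) \<partial>lborel)" .
  qed
qed

text \<open>The index is shifted: \<open>conv_pow f k\<close> has \<open>k + 1\<close> factors, and so has \<open>cconv_pow\<close> below.\<close>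

primrec conv_pow :: "('a::euclidean_space \<Rightarrow> ennreal) \<Rightarrow> nat \<Rightarrow> 'a \<Rightarrow> ennreal" where
  "conv_pow f 0 = f"
| "conv_pow f (Suc k) = conv f (conv_pow f k)"

lemma conv_pow_measurable[measurable]:
  assumes [measurable]: "f \<in> borel_measurable borel"
  shows "conv_pow f k \<in> borel_measurable borel"
  by (induction k) auto

lemma conv_pow_steiner_L2_le:
  assumes f[measurable]: "f \<in> borel_measurable borel" and e: "norm e = 1"
  shows "(\<integral>\<^sup>+x. (conv_pow f k x)\<^sup>2 \<partial>lborel) \<le> (\<integral>\<^sup>+x. (conv_pow (steiner e f) k x)\<^sup>2 \<partial>lborel)"
proof -
  have dom: "line_dominated e (conv_pow f k) (conv_pow (steiner e f) k)"
    by (induction k) (auto intro: line_dominated_steiner line_dominated_conv f e)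
  have "(\<integral>\<^sup>+x. (conv_pow f k x)\<^sup>2 \<partial>lborel) = (\<integral>\<^sup>+y. indicator {0<..<1} (y \<bullet> e) *
     (\<integral>\<^sup>+s. conv_pow f k (hproj e y + s *\<^sub>R e) * conv_pow f k (hproj e y + s *\<^sub>R e) \<partial>lborel) \<partial>lborel)"
    unfolding power2_eq_square by (rule nn_integral_lines[OF _ e]) measurable
  also have "\<dots> \<le> (\<integral>\<^sup>+y. indicator {0<..<1} (y \<bullet> e) *
     (\<integral>\<^sup>+s. conv_pow (steiner e f) k (hproj e y + s *\<^sub>R e) * conv_pow (steiner e f) k (hproj e y + s *\<^sub>R e) \<partial>lborel) \<partial>lborel)"
    using dom unfolding line_dominated_def
    by (intro nn_integral_mono mult_left_mono dominated_integral_mult) auto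
  also have "\<dots> = (\<integral>\<^sup>+x. (conv_pow (steiner e f) k x)\<^sup>2 \<partial>lborel)"
    unfolding power2_eq_square by (rule nn_integral_lines[OF _ e, symmetric]) measurable
  finally show ?thesis .
qed

section \<open>Strict decrease of the weighted norm under symmetrization\<close>

lemma AE_eq_of_nn_integral_le:
  assumes [measurable]: "u \<in> borel_measurable M" "v \<in> borel_measurable M"
    and le: "AE x in M. u x \<le> v x" and ge: "(\<integral>\<^sup>+x. v x \<partial>M) \<le> (\<integral>\<^sup>+x. u x \<partial>M)" and fin: "(\<integral>\<^sup>+x. u x \<partial>M) < \<infinity>"
  shows "AE x in M. u x = v x"
proof -
  have "(\<integral>\<^sup>+x. v x - u x \<partial>M) = (\<integral>\<^sup>+x. v x \<partial>M) - (\<integral>\<^sup>+x. u x \<partial>M)"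
    using le fin by (intro nn_integral_diff) auto
  also have "\<dots> = 0" using ge fin by (intro diff_eq_0_ennreal) (auto intro: le_less_trans)
  finally have "AE x in M. v x - u x = 0" by (simp add: nn_integral_0_iff_AE)
  with le show ?thesis
    by eventually_elim (metis add.right_neutral add_diff_inverse_ennreal)
qed

text \<open>\<open>E\<close> and the centered interval differ by two pieces of equal measure, and
  the value of \<open>v\<close> at the end of the interval separates the two: \<open>v\<close> is at
  most this value inside and at least this value outside. Equality forces \<open>v\<close> to be
  equal to it almost everywhere on the outer piece, which strict monotonicity permits only at the
  two end points.\<close>

lemma rearranged_set_integral:
  fixes v :: "real \<Rightarrow> ennreal"
  assumes [measurable]: "v \<in> borel_measurable borel" "E \<in> sets borel"
    and vfin: "\<And>s. v s < \<infinity>" and mono: "\<And>s t. \<bar>s\<bar> < \<bar>t\<bar> \<Longrightarrow> v s < v t" and even: "\<And>s t. \<bar>s\<bar> = \<bar>t\<bar> \<Longrightarrow> v s = v t"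
    and fin: "emeasure lborel E < \<infinity>"
  shows "(\<integral>\<^sup>+s. indicator (centered (emeasure lborel E)) s * v s \<partial>lborel) \<le> (\<integral>\<^sup>+s. indicator E s * v s \<partial>lborel)" (is "?L \<le> ?R")
    and "(\<integral>\<^sup>+s. indicator E s * v s \<partial>lborel) \<le> (\<integral>\<^sup>+s. indicator (centered (emeasure lborel E)) s * v s \<partial>lborel)
      \<Longrightarrow> (\<integral>\<^sup>+s. indicator E s * v s \<partial>lborel) < \<infinity> \<Longrightarrow> AE s in lborel. s \<in> E \<longleftrightarrow> s \<in> centered (emeasure lborel E)"
proof -
  let ?S = "centered (emeasure lborel E)"
  obtain r where r: "emeasure lborel E = ennreal r" "r \<ge> 0" using fin by (cases "emeasure lborel E") auto
  define p where "p = v (r / 2)"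
  have S: "?S = {-r/2<..<r/2}" using r by (simp add: centered_real)
  have vle: "\<bar>s\<bar> \<le> \<bar>t\<bar> \<Longrightarrow> v s \<le> v t" for s t using mono[of s t] even[of s t] by (cases "\<bar>s\<bar> = \<bar>t\<bar>") auto
  have split: "emeasure lborel X = emeasure lborel (X \<inter> Y) + emeasure lborel (X - Y)"
    if "X \<in> sets borel" "Y \<in> sets borel" for X Y :: "real set"
    using plus_emeasure[of "X \<inter> Y" lborel "X - Y"] that by (simp add: Int_Diff_Un Int_Diff_disjoint)
  have split1: "emeasure lborel E = emeasure lborel (E \<inter> ?S) + emeasure lborel (E - ?S)"
    by (rule split) measurable
  have split2: "emeasure lborel ?S = emeasure lborel (E \<inter> ?S) + emeasure lborel (?S - E)"
    using split[of ?S E] by (simp add: Int_commute)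
  have finI: "emeasure lborel (E \<inter> ?S) < \<infinity>"
    using emeasure_mono[of "E \<inter> ?S" E lborel] fin by (auto intro: le_less_trans)
  have eqD: "emeasure lborel (E - ?S) = emeasure lborel (?S - E)"
    using split1 split2 finI by (metis emeasure_centered ennreal_add_left_cancel infinity_ennreal_def less_irrefl)
  have i1: "?R = (\<integral>\<^sup>+s. indicator (E \<inter> ?S) s * v s \<partial>lborel) + (\<integral>\<^sup>+s. indicator (E - ?S) s * v s \<partial>lborel)"
    by (subst nn_integral_add[symmetric]) (auto intro!: nn_integral_cong simp: indicator_def)
  have i2: "?L = (\<integral>\<^sup>+s. indicator (E \<inter> ?S) s * v s \<partial>lborel) + (\<integral>\<^sup>+s. indicator (?S - E) s * v s \<partial>lborel)"
    by (subst nn_integral_add[symmetric]) (auto intro!: nn_integral_cong simp: indicator_def)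
  have o1: "indicator (E - ?S) s * p \<le> indicator (E - ?S) s * v s" for s
    using r unfolding p_def S by (auto simp: indicator_def intro!: vle)
  have o2: "(\<integral>\<^sup>+s. indicator (?S - E) s * v s \<partial>lborel) \<le> (\<integral>\<^sup>+s. indicator (E - ?S) s * p \<partial>lborel)"
  proof -
    have "(\<integral>\<^sup>+s. indicator (?S - E) s * v s \<partial>lborel) \<le> (\<integral>\<^sup>+s. indicator (?S - E) s * p \<partial>lborel)"
      using r unfolding p_def S by (intro nn_integral_mono) (auto simp: indicator_def intro!: vle)
    also have "\<dots> = (\<integral>\<^sup>+s. indicator (E - ?S) s * p \<partial>lborel)"
      by (simp add: nn_integral_multc eqD)
    finally show ?thesis .
  qed
  show "?L \<le> ?R" unfolding i1 i2
    by (intro add_left_mono order_trans[OF o2] nn_integral_mono o1)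
  assume le: "?R \<le> ?L" and Rfin: "?R < \<infinity>"
  have "(\<integral>\<^sup>+s. indicator (E \<inter> ?S) s * v s \<partial>lborel) \<noteq> \<top>"
    using Rfin unfolding i1 by auto
  then have "(\<integral>\<^sup>+s. indicator (E - ?S) s * v s \<partial>lborel) \<le> (\<integral>\<^sup>+s. indicator (?S - E) s * v s \<partial>lborel)"
    using le unfolding i1 i2 by (simp add: ennreal_add_left_cancel_le)
  then have ge: "(\<integral>\<^sup>+s. indicator (E - ?S) s * v s \<partial>lborel) \<le> (\<integral>\<^sup>+s. indicator (E - ?S) s * p \<partial>lborel)"
    using o2 by (rule order_trans)
  have "(\<integral>\<^sup>+s. indicator (E - ?S) s * p \<partial>lborel) \<le> (\<integral>\<^sup>+s. indicator (E - ?S) s * v s \<partial>lborel)"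
    by (intro nn_integral_mono o1)
  also have "\<dots> < \<infinity>" using Rfin unfolding i1 by auto
  finally have "AE s in lborel. indicator (E - ?S) s * p = indicator (E - ?S) s * v s"
    using ge by (intro AE_eq_of_nn_integral_le) (auto intro: o1)
  then have AE1: "AE s in lborel. s \<notin> E - ?S"
    using AE_lborel_singleton[of "r/2"] AE_lborel_singleton[of "-r/2"]
  proof eventually_elim
    fix s assume eq: "indicator (E - ?S) s * p = indicator (E - ?S) s * v s" and "s \<noteq> r/2" "s \<noteq> -r/2"
    show "s \<notin> E - ?S"
    proof
      assume s: "s \<in> E - ?S"
      then have "s \<notin> {-r/2<..<r/2}" using S by blast
      then have "\<bar>r/2\<bar> < \<bar>s\<bar>" using \<open>s \<noteq> r/2\<close> \<open>s \<noteq> -r/2\<close> r by auto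
      from mono[OF this] s eq show False by (simp add: p_def)
    qed
  qed
  then have "E - ?S \<in> null_sets lborel" by (simp add: AE_iff_null_sets)
  then have "?S - E \<in> null_sets lborel" using eqD by (simp add: null_sets_def)
  then have "AE s in lborel. s \<notin> ?S - E" by (simp add: AE_iff_null_sets)
  with AE1 show "AE s in lborel. s \<in> E \<longleftrightarrow> s \<in> ?S" by eventually_elim auto
qed

lemma nn_integral_layer_sq: "(\<integral>\<^sup>+\<sigma>. ennreal (2 * \<sigma>) * layer x \<sigma> \<partial>lborel) = x\<^sup>2"
proof -
  have le: "(\<integral>\<^sup>+\<sigma>. ennreal (2 * \<sigma>) * indicator {0..r} \<sigma> \<partial>lborel) = ennreal (r\<^sup>2)" if "r \<ge> 0" for r
    by (subst nn_integral_FTC_Icc[where F="\<lambda>x. x\<^sup>2"]) (use that in \<open>auto intro!: derivative_eq_intros\<close>)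
  show ?thesis
  proof (cases x)
    case (real r)
    have "(\<integral>\<^sup>+\<sigma>. ennreal (2 * \<sigma>) * layer x \<sigma> \<partial>lborel) = (\<integral>\<^sup>+\<sigma>. ennreal (2 * \<sigma>) * indicator {0..r} \<sigma> \<partial>lborel)"
      using AE_lborel_singleton[of r] real
      by (intro nn_integral_cong_AE) (auto simp: layer_def indicator_def ennreal_less_iff elim!: eventually_mono)
    then show ?thesis using le real by (simp add: ennreal_power)
  next
    case top
    have "ennreal (real n) \<le> (\<integral>\<^sup>+\<sigma>. ennreal (2 * \<sigma>) * layer x \<sigma> \<partial>lborel)" for n :: nat
    proof -
      have "ennreal (real n) \<le> ennreal ((real n)\<^sup>2)"
        by (intro ennreal_leI) (cases n; simp add: power2_eq_square)
      also have "\<dots> \<le> (\<integral>\<^sup>+\<sigma>. ennreal (2 * \<sigma>) * layer x \<sigma> \<partial>lborel)"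
        unfolding le[symmetric, OF of_nat_0_le_iff]
        by (intro nn_integral_mono) (auto simp: layer_def indicator_def top)
      finally show ?thesis .
    qed
    then have "(\<integral>\<^sup>+\<sigma>. ennreal (2 * \<sigma>) * layer x \<sigma> \<partial>lborel) = \<top>"
      by (metis ennreal_of_nat_eq_real_of_nat ennreal_SUP_of_nat_eq_top SUP_least top.extremum_unique)
    then show ?thesis using top by (simp add: power2_eq_square)
  qed
qed

lemma steiner_weighted_norm:
  fixes f m :: "'a::euclidean_space \<Rightarrow> ennreal"
  assumes f[measurable]: "f \<in> borel_measurable borel" and m[measurable]: "m \<in> borel_measurable borel" and e: "norm e = 1"
    and mfin: "\<And>x. m x < \<infinity>" and m1: "\<And>x. m x \<ge> 1"
    and mono: "\<And>x y. norm x < norm y \<Longrightarrow> m x < m y" and even: "\<And>x y. norm x = norm y \<Longrightarrow> m x = m y"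
    and fin: "(\<integral>\<^sup>+x. m x * (f x)\<^sup>2 \<partial>lborel) < \<infinity>"
  shows "(\<integral>\<^sup>+x. m x * (steiner e f x)\<^sup>2 \<partial>lborel) \<le> (\<integral>\<^sup>+x. m x * (f x)\<^sup>2 \<partial>lborel)" (is "?L \<le> ?R")
    and "(\<integral>\<^sup>+x. m x * (f x)\<^sup>2 \<partial>lborel) \<le> (\<integral>\<^sup>+x. m x * (steiner e f x)\<^sup>2 \<partial>lborel) \<Longrightarrow> AE x in lborel. f x = steiner e f x"
proof -
  \<comment> \<open>The contribution of height \<open>\<sigma>\<close> and of the line through
    \<open>y\<close> to the weighted norm; the factor 2 \<sigma> is the derivative of the
    square.\<close>
  define D where "D g \<sigma> y = ennreal (2 * \<sigma>) * (indicator {0<..<1} (y \<bullet> e) *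
     (\<integral>\<^sup>+s. m (hproj e y + s *\<^sub>R e) * layer (g (hproj e y + s *\<^sub>R e)) \<sigma> \<partial>lborel))" for g \<sigma> y
  have D_meas[measurable]: "(\<lambda>(\<sigma>, y). D g \<sigma> y) \<in> borel_measurable (borel \<Otimes>\<^sub>M borel)"
    if [measurable]: "g \<in> borel_measurable borel" for g
    unfolding D_def by measurable
  have D_meas2[measurable]: "D g \<sigma> \<in> borel_measurable borel"
    if [measurable]: "g \<in> borel_measurable borel" for g \<sigma>
    unfolding D_def by measurable
  have D_int: "(\<integral>\<^sup>+x. m x * (g x)\<^sup>2 \<partial>lborel) = (\<integral>\<^sup>+\<sigma>. \<integral>\<^sup>+y. D g \<sigma> y \<partial>lborel \<partial>lborel)"
    if [measurable]: "g \<in> borel_measurable borel" for g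
  proof -
    have "(\<integral>\<^sup>+x. m x * (g x)\<^sup>2 \<partial>lborel) = (\<integral>\<^sup>+x. \<integral>\<^sup>+\<sigma>. m x * (ennreal (2 * \<sigma>) * layer (g x) \<sigma>) \<partial>lborel \<partial>lborel)"
      by (subst nn_integral_cmult) (auto simp: nn_integral_layer_sq)
    also have "\<dots> = (\<integral>\<^sup>+\<sigma>. \<integral>\<^sup>+x. m x * (ennreal (2 * \<sigma>) * layer (g x) \<sigma>) \<partial>lborel \<partial>lborel)"
      by (rule lborel_pair.Fubini') measurable
    also have "\<dots> = (\<integral>\<^sup>+\<sigma>. ennreal (2 * \<sigma>) * (\<integral>\<^sup>+x. m x * layer (g x) \<sigma> \<partial>lborel) \<partial>lborel)"
      by (subst nn_integral_cmult[symmetric]) (auto simp: mult_ac)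
    also have "\<dots> = (\<integral>\<^sup>+\<sigma>. \<integral>\<^sup>+y. D g \<sigma> y \<partial>lborel \<partial>lborel)"
      unfolding D_def by (subst nn_integral_lines[OF _ e]) (auto intro!: nn_integral_cong nn_integral_cmult[symmetric])
    finally show ?thesis .
  qed
  \<comment> \<open>Chebyshev's inequality, with a weight of at least 1: on almost every line of the
    slab the superlevel set has finite length, as the comparison of sets requires.\<close>
  have level: "AE y in lborel. y \<bullet> e \<in> {0<..<1} \<longrightarrow> line_level e f y \<sigma> < \<infinity>" if "\<sigma> > 0" for \<sigma>
  proof -
    have "(\<integral>\<^sup>+y. indicator {0<..<1} (y \<bullet> e) * line_level e f y \<sigma> \<partial>lborel) = (\<integral>\<^sup>+x. layer (f x) \<sigma> \<partial>lborel)"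
      by (subst nn_integral_lines[OF _ e]) (auto intro!: nn_integral_cong arg_cong2[where f="(*)"] emeasure_layer simp: line_level_def that)
    also have "\<dots> \<le> (\<integral>\<^sup>+x. ennreal (1 / \<sigma>\<^sup>2) * (m x * (f x)\<^sup>2) \<partial>lborel)"
    proof (rule nn_integral_mono)
      fix x
      show "layer (f x) \<sigma> \<le> ennreal (1 / \<sigma>\<^sup>2) * (m x * (f x)\<^sup>2)"
      proof (cases "ennreal \<sigma> < f x")
        case True
        have "1 = ennreal (1 / \<sigma>\<^sup>2) * (1 * (ennreal \<sigma>)\<^sup>2)"
          using that by (simp add: ennreal_power flip: ennreal_mult)
        also have "\<dots> \<le> ennreal (1 / \<sigma>\<^sup>2) * (m x * (f x)\<^sup>2)"
          using True m1 by (intro mult_mono power_mono order_refl) auto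
        finally show ?thesis by (simp add: layer_def)
      qed (simp add: layer_def)
    qed
    also have "\<dots> < \<infinity>" using fin by (subst nn_integral_cmult) (auto simp: ennreal_mult_less_top)
    finally have "AE y in lborel. indicator {0<..<1} (y \<bullet> e) * line_level e f y \<sigma> \<noteq> \<infinity>"
      by (intro nn_integral_PInf_AE) auto
    then show ?thesis by eventually_elim (auto simp: indicator_def less_top[symmetric] split: if_splits)
  qed
  let ?v = "\<lambda>y s. m (hproj e y + s *\<^sub>R e)"
  let ?E = "\<lambda>y \<sigma>. {s. ennreal \<sigma> < f (hproj e y + s *\<^sub>R e)}"
  have v_mono: "?v y s < ?v y t" if "\<bar>s\<bar> < \<bar>t\<bar>" for y s t
  proof (rule mono)
    have "(norm (hproj e y + s *\<^sub>R e))\<^sup>2 < (norm (hproj e y + t *\<^sub>R e))\<^sup>2"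
      using power_strict_mono[OF that, of 2] by (simp add: norm_line[OF e])
    then show "norm (hproj e y + s *\<^sub>R e) < norm (hproj e y + t *\<^sub>R e)" by (rule power2_less_imp_less) simp
  qed
  have v_even: "?v y s = ?v y t" if "\<bar>s\<bar> = \<bar>t\<bar>" for y s t
  proof (rule even)
    have "s\<^sup>2 = t\<^sup>2" using that by (metis power2_abs)
    then have "(norm (hproj e y + s *\<^sub>R e))\<^sup>2 = (norm (hproj e y + t *\<^sub>R e))\<^sup>2" by (simp add: norm_line[OF e])
    then show "norm (hproj e y + s *\<^sub>R e) = norm (hproj e y + t *\<^sub>R e)" by simp
  qed
  have lay_f: "layer (f (hproj e y + s *\<^sub>R e)) \<sigma> = indicator (?E y \<sigma>) s" if "\<sigma> > 0" for y \<sigma> s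
    using that by (auto simp: layer_def indicator_def)
  have lay_st: "layer (steiner e f (hproj e y + s *\<^sub>R e)) \<sigma> = indicator (centered (line_level e f y \<sigma>)) s" if "\<sigma> > 0" for y \<sigma> s
    using that by (simp add: layer_steiner[OF f] line_level_line[OF e] hproj_line[OF e])
  have lev_E: "emeasure lborel (?E y \<sigma>) = line_level e f y \<sigma>" for y \<sigma> by (simp add: line_level_def)
  have D_le: "AE y in lborel. D (steiner e f) \<sigma> y \<le> D f \<sigma> y" for \<sigma>
  proof (cases "\<sigma> > 0")
    case True
    show ?thesis using level[OF True]
    proof eventually_elim
      fix y assume fl: "y \<bullet> e \<in> {0<..<1} \<longrightarrow> line_level e f y \<sigma> < \<infinity>"
      show "D (steiner e f) \<sigma> y \<le> D f \<sigma> y"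
        using fl rearranged_set_integral(1)[of "?v y" "?E y \<sigma>", OF _ _ mfin v_mono v_even] True
        unfolding D_def lev_E lay_f[OF True] lay_st[OF True]
        by (auto intro!: mult_left_mono simp: indicator_def[of "{0<..<1}"] mult.commute)
    qed
  qed (simp add: D_def ennreal_neg)
  have D_le_int: "(\<integral>\<^sup>+y. D (steiner e f) \<sigma> y \<partial>lborel) \<le> (\<integral>\<^sup>+y. D f \<sigma> y \<partial>lborel)" for \<sigma>
    by (rule nn_integral_mono_AE[OF D_le])
  show le: "?L \<le> ?R" unfolding D_int[OF f] D_int[OF steiner_measurable[OF f]]
    by (rule nn_integral_mono[OF D_le_int])
  \<comment> \<open>Equality is handed down from the whole integral to almost every height, then to
    almost every line, then to almost every point of the line. Each passage uses that one integrand
    is below the other and that the integrals are finite.\<close>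
  assume ge: "?R \<le> ?L"
  have "AE \<sigma> in lborel. (\<integral>\<^sup>+y. D (steiner e f) \<sigma> y \<partial>lborel) = (\<integral>\<^sup>+y. D f \<sigma> y \<partial>lborel)"
    by (rule AE_eq_of_nn_integral_le)
      (use ge le fin D_le_int in \<open>auto simp flip: D_int intro: le_less_trans\<close>)
  moreover have "AE \<sigma> in lborel. (\<integral>\<^sup>+y. D f \<sigma> y \<partial>lborel) \<noteq> \<infinity>"
    using fin by (intro nn_integral_PInf_AE) (auto simp flip: D_int)
  ultimately have "AE \<sigma> in lborel. \<sigma> > 0 \<longrightarrow> (AE y in lborel. y \<bullet> e \<in> {0<..<1} \<longrightarrow>
      (AE s in lborel. layer (f (hproj e y + s *\<^sub>R e)) \<sigma> = layer (steiner e f (hproj e y + s *\<^sub>R e)) \<sigma>))"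
  proof eventually_elim
    fix \<sigma> :: real assume eq: "(\<integral>\<^sup>+y. D (steiner e f) \<sigma> y \<partial>lborel) = (\<integral>\<^sup>+y. D f \<sigma> y \<partial>lborel)"
      and Dfin: "(\<integral>\<^sup>+y. D f \<sigma> y \<partial>lborel) \<noteq> \<infinity>"
    have AEeq: "AE y in lborel. D (steiner e f) \<sigma> y = D f \<sigma> y"
      by (rule AE_eq_of_nn_integral_le) (use eq Dfin D_le in \<open>auto simp: less_top[symmetric]\<close>)
    have AEfin: "AE y in lborel. D f \<sigma> y \<noteq> \<infinity>"
      using Dfin by (intro nn_integral_PInf_AE) auto
    show "\<sigma> > 0 \<longrightarrow> (AE y in lborel. y \<bullet> e \<in> {0<..<1} \<longrightarrow>
      (AE s in lborel. layer (f (hproj e y + s *\<^sub>R e)) \<sigma> = layer (steiner e f (hproj e y + s *\<^sub>R e)) \<sigma>))"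
    proof
      assume "\<sigma> > 0"
      show "AE y in lborel. y \<bullet> e \<in> {0<..<1} \<longrightarrow>
        (AE s in lborel. layer (f (hproj e y + s *\<^sub>R e)) \<sigma> = layer (steiner e f (hproj e y + s *\<^sub>R e)) \<sigma>)"
        using AEeq AEfin level[OF \<open>\<sigma> > 0\<close>]
      proof eventually_elim
        fix y assume 1: "D (steiner e f) \<sigma> y = D f \<sigma> y" and 2: "D f \<sigma> y \<noteq> \<infinity>"
          and 3: "y \<bullet> e \<in> {0<..<1} \<longrightarrow> line_level e f y \<sigma> < \<infinity>"
        show "y \<bullet> e \<in> {0<..<1} \<longrightarrow>
          (AE s in lborel. layer (f (hproj e y + s *\<^sub>R e)) \<sigma> = layer (steiner e f (hproj e y + s *\<^sub>R e)) \<sigma>)"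
        proof
          assume y: "y \<bullet> e \<in> {0<..<1}"
          have pos: "ennreal (2 * \<sigma>) \<noteq> 0" "ennreal (2 * \<sigma>) \<noteq> \<top>" using \<open>\<sigma> > 0\<close> by auto
          have Deq: "D g \<sigma> y = ennreal (2 * \<sigma>) * (\<integral>\<^sup>+s. layer (g (hproj e y + s *\<^sub>R e)) \<sigma> * ?v y s \<partial>lborel)" for g
            using y by (simp add: D_def mult.commute)
          have "AE s in lborel. s \<in> ?E y \<sigma> \<longleftrightarrow> s \<in> centered (emeasure lborel (?E y \<sigma>))"
          proof (rule rearranged_set_integral(2)[of "?v y" "?E y \<sigma>", OF _ _ mfin v_mono v_even])
            show "emeasure lborel (?E y \<sigma>) < \<infinity>" using 3 y unfolding lev_E by auto
            show "(\<integral>\<^sup>+s. indicator (?E y \<sigma>) s * ?v y s \<partial>lborel) \<le> (\<integral>\<^sup>+s. indicator (centered (emeasure lborel (?E y \<sigma>))) s * ?v y s \<partial>lborel)"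
              using 1 pos unfolding Deq lev_E lay_f[OF \<open>\<sigma> > 0\<close>] lay_st[OF \<open>\<sigma> > 0\<close>] by (simp add: ennreal_mult_cancel_left)
            show "(\<integral>\<^sup>+s. indicator (?E y \<sigma>) s * ?v y s \<partial>lborel) < \<infinity>"
              using 2 pos unfolding Deq lay_f[OF \<open>\<sigma> > 0\<close>] by (auto simp: ennreal_mult_eq_top_iff less_top[symmetric])
          qed measurable
          then show "AE s in lborel. layer (f (hproj e y + s *\<^sub>R e)) \<sigma> = layer (steiner e f (hproj e y + s *\<^sub>R e)) \<sigma>"
            unfolding lay_f[OF \<open>\<sigma> > 0\<close>] lay_st[OF \<open>\<sigma> > 0\<close>] lev_E by eventually_elim (auto simp: indicator_def)
        qed
      qed
    qed
  qed
  then have AEl: "AE \<sigma> in lborel. \<sigma> > 0 \<longrightarrow> (AE y in lborel. y \<bullet> e \<in> {0<..<1} \<longrightarrow>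
      (AE s in lborel. layer (f (hproj e y + s *\<^sub>R e)) \<sigma> = layer (steiner e f (hproj e y + s *\<^sub>R e)) \<sigma>))" .
  \<comment> \<open>\<open>N\<close> vanishes exactly where the two layers agree. Writing
    disagreement as a nonnegative function allows Tonelli to turn "for almost every height, almost
    every line, almost every point" into "for almost every \<open>x\<close>, almost every
    height".\<close>
  define N where "N x \<sigma> = (layer (f x) \<sigma> - layer (steiner e f x) \<sigma>) + (layer (steiner e f x) \<sigma> - layer (f x) \<sigma>)" for x \<sigma>
  have [measurable]: "(\<lambda>(x, \<sigma>). N x \<sigma>) \<in> borel_measurable (borel \<Otimes>\<^sub>M borel)" unfolding N_def by measurable
  have [measurable]: "(\<lambda>(\<sigma>, x). N x \<sigma>) \<in> borel_measurable (borel \<Otimes>\<^sub>M borel)" unfolding N_def by measurable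
  have N0: "N x \<sigma> = 0 \<longleftrightarrow> layer (f x) \<sigma> = layer (steiner e f x) \<sigma>" for x \<sigma>
    by (auto simp: N_def layer_def)
  have "(\<integral>\<^sup>+x. \<integral>\<^sup>+\<sigma>. N x \<sigma> \<partial>lborel \<partial>lborel) = (\<integral>\<^sup>+\<sigma>. \<integral>\<^sup>+x. N x \<sigma> \<partial>lborel \<partial>lborel)"
    by (rule lborel_pair.Fubini') measurable
  also have "\<dots> = (\<integral>\<^sup>+\<sigma>. 0 \<partial>(lborel::real measure))"
    using AEl
  proof (intro nn_integral_cong_AE, eventually_elim)
    fix \<sigma> :: real
    assume as: "\<sigma> > 0 \<longrightarrow> (AE y in lborel. y \<bullet> e \<in> {0<..<1} \<longrightarrow>
      (AE s in lborel. layer (f (hproj e y + s *\<^sub>R e)) \<sigma> = layer (steiner e f (hproj e y + s *\<^sub>R e)) \<sigma>))"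
    show "(\<integral>\<^sup>+x. N x \<sigma> \<partial>lborel) = 0"
    proof (cases "\<sigma> > 0")
      case False
      then have "N x \<sigma> = 0" for x by (simp add: N0 layer_def)
      then show ?thesis by simp
    next
      case True
      have "(\<integral>\<^sup>+x. N x \<sigma> \<partial>lborel) = (\<integral>\<^sup>+y. indicator {0<..<1} (y \<bullet> e) * (\<integral>\<^sup>+s. N (hproj e y + s *\<^sub>R e) \<sigma> \<partial>lborel) \<partial>lborel)"
        by (rule nn_integral_lines[OF _ e]) measurable
      also have "\<dots> = (\<integral>\<^sup>+y. 0 \<partial>(lborel :: 'a measure))"
        using as[rule_format, OF True]
      proof (intro nn_integral_cong_AE, eventually_elim)
        fix y assume as2: "y \<bullet> e \<in> {0<..<1} \<longrightarrow>
          (AE s in lborel. layer (f (hproj e y + s *\<^sub>R e)) \<sigma> = layer (steiner e f (hproj e y + s *\<^sub>R e)) \<sigma>)"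
        show "indicator {0<..<1} (y \<bullet> e) * (\<integral>\<^sup>+s. N (hproj e y + s *\<^sub>R e) \<sigma> \<partial>lborel) = 0"
        proof (cases "y \<bullet> e \<in> {0<..<1}")
          case True
          have "(\<integral>\<^sup>+s. N (hproj e y + s *\<^sub>R e) \<sigma> \<partial>lborel) = 0"
            using as2 True by (subst nn_integral_0_iff_AE) (auto simp: N0)
          then show ?thesis by simp
        qed (auto simp: indicator_def)
      qed
      finally show ?thesis by simp
    qed
  qed
  finally have "AE x in lborel. (\<integral>\<^sup>+\<sigma>. N x \<sigma> \<partial>lborel) = 0"
    by (simp add: nn_integral_0_iff_AE)
  then show "AE x in lborel. f x = steiner e f x"
  proof eventually_elim
    fix x assume "(\<integral>\<^sup>+\<sigma>. N x \<sigma> \<partial>lborel) = 0"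
    then have "AE \<sigma> in lborel. layer (f x) \<sigma> = layer (steiner e f x) \<sigma>"
      by (simp add: nn_integral_0_iff_AE N0)
    then have "(\<integral>\<^sup>+\<sigma>. layer (f x) \<sigma> \<partial>lborel) = (\<integral>\<^sup>+\<sigma>. layer (steiner e f x) \<sigma> \<partial>lborel)"
      by (rule nn_integral_cong_AE)
    then show "f x = steiner e f x" by simp
  qed
qed

section \<open>Square integrable functions\<close>

text \<open>The squared norm with values in [0, \<infinity>]. It carries information before
  membership in L2 is known, whereas the Bochner integral in \<open>L2_nrm\<close> returns 0 when
  the square is not integrable.\<close>

definition l2sq :: "('a::euclidean_space \<Rightarrow> complex) \<Rightarrow> ennreal" where
  "l2sq f = (\<integral>\<^sup>+x. (ennreal (cmod (f x)))\<^sup>2 \<partial>lebesgue)"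

lemma l2sq_lborel: "l2sq f = (\<integral>\<^sup>+x. (ennreal (cmod (f x)))\<^sup>2 \<partial>lborel)"
  by (simp add: l2sq_def nn_integral_completion)

lemma L2_fun_iff: "f \<in> L2_fun \<longleftrightarrow> f \<in> borel_measurable lebesgue \<and> l2sq f < \<infinity>"
  by (auto simp: L2_fun_def l2sq_def integrable_iff_bounded ennreal_power)

lemma L2_funD[measurable_dest]: "f \<in> L2_fun \<Longrightarrow> f \<in> borel_measurable lebesgue"
  and L2_fun_l2sq: "f \<in> L2_fun \<Longrightarrow> l2sq f < \<infinity>"
  by (auto simp: L2_fun_iff)

lemma L2_fun_borelI: "f \<in> borel_measurable borel \<Longrightarrow> l2sq f < \<infinity> \<Longrightarrow> f \<in> L2_fun"
  by (auto simp: L2_fun_iff intro: measurable_completion)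

lemma L2_nrm_nonneg[simp]: "L2_nrm f \<ge> 0"
  by (simp add: L2_nrm_def)

lemma L2_nrm_enn2real:
  assumes "f \<in> borel_measurable lebesgue"
  shows "L2_nrm f = sqrt (enn2real (l2sq f))"
proof -
  note assms[measurable]
  have "(\<integral>x. (cmod (f x))\<^sup>2 \<partial>lebesgue) = enn2real (l2sq f)"
    unfolding l2sq_def by (subst integral_eq_nn_integral) (auto simp: ennreal_power)
  then show ?thesis by (simp add: L2_nrm_def)
qed

lemma L2_nrm_sq: "f \<in> L2_fun \<Longrightarrow> ennreal ((L2_nrm f)\<^sup>2) = l2sq f"
  using L2_nrm_enn2real[of f] by (auto simp: L2_fun_iff enn2real_nonneg)

lemma L2_nrm_le_iff:
  assumes "f \<in> borel_measurable lebesgue" "c \<ge> 0"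
  shows "f \<in> L2_fun \<and> L2_nrm f \<le> c \<longleftrightarrow> l2sq f \<le> ennreal (c\<^sup>2)"
proof safe
  assume "f \<in> L2_fun" "L2_nrm f \<le> c"
  then show "l2sq f \<le> ennreal (c\<^sup>2)"
    by (subst L2_nrm_sq[symmetric]) (auto intro!: ennreal_leI power_mono)
next
  assume le: "l2sq f \<le> ennreal (c\<^sup>2)"
  then show "f \<in> L2_fun" using assms by (auto simp: L2_fun_iff intro: le_less_trans)
  then have "ennreal ((L2_nrm f)\<^sup>2) \<le> ennreal (c\<^sup>2)" using le by (simp add: L2_nrm_sq)
  then have "(L2_nrm f)\<^sup>2 \<le> c\<^sup>2" by simp
  then show "L2_nrm f \<le> c" using assms(2) by (rule power2_le_imp_le)
qed

lemma L2_nrm_0_iff: "f \<in> L2_fun \<Longrightarrow> L2_nrm f = 0 \<longleftrightarrow> (AE x in lebesgue. f x = 0)"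
proof -
  assume f: "f \<in> L2_fun"
  note [measurable] = L2_funD[OF f]
  have "L2_nrm f = 0 \<longleftrightarrow> ennreal ((L2_nrm f)\<^sup>2) = 0" by simp
  also have "\<dots> \<longleftrightarrow> l2sq f = 0" by (simp only: L2_nrm_sq[OF f])
  also have "\<dots> \<longleftrightarrow> (AE x in lebesgue. f x = 0)"
    unfolding l2sq_def by (subst nn_integral_0_iff_AE) auto
  finally show ?thesis .
qed

lemma L2_nrm_cong_AE: "f \<in> L2_fun \<Longrightarrow> g \<in> L2_fun \<Longrightarrow> AE x in lebesgue. f x = g x \<Longrightarrow> L2_nrm f = L2_nrm g"
  unfolding L2_nrm_def by (auto intro!: integral_cong_AE arg_cong[where f=sqrt] elim!: eventually_mono)

lemma L2_nrm_cong_norm: "(\<And>x. cmod (f x) = cmod (g x)) \<Longrightarrow> L2_nrm f = L2_nrm g"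
  by (simp add: L2_nrm_def)

lemma L2_fun_mono:
  assumes "f \<in> L2_fun" "g \<in> borel_measurable lebesgue" "\<And>x. cmod (g x) \<le> cmod (f x)"
  shows "g \<in> L2_fun"
proof -
  have "l2sq g \<le> l2sq f" unfolding l2sq_def
    by (intro nn_integral_mono power_mono ennreal_leI assms) auto
  then show ?thesis using assms by (auto simp: L2_fun_iff intro: le_less_trans)
qed

lemma L2_fun_cmult: "f \<in> L2_fun \<Longrightarrow> (\<lambda>x. c * f x) \<in> L2_fun"
proof -
  assume f: "f \<in> L2_fun"
  note [measurable] = L2_funD[OF f]
  have "l2sq (\<lambda>x. c * f x) = (ennreal (cmod c))\<^sup>2 * l2sq f"
    unfolding l2sq_def by (subst nn_integral_cmult[symmetric]) (auto simp: norm_mult ennreal_mult power_mult_distrib)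
  then show ?thesis using f by (auto simp: L2_fun_iff ennreal_mult_less_top ennreal_power)
qed

lemma L2_fun_add: "f \<in> L2_fun \<Longrightarrow> g \<in> L2_fun \<Longrightarrow> (\<lambda>x. f x + g x) \<in> L2_fun"
proof -
  assume f: "f \<in> L2_fun" and g: "g \<in> L2_fun"
  note [measurable] = L2_funD[OF f] L2_funD[OF g]
  have "l2sq (\<lambda>x. f x + g x) \<le> (\<integral>\<^sup>+x. 2 * (ennreal (cmod (f x)))\<^sup>2 + 2 * (ennreal (cmod (g x)))\<^sup>2 \<partial>lebesgue)"
    unfolding l2sq_def
  proof (rule nn_integral_mono)
    fix x
    have "(cmod (f x + g x))\<^sup>2 \<le> (cmod (f x) + cmod (g x))\<^sup>2" by (intro power_mono norm_triangle_ineq) auto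
    also have "\<dots> \<le> 2 * (cmod (f x))\<^sup>2 + 2 * (cmod (g x))\<^sup>2"
      using sum_squares_ge_zero[of "cmod (f x) - cmod (g x)" 0] by (simp add: power2_eq_square algebra_simps)
    finally have "ennreal ((cmod (f x + g x))\<^sup>2) \<le> ennreal (2 * (cmod (f x))\<^sup>2 + 2 * (cmod (g x))\<^sup>2)" by (rule ennreal_leI)
    then show "(ennreal (cmod (f x + g x)))\<^sup>2 \<le> 2 * (ennreal (cmod (f x)))\<^sup>2 + 2 * (ennreal (cmod (g x)))\<^sup>2"
      by (simp add: ennreal_power ennreal_mult')
  qed
  also have "\<dots> = 2 * l2sq f + 2 * l2sq g"
    unfolding l2sq_def by (subst nn_integral_add) (auto simp: nn_integral_cmult)
  also have "\<dots> < \<infinity>" using f g by (auto simp: L2_fun_iff ennreal_mult_less_top)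
  finally show ?thesis by (simp add: L2_fun_iff)
qed

lemma L2_fun_diff: "f \<in> L2_fun \<Longrightarrow> g \<in> L2_fun \<Longrightarrow> (\<lambda>x. f x - g x) \<in> L2_fun"
  using L2_fun_add[of f "\<lambda>x. (-1) * g x"] L2_fun_cmult[of g "-1"] by simp

lemma borel_measurable_cnj[measurable (raw)]:
  "f \<in> borel_measurable M \<Longrightarrow> (\<lambda>x. cnj (f x)) \<in> borel_measurable M"
  by (simp add: borel_measurable_complex_iff)

lemma L2_fun_cnj: "f \<in> L2_fun \<Longrightarrow> (\<lambda>x. cnj (f x)) \<in> L2_fun"
  by (rule L2_fun_mono[of f]) (auto intro: borel_measurable_cnj L2_funD)

lemma nn_integral_mult_L2:
  assumes "f \<in> L2_fun" "g \<in> L2_fun"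
  shows "(\<integral>\<^sup>+x. ennreal (cmod (f x * g x)) \<partial>lebesgue) \<le> ennreal (L2_nrm f * L2_nrm g)"
proof -
  note [measurable] = L2_funD[OF assms(1)] L2_funD[OF assms(2)]
  let ?I = "\<integral>\<^sup>+x. ennreal (cmod (f x)) * ennreal (cmod (g x)) \<partial>lebesgue"
  have "?I\<^sup>2 \<le> l2sq f * l2sq g" unfolding l2sq_def by (rule Cauchy_Schwarz_nn_integral) auto
  also have "\<dots> = ennreal ((L2_nrm f * L2_nrm g)\<^sup>2)"
    using assms by (simp add: L2_nrm_sq[symmetric] power_mult_distrib ennreal_mult)
  finally have le: "?I\<^sup>2 \<le> ennreal ((L2_nrm f * L2_nrm g)\<^sup>2)" .
  have "?I \<le> ennreal (L2_nrm f * L2_nrm g)"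
  proof (cases ?I)
    case (real r)
    with le have "r\<^sup>2 \<le> (L2_nrm f * L2_nrm g)\<^sup>2" by (simp add: ennreal_power)
    then have "r \<le> L2_nrm f * L2_nrm g" by (rule power2_le_imp_le) simp
    then show ?thesis using real by (simp add: ennreal_leI)
  next
    case top
    with le show ?thesis by (simp add: power2_eq_square top_unique)
  qed
  then show ?thesis by (simp add: norm_mult ennreal_mult)
qed

lemma integrable_mult_L2:
  assumes "f \<in> L2_fun" "g \<in> L2_fun"
  shows "integrable lebesgue (\<lambda>x. f x * g x)"
proof -
  note [measurable] = L2_funD[OF assms(1)] L2_funD[OF assms(2)]
  show ?thesis
    using nn_integral_mult_L2[OF assms] by (auto simp: integrable_iff_bounded intro: le_less_trans)
qed

lemma integral_mult_L2_le:
  assumes "f \<in> L2_fun" "g \<in> L2_fun"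
  shows "cmod (\<integral>x. f x * g x \<partial>lebesgue) \<le> L2_nrm f * L2_nrm g"
proof -
  have "ennreal (cmod (\<integral>x. f x * g x \<partial>lebesgue)) \<le> (\<integral>\<^sup>+x. ennreal (cmod (f x * g x)) \<partial>lebesgue)"
    by (rule integral_norm_bound_ennreal[OF integrable_mult_L2[OF assms]])
  also have "\<dots> \<le> ennreal (L2_nrm f * L2_nrm g)" by (rule nn_integral_mult_L2[OF assms])
  finally show ?thesis by (subst (asm) ennreal_le_iff) auto
qed

lemma integral_mult_cnj_L2: "f \<in> L2_fun \<Longrightarrow> (\<integral>x. f x * cnj (f x) \<partial>lebesgue) = of_real ((L2_nrm f)\<^sup>2)"
  by (simp add: L2_nrm_def flip: complex_norm_square integral_complex_of_real)

lemma L2_nrm_diff_sq: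
  assumes "f \<in> L2_fun" "g \<in> L2_fun"
  shows "(L2_nrm (\<lambda>x. f x - g x))\<^sup>2 = (L2_nrm f)\<^sup>2 - 2 * Re (\<integral>x. f x * cnj (g x) \<partial>lebesgue) + (L2_nrm g)\<^sup>2"
proof -
  let ?I = "\<lambda>f g. \<integral>x. f x * cnj (g x) \<partial>lebesgue"
  have i: "integrable lebesgue (\<lambda>x. f x * cnj (g x))" if "f \<in> L2_fun" "g \<in> L2_fun" for f g :: "_ \<Rightarrow> complex"
    using that by (intro integrable_mult_L2 L2_fun_cnj)
  have "complex_of_real ((L2_nrm (\<lambda>x. f x - g x))\<^sup>2) = ?I (\<lambda>x. f x - g x) (\<lambda>x. f x - g x)"
    using assms by (intro integral_mult_cnj_L2[symmetric] L2_fun_diff)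
  also have "\<dots> = (\<integral>x. (f x * cnj (f x) - f x * cnj (g x)) - (g x * cnj (f x) - g x * cnj (g x)) \<partial>lebesgue)"
    by (simp add: algebra_simps)
  also have "\<dots> = (?I f f - ?I f g) - (?I g f - ?I g g)"
    using assms by (simp add: i)
  also have "?I g f = cnj (?I f g)"
  proof -
    have "(\<lambda>x. g x * cnj (f x)) = (\<lambda>x. cnj (f x * cnj (g x)))" by (simp add: mult.commute)
    then show ?thesis by (simp only: Bochner_Integration.integral_cnj)
  qed
  finally show ?thesis
    using assms by (simp add: integral_mult_cnj_L2 complex_eq_iff)
qed

lemma L2_nrm_triangle:
  assumes f: "f \<in> L2_fun" and g: "g \<in> L2_fun"
  shows "L2_nrm (\<lambda>x. f x - g x) \<le> L2_nrm f + L2_nrm g"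
proof (rule power2_le_imp_le)
  have "\<bar>Re (\<integral>x. f x * cnj (g x) \<partial>lebesgue)\<bar> \<le> cmod (\<integral>x. f x * cnj (g x) \<partial>lebesgue)" by (rule abs_Re_le_cmod)
  also have "\<dots> \<le> L2_nrm f * L2_nrm (\<lambda>x. cnj (g x))" using f g by (intro integral_mult_L2_le L2_fun_cnj)
  also have "L2_nrm (\<lambda>x. cnj (g x)) = L2_nrm g" by (rule L2_nrm_cong_norm) simp
  finally show "(L2_nrm (\<lambda>x. f x - g x))\<^sup>2 \<le> (L2_nrm f + L2_nrm g)\<^sup>2"
    by (simp add: L2_nrm_diff_sq[OF f g] power2_sum)
qed simp

lemma L2_nrm_triangle3:
  assumes "f \<in> L2_fun" "g \<in> L2_fun" "h \<in> L2_fun"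
  shows "L2_nrm (\<lambda>x. f x - g x) \<le> L2_nrm (\<lambda>x. f x - h x) + L2_nrm (\<lambda>x. g x - h x)"
  using L2_nrm_triangle[OF L2_fun_diff[OF assms(1,3)] L2_fun_diff[OF assms(2,3)]] by simp

lemma L2_nrm_minus_commute: "L2_nrm (\<lambda>x. f x - g x) = L2_nrm (\<lambda>x. g x - f x)"
  by (rule L2_nrm_cong_norm) (simp add: norm_minus_commute)

lemma L2_nrm_minus: "L2_nrm (\<lambda>x. - f x) = L2_nrm f"
  by (rule L2_nrm_cong_norm) simp

lemma L2_nrm_diff_le:
  assumes "f \<in> L2_fun" "g \<in> L2_fun"
  shows "\<bar>L2_nrm f - L2_nrm g\<bar> \<le> L2_nrm (\<lambda>x. f x - g x)"
proof -
  have "L2_nrm f \<le> L2_nrm (\<lambda>x. f x - g x) + L2_nrm (\<lambda>x. (-1) * g x)"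
    using L2_nrm_triangle[OF L2_fun_diff[OF assms] L2_fun_cmult[OF assms(2), of "-1"]] by simp
  moreover have "L2_nrm g \<le> L2_nrm (\<lambda>x. g x - f x) + L2_nrm (\<lambda>x. (-1) * f x)"
    using L2_nrm_triangle[OF L2_fun_diff[OF assms(2,1)] L2_fun_cmult[OF assms(1), of "-1"]] by simp
  ultimately show ?thesis
    by (simp add: L2_nrm_minus L2_nrm_minus_commute[of g f])
qed

lemma L2_tendsto_nrm:
  assumes "\<And>k. F k \<in> L2_fun" "f \<in> L2_fun" "(\<lambda>k. L2_nrm (\<lambda>x. F k x - f x)) \<longlonglongrightarrow> 0"
  shows "(\<lambda>k. L2_nrm (F k)) \<longlonglongrightarrow> L2_nrm f"
proof -
  have "(\<lambda>k. L2_nrm (F k) - L2_nrm f) \<longlonglongrightarrow> 0"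
    using assms(3) by (rule Lim_null_comparison[rotated]) (auto intro!: always_eventually L2_nrm_diff_le assms)
  then show ?thesis by (simp add: LIM_zero_iff)
qed

lemma L2_tendsto_integral_mult:
  assumes F: "\<And>k. F k \<in> L2_fun" "f \<in> L2_fun" "(\<lambda>k. L2_nrm (\<lambda>x. F k x - f x)) \<longlonglongrightarrow> 0"
    and G: "\<And>k. G k \<in> L2_fun" "g \<in> L2_fun" "(\<lambda>k. L2_nrm (\<lambda>x. G k x - g x)) \<longlonglongrightarrow> 0"
  shows "(\<lambda>k. \<integral>x. F k x * G k x \<partial>lebesgue) \<longlonglongrightarrow> (\<integral>x. f x * g x \<partial>lebesgue)"
proof -
  have "(\<lambda>k. (\<integral>x. F k x * G k x \<partial>lebesgue) - (\<integral>x. f x * g x \<partial>lebesgue)) \<longlonglongrightarrow> 0"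
  proof (rule Lim_null_comparison)
    show "\<forall>\<^sub>F k in sequentially. norm ((\<integral>x. F k x * G k x \<partial>lebesgue) - (\<integral>x. f x * g x \<partial>lebesgue))
      \<le> L2_nrm (\<lambda>x. F k x - f x) * L2_nrm (G k) + L2_nrm f * L2_nrm (\<lambda>x. G k x - g x)"
    proof (intro always_eventually allI)
      fix k
      have "(\<integral>x. F k x * G k x \<partial>lebesgue) - (\<integral>x. f x * g x \<partial>lebesgue) = (\<integral>x. F k x * G k x - f x * g x \<partial>lebesgue)"
        using F G by (intro Bochner_Integration.integral_diff[symmetric] integrable_mult_L2)
      also have "\<dots> = (\<integral>x. (F k x - f x) * G k x + f x * (G k x - g x) \<partial>lebesgue)"
        by (simp add: algebra_simps)
      also have "\<dots> = (\<integral>x. (F k x - f x) * G k x \<partial>lebesgue) + (\<integral>x. f x * (G k x - g x) \<partial>lebesgue)"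
        using F G by (intro Bochner_Integration.integral_add integrable_mult_L2 L2_fun_diff)
      finally show "norm ((\<integral>x. F k x * G k x \<partial>lebesgue) - (\<integral>x. f x * g x \<partial>lebesgue))
        \<le> L2_nrm (\<lambda>x. F k x - f x) * L2_nrm (G k) + L2_nrm f * L2_nrm (\<lambda>x. G k x - g x)"
        using F G by (auto intro!: norm_triangle_le add_mono integral_mult_L2_le L2_fun_diff)
    qed
    have "(\<lambda>k. L2_nrm (\<lambda>x. F k x - f x) * L2_nrm (G k) + L2_nrm f * L2_nrm (\<lambda>x. G k x - g x)) \<longlonglongrightarrow> 0 * L2_nrm g + L2_nrm f * 0"
      by (intro tendsto_intros F G L2_tendsto_nrm)
    then show "(\<lambda>k. L2_nrm (\<lambda>x. F k x - f x) * L2_nrm (G k) + L2_nrm f * L2_nrm (\<lambda>x. G k x - g x)) \<longlonglongrightarrow> 0" by simp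
  qed
  then show ?thesis by (simp add: LIM_zero_iff)
qed

lemma L2_tendsto_AE_subseq:
  assumes F: "\<And>k. F k \<in> L2_fun" "f \<in> L2_fun" "(\<lambda>k. L2_nrm (\<lambda>x. F k x - f x)) \<longlonglongrightarrow> 0"
  obtains r :: "nat \<Rightarrow> nat" where "strict_mono r" "AE x in lebesgue. (\<lambda>n. F (r n) x) \<longlonglongrightarrow> f x"
proof -
  have "(\<lambda>k. (L2_nrm (\<lambda>x. F k x - f x))\<^sup>2) \<longlonglongrightarrow> 0" using tendsto_power[OF F(3), of 2] by simp
  then have "(\<lambda>n. \<integral>x. norm ((cmod (F n x - f x))\<^sup>2) \<partial>lebesgue) \<longlonglongrightarrow> 0"
    by (simp add: L2_nrm_def)
  moreover have "integrable lebesgue (\<lambda>x. (cmod (F n x - f x))\<^sup>2)" for n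
    using L2_fun_diff[OF F(1,2)] by (auto simp: L2_fun_def)
  ultimately obtain r :: "nat \<Rightarrow> nat" where r: "strict_mono r" "AE x in lebesgue. (\<lambda>n. (cmod (F (r n) x - f x))\<^sup>2) \<longlonglongrightarrow> 0"
    using tendsto_L1_AE_subseq[of lebesgue "\<lambda>n x. (cmod (F n x - f x))\<^sup>2"] by blast
  from r(2) have "AE x in lebesgue. (\<lambda>n. F (r n) x) \<longlonglongrightarrow> f x"
  proof eventually_elim
    fix x assume "(\<lambda>n. (cmod (F (r n) x - f x))\<^sup>2) \<longlonglongrightarrow> 0"
    then have "(\<lambda>n. sqrt ((cmod (F (r n) x - f x))\<^sup>2)) \<longlonglongrightarrow> sqrt 0" by (rule tendsto_real_sqrt)
    then have "(\<lambda>n. F (r n) x - f x) \<longlonglongrightarrow> 0" by (simp add: tendsto_norm_zero_iff)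
    then show "(\<lambda>n. F (r n) x) \<longlonglongrightarrow> f x" by (simp add: LIM_zero_iff)
  qed
  with r(1) show ?thesis by (rule that)
qed

text \<open>A pointwise limit inherits a norm bound together with membership in L2; in the proof of
  completeness this is what turns pointwise convergence back into convergence in norm.\<close>

lemma L2_Fatou:
  assumes F: "\<And>k. F k \<in> L2_fun" and f: "f \<in> borel_measurable lebesgue" and conv: "AE x in lebesgue. (\<lambda>k. F k x) \<longlonglongrightarrow> f x"
    and le: "\<And>k. k \<ge> N \<Longrightarrow> L2_nrm (F k) \<le> c"
  shows "f \<in> L2_fun" "L2_nrm f \<le> c"
proof -
  note [measurable] = L2_funD[OF F] f
  have c: "c \<ge> 0" using le[of N] L2_nrm_nonneg[of "F N"] by linarith
  have "l2sq f = (\<integral>\<^sup>+x. liminf (\<lambda>k. (ennreal (cmod (F k x)))\<^sup>2) \<partial>lebesgue)"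
    unfolding l2sq_def
  proof (rule nn_integral_cong_AE, use conv in eventually_elim)
    fix x assume "(\<lambda>k. F k x) \<longlonglongrightarrow> f x"
    then have "(\<lambda>k. ennreal ((cmod (F k x))\<^sup>2)) \<longlonglongrightarrow> ennreal ((cmod (f x))\<^sup>2)"
      by (intro tendsto_ennrealI tendsto_intros)
    then have "(\<lambda>k. (ennreal (cmod (F k x)))\<^sup>2) \<longlonglongrightarrow> (ennreal (cmod (f x)))\<^sup>2"
      by (simp add: ennreal_power)
    then show "(ennreal (cmod (f x)))\<^sup>2 = liminf (\<lambda>k. (ennreal (cmod (F k x)))\<^sup>2)"
      by (simp add: lim_imp_Liminf)
  qed
  also have "\<dots> \<le> liminf (\<lambda>k. l2sq (F k))"
    unfolding l2sq_def by (rule nn_integral_liminf) measurable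
  also have "\<dots> \<le> ennreal (c\<^sup>2)"
  proof -
    have "\<forall>\<^sub>F k in sequentially. l2sq (F k) \<le> ennreal (c\<^sup>2)"
      using eventually_ge_at_top[of N]
      by eventually_elim (use le F in \<open>auto simp: L2_nrm_sq[symmetric] intro!: ennreal_leI power_mono\<close>)
    then have "liminf (\<lambda>k. l2sq (F k)) \<le> liminf (\<lambda>k. ennreal (c\<^sup>2))" by (rule Liminf_mono)
    then show ?thesis by (simp add: Liminf_const)
  qed
  finally have "l2sq f \<le> ennreal (c\<^sup>2)" .
  then show "f \<in> L2_fun" "L2_nrm f \<le> c" using L2_nrm_le_iff[OF f c] by auto
qed

text \<open>The Riesz-Fischer argument: along a subsequence with increments of norm below 2^-n the
  moduli of the increments add up to a function with finite norm, hence to a finite sum almost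
  everywhere, and the subsequence converges there.\<close>

theorem L2_complete:
  fixes F :: "nat \<Rightarrow> (real, 'n::finite) vec \<Rightarrow> complex"
  assumes F: "\<And>k. F k \<in> L2_fun"
    and Cauchy: "\<And>e. e > 0 \<Longrightarrow> \<exists>N. \<forall>m\<ge>N. \<forall>n\<ge>N. L2_nrm (\<lambda>x. F m x - F n x) < e"
  obtains f where "f \<in> L2_fun" "(\<lambda>k. L2_nrm (\<lambda>x. F k x - f x)) \<longlonglongrightarrow> 0"
proof -
  note [measurable] = L2_funD[OF F]
  have "\<exists>r::nat\<Rightarrow>nat. \<forall>n. (\<forall>m\<ge>r n. \<forall>k\<ge>r n. L2_nrm (\<lambda>x. F m x - F k x) < (1/2)^n) \<and> r n < r (Suc n)"
  proof (rule dependent_nat_choice)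
    show "\<exists>N. \<forall>m\<ge>N. \<forall>k\<ge>N. L2_nrm (\<lambda>x. F m x - F k x) < (1/2)^0" using Cauchy[of 1] by simp
  next
    fix N n
    obtain N' where N': "\<forall>m\<ge>N'. \<forall>k\<ge>N'. L2_nrm (\<lambda>x. F m x - F k x) < (1/2)^Suc n"
      using Cauchy[of "(1/2)^Suc n"] by auto
    show "\<exists>y. (\<forall>m\<ge>y. \<forall>k\<ge>y. L2_nrm (\<lambda>x. F m x - F k x) < (1/2)^Suc n) \<and> N < y"
      using N' by (intro exI[of _ "max N' (Suc N)"]) auto
  qed
  then obtain r :: "nat \<Rightarrow> nat" where r: "\<And>n m k. m \<ge> r n \<Longrightarrow> k \<ge> r n \<Longrightarrow> L2_nrm (\<lambda>x. F m x - F k x) < (1/2)^n"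
    and rmono: "\<And>n. r n < r (Suc n)" by blast
  define d where "d n x = F (r (Suc n)) x - F (r n) x" for n x
  have d_L2: "d n \<in> L2_fun" for n unfolding d_def by (intro L2_fun_diff F)
  note [measurable] = L2_funD[OF d_L2]
  have d_nrm: "L2_nrm (d n) \<le> (1/2)^n" for n
    unfolding d_def using rmono[of n] r[of n "r (Suc n)" "r n"] by simp
  define D where "D n x = (\<Sum>i<n. complex_of_real (cmod (d i x)))" for n x
  \<comment> \<open>The bound is the geometric sum of (1/2)^i over i < n; it stays below 2, whence
    the 4 for the squared norm.\<close>
  have D: "D n \<in> L2_fun \<and> L2_nrm (D n) \<le> 2 - 2 * (1/2)^n" for n
  proof (induction n)
    case 0
    show ?case by (auto simp: D_def L2_nrm_def L2_fun_def)
  next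
    case (Suc n)
    let ?g = "\<lambda>x. - complex_of_real (cmod (d n x))"
    have g: "?g \<in> L2_fun" by (rule L2_fun_mono[OF d_L2[of n]]) auto
    have "L2_nrm ?g = L2_nrm (d n)" by (rule L2_nrm_cong_norm) simp
    moreover have "D (Suc n) = (\<lambda>x. D n x - ?g x)" by (simp add: D_def fun_eq_iff)
    ultimately show ?case
      using Suc L2_fun_diff[OF _ g, of "D n"] L2_nrm_triangle[OF _ g, of "D n"] d_nrm[of n] by simp
  qed
  have [measurable]: "D n \<in> borel_measurable lebesgue" for n using D[of n] by (auto dest: L2_funD)
  have "(\<integral>\<^sup>+x. (SUP n. (ennreal (cmod (D n x)))\<^sup>2) \<partial>lebesgue) = (SUP n. l2sq (D n))"
    unfolding l2sq_def
  proof (rule nn_integral_monotone_convergence_SUP)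
    show "incseq (\<lambda>n x. (ennreal (cmod (D n x)))\<^sup>2)"
    proof (intro incseq_SucI le_funI power_mono ennreal_leI)
      fix n x
      show "cmod (D n x) \<le> cmod (D (Suc n) x)"
        unfolding D_def of_real_sum[symmetric] norm_of_real by (simp add: sum_nonneg)
    qed simp
  qed measurable
  also have "\<dots> \<le> ennreal 4"
  proof (rule SUP_least)
    fix n
    have "L2_nrm (D n) \<le> 2" using D[of n] by (auto intro: order_trans)
    then show "l2sq (D n) \<le> ennreal 4" using L2_nrm_le_iff[of "D n" 2] D[of n] by (auto dest: L2_funD)
  qed
  finally have "(\<integral>\<^sup>+x. (SUP n. (ennreal (cmod (D n x)))\<^sup>2) \<partial>lebesgue) \<noteq> \<infinity>" by (auto simp: top_unique)
  then have "AE x in lebesgue. (SUP n. (ennreal (cmod (D n x)))\<^sup>2) \<noteq> \<infinity>"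
    by (intro nn_integral_PInf_AE) auto
  then have AEc: "AE x in lebesgue. convergent (\<lambda>n. F (r n) x)"
  proof eventually_elim
    fix x assume fin: "(SUP n. (ennreal (cmod (D n x)))\<^sup>2) \<noteq> \<infinity>"
    then obtain c where c: "(SUP n. (ennreal (cmod (D n x)))\<^sup>2) = ennreal c" "c \<ge> 0"
      by (cases "SUP n. (ennreal (cmod (D n x)))\<^sup>2") auto
    have "(\<Sum>i<n. cmod (d i x)) \<le> sqrt c" for n
    proof -
      have "ennreal ((cmod (D n x))\<^sup>2) \<le> ennreal c"
        unfolding c(1)[symmetric] by (intro SUP_upper2[of n]) (auto simp: ennreal_power)
      then have "(cmod (D n x))\<^sup>2 \<le> c" using c(2) by simp
      then have "cmod (D n x) \<le> sqrt c" by (rule real_le_rsqrt)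
      then show ?thesis unfolding D_def of_real_sum[symmetric] norm_of_real by simp
    qed
    then have "summable (\<lambda>i. cmod (d i x))" by (intro bounded_imp_summable[where B="sqrt c"]) (auto simp: lessThan_Suc_atMost[symmetric] simp del: sum.lessThan_Suc)
    then have "summable (\<lambda>i. d i x)" by (rule summable_norm_cancel)
    then have "convergent (\<lambda>n. \<Sum>i<n. d i x)" by (simp add: summable_iff_convergent)
    moreover have "(\<Sum>i<n. d i x) = F (r n) x - F (r 0) x" for n unfolding d_def by (rule sum_lessThan_telescope)
    ultimately have "convergent (\<lambda>n. (F (r n) x - F (r 0) x) + F (r 0) x)" by (intro convergent_add) (auto simp: convergent_const)
    then show "convergent (\<lambda>n. F (r n) x)" by simp
  qed
  define f where "f x = lim (\<lambda>n. F (r n) x)" for x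
  have [measurable]: "f \<in> borel_measurable lebesgue" unfolding f_def by (rule borel_measurable_lim_metric) measurable
  have est: "(\<lambda>x. F k x - f x) \<in> L2_fun \<and> L2_nrm (\<lambda>x. F k x - f x) \<le> (1/2)^n" if "k \<ge> r n" for k n
  proof -
    have rn: "n \<le> m \<Longrightarrow> r n \<le> r m" for m by (rule lift_Suc_mono_le[of r]) (auto intro: less_imp_le rmono)
    have "AE x in lebesgue. (\<lambda>m. F k x - F (r m) x) \<longlonglongrightarrow> F k x - f x"
      using AEc by eventually_elim (auto simp: f_def intro!: tendsto_intros simp: convergent_LIMSEQ_iff[symmetric])
    note fatou = L2_Fatou[where F="\<lambda>m x. F k x - F (r m) x" and N=n and c="(1/2)^n", OF _ _ this]
    show ?thesis
      by (intro conjI fatou L2_fun_diff F less_imp_le[OF r] that rn) auto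
  qed
  show ?thesis
  proof
    have "(\<lambda>x. F (r 0) x - (F (r 0) x - f x)) \<in> L2_fun" using est[of 0 "r 0"] by (subst L2_fun_diff[OF F]) auto
    then show "f \<in> L2_fun" by simp
    show "(\<lambda>k. L2_nrm (\<lambda>x. F k x - f x)) \<longlonglongrightarrow> 0"
    proof (rule LIMSEQ_I)
      fix e :: real assume "e > 0"
      then obtain n where "(1/2)^n < e" using real_arch_pow_inv[of e "1/2"] by auto
      then show "\<exists>no. \<forall>k\<ge>no. norm (L2_nrm (\<lambda>x. F k x - f x) - 0) < e"
        using est by (intro exI[of _ "r n"]) (auto intro: le_less_trans)
    qed
  qed
qed

lemma L2_borel_rep:
  fixes f :: "'a::euclidean_space \<Rightarrow> complex"
  assumes "f \<in> borel_measurable lebesgue"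
  obtains g :: "'a \<Rightarrow> complex" where "g \<in> borel_measurable borel" "AE x in lebesgue. f x = g x"
proof -
  obtain a where a: "a \<in> borel_measurable lborel" "AE x in lborel. Re (f x) = a x"
    using completion_ex_borel_measurable_real[of "\<lambda>x. Re (f x)" lborel] assms by auto
  obtain b where b: "b \<in> borel_measurable lborel" "AE x in lborel. Im (f x) = b x"
    using completion_ex_borel_measurable_real[of "\<lambda>x. Im (f x)" lborel] assms by auto
  show ?thesis
  proof
    show "(\<lambda>x. Complex (a x) (b x)) \<in> borel_measurable borel"
      using a b by (simp add: borel_measurable_complex_iff)
    have "AE x in lborel. f x = Complex (a x) (b x)" using a(2) b(2)
      by eventually_elim (simp add: complex_eq_iff)
    then show "AE x in lebesgue. f x = Complex (a x) (b x)" by (rule AE_completion)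
  qed
qed

section \<open>Continuity of translations in L1 and L2\<close>

lemma tendsto_0_le_enn:
  fixes f :: "nat \<Rightarrow> ennreal"
  assumes "\<And>e. e > 0 \<Longrightarrow> eventually (\<lambda>n. f n \<le> ennreal e) sequentially"
  shows "f \<longlonglongrightarrow> 0"
proof (rule order_tendstoI)
  fix a :: ennreal assume "0 < a"
  then obtain b where b: "0 < b" "b < a" using dense by blast
  then obtain e where e: "b = ennreal e" "e > 0" by (cases b) auto
  show "eventually (\<lambda>n. f n < a) sequentially"
    using assms[OF e(2)] by eventually_elim (use b e in auto)
qed auto

lemma nn_integral_translate_diff:
  fixes f g :: "'a::euclidean_space \<Rightarrow> complex"
  assumes [measurable]: "f \<in> borel_measurable borel" "g \<in> borel_measurable borel"
  shows "(\<integral>\<^sup>+x. cmod (f (x + z) - f x) \<partial>lborel)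
    \<le> 2 * (\<integral>\<^sup>+x. cmod (f x - g x) \<partial>lborel) + (\<integral>\<^sup>+x. cmod (g (x + z) - g x) \<partial>lborel)"
proof -
  have "(\<integral>\<^sup>+x. cmod (f (x + z) - f x) \<partial>lborel)
     \<le> (\<integral>\<^sup>+x. ennreal (cmod (f (x + z) - g (x + z))) + ennreal (cmod (f x - g x)) + ennreal (cmod (g (x + z) - g x)) \<partial>lborel)"
  proof (rule nn_integral_mono)
    fix x
    have "f (x + z) - f x = (f (x + z) - g (x + z)) + (g (x + z) - g x) - (f x - g x)" by simp
    then have "cmod (f (x + z) - f x) \<le> cmod (f (x + z) - g (x + z)) + cmod (g (x + z) - g x) + cmod (f x - g x)"
      by (metis norm_triangle_ineq norm_triangle_ineq4 add_right_mono order_trans)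
    then show "ennreal (cmod (f (x + z) - f x)) \<le> ennreal (cmod (f (x + z) - g (x + z))) + ennreal (cmod (f x - g x)) + ennreal (cmod (g (x + z) - g x))"
      by (simp flip: ennreal_plus add: ennreal_leI)
  qed
  also have "\<dots> = (\<integral>\<^sup>+x. cmod (f (x + z) - g (x + z)) \<partial>lborel) + (\<integral>\<^sup>+x. cmod (f x - g x) \<partial>lborel) + (\<integral>\<^sup>+x. cmod (g (x + z) - g x) \<partial>lborel)"
    by (simp add: nn_integral_add)
  also have "(\<integral>\<^sup>+x. cmod (f (x + z) - g (x + z)) \<partial>lborel) = (\<integral>\<^sup>+x. cmod (f x - g x) \<partial>lborel)"
    by (rule nn_integral_translate[where f="\<lambda>x. ennreal (cmod (f x - g x))"]) measurable
  finally show ?thesis by (simp add: mult_2)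
qed

lemma emeasure_translate:
  fixes A :: "'a::euclidean_space set"
  assumes [measurable]: "A \<in> sets borel"
  shows "emeasure lborel {x. x + z \<in> A} = emeasure lborel A"
proof -
  have "emeasure lborel {x. x + z \<in> A} = (\<integral>\<^sup>+x. indicator {x. x + z \<in> A} x \<partial>lborel)" by simp
  also have "\<dots> = (\<integral>\<^sup>+x. indicator A (x + z) \<partial>lborel)" by (intro nn_integral_cong) (auto simp: indicator_def)
  also have "\<dots> = emeasure lborel A" by (subst nn_integral_translate) auto
  finally show ?thesis .
qed

lemma emeasure_Int_Diff:
  assumes "X \<in> sets M" "Y \<in> sets M"
  shows "emeasure M X = emeasure M (X \<inter> Y) + emeasure M (X - Y)"
  using plus_emeasure[of "X \<inter> Y" M "X - Y"] assms by (simp add: Int_Diff_Un Int_Diff_disjoint)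

text \<open>Sums and dominated limits are routine; the work lies in the indicator of a set
  \<open>A\<close> of finite measure. An open \<open>U\<close> around \<open>A\<close> with little
  excess eventually contains \<open>x + z n\<close> for each \<open>x\<close> in \<open>A\<close>,
  so the part of \<open>A\<close> that is moved out of \<open>A\<close> is small.\<close>

lemma translation_continuous_L1:
  fixes f :: "'a::euclidean_space \<Rightarrow> complex"
  assumes "integrable lborel f" and z: "z \<longlonglongrightarrow> 0"
  shows "(\<lambda>n. \<integral>\<^sup>+x. cmod (f (x + z n) - f x) \<partial>lborel) \<longlonglongrightarrow> 0"
  using assms(1)
proof (induction rule: integrable_induct)
  case (base A c)
  then have [measurable]: "A \<in> sets borel" and fin: "emeasure lborel A < \<infinity>" by auto
  have ind: "(\<lambda>n. emeasure lborel {x \<in> A. x + z n \<notin> A}) \<longlonglongrightarrow> 0"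
  proof (rule tendsto_0_le_enn)
    show "eventually (\<lambda>n. emeasure lborel {x \<in> A. x + z n \<notin> A} \<le> ennreal e) sequentially" if "e > 0" for e
    proof -
      obtain U where U: "open U" "A \<subseteq> U" "emeasure lborel (U - A) < ennreal (e / 2)"
        using outer_regular_lborel[of A "e/2"] \<open>e > 0\<close> by auto
      have [measurable]: "U \<in> sets borel" using U by auto
      have "(\<lambda>n. \<integral>\<^sup>+x. indicator {x \<in> A. x + z n \<notin> U} x \<partial>lborel) \<longlonglongrightarrow> (\<integral>\<^sup>+x. 0 \<partial>(lborel::'a measure))"
      proof (rule nn_integral_dominated_convergence[where w="indicator A"])
        show "AE x in lborel. (\<lambda>n. indicator {x \<in> A. x + z n \<notin> U} x) \<longlonglongrightarrow> (0::ennreal)"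
        proof (intro AE_I2)
          fix x
          show "(\<lambda>n. indicator {x \<in> A. x + z n \<notin> U} x) \<longlonglongrightarrow> (0::ennreal)"
          proof (cases "x \<in> A")
            case True
            have "(\<lambda>n. x + z n) \<longlonglongrightarrow> x + 0" by (intro tendsto_intros z)
            then have "eventually (\<lambda>n. x + z n \<in> U) sequentially"
              using U True by (auto simp: tendsto_def)
            then show ?thesis by (intro tendsto_eventually) (auto elim: eventually_mono)
          qed simp
        qed
      qed (use fin in \<open>auto split: split_indicator\<close>)
      then have "(\<lambda>n. emeasure lborel {x \<in> A. x + z n \<notin> U}) \<longlonglongrightarrow> 0" by simp
      then have "eventually (\<lambda>n. emeasure lborel {x \<in> A. x + z n \<notin> U} < ennreal (e/2)) sequentially"
        using \<open>e > 0\<close> by (intro order_tendstoD(2)) auto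
      then show ?thesis
      proof eventually_elim
        fix n assume *: "emeasure lborel {x \<in> A. x + z n \<notin> U} < ennreal (e/2)"
        have "emeasure lborel {x \<in> A. x + z n \<notin> A} \<le> emeasure lborel ({x \<in> A. x + z n \<notin> U} \<union> {x. x + z n \<in> U - A})"
          by (rule emeasure_mono) auto
        also have "\<dots> \<le> emeasure lborel {x \<in> A. x + z n \<notin> U} + emeasure lborel {x. x + z n \<in> U - A}"
          by (rule emeasure_subadditive) auto
        also have "emeasure lborel {x. x + z n \<in> U - A} = emeasure lborel (U - A)"
          by (rule emeasure_translate) measurable
        also have "emeasure lborel {x \<in> A. x + z n \<notin> U} + emeasure lborel (U - A) \<le> ennreal (e/2) + ennreal (e/2)"
          using * U by (intro add_mono) auto
        also have "\<dots> = ennreal e" using \<open>e > 0\<close> by (simp flip: ennreal_plus)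
        finally show "emeasure lborel {x \<in> A. x + z n \<notin> A} \<le> ennreal e" .
      qed
    qed
  qed
  \<comment> \<open>A set of finite measure and its translate have differences of equal measure in
    both directions, hence the factor 2.\<close>
  have eq: "(\<integral>\<^sup>+x. cmod (indicator A (x + z n) *\<^sub>R c - indicator A x *\<^sub>R c) \<partial>lborel) = 2 * ennreal (cmod c) * emeasure lborel {x \<in> A. x + z n \<notin> A}" for n
  proof -
    let ?A = "{x. x + z n \<in> A}"
    have eA: "emeasure lborel ?A = emeasure lborel A"
      by (rule emeasure_translate) measurable
    have s1: "emeasure lborel A = emeasure lborel (A \<inter> ?A) + emeasure lborel (A - ?A)"
      by (rule emeasure_Int_Diff) measurable
    have s2: "emeasure lborel ?A = emeasure lborel (A \<inter> ?A) + emeasure lborel (?A - A)"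
      using emeasure_Int_Diff[of ?A lborel A] by (simp add: Int_commute)
    have "emeasure lborel (A \<inter> ?A) < \<infinity>" using emeasure_mono[of "A \<inter> ?A" A lborel] fin by (auto intro: le_less_trans)
    moreover have "emeasure lborel (A \<inter> ?A) + emeasure lborel (?A - A) = emeasure lborel (A \<inter> ?A) + emeasure lborel (A - ?A)"
      by (simp only: s1[symmetric] s2[symmetric] eA)
    ultimately have e2: "emeasure lborel (?A - A) = emeasure lborel (A - ?A)"
      by (auto simp: ennreal_add_left_cancel)
    have "(\<integral>\<^sup>+x. cmod (indicator A (x + z n) *\<^sub>R c - indicator A x *\<^sub>R c) \<partial>lborel)
      = (\<integral>\<^sup>+x. ennreal (cmod c) * indicator (A - ?A) x + ennreal (cmod c) * indicator (?A - A) x \<partial>lborel)"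
      by (intro nn_integral_cong) (auto simp: indicator_def)
    also have "\<dots> = ennreal (cmod c) * emeasure lborel (A - ?A) + ennreal (cmod c) * emeasure lborel (?A - A)"
      by (subst nn_integral_add) (auto simp: nn_integral_cmult)
    also have "\<dots> = 2 * ennreal (cmod c) * emeasure lborel (A - ?A)" unfolding e2 by (simp add: mult_2 distrib_right)
    also have "A - ?A = {x \<in> A. x + z n \<notin> A}" by auto
    finally show ?thesis .
  qed
  have "(\<lambda>n. 2 * ennreal (cmod c) * emeasure lborel {x \<in> A. x + z n \<notin> A}) \<longlonglongrightarrow> 2 * ennreal (cmod c) * 0"
    by (intro ennreal_tendsto_cmult ind) (simp add: ennreal_mult_less_top)
  then show ?case unfolding eq by simp
next
  case (add f g)
  have [measurable]: "f \<in> borel_measurable borel" "g \<in> borel_measurable borel" using add by auto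
  show ?case
  proof (rule tendsto_sandwich[of "\<lambda>_. 0"])
    show "\<forall>\<^sub>F n in sequentially. (\<integral>\<^sup>+x. cmod (f (x + z n) + g (x + z n) - (f x + g x)) \<partial>lborel)
      \<le> (\<integral>\<^sup>+x. cmod (f (x + z n) - f x) \<partial>lborel) + (\<integral>\<^sup>+x. cmod (g (x + z n) - g x) \<partial>lborel)"
    proof (intro always_eventually allI)
      fix n
      have "cmod (f (x + z n) + g (x + z n) - (f x + g x)) \<le> cmod (f (x + z n) - f x) + cmod (g (x + z n) - g x)" for x
        by (metis add_diff_add norm_triangle_ineq)
      then show "(\<integral>\<^sup>+x. cmod (f (x + z n) + g (x + z n) - (f x + g x)) \<partial>lborel)
      \<le> (\<integral>\<^sup>+x. cmod (f (x + z n) - f x) \<partial>lborel) + (\<integral>\<^sup>+x. cmod (g (x + z n) - g x) \<partial>lborel)"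
        by (subst nn_integral_add[symmetric]) (auto intro!: nn_integral_mono simp flip: ennreal_plus simp: ennreal_leI)
    qed
    show "(\<lambda>n. (\<integral>\<^sup>+x. cmod (f (x + z n) - f x) \<partial>lborel) + (\<integral>\<^sup>+x. cmod (g (x + z n) - g x) \<partial>lborel)) \<longlonglongrightarrow> 0"
      using tendsto_add[OF add.IH(1,2)] by simp
  qed auto
next
  case (lim f s)
  have [measurable]: "f \<in> borel_measurable borel" "\<And>i. s i \<in> borel_measurable borel" using lim by auto
  have "(\<lambda>i. \<integral>\<^sup>+x. cmod (f x - s i x) \<partial>lborel) \<longlonglongrightarrow> (\<integral>\<^sup>+x. 0 \<partial>(lborel::'a measure))"
  proof (rule nn_integral_dominated_convergence[where w="\<lambda>x. 3 * ennreal (cmod (f x))"])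
    show "AE x in lborel. ennreal (cmod (f x - s j x)) \<le> 3 * ennreal (cmod (f x))" for j
    proof (intro AE_I2)
      fix x
      have "cmod (f x - s j x) \<le> cmod (f x) + cmod (s j x)" by (rule norm_triangle_ineq4)
      also have "\<dots> \<le> 3 * cmod (f x)" using lim.hyps(3)[of x j] by simp
      finally have "ennreal (cmod (f x - s j x)) \<le> ennreal (3 * cmod (f x))" by (rule ennreal_leI)
      then show "ennreal (cmod (f x - s j x)) \<le> 3 * ennreal (cmod (f x))" by (simp add: ennreal_mult')
    qed
    show "(\<integral>\<^sup>+x. 3 * ennreal (cmod (f x)) \<partial>lborel) < \<infinity>"
      using lim.hyps(4) by (subst nn_integral_cmult) (auto simp: integrable_iff_bounded ennreal_mult_less_top)
    show "AE x in lborel. (\<lambda>i. ennreal (cmod (f x - s i x))) \<longlonglongrightarrow> 0"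
    proof (intro AE_I2)
      fix x
      have "(\<lambda>i. cmod (f x - s i x)) \<longlonglongrightarrow> cmod (f x - f x)" by (intro tendsto_intros lim.hyps(2)) simp
      then show "(\<lambda>i. ennreal (cmod (f x - s i x))) \<longlonglongrightarrow> 0" by (simp add: tendsto_ennrealI[where x=0, simplified])
    qed
  qed auto
  then have fs: "(\<lambda>i. \<integral>\<^sup>+x. cmod (f x - s i x) \<partial>lborel) \<longlonglongrightarrow> 0" by simp
  show ?case
  proof (rule tendsto_0_le_enn)
    fix e :: real assume "e > 0"
    obtain i where i: "(\<integral>\<^sup>+x. cmod (f x - s i x) \<partial>lborel) < ennreal (e / 4)"
      using order_tendstoD(2)[OF fs, of "ennreal (e/4)"] \<open>e > 0\<close> by (auto simp: eventually_sequentially)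
    have "\<forall>\<^sub>F n in sequentially. (\<integral>\<^sup>+x. cmod (s i (x + z n) - s i x) \<partial>lborel) < ennreal (e/2)"
      using order_tendstoD(2)[OF lim.IH[of i], of "ennreal (e/2)"] \<open>e > 0\<close> by auto
    then show "\<forall>\<^sub>F n in sequentially. (\<integral>\<^sup>+x. cmod (f (x + z n) - f x) \<partial>lborel) \<le> ennreal e"
    proof eventually_elim
      fix n assume *: "(\<integral>\<^sup>+x. cmod (s i (x + z n) - s i x) \<partial>lborel) < ennreal (e/2)"
      have "(\<integral>\<^sup>+x. cmod (f (x + z n) - f x) \<partial>lborel) \<le> 2 * (\<integral>\<^sup>+x. cmod (f x - s i x) \<partial>lborel) + (\<integral>\<^sup>+x. cmod (s i (x + z n) - s i x) \<partial>lborel)"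
        by (rule nn_integral_translate_diff) measurable
      also have "\<dots> \<le> 2 * ennreal (e/4) + ennreal (e/2)" using i * by (intro add_mono mult_left_mono) auto
      also have "\<dots> = ennreal 2 * ennreal (e/4) + ennreal (e/2)" by simp
      also have "\<dots> = ennreal e" using \<open>e > 0\<close> by (simp del: ennreal_numeral flip: ennreal_plus ennreal_mult)
      finally show "(\<integral>\<^sup>+x. cmod (f (x + z n) - f x) \<partial>lborel) \<le> ennreal e" .
    qed
  qed
qed

lemma L2_fun_translate:
  assumes [measurable]: "f \<in> borel_measurable borel" and "f \<in> L2_fun"
  shows "(\<lambda>x. f (x + a)) \<in> L2_fun" "L2_nrm (\<lambda>x. f (x + a)) = L2_nrm f"
proof -
  have eq: "l2sq (\<lambda>x. f (x + a)) = l2sq f"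
    unfolding l2sq_lborel by (rule nn_integral_translate[where f="\<lambda>x. (ennreal (cmod (f x)))\<^sup>2"]) measurable
  have m: "(\<lambda>x. f (x + a)) \<in> borel_measurable borel" by measurable
  then show "(\<lambda>x. f (x + a)) \<in> L2_fun"
    using L2_fun_l2sq[OF assms(2)] eq by (intro L2_fun_borelI) auto
  have "(\<lambda>x. f (x + a)) \<in> borel_measurable lebesgue" using m by (simp add: measurable_completion)
  then show "L2_nrm (\<lambda>x. f (x + a)) = L2_nrm f"
    using eq by (simp add: L2_nrm_enn2real L2_funD[OF assms(2)])
qed

text \<open>Cutting off both the values and the argument makes a Borel function bounded with bounded
  support, hence integrable. A function is left unchanged at each given point once \<open>M\<close>
  is large.\<close>

definition truncate :: "real \<Rightarrow> ('a::real_normed_vector \<Rightarrow> complex) \<Rightarrow> 'a \<Rightarrow> complex" where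
  "truncate M f x = (if cmod (f x) \<le> M \<and> norm x \<le> M then f x else 0)"

lemma truncate_measurable:
  assumes [measurable]: "f \<in> borel_measurable borel"
  shows "truncate M (f :: 'a::euclidean_space \<Rightarrow> complex) \<in> borel_measurable borel"
  unfolding truncate_def by measurable

lemma L2_fun_truncate:
  assumes "f \<in> borel_measurable borel" "f \<in> L2_fun"
  shows "truncate M f \<in> L2_fun"
proof (rule L2_fun_mono[OF assms(2)])
  show "truncate M f \<in> borel_measurable lebesgue"
    using truncate_measurable[OF assms(1), of M] by (intro measurable_completion) simp
qed (simp add: truncate_def)

lemma integrable_truncate:
  assumes [measurable]: "f \<in> borel_measurable borel"
  shows "integrable lborel (truncate M f :: 'a::euclidean_space \<Rightarrow> complex)"
proof (rule integrableI_bounded_set[where A="cball 0 M" and B=M])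
  show "truncate M f \<in> borel_measurable lborel" using truncate_measurable[OF assms] by simp
  show "AE x in lborel. x \<in> cball 0 M \<longrightarrow> norm (truncate M f x) \<le> M"
    by (intro AE_I2) (auto simp: truncate_def intro: order_trans[OF norm_ge_zero])
qed (auto simp: truncate_def emeasure_lborel_cball_finite[unfolded infinity_ennreal_def])

lemma truncate_tendsto_L2:
  assumes [measurable]: "f \<in> borel_measurable borel" and f: "f \<in> L2_fun"
  shows "(\<lambda>n::nat. L2_nrm (\<lambda>x. truncate (real n) f x - f x)) \<longlonglongrightarrow> 0"
proof -
  have [measurable]: "truncate M f \<in> borel_measurable borel" for M by (rule truncate_measurable) measurable
  have m: "(\<lambda>x. truncate M f x - f x) \<in> borel_measurable lebesgue" for M by (intro borel_measurable_diff L2_funD f L2_fun_truncate) measurable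
  have "(\<lambda>n. \<integral>\<^sup>+x. (ennreal (cmod (truncate (real n) f x - f x)))\<^sup>2 \<partial>lborel) \<longlonglongrightarrow> (\<integral>\<^sup>+x. 0 \<partial>(lborel::(real,'a) vec measure))"
  proof (rule nn_integral_dominated_convergence[where w="\<lambda>x. (ennreal (cmod (f x)))\<^sup>2"])
    show "(\<integral>\<^sup>+x. (ennreal (cmod (f x)))\<^sup>2 \<partial>lborel) < \<infinity>" using L2_fun_l2sq[OF f] by (simp add: l2sq_lborel)
    show "AE x in lborel. (ennreal (cmod (truncate (real j) f x - f x)))\<^sup>2 \<le> (ennreal (cmod (f x)))\<^sup>2" for j
      by (intro AE_I2) (simp add: truncate_def)
    show "AE x in lborel. (\<lambda>i. (ennreal (cmod (truncate (real i) f x - f x)))\<^sup>2) \<longlonglongrightarrow> 0"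
    proof (intro AE_I2)
      fix x
      obtain N :: nat where N: "max (cmod (f x)) (norm x) \<le> real N" using real_arch_simple by blast
      have "\<forall>\<^sub>F n in sequentially. truncate (real n) f x = f x"
        using eventually_ge_at_top[of N] by eventually_elim (use N in \<open>auto simp: truncate_def\<close>)
      then show "(\<lambda>i. (ennreal (cmod (truncate (real i) f x - f x)))\<^sup>2) \<longlonglongrightarrow> 0"
        by (intro tendsto_eventually) (auto elim: eventually_mono)
    qed
  qed measurable
  then have "(\<lambda>n. l2sq (\<lambda>x. truncate (real n) f x - f x)) \<longlonglongrightarrow> 0" by (simp add: l2sq_lborel)
  then have "(\<lambda>n. sqrt (enn2real (l2sq (\<lambda>x. truncate (real n) f x - f x)))) \<longlonglongrightarrow> sqrt (enn2real 0)"
    by (intro tendsto_intros) auto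
  then show ?thesis by (simp add: L2_nrm_enn2real[OF m])
qed

lemma translation_continuous_L2:
  assumes [measurable]: "f \<in> borel_measurable borel" and f: "f \<in> L2_fun" and z: "z \<longlonglongrightarrow> 0"
  shows "(\<lambda>n. L2_nrm (\<lambda>x. f (x + z n) - f x)) \<longlonglongrightarrow> 0"
proof (rule LIMSEQ_I)
  fix e :: real assume "e > 0"
  obtain M where M: "L2_nrm (\<lambda>x. truncate (real M) f x - f x) < e / 4"
    using order_tendstoD(2)[OF truncate_tendsto_L2[OF assms(1) f], of "e/4"] \<open>e > 0\<close> by (auto simp: eventually_sequentially)
  define g where "g = truncate (real M) f"
  have [measurable]: "g \<in> borel_measurable borel" unfolding g_def by (rule truncate_measurable) measurable
  have g: "g \<in> L2_fun" unfolding g_def by (intro L2_fun_truncate f) measurable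
  have gM: "cmod (g x) \<le> real M" for x by (auto simp: g_def truncate_def)
  \<comment> \<open>\<open>?c\<close> bounds the difference of two values of \<open>g\<close>, so
    the squared norm of a difference is at most \<open>?c\<close> times its integral norm. The
    threshold below is divided by ?c + 1, which is positive even for M = 0.\<close>
  let ?c = "2 * real M"
  have "(\<lambda>n. \<integral>\<^sup>+x. cmod (g (x + z n) - g x) \<partial>lborel) \<longlonglongrightarrow> 0"
    unfolding g_def by (intro translation_continuous_L1 integrable_truncate z) measurable
  then have "\<forall>\<^sub>F n in sequentially. (\<integral>\<^sup>+x. cmod (g (x + z n) - g x) \<partial>lborel) < ennreal ((e/4)\<^sup>2 / (?c + 1))"
    using \<open>e > 0\<close> by (intro order_tendstoD(2)) (auto intro!: divide_pos_pos add_nonneg_pos)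
  then obtain N where N: "\<And>n. n \<ge> N \<Longrightarrow> (\<integral>\<^sup>+x. cmod (g (x + z n) - g x) \<partial>lborel) < ennreal ((e/4)\<^sup>2 / (?c + 1))"
    by (auto simp: eventually_sequentially)
  have "norm (L2_nrm (\<lambda>x. f (x + z n) - f x) - 0) < e" if n: "n \<ge> N" for n
  proof -
    let ?t = "\<lambda>f x. f (x + z n)"
    have tf: "?t f \<in> L2_fun" and tg: "?t g \<in> L2_fun" using f g by (auto intro!: L2_fun_translate)
    have 1: "L2_nrm (\<lambda>x. g (x + z n) - g x) \<le> e / 4"
    proof -
      have "l2sq (\<lambda>x. g (x + z n) - g x) \<le> (\<integral>\<^sup>+x. ennreal ?c * ennreal (cmod (g (x + z n) - g x)) \<partial>lborel)"
        unfolding l2sq_lborel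
      proof (rule nn_integral_mono)
        fix x
        have "cmod (g (x + z n) - g x) \<le> ?c" using norm_triangle_ineq4[of "g (x + z n)" "g x"] gM[of x] gM[of "x + z n"] by simp
        then show "(ennreal (cmod (g (x + z n) - g x)))\<^sup>2 \<le> ennreal ?c * ennreal (cmod (g (x + z n) - g x))"
          unfolding power2_eq_square by (intro mult_right_mono ennreal_leI) auto
      qed
      also have "\<dots> = ennreal ?c * (\<integral>\<^sup>+x. cmod (g (x + z n) - g x) \<partial>lborel)" by (rule nn_integral_cmult) measurable
      also have "\<dots> \<le> ennreal ?c * ennreal ((e/4)\<^sup>2 / (?c + 1))" using N[OF n] by (intro mult_left_mono) auto
      also have "\<dots> = ennreal (?c / (?c + 1) * (e/4)\<^sup>2)" by (simp flip: ennreal_mult)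
      also have "\<dots> \<le> ennreal (1 * (e/4)\<^sup>2)" by (intro ennreal_leI mult_right_mono) (auto simp: field_simps)
      finally have "l2sq (\<lambda>x. g (x + z n) - g x) \<le> ennreal ((e/4)\<^sup>2)" by simp
      then show ?thesis using \<open>e > 0\<close> L2_fun_diff[OF tg g] by (subst (asm) L2_nrm_le_iff[symmetric]) (auto dest: L2_funD)
    qed
    have 2: "L2_nrm (\<lambda>x. ?t f x - ?t g x) = L2_nrm (\<lambda>x. f x - g x)"
      by (rule L2_fun_translate(2)[where f="\<lambda>x. f x - g x"]) (auto intro: L2_fun_diff f g)
    have 3: "L2_nrm (\<lambda>x. f x - g x) < e / 4" using M by (subst L2_nrm_minus_commute) (simp add: g_def)
    have "L2_nrm (\<lambda>x. ?t f x - f x) \<le> L2_nrm (\<lambda>x. ?t f x - ?t g x) + L2_nrm (\<lambda>x. f x - ?t g x)"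
      by (rule L2_nrm_triangle3[OF tf f tg])
    also have "L2_nrm (\<lambda>x. f x - ?t g x) \<le> L2_nrm (\<lambda>x. f x - g x) + L2_nrm (\<lambda>x. ?t g x - g x)"
      by (rule L2_nrm_triangle3[OF f tg g])
    finally show ?thesis using 1 2 3 \<open>e > 0\<close> by simp
  qed
  then show "\<exists>no. \<forall>n\<ge>no. norm (L2_nrm (\<lambda>x. f (x + z n) - f x) - 0) < e" by blast
qed

section \<open>The Plancherel transform\<close>

text \<open>The transform \<open>fourier_int\<close> taken with respect to Lebesgue measure on the
  Borel sets, where product measures and Fubini are at hand; on Borel functions the two
  agree.\<close>

definition ft :: "('a::euclidean_space \<Rightarrow> complex) \<Rightarrow> 'a \<Rightarrow> complex" where
  "ft f \<xi> = (\<integral>x. cis (- 2 * pi * (x \<bullet> \<xi>)) * f x \<partial>lborel)"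

lemma cis_measurable[measurable]: "cis \<in> borel_measurable borel"
  by (intro borel_measurable_continuous_onI continuous_intros)

lemma ft_measurable[measurable]:
  assumes [measurable]: "f \<in> borel_measurable borel"
  shows "ft f \<in> borel_measurable borel"
  unfolding ft_def by measurable

lemma fourier_int_eq_ft: "f \<in> borel_measurable borel \<Longrightarrow> fourier_int f = ft f"
  unfolding fourier_int_def ft_def fun_eq_iff by (auto intro!: integral_completion)

lemma fourier_int_cong_AE:
  assumes "f \<in> borel_measurable lebesgue" "g \<in> borel_measurable lebesgue" "AE x in lebesgue. f x = g x"
  shows "fourier_int f = fourier_int g"
proof -
  have c: "(\<lambda>x. cis (- (2 * pi * (x \<bullet> \<xi>)))) \<in> borel_measurable lebesgue" for \<xi> :: "(real, 'a) vec"
    by (intro measurable_completion) simp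
  show ?thesis unfolding fourier_int_def fun_eq_iff
    using assms by (auto intro!: integral_cong_AE borel_measurable_times c elim!: eventually_mono)
qed

lemma integrable_cis_mult:
  fixes f :: "'a::euclidean_space \<Rightarrow> complex"
  assumes [measurable]: "g \<in> borel_measurable borel" and f: "integrable lborel f"
  shows "integrable lborel (\<lambda>x. cis (g x) * f x)"
proof (rule Bochner_Integration.integrable_bound[OF f])
  have [measurable]: "f \<in> borel_measurable borel" using f by auto
  show "(\<lambda>x. cis (g x) * f x) \<in> borel_measurable lborel" by measurable
qed (auto simp: norm_mult)

lemma ft_norm_le: "cmod (ft f \<xi>) \<le> (\<integral>x. cmod (f x) \<partial>lborel)"
  unfolding ft_def using integral_norm_bound[of lborel "\<lambda>x. cis (- 2 * pi * (x \<bullet> \<xi>)) * f x"] by (simp add: norm_mult)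

lemma ft_mult_formula:
  assumes f: "integrable lborel f" and g: "integrable lborel g"
  shows "(\<integral>\<xi>. ft f \<xi> * g \<xi> \<partial>lborel) = (\<integral>x. f x * ft g x \<partial>lborel)"
proof -
  have [measurable]: "f \<in> borel_measurable borel" "g \<in> borel_measurable borel" using f g by auto
  have int: "integrable (lborel \<Otimes>\<^sub>M lborel) (\<lambda>(\<xi>, x). cis (- 2 * pi * (x \<bullet> \<xi>)) * f x * g \<xi>)"
  proof (rule lborel_pair.Fubini_integrable)
    show "AE \<xi> in lborel. integrable lborel (\<lambda>x. case (\<xi>, x) of (\<xi>, x) \<Rightarrow> cis (- 2 * pi * (x \<bullet> \<xi>)) * f x * g \<xi>)"
      using f by (auto intro!: integrable_mult_left integrable_cis_mult)
    have "integrable lborel (\<lambda>\<xi>. (\<integral>x. norm (f x) \<partial>lborel) * norm (g \<xi>))" using g by auto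
    then show "integrable lborel (\<lambda>\<xi>. \<integral>x. norm (case (\<xi>, x) of (\<xi>, x) \<Rightarrow> cis (- 2 * pi * (x \<bullet> \<xi>)) * f x * g \<xi>) \<partial>lborel)"
      by (simp add: norm_mult)
  qed measurable
  have "(\<integral>\<xi>. ft f \<xi> * g \<xi> \<partial>lborel) = (\<integral>\<xi>. \<integral>x. cis (- 2 * pi * (x \<bullet> \<xi>)) * f x * g \<xi> \<partial>lborel \<partial>lborel)"
    by (simp add: ft_def)
  also have "\<dots> = (\<integral>x. \<integral>\<xi>. cis (- 2 * pi * (x \<bullet> \<xi>)) * f x * g \<xi> \<partial>lborel \<partial>lborel)"
    using lborel_pair.Fubini_integral[of "\<lambda>\<xi> x. cis (- 2 * pi * (x \<bullet> \<xi>)) * f x * g \<xi>"] int by simp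
  also have "\<dots> = (\<integral>x. f x * (\<integral>\<xi>. cis (- 2 * pi * (\<xi> \<bullet> x)) * g \<xi> \<partial>lborel) \<partial>lborel)"
    by (subst integral_mult_right_zero[symmetric]) (simp add: mult_ac inner_commute)
  finally show ?thesis by (simp add: ft_def)
qed

section \<open>Gaussians, their transforms and affine substitutions\<close>

definition gauss :: "'a::euclidean_space \<Rightarrow> real" where
  "gauss x = exp (- (norm x)\<^sup>2 / 2)"

text \<open>The transform of \<open>gauss\<close>. Each factor is the density of the centered normal
  law with standard deviation 1 / (2 \<pi>), so the product has total mass 1 and can serve as an
  averaging kernel.\<close>

definition gauss_ft :: "'a::euclidean_space \<Rightarrow> real" where
  "gauss_ft x = (\<Prod>b\<in>Basis. sqrt (2 * pi) * exp (- (2 * pi * (x \<bullet> b))\<^sup>2 / 2))"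

lemma gauss_prod: "gauss (x :: 'a::euclidean_space) = (\<Prod>b\<in>Basis. exp (- (x \<bullet> b)\<^sup>2 / 2))"
proof -
  have "(norm x)\<^sup>2 = (\<Sum>b\<in>Basis. (x \<bullet> b)\<^sup>2)"
    unfolding power2_norm_eq_inner by (subst euclidean_inner) (simp add: power2_eq_square)
  then show ?thesis
    by (simp add: gauss_def exp_sum[symmetric] sum_negf sum_divide_distrib[symmetric])
qed

lemma gauss_1d_integrable: "integrable lborel (\<lambda>t::real. exp (- t\<^sup>2 / 2))"
proof -
  have "integrable lborel (\<lambda>t. sqrt (2 * pi) * std_normal_density t)" by simp
  then show ?thesis by (simp add: std_normal_density_def)
qed

lemma gauss_1d_ft:
  "(\<integral>t. cis (- 2 * pi * (t * s)) * complex_of_real (exp (- t\<^sup>2 / 2)) \<partial>lborel)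
    = complex_of_real (sqrt (2 * pi) * exp (- (2 * pi * s)\<^sup>2 / 2))"
proof -
  have "complex_of_real (exp (- ((- 2 * pi * s)\<^sup>2) / 2)) = char std_normal_distribution (- 2 * pi * s)"
    by (simp add: char_std_normal_distribution)
  also have "\<dots> = (\<integral>t. std_normal_density t *\<^sub>R iexp (- 2 * pi * s * t) \<partial>lborel)"
    unfolding char_def by (subst integral_density) auto
  also have "\<dots> = (\<integral>t. complex_of_real (1 / sqrt (2 * pi)) * (cis (- 2 * pi * (t * s)) * complex_of_real (exp (- t\<^sup>2 / 2))) \<partial>lborel)"
    by (intro Bochner_Integration.integral_cong refl)
       (simp add: std_normal_density_def cis_conv_exp scaleR_conv_of_real mult_ac)
  also have "\<dots> = complex_of_real (1 / sqrt (2 * pi)) * (\<integral>t. cis (- 2 * pi * (t * s)) * complex_of_real (exp (- t\<^sup>2 / 2)) \<partial>lborel)"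
    by (rule Bochner_Integration.integral_mult_right_zero)
  finally show ?thesis by (simp add: field_simps)
qed

interpretation lborel_PiM: product_sigma_finite "\<lambda>_. lborel :: real measure"
  by standard

lemma integral_lborel_prod:
  fixes f :: "'a::euclidean_space \<Rightarrow> real \<Rightarrow> complex"
  assumes f: "\<And>b. b \<in> Basis \<Longrightarrow> integrable lborel (f b)"
  shows "(\<integral>x. (\<Prod>b\<in>Basis. f b (x \<bullet> b)) \<partial>lborel) = (\<Prod>b\<in>Basis. \<integral>t. f b t \<partial>lborel)"
proof -
  have [measurable]: "f b \<in> borel_measurable borel" if "b \<in> Basis" for b using f[OF that] by auto
  have "(\<integral>x. (\<Prod>b\<in>Basis. f b (x \<bullet> b)) \<partial>(lborel :: 'a measure))
     = (\<integral>x. (\<Prod>b\<in>Basis. f b (x \<bullet> b)) \<partial>distr (\<Pi>\<^sub>M b\<in>Basis. lborel) borel (\<lambda>f. \<Sum>b\<in>(Basis::'a set). f b *\<^sub>R b))"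
    by (simp only: lborel_eq[symmetric])
  also have "\<dots> = (\<integral>x. (\<Prod>b\<in>(Basis::'a set). f b ((\<Sum>b\<in>Basis. x b *\<^sub>R b) \<bullet> b)) \<partial>(\<Pi>\<^sub>M b\<in>Basis. lborel))"
    by (subst integral_distr) auto
  also have "\<dots> = (\<integral>x. (\<Prod>b\<in>(Basis::'a set). f b (x b)) \<partial>(\<Pi>\<^sub>M b\<in>Basis. lborel))"
    by (intro Bochner_Integration.integral_cong prod.cong refl) (simp add: inner_sum_left_Basis)
  also have "\<dots> = (\<Prod>b\<in>Basis. \<integral>t. f b t \<partial>lborel)"
    by (rule lborel_PiM.product_integral_prod) (use f in auto)
  finally show ?thesis .
qed

lemma gauss_measurable[measurable]: "gauss \<in> borel_measurable borel"
  unfolding gauss_def by measurable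

lemma gauss_ft_measurable[measurable]: "gauss_ft \<in> borel_measurable borel"
  unfolding gauss_ft_def by measurable

lemma gauss_pos: "gauss x > 0"
  by (simp add: gauss_def)

lemma gauss_ft_nonneg: "gauss_ft x \<ge> 0"
  by (auto simp: gauss_ft_def intro!: prod_nonneg)

lemma gauss_integrable: "integrable lborel (gauss :: 'a::euclidean_space \<Rightarrow> real)"
proof (rule integrableI_bounded)
  have "(\<integral>\<^sup>+x. ennreal (norm (gauss (x::'a))) \<partial>lborel) = (\<integral>\<^sup>+x. (\<Prod>b\<in>(Basis::'a set). ennreal (exp (- (x \<bullet> b)\<^sup>2 / 2))) \<partial>lborel)"
    by (simp add: gauss_prod abs_prod prod_ennreal)
  also have "\<dots> = (\<Prod>b\<in>(Basis::'a set). \<integral>\<^sup>+t. ennreal (exp (- t\<^sup>2 / 2)) \<partial>lborel)"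
    by (rule nn_integral_lborel_prod) auto
  also have "\<dots> < \<infinity>" using gauss_1d_integrable
    by (auto simp: integrable_iff_bounded simp: power_less_top_ennreal)
  finally show "(\<integral>\<^sup>+x. ennreal (norm (gauss (x::'a))) \<partial>lborel) < \<infinity>" .
qed measurable

lemma ft_gauss: "ft (\<lambda>x. complex_of_real (gauss x)) \<xi> = complex_of_real (gauss_ft \<xi>)"
proof -
  have c: "cis (- 2 * pi * (x \<bullet> \<xi>)) = (\<Prod>b\<in>Basis. cis (- 2 * pi * ((x \<bullet> b) * (\<xi> \<bullet> b))))" for x
  proof -
    have "cis (- 2 * pi * (x \<bullet> \<xi>)) = exp (\<Sum>b\<in>Basis. \<i> * complex_of_real (- 2 * pi * ((x \<bullet> b) * (\<xi> \<bullet> b))))"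
      unfolding cis_conv_exp by (subst euclidean_inner) (simp add: sum_distrib_left of_real_sum[symmetric] del: of_real_mult)
    then show ?thesis by (simp add: exp_sum cis_conv_exp)
  qed
  have "ft (\<lambda>x. complex_of_real (gauss x)) \<xi>
     = (\<integral>x. (\<Prod>b\<in>Basis. cis (- 2 * pi * ((x \<bullet> b) * (\<xi> \<bullet> b))) * complex_of_real (exp (- (x \<bullet> b)\<^sup>2 / 2))) \<partial>lborel)"
    unfolding ft_def c gauss_prod by (simp add: prod.distrib)
  also have "\<dots> = (\<Prod>b\<in>Basis. \<integral>t. cis (- 2 * pi * (t * (\<xi> \<bullet> b))) * complex_of_real (exp (- t\<^sup>2 / 2)) \<partial>lborel)"
    by (rule integral_lborel_prod) (intro integrable_cis_mult integrable_of_real gauss_1d_integrable, measurable)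
  also have "\<dots> = complex_of_real (gauss_ft \<xi>)"
    unfolding gauss_1d_ft gauss_ft_def by simp
  finally show ?thesis .
qed

lemma nn_integral_gauss_ft: "(\<integral>\<^sup>+x. ennreal (gauss_ft (x::'a::euclidean_space)) \<partial>lborel) = 1"
proof -
  have d: "sqrt (2 * pi) * exp (- (2 * pi * t)\<^sup>2 / 2) = normal_density 0 (1 / (2 * pi)) t" for t
  proof -
    have "sqrt (2 * pi * (1 / (2 * pi))\<^sup>2) = 1 / sqrt (2 * pi)"
      by (simp add: power2_eq_square real_sqrt_divide real_sqrt_mult)
    then show ?thesis unfolding normal_density_def by (simp add: power_divide power_mult_distrib)
  qed
  have "(\<integral>\<^sup>+t. ennreal (normal_density 0 (1 / (2 * pi)) t) \<partial>lborel) = 1"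
  proof -
    interpret prob_space "density lborel (normal_density 0 (1 / (2 * pi)))"
      by (rule prob_space_normal_density) simp
    show ?thesis using emeasure_space_1 by (simp add: emeasure_density)
  qed
  then have 1: "(\<integral>\<^sup>+t. ennreal (sqrt (2 * pi) * exp (- (2 * pi * t)\<^sup>2 / 2)) \<partial>lborel) = 1"
    by (simp only: d)
  have "(\<integral>\<^sup>+x. ennreal (gauss_ft (x::'a)) \<partial>lborel)
    = (\<integral>\<^sup>+x. (\<Prod>b\<in>(Basis::'a set). ennreal (sqrt (2 * pi) * exp (- (2 * pi * (x \<bullet> b))\<^sup>2 / 2))) \<partial>lborel)"
    by (simp add: gauss_ft_def prod_ennreal)
  also have "\<dots> = (\<Prod>b\<in>(Basis::'a set). \<integral>\<^sup>+t. ennreal (sqrt (2 * pi) * exp (- (2 * pi * t)\<^sup>2 / 2)) \<partial>lborel)"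
    by (rule nn_integral_lborel_prod) auto
  also have "\<dots> = 1" unfolding 1 by simp
  finally show ?thesis .
qed

lemma gauss_ft_integrable: "integrable lborel (gauss_ft :: 'a::euclidean_space \<Rightarrow> real)"
  by (rule integrableI_bounded) (auto simp: nn_integral_gauss_ft gauss_ft_nonneg)

lemma integral_gauss_ft: "(\<integral>x. gauss_ft (x::'a::euclidean_space) \<partial>lborel) = 1"
  by (subst integral_eq_nn_integral) (auto simp: nn_integral_gauss_ft gauss_ft_nonneg)

lemma
  fixes h :: "'a::euclidean_space \<Rightarrow> 'b::{banach, second_countable_topology}"
  assumes [measurable]: "h \<in> borel_measurable borel" and c: "c \<noteq> 0"
  shows integral_affine: "(\<integral>x. h x \<partial>lborel) = \<bar>c\<bar> ^ DIM('a) *\<^sub>R (\<integral>x. h (t + c *\<^sub>R x) \<partial>lborel)"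
    and integrable_affine: "integrable lborel h \<Longrightarrow> integrable lborel (\<lambda>x. h (t + c *\<^sub>R x))"
proof -
  have "(\<integral>x. h x \<partial>lborel) = (\<integral>x. h x \<partial>density (distr lborel borel (\<lambda>x. t + c *\<^sub>R x)) (\<lambda>_. \<bar>c\<bar> ^ DIM('a)))"
    by (simp only: lborel_affine[OF c, symmetric])
  also have "\<dots> = \<bar>c\<bar> ^ DIM('a) *\<^sub>R (\<integral>x. h (t + c *\<^sub>R x) \<partial>lborel)"
    by (subst integral_density) (auto simp: integral_distr)
  finally show "(\<integral>x. h x \<partial>lborel) = \<bar>c\<bar> ^ DIM('a) *\<^sub>R (\<integral>x. h (t + c *\<^sub>R x) \<partial>lborel)" .
  assume "integrable lborel h"
  then have "integrable (density (distr lborel borel (\<lambda>x. t + c *\<^sub>R x)) (\<lambda>_. \<bar>c\<bar> ^ DIM('a))) h"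
    by (simp only: lborel_affine[OF c, symmetric])
  then have "integrable lborel (\<lambda>x. \<bar>c\<bar> ^ DIM('a) *\<^sub>R h (t + c *\<^sub>R x))"
    by (subst (asm) integrable_density) (auto simp: integrable_distr_eq)
  from integrable_scaleR_right[OF this, of "1 / \<bar>c\<bar> ^ DIM('a)"]
  show "integrable lborel (\<lambda>x. h (t + c *\<^sub>R x))" using c by simp
qed

lemma gauss_scaled_integrable: "c \<noteq> 0 \<Longrightarrow> integrable lborel (\<lambda>x::'a::euclidean_space. gauss (c *\<^sub>R x))"
  using integrable_affine[of gauss c 0] gauss_integrable by simp

section \<open>Plancherel's identity for integrable functions\<close>

definition autocorr :: "((real, 'n::finite) vec \<Rightarrow> complex) \<Rightarrow> (real, 'n) vec \<Rightarrow> complex" where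
  "autocorr f z = (\<integral>x. f x * cnj (f (x + z)) \<partial>lborel)"

lemma autocorr_measurable[measurable]:
  assumes [measurable]: "f \<in> borel_measurable borel"
  shows "autocorr f \<in> borel_measurable borel"
  unfolding autocorr_def by measurable

context
  fixes f :: "(real, 'n::finite) vec \<Rightarrow> complex"
  assumes f_meas[measurable]: "f \<in> borel_measurable borel" and f_int: "integrable lborel f" and f_L2: "f \<in> L2_fun"
begin

lemma integrable_autocorr: "integrable lborel (\<lambda>x. f x * cnj (f (x + z)))"
proof -
  have "integrable lebesgue (\<lambda>x. f x * cnj (f (x + z)))"
    by (intro integrable_mult_L2 f_L2 L2_fun_cnj L2_fun_translate f_meas)
  then show ?thesis by (subst (asm) integrable_completion) auto
qed

lemma autocorr_bound: "(\<integral>x. cmod (f x * cnj (f (x + z))) \<partial>lborel) \<le> (L2_nrm f)\<^sup>2"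
proof -
  have t: "(\<lambda>x. cnj (f (x + z))) \<in> L2_fun" by (intro L2_fun_cnj L2_fun_translate f_meas f_L2)
  have "ennreal (\<integral>x. cmod (f x * cnj (f (x + z))) \<partial>lborel) = (\<integral>\<^sup>+x. cmod (f x * cnj (f (x + z))) \<partial>lborel)"
    by (intro nn_integral_eq_integral[symmetric] integrable_norm integrable_autocorr) auto
  also have "\<dots> \<le> ennreal (L2_nrm f * L2_nrm (\<lambda>x. cnj (f (x + z))))"
    using nn_integral_mult_L2[OF f_L2 t] by (simp add: nn_integral_completion)
  also have "L2_nrm (\<lambda>x. cnj (f (x + z))) = L2_nrm (\<lambda>x. f (x + z))" by (rule L2_nrm_cong_norm) simp
  also have "\<dots> = L2_nrm f" by (rule L2_fun_translate(2)[OF f_meas f_L2])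
  finally show ?thesis by (simp add: power2_eq_square)
qed

lemma autocorr_norm_le: "cmod (autocorr f z) \<le> (L2_nrm f)\<^sup>2"
  unfolding autocorr_def using integral_norm_bound autocorr_bound by (rule order_trans)

lemma autocorr_0: "autocorr f 0 = of_real ((L2_nrm f)\<^sup>2)"
  using integral_mult_cnj_L2[OF f_L2] unfolding autocorr_def by (subst (asm) integral_completion) auto

text \<open>Cauchy-Schwarz reduces this to the continuity of translations in L2. The value at 0 is
  the squared norm of \<open>f\<close>, so this is the side of Plancherel's identity without a
  transform.\<close>

lemma autocorr_cont:
  assumes z: "z \<longlonglongrightarrow> 0"
  shows "(\<lambda>n. autocorr f (z n)) \<longlonglongrightarrow> autocorr f 0"
proof -
  have "(\<lambda>n. autocorr f (z n) - autocorr f 0) \<longlonglongrightarrow> 0"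
  proof (rule Lim_null_comparison)
    show "\<forall>\<^sub>F n in sequentially. norm (autocorr f (z n) - autocorr f 0) \<le> L2_nrm f * L2_nrm (\<lambda>x. f (x + z n) - f x)"
    proof (intro always_eventually allI)
      fix n
      have t: "(\<lambda>x. cnj (f (x + z n) - f x)) \<in> L2_fun" by (intro L2_fun_cnj L2_fun_diff L2_fun_translate f_meas f_L2)
      have "autocorr f (z n) - autocorr f 0 = (\<integral>x. f x * cnj (f (x + z n)) - f x * cnj (f (x + 0)) \<partial>lborel)"
        unfolding autocorr_def by (intro Bochner_Integration.integral_diff[symmetric] integrable_autocorr)
      also have "\<dots> = (\<integral>x. f x * cnj (f (x + z n) - f x) \<partial>lborel)" by (simp add: algebra_simps)
      also have "\<dots> = (\<integral>x. f x * cnj (f (x + z n) - f x) \<partial>lebesgue)" by (rule integral_completion[symmetric]) measurable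
      finally have "norm (autocorr f (z n) - autocorr f 0) \<le> L2_nrm f * L2_nrm (\<lambda>x. cnj (f (x + z n) - f x))"
        using integral_mult_L2_le[OF f_L2 t] by simp
      also have "L2_nrm (\<lambda>x. cnj (f (x + z n) - f x)) = L2_nrm (\<lambda>x. f (x + z n) - f x)" by (rule L2_nrm_cong_norm) (metis complex_mod_cnj)
      finally show "norm (autocorr f (z n) - autocorr f 0) \<le> L2_nrm f * L2_nrm (\<lambda>x. f (x + z n) - f x)" .
    qed
    show "(\<lambda>n. L2_nrm f * L2_nrm (\<lambda>x. f (x + z n) - f x)) \<longlonglongrightarrow> 0"
      using tendsto_mult_left[OF translation_continuous_L2[OF f_meas f_L2 z], of "L2_nrm f"] by simp
  qed
  then show ?thesis by (simp add: LIM_zero_iff)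
qed

lemma ft_integrable_mult:
  assumes g: "integrable lborel g"
  shows "integrable lborel (\<lambda>\<xi>. ft f \<xi> * g \<xi>)" "integrable lborel (\<lambda>\<xi>. cnj (ft f \<xi>) * g \<xi>)"
proof -
  have [measurable]: "g \<in> borel_measurable borel" using g by auto
  have i: "integrable lborel (\<lambda>\<xi>. (\<integral>x. cmod (f x) \<partial>lborel) * cmod (g \<xi>))" using g by auto
  show "integrable lborel (\<lambda>\<xi>. ft f \<xi> * g \<xi>)" "integrable lborel (\<lambda>\<xi>. cnj (ft f \<xi>) * g \<xi>)"
    by (rule Bochner_Integration.integrable_bound[OF i], measurable,
        auto simp: norm_mult intro!: mult_mono order_trans[OF ft_norm_le])+
qed

text \<open>The Gaussian makes Fubini applicable; as \<open>c\<close> tends to \<open>0\<close>, continuity of the autocorrelation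
  at \<open>0\<close> gives Plancherel's identity.\<close>

lemma damped_plancherel:
  assumes c: "c > 0"
  shows "(\<integral>\<xi>. ft f \<xi> * (cnj (ft f \<xi>) * complex_of_real (gauss (c *\<^sub>R \<xi>))) \<partial>lborel)
    = (\<integral>w. complex_of_real (gauss_ft w) * autocorr f (c *\<^sub>R w) \<partial>lborel)"
proof -
  define v where "v \<xi> = cnj (ft f \<xi>) * complex_of_real (gauss (c *\<^sub>R \<xi>))" for \<xi>
  define g where "g x \<xi> = cis (2 * pi * (\<xi> \<bullet> x)) * complex_of_real (gauss (c *\<^sub>R \<xi>))" for x \<xi> :: "(real, 'n) vec"
  have gi: "integrable lborel (\<lambda>\<xi>::(real, 'n) vec. complex_of_real (gauss (c *\<^sub>R \<xi>)))"
    using c by (intro integrable_of_real gauss_scaled_integrable) auto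
  have v: "integrable lborel v" unfolding v_def by (rule ft_integrable_mult(2)[OF gi])
  have g: "integrable lborel (g x)" for x unfolding g_def by (intro integrable_cis_mult gi) measurable
  have [measurable]: "g x \<in> borel_measurable borel" for x unfolding g_def by measurable
  \<comment> \<open>The modulation in \<open>g x\<close> moves the center of the transformed
    Gaussian to \<open>x\<close>. Evaluated at x + c w and rescaled by the Jacobian, it becomes a
    kernel in \<open>w\<close> that no longer depends on \<open>c\<close> or
    \<open>x\<close>.\<close>
  have ftg: "\<bar>c\<bar> ^ DIM((real, 'n) vec) *\<^sub>R ft (g x) (x + c *\<^sub>R w) = complex_of_real (gauss_ft w)" for x w
  proof -
    have "complex_of_real (gauss_ft w) = ft (\<lambda>x. complex_of_real (gauss x)) w" by (rule ft_gauss[symmetric])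
    also have "\<dots> = \<bar>c\<bar> ^ DIM((real, 'n) vec) *\<^sub>R (\<integral>\<xi>. cis (- 2 * pi * ((0 + c *\<^sub>R \<xi>) \<bullet> w)) * complex_of_real (gauss (0 + c *\<^sub>R \<xi>)) \<partial>lborel)"
      unfolding ft_def using c by (intro integral_affine) auto
    also have "(\<integral>\<xi>. cis (- 2 * pi * ((0 + c *\<^sub>R \<xi>) \<bullet> w)) * complex_of_real (gauss (0 + c *\<^sub>R \<xi>)) \<partial>lborel) = ft (g x) (x + c *\<^sub>R w)"
      unfolding ft_def g_def
    proof (intro Bochner_Integration.integral_cong refl)
      fix \<xi> :: "(real, 'n) vec"
      have "- 2 * pi * ((0 + c *\<^sub>R \<xi>) \<bullet> w) = - 2 * pi * (\<xi> \<bullet> (x + c *\<^sub>R w)) + 2 * pi * (\<xi> \<bullet> x)"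
        by (simp add: inner_add_right algebra_simps)
      then show "cis (- 2 * pi * ((0 + c *\<^sub>R \<xi>) \<bullet> w)) * complex_of_real (gauss (0 + c *\<^sub>R \<xi>))
        = cis (- 2 * pi * (\<xi> \<bullet> (x + c *\<^sub>R w))) * (cis (2 * pi * (\<xi> \<bullet> x)) * complex_of_real (gauss (c *\<^sub>R \<xi>)))"
        by (simp only: cis_mult[symmetric] mult.assoc add_0_left)
    qed
    finally show ?thesis ..
  qed
  have ftv: "ft v x = (\<integral>w. complex_of_real (gauss_ft w) * cnj (f (x + c *\<^sub>R w)) \<partial>lborel)" for x
  proof -
    have "ft v x = (\<integral>\<xi>. cnj (ft f \<xi> * g x \<xi>) \<partial>lborel)"
      unfolding ft_def[of v] v_def g_def by (intro Bochner_Integration.integral_cong refl) (simp add: cis_cnj mult_ac)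
    also have "\<dots> = cnj (\<integral>\<xi>. ft f \<xi> * g x \<xi> \<partial>lborel)" by (rule Bochner_Integration.integral_cnj)
    also have "(\<integral>\<xi>. ft f \<xi> * g x \<xi> \<partial>lborel) = (\<integral>y. f y * ft (g x) y \<partial>lborel)" by (rule ft_mult_formula[OF f_int g])
    also have "\<dots> = \<bar>c\<bar> ^ DIM((real, 'n) vec) *\<^sub>R (\<integral>w. f (x + c *\<^sub>R w) * ft (g x) (x + c *\<^sub>R w) \<partial>lborel)"
      using c by (intro integral_affine) auto
    also have "\<dots> = (\<integral>w. f (x + c *\<^sub>R w) * (\<bar>c\<bar> ^ DIM((real, 'n) vec) *\<^sub>R ft (g x) (x + c *\<^sub>R w)) \<partial>lborel)"
      by (subst integral_scaleR_right[symmetric]) simp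
    also have "\<dots> = (\<integral>w. f (x + c *\<^sub>R w) * complex_of_real (gauss_ft w) \<partial>lborel)" unfolding ftg ..
    also have "cnj \<dots> = (\<integral>w. cnj (f (x + c *\<^sub>R w) * complex_of_real (gauss_ft w)) \<partial>lborel)" by (rule Bochner_Integration.integral_cnj[symmetric])
    finally show ?thesis by (simp add: mult.commute)
  qed
  have int: "integrable (lborel \<Otimes>\<^sub>M lborel) (\<lambda>(w, x). complex_of_real (gauss_ft w) * (f x * cnj (f (x + c *\<^sub>R w))))"
  proof (rule lborel_pair.Fubini_integrable)
    show "AE w in lborel. integrable lborel (\<lambda>x. case (w, x) of (w, x) \<Rightarrow> complex_of_real (gauss_ft w) * (f x * cnj (f (x + c *\<^sub>R w))))"
      using integrable_autocorr by auto
    have b: "integrable lborel (\<lambda>w::(real,'n) vec. gauss_ft w * (L2_nrm f)\<^sup>2)" using gauss_ft_integrable by auto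
    show "integrable lborel (\<lambda>w. \<integral>x. norm (case (w, x) of (w, x) \<Rightarrow> complex_of_real (gauss_ft w) * (f x * cnj (f (x + c *\<^sub>R w)))) \<partial>lborel)"
    proof (rule Bochner_Integration.integrable_bound[OF b])
      show "AE w in lborel. norm (\<integral>x. norm (case (w, x) of (w, x) \<Rightarrow> complex_of_real (gauss_ft w) * (f x * cnj (f (x + c *\<^sub>R w)))) \<partial>lborel) \<le> norm (gauss_ft w * (L2_nrm f)\<^sup>2)"
      proof (intro AE_I2)
        fix w
        have "(\<integral>x. norm (case (w, x) of (w, x) \<Rightarrow> complex_of_real (gauss_ft w) * (f x * cnj (f (x + c *\<^sub>R w)))) \<partial>lborel)
          = gauss_ft w * (\<integral>x. cmod (f x * cnj (f (x + c *\<^sub>R w))) \<partial>lborel)"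
          using gauss_ft_nonneg[of w] by (simp add: norm_mult)
        then show "norm (\<integral>x. norm (case (w, x) of (w, x) \<Rightarrow> complex_of_real (gauss_ft w) * (f x * cnj (f (x + c *\<^sub>R w)))) \<partial>lborel) \<le> norm (gauss_ft w * (L2_nrm f)\<^sup>2)"
          using gauss_ft_nonneg[of w] autocorr_bound[of "c *\<^sub>R w"] by (simp add: abs_mult mult_left_mono)
      qed
    qed measurable
  qed measurable
  have "(\<integral>\<xi>. ft f \<xi> * v \<xi> \<partial>lborel) = (\<integral>x. f x * ft v x \<partial>lborel)" by (rule ft_mult_formula[OF f_int v])
  also have "\<dots> = (\<integral>x. \<integral>w. complex_of_real (gauss_ft w) * (f x * cnj (f (x + c *\<^sub>R w))) \<partial>lborel \<partial>lborel)"
    unfolding ftv by (subst integral_mult_right_zero[symmetric]) (simp add: mult_ac)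
  also have "\<dots> = (\<integral>w. \<integral>x. complex_of_real (gauss_ft w) * (f x * cnj (f (x + c *\<^sub>R w))) \<partial>lborel \<partial>lborel)"
    using lborel_pair.Fubini_integral[of "\<lambda>w x. complex_of_real (gauss_ft w) * (f x * cnj (f (x + c *\<^sub>R w)))"] int by simp
  also have "\<dots> = (\<integral>w. complex_of_real (gauss_ft w) * autocorr f (c *\<^sub>R w) \<partial>lborel)"
    unfolding autocorr_def by (subst integral_mult_right_zero[symmetric]) simp
  finally show ?thesis unfolding v_def .
qed

lemma plancherel_ft: "ft f \<in> L2_fun" "L2_nrm (ft f) = L2_nrm f"
proof -
  define c where "c n = inverse (real (Suc n))" for n
  have c_pos: "c n > 0" for n by (simp add: c_def)
  have c_lim: "c \<longlonglongrightarrow> 0" unfolding c_def by (rule LIMSEQ_inverse_real_of_nat)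
  define I where "I n = (\<integral>\<xi>. ft f \<xi> * (cnj (ft f \<xi>) * complex_of_real (gauss (c n *\<^sub>R \<xi>))) \<partial>lborel)" for n
  have "(\<lambda>n. \<integral>w. complex_of_real (gauss_ft w) * autocorr f (c n *\<^sub>R w) \<partial>lborel)
    \<longlonglongrightarrow> (\<integral>w. complex_of_real (gauss_ft w) * autocorr f 0 \<partial>(lborel :: (real, 'n) vec measure))"
  proof (rule integral_dominated_convergence[where w="\<lambda>w. gauss_ft w * (L2_nrm f)\<^sup>2"])
    show "AE w in lborel. (\<lambda>n. complex_of_real (gauss_ft w) * autocorr f (c n *\<^sub>R w)) \<longlonglongrightarrow> complex_of_real (gauss_ft w) * autocorr f 0"
    proof (intro AE_I2 tendsto_mult_left autocorr_cont)
      fix w :: "(real, 'n) vec"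
      show "(\<lambda>n. c n *\<^sub>R w) \<longlonglongrightarrow> 0" using tendsto_scaleR[OF c_lim tendsto_const[of w]] by simp
    qed
    show "AE w in lborel. norm (complex_of_real (gauss_ft w) * autocorr f (c n *\<^sub>R w)) \<le> gauss_ft w * (L2_nrm f)\<^sup>2" for n
      using autocorr_norm_le by (auto simp: norm_mult abs_of_nonneg gauss_ft_nonneg intro!: AE_I2 mult_left_mono)
    show "integrable lborel (\<lambda>w::(real,'n) vec. gauss_ft w * (L2_nrm f)\<^sup>2)" using gauss_ft_integrable by auto
  qed measurable
  moreover have "(\<integral>w. complex_of_real (gauss_ft w) * autocorr f 0 \<partial>(lborel :: (real, 'n) vec measure)) = of_real ((L2_nrm f)\<^sup>2)"
    by (simp add: autocorr_0 integral_gauss_ft)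
  ultimately have I_lim: "I \<longlonglongrightarrow> of_real ((L2_nrm f)\<^sup>2)"
    unfolding I_def by (simp add: damped_plancherel[OF c_pos])
  let ?h = "\<lambda>n \<xi>. (cmod (ft f \<xi>))\<^sup>2 * gauss (c n *\<^sub>R \<xi>)"
  have h_eq: "ft f \<xi> * (cnj (ft f \<xi>) * complex_of_real (gauss (c n *\<^sub>R \<xi>))) = of_real (?h n \<xi>)" for n \<xi>
    unfolding mult.assoc[symmetric] complex_norm_square[symmetric] by simp
  have h_int: "integrable lborel (?h n)" for n
  proof -
    have "integrable lborel (\<lambda>\<xi>. ft f \<xi> * (cnj (ft f \<xi>) * complex_of_real (gauss (c n *\<^sub>R \<xi>))))"
      using c_pos[of n] by (intro ft_integrable_mult integrable_of_real gauss_scaled_integrable) auto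
    then show ?thesis unfolding h_eq by (simp only: complex_of_real_integrable_eq)
  qed
  have nn: "(\<integral>\<^sup>+\<xi>. ennreal (?h n \<xi>) \<partial>lborel) = ennreal (Re (I n))" for n
  proof -
    have "(\<integral>\<^sup>+\<xi>. ennreal (?h n \<xi>) \<partial>lborel) = ennreal (\<integral>\<xi>. ?h n \<xi> \<partial>lborel)"
      by (rule nn_integral_eq_integral[OF h_int]) (auto intro!: AE_I2 mult_nonneg_nonneg less_imp_le[OF gauss_pos])
    also have "(\<integral>\<xi>. ?h n \<xi> \<partial>lborel) = Re (I n)"
      unfolding I_def h_eq integral_complex_of_real by simp
    finally show ?thesis .
  qed
  have "(\<lambda>n. \<integral>\<^sup>+\<xi>. ennreal (?h n \<xi>) \<partial>lborel) \<longlonglongrightarrow> ennreal (Re (of_real ((L2_nrm f)\<^sup>2)))"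
    unfolding nn by (intro tendsto_ennrealI tendsto_intros I_lim)
  \<comment> \<open>As \<open>c n\<close> decreases to 0 the damping factors increase to 1. Monotone
    convergence therefore applies before \<open>ft f\<close> is known to be square integrable, and
    the resulting limit proves that it is.\<close>
  moreover have "(\<lambda>n. \<integral>\<^sup>+\<xi>. ennreal (?h n \<xi>) \<partial>lborel) \<longlonglongrightarrow> (\<integral>\<^sup>+\<xi>. ennreal ((cmod (ft f \<xi>))\<^sup>2) \<partial>lborel)"
  proof (rule nn_integral_LIMSEQ)
    show "incseq (\<lambda>n \<xi>. ennreal (?h n \<xi>))"
    proof (intro incseq_SucI le_funI ennreal_leI mult_left_mono)
      fix n and \<xi> :: "(real, 'n) vec"
      have "c (Suc n) \<le> c n" unfolding c_def by (rule le_imp_inverse_le) auto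
      then have "norm (c (Suc n) *\<^sub>R \<xi>) \<le> norm (c n *\<^sub>R \<xi>)" using c_pos[of n] c_pos[of "Suc n"] by (simp add: mult_right_mono)
      then show "gauss (c n *\<^sub>R \<xi>) \<le> gauss (c (Suc n) *\<^sub>R \<xi>)"
        unfolding gauss_def by (simp add: power_mono del: norm_scaleR)
    qed simp
    show "(\<lambda>n. ennreal (?h n \<xi>)) \<longlonglongrightarrow> ennreal ((cmod (ft f \<xi>))\<^sup>2)" for \<xi>
    proof -
      have "(\<lambda>n. ?h n \<xi>) \<longlonglongrightarrow> (cmod (ft f \<xi>))\<^sup>2 * exp (- (norm (0 *\<^sub>R \<xi>))\<^sup>2 / 2)"
        unfolding gauss_def by (intro tendsto_intros c_lim) simp
      then show ?thesis by (intro tendsto_ennrealI) simp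
    qed
  qed measurable
  ultimately have "(\<integral>\<^sup>+\<xi>. ennreal ((cmod (ft f \<xi>))\<^sup>2) \<partial>lborel) = ennreal (Re (of_real ((L2_nrm f)\<^sup>2)))"
    using LIMSEQ_unique by blast
  then have eq: "l2sq (ft f) = ennreal ((L2_nrm f)\<^sup>2)" by (simp add: l2sq_lborel ennreal_power)
  show L2: "ft f \<in> L2_fun" by (rule L2_fun_borelI) (auto simp: eq)
  have "ennreal ((L2_nrm (ft f))\<^sup>2) = ennreal ((L2_nrm f)\<^sup>2)" using L2_nrm_sq[OF L2] eq by simp
  then show "L2_nrm (ft f) = L2_nrm f" by simp
qed

end

section \<open>Extension to L2 as the closure of a graph, and inversion\<close>

lemma L1_L2_borel_rep:
  assumes F: "F \<in> L2_fun" "integrable lebesgue F"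
  obtains g where "g \<in> borel_measurable borel" "AE x in lebesgue. F x = g x" "g \<in> L2_fun" "integrable lborel g"
    "fourier_int F = ft g"
proof -
  obtain g where g: "g \<in> borel_measurable borel" "AE x in lebesgue. F x = g x"
    using L2_borel_rep L2_funD[OF F(1)] by blast
  have gl: "g \<in> borel_measurable lebesgue" using g(1) by (simp add: measurable_completion)
  have "l2sq F = l2sq g" unfolding l2sq_def
    by (rule nn_integral_cong_AE) (use g(2) in \<open>auto elim!: eventually_mono\<close>)
  then have gL2: "g \<in> L2_fun" using F(1) g(1) by (intro L2_fun_borelI) (auto dest: L2_fun_l2sq)
  have "integrable lebesgue g" using F L2_funD[OF F(1)] gl g(2) integrable_cong_AE[of F lebesgue g] by blast
  then have gi: "integrable lborel g" using g(1) by (simp add: integrable_completion)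
  have "fourier_int F = ft g"
    using fourier_int_cong_AE[OF L2_funD[OF F(1)] gl g(2)] fourier_int_eq_ft[OF g(1)] by simp
  with g gL2 gi show ?thesis by (intro that)
qed

lemma L2_fun_cong_AE_borel:
  assumes "f \<in> L2_fun" "g \<in> borel_measurable borel" "AE x in lebesgue. f x = g x"
  shows "g \<in> L2_fun"
proof -
  have "l2sq f = l2sq g" unfolding l2sq_def
    by (rule nn_integral_cong_AE) (use assms(3) in \<open>auto elim!: eventually_mono\<close>)
  then show ?thesis using assms by (intro L2_fun_borelI) (auto dest: L2_fun_l2sq)
qed

lemma plancherel_fourier_int:
  assumes F: "F \<in> L2_fun" "integrable lebesgue F"
  shows "fourier_int F \<in> L2_fun" "L2_nrm (fourier_int F) = L2_nrm F"
proof -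
  obtain g where g: "g \<in> borel_measurable borel" "AE x in lebesgue. F x = g x" "g \<in> L2_fun" "integrable lborel g"
    "fourier_int F = ft g" using L1_L2_borel_rep[OF F] by blast
  show "fourier_int F \<in> L2_fun" using plancherel_ft(1)[OF g(1,4,3)] g(5) by simp
  show "L2_nrm (fourier_int F) = L2_nrm F"
    using plancherel_ft(2)[OF g(1,4,3)] g(5) L2_nrm_cong_AE[OF F(1) g(3,2)] by simp
qed

lemma integrable_cis_mult_lebesgue:
  assumes "integrable lebesgue (f :: (real, 'n::finite) vec \<Rightarrow> complex)"
  shows "integrable lebesgue (\<lambda>x. cis (- 2 * pi * (x \<bullet> \<xi>)) * f x)"
proof (rule Bochner_Integration.integrable_bound[OF assms])
  have "(\<lambda>x. cis (- 2 * pi * (x \<bullet> \<xi>))) \<in> borel_measurable lebesgue"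
    by (intro measurable_completion) simp
  then show "(\<lambda>x. cis (- 2 * pi * (x \<bullet> \<xi>)) * f x) \<in> borel_measurable lebesgue"
    using assms by (intro borel_measurable_times) auto
qed (auto simp: norm_mult)

lemma fourier_int_diff:
  assumes "integrable lebesgue f" "integrable lebesgue g"
  shows "fourier_int (\<lambda>x. f x - g x) \<xi> = fourier_int f \<xi> - fourier_int g \<xi>"
  unfolding fourier_int_def right_diff_distrib
  by (intro Bochner_Integration.integral_diff integrable_cis_mult_lebesgue assms)

lemma is_fourierE:
  assumes "is_fourier f g"
  obtains F where "\<And>k. F k \<in> L2_fun" "\<And>k. integrable lebesgue (F k)" "\<And>k. fourier_int (F k) \<in> L2_fun"
    "(\<lambda>k. L2_nrm (\<lambda>x. F k x - f x)) \<longlonglongrightarrow> 0" "(\<lambda>k. L2_nrm (\<lambda>\<xi>. fourier_int (F k) \<xi> - g \<xi>)) \<longlonglongrightarrow> 0"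
    "f \<in> L2_fun" "g \<in> L2_fun"
  using assms unfolding is_fourier_def by blast

lemma is_fourierI:
  assumes "\<And>k. F k \<in> L2_fun" "\<And>k. integrable lebesgue (F k)"
    "(\<lambda>k. L2_nrm (\<lambda>x. F k x - f x)) \<longlonglongrightarrow> 0" "(\<lambda>k. L2_nrm (\<lambda>\<xi>. fourier_int (F k) \<xi> - g \<xi>)) \<longlonglongrightarrow> 0"
    "f \<in> L2_fun" "g \<in> L2_fun"
  shows "is_fourier f g"
  unfolding is_fourier_def using assms plancherel_fourier_int(1)[OF assms(1,2)] by blast

lemma is_fourier_L2: "is_fourier f g \<Longrightarrow> f \<in> L2_fun" "is_fourier f g \<Longrightarrow> g \<in> L2_fun"
  by (auto simp: is_fourier_def)

lemma is_fourier_fourier_int: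
  assumes "F \<in> L2_fun" "integrable lebesgue F"
  shows "is_fourier F (fourier_int F)"
proof (rule is_fourierI[where F="\<lambda>_. F"])
  have "L2_nrm (\<lambda>x. 0 :: complex) = 0" for x :: "(real, 'a) vec" by (simp add: L2_nrm_def)
  then show "(\<lambda>k. L2_nrm (\<lambda>x. F x - F x)) \<longlonglongrightarrow> 0" "(\<lambda>k. L2_nrm (\<lambda>\<xi>. fourier_int F \<xi> - fourier_int F \<xi>)) \<longlonglongrightarrow> 0"
    by (simp_all add: L2_nrm_def)
qed (use assms plancherel_fourier_int in auto)

lemma L2_nrm_cong_AE_diff:
  assumes "F \<in> L2_fun" "f \<in> L2_fun" "f' \<in> L2_fun" "AE x in lebesgue. f x = f' x"
  shows "L2_nrm (\<lambda>x. F x - f x) = L2_nrm (\<lambda>x. F x - f' x)"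
  using assms by (intro L2_nrm_cong_AE L2_fun_diff) (auto elim!: eventually_mono)

lemma is_fourier_cong_AE:
  assumes "is_fourier f g" "f' \<in> L2_fun" "g' \<in> L2_fun" "AE x in lebesgue. f x = f' x" "AE x in lebesgue. g x = g' x"
  shows "is_fourier f' g'"
proof -
  obtain F where F: "\<And>k. F k \<in> L2_fun" "\<And>k. integrable lebesgue (F k)" "\<And>k. fourier_int (F k) \<in> L2_fun"
    "(\<lambda>k. L2_nrm (\<lambda>x. F k x - f x)) \<longlonglongrightarrow> 0" "(\<lambda>k. L2_nrm (\<lambda>\<xi>. fourier_int (F k) \<xi> - g \<xi>)) \<longlonglongrightarrow> 0"
    "f \<in> L2_fun" "g \<in> L2_fun" using is_fourierE[OF assms(1)] by blast
  show ?thesis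
    by (rule is_fourierI[where F=F])
       (use F assms L2_nrm_cong_AE_diff[OF F(1,6) assms(2,4)] L2_nrm_cong_AE_diff[OF F(3,7) assms(3,5)] in auto)
qed

lemma tendsto_L2_diff:
  assumes "\<And>k. F k \<in> L2_fun" "\<And>k. G k \<in> L2_fun" "f \<in> L2_fun" "g \<in> L2_fun"
    "(\<lambda>k. L2_nrm (\<lambda>x. F k x - f x)) \<longlonglongrightarrow> 0" "(\<lambda>k. L2_nrm (\<lambda>x. G k x - g x)) \<longlonglongrightarrow> 0"
  shows "(\<lambda>k. L2_nrm (\<lambda>x. (F k x - G k x) - (f x - g x))) \<longlonglongrightarrow> 0"
proof (rule Lim_null_comparison)
  show "\<forall>\<^sub>F k in sequentially. norm (L2_nrm (\<lambda>x. (F k x - G k x) - (f x - g x)))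
     \<le> L2_nrm (\<lambda>x. F k x - f x) + L2_nrm (\<lambda>x. G k x - g x)"
  proof (intro always_eventually allI)
    fix k
    have "L2_nrm (\<lambda>x. (F k x - G k x) - (f x - g x)) = L2_nrm (\<lambda>x. (F k x - f x) - (G k x - g x))"
      by (simp add: algebra_simps)
    also have "\<dots> \<le> L2_nrm (\<lambda>x. F k x - f x) + L2_nrm (\<lambda>x. G k x - g x)"
      by (intro L2_nrm_triangle L2_fun_diff assms)
    finally show "norm (L2_nrm (\<lambda>x. (F k x - G k x) - (f x - g x)))
     \<le> L2_nrm (\<lambda>x. F k x - f x) + L2_nrm (\<lambda>x. G k x - g x)" by simp
  qed
  show "(\<lambda>k. L2_nrm (\<lambda>x. F k x - f x) + L2_nrm (\<lambda>x. G k x - g x)) \<longlonglongrightarrow> 0"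
    using tendsto_add[OF assms(5,6)] by simp
qed

lemma is_fourier_diff:
  assumes "is_fourier f g" "is_fourier f' g'"
  shows "is_fourier (\<lambda>x. f x - f' x) (\<lambda>x. g x - g' x)"
proof -
  obtain F where F: "\<And>k. F k \<in> L2_fun" "\<And>k. integrable lebesgue (F k)" "\<And>k. fourier_int (F k) \<in> L2_fun"
    "(\<lambda>k. L2_nrm (\<lambda>x. F k x - f x)) \<longlonglongrightarrow> 0" "(\<lambda>k. L2_nrm (\<lambda>\<xi>. fourier_int (F k) \<xi> - g \<xi>)) \<longlonglongrightarrow> 0"
    "f \<in> L2_fun" "g \<in> L2_fun" using is_fourierE[OF assms(1)] by blast
  obtain G where G: "\<And>k. G k \<in> L2_fun" "\<And>k. integrable lebesgue (G k)" "\<And>k. fourier_int (G k) \<in> L2_fun"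
    "(\<lambda>k. L2_nrm (\<lambda>x. G k x - f' x)) \<longlonglongrightarrow> 0" "(\<lambda>k. L2_nrm (\<lambda>\<xi>. fourier_int (G k) \<xi> - g' \<xi>)) \<longlonglongrightarrow> 0"
    "f' \<in> L2_fun" "g' \<in> L2_fun" using is_fourierE[OF assms(2)] by blast
  show ?thesis
  proof (rule is_fourierI[where F="\<lambda>k x. F k x - G k x"])
    show "(\<lambda>k. L2_nrm (\<lambda>x. F k x - G k x - (f x - f' x))) \<longlonglongrightarrow> 0"
      by (intro tendsto_L2_diff F G)
    show "(\<lambda>k. L2_nrm (\<lambda>\<xi>. fourier_int (\<lambda>x. F k x - G k x) \<xi> - (g \<xi> - g' \<xi>))) \<longlonglongrightarrow> 0"
      unfolding fourier_int_diff[OF F(2) G(2)] by (intro tendsto_L2_diff F G)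
  qed (intro L2_fun_diff F G Bochner_Integration.integrable_diff)+
qed

lemma is_fourier_isometry:
  assumes "is_fourier f g"
  shows "L2_nrm g = L2_nrm f"
proof -
  obtain F where F: "\<And>k. F k \<in> L2_fun" "\<And>k. integrable lebesgue (F k)" "\<And>k. fourier_int (F k) \<in> L2_fun"
    "(\<lambda>k. L2_nrm (\<lambda>x. F k x - f x)) \<longlonglongrightarrow> 0" "(\<lambda>k. L2_nrm (\<lambda>\<xi>. fourier_int (F k) \<xi> - g \<xi>)) \<longlonglongrightarrow> 0"
    "f \<in> L2_fun" "g \<in> L2_fun" using is_fourierE[OF assms(1)] by blast
  have "(\<lambda>k. L2_nrm (F k)) \<longlonglongrightarrow> L2_nrm f" by (rule L2_tendsto_nrm[OF F(1,6,4)])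
  moreover have "(\<lambda>k. L2_nrm (fourier_int (F k))) \<longlonglongrightarrow> L2_nrm g" by (rule L2_tendsto_nrm[OF F(3,7,5)])
  ultimately show ?thesis
    using LIMSEQ_unique by (simp add: plancherel_fourier_int(2)[OF F(1,2)]) blast
qed

text \<open>The isometry applied to differences. Read in the two directions it says that transform
  and inverse transform are determined up to null sets, whichever representative the choice operator
  selects.\<close>

lemma is_fourier_AE_eq_iff:
  assumes "is_fourier f g" "is_fourier f' g'"
  shows "(AE x in lebesgue. f x = f' x) \<longleftrightarrow> (AE \<xi> in lebesgue. g \<xi> = g' \<xi>)"
proof -
  have d: "is_fourier (\<lambda>x. f x - f' x) (\<lambda>x. g x - g' x)" by (rule is_fourier_diff[OF assms])
  show ?thesis
    using L2_nrm_0_iff[OF is_fourier_L2(1)[OF d]] L2_nrm_0_iff[OF is_fourier_L2(2)[OF d]] is_fourier_isometry[OF d] by simp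
qed

text \<open>Truncations approximate \<open>f\<close> by integrable functions; Plancherel's identity
  makes their transforms a Cauchy sequence, and completeness supplies the limit.\<close>

lemma is_fourier_exists:
  assumes f: "f \<in> L2_fun"
  obtains g where "is_fourier f g"
proof -
  obtain h where h: "h \<in> borel_measurable borel" "AE x in lebesgue. f x = h x"
    using L2_borel_rep L2_funD[OF f] by blast
  have hL2: "h \<in> L2_fun" by (rule L2_fun_cong_AE_borel[OF f h])
  define F where "F k = truncate (real k) h" for k
  have F: "F k \<in> L2_fun" for k unfolding F_def by (intro L2_fun_truncate h hL2)
  have Fi: "integrable lebesgue (F k)" for k
    unfolding F_def using integrable_truncate[OF h(1)] truncate_measurable[OF h(1)] by (subst integrable_completion) auto
  have "(\<lambda>k. L2_nrm (\<lambda>x. F k x - h x)) \<longlonglongrightarrow> 0" unfolding F_def by (rule truncate_tendsto_L2[OF h(1) hL2])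
  then have Ff: "(\<lambda>k. L2_nrm (\<lambda>x. F k x - f x)) \<longlonglongrightarrow> 0" using L2_nrm_cong_AE_diff[OF F f hL2 h(2)] by simp
  have eq: "L2_nrm (\<lambda>\<xi>. fourier_int (F m) \<xi> - fourier_int (F n) \<xi>) = L2_nrm (\<lambda>x. F m x - F n x)" for m n
    using plancherel_fourier_int(2)[OF L2_fun_diff[OF F F] Bochner_Integration.integrable_diff[OF Fi Fi], of m n]
      by (simp add: fourier_int_diff[OF Fi Fi, abs_def])
  obtain g where g: "g \<in> L2_fun" "(\<lambda>k. L2_nrm (\<lambda>\<xi>. fourier_int (F k) \<xi> - g \<xi>)) \<longlonglongrightarrow> 0"
  proof (rule L2_complete[of "\<lambda>k. fourier_int (F k)"])
    show "fourier_int (F k) \<in> L2_fun" for k by (rule plancherel_fourier_int(1)[OF F Fi])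
    fix e :: real assume "e > 0"
    then obtain N where N: "\<And>n. n \<ge> N \<Longrightarrow> L2_nrm (\<lambda>x. F n x - f x) < e / 2"
      using order_tendstoD(2)[OF Ff, of "e/2"] by (auto simp: eventually_sequentially)
    show "\<exists>N. \<forall>m\<ge>N. \<forall>n\<ge>N. L2_nrm (\<lambda>x. fourier_int (F m) x - fourier_int (F n) x) < e"
    proof (intro exI[of _ N] allI impI)
      fix m n assume "m \<ge> N" "n \<ge> N"
      then show "L2_nrm (\<lambda>x. fourier_int (F m) x - fourier_int (F n) x) < e"
        unfolding eq using L2_nrm_triangle3[OF F F f, of m n] N[of m] N[of n] by simp
    qed
  qed
  show ?thesis by (rule that, rule is_fourierI[OF F Fi Ff g(2) f g(1)])
qed

lemma fourier_int_mult_formula: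
  assumes "F \<in> L2_fun" "integrable lebesgue F" "G \<in> L2_fun" "integrable lebesgue G"
  shows "(\<integral>\<xi>. fourier_int F \<xi> * G \<xi> \<partial>lebesgue) = (\<integral>x. F x * fourier_int G x \<partial>lebesgue)"
proof -
  obtain f where f: "f \<in> borel_measurable borel" "AE x in lebesgue. F x = f x" "f \<in> L2_fun" "integrable lborel f"
    "fourier_int F = ft f" using L1_L2_borel_rep[OF assms(1,2)] by blast
  obtain g where g: "g \<in> borel_measurable borel" "AE x in lebesgue. G x = g x" "g \<in> L2_fun" "integrable lborel g"
    "fourier_int G = ft g" using L1_L2_borel_rep[OF assms(3,4)] by blast
  note [measurable] = f(1) g(1)
  have "(\<integral>\<xi>. fourier_int F \<xi> * G \<xi> \<partial>lebesgue) = (\<integral>\<xi>. ft f \<xi> * g \<xi> \<partial>lebesgue)"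
    unfolding f(5) using g(2,3) L2_funD[OF assms(3)] ft_measurable[OF f(1)]
    by (intro integral_cong_AE borel_measurable_times) (auto elim!: eventually_mono dest: L2_funD intro: measurable_completion)
  also have "\<dots> = (\<integral>\<xi>. ft f \<xi> * g \<xi> \<partial>lborel)" by (rule integral_completion) measurable
  also have "\<dots> = (\<integral>\<xi>. f \<xi> * ft g \<xi> \<partial>lborel)" by (rule ft_mult_formula[OF f(4) g(4)])
  also have "\<dots> = (\<integral>\<xi>. f \<xi> * ft g \<xi> \<partial>lebesgue)" by (rule integral_completion[symmetric]) measurable
  also have "\<dots> = (\<integral>x. F x * fourier_int G x \<partial>lebesgue)"
    unfolding g(5) using f(2,3) L2_funD[OF assms(1)] ft_measurable[OF g(1)]
    by (intro integral_cong_AE borel_measurable_times) (auto elim!: eventually_mono dest: L2_funD intro: measurable_completion)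
  finally show ?thesis .
qed

lemma is_fourier_mult_formula:
  assumes "is_fourier f g" "is_fourier f' g'"
  shows "(\<integral>x. g x * f' x \<partial>lebesgue) = (\<integral>x. f x * g' x \<partial>lebesgue)"
proof -
  obtain F where F: "\<And>k. F k \<in> L2_fun" "\<And>k. integrable lebesgue (F k)" "\<And>k. fourier_int (F k) \<in> L2_fun"
    "(\<lambda>k. L2_nrm (\<lambda>x. F k x - f x)) \<longlonglongrightarrow> 0" "(\<lambda>k. L2_nrm (\<lambda>\<xi>. fourier_int (F k) \<xi> - g \<xi>)) \<longlonglongrightarrow> 0"
    "f \<in> L2_fun" "g \<in> L2_fun" using is_fourierE[OF assms(1)] by blast
  obtain G where G: "\<And>k. G k \<in> L2_fun" "\<And>k. integrable lebesgue (G k)" "\<And>k. fourier_int (G k) \<in> L2_fun"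
    "(\<lambda>k. L2_nrm (\<lambda>x. G k x - f' x)) \<longlonglongrightarrow> 0" "(\<lambda>k. L2_nrm (\<lambda>\<xi>. fourier_int (G k) \<xi> - g' \<xi>)) \<longlonglongrightarrow> 0"
    "f' \<in> L2_fun" "g' \<in> L2_fun" using is_fourierE[OF assms(2)] by blast
  have 1: "(\<lambda>k. \<integral>x. fourier_int (F k) x * G k x \<partial>lebesgue) \<longlonglongrightarrow> (\<integral>x. g x * f' x \<partial>lebesgue)"
    by (rule L2_tendsto_integral_mult[OF F(3,7,5) G(1,6,4)])
  have 2: "(\<lambda>k. \<integral>x. F k x * fourier_int (G k) x \<partial>lebesgue) \<longlonglongrightarrow> (\<integral>x. f x * g' x \<partial>lebesgue)"
    by (rule L2_tendsto_integral_mult[OF F(1,6,4) G(3,7,5)])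
  show ?thesis
    using 1 unfolding fourier_int_mult_formula[OF F(1,2) G(1,2)] by (rule LIMSEQ_unique) (rule 2)
qed

text \<open>Fourier inversion: conjugation exchanges the transform with its inverse. If
  \<open>h\<close> is the transform of \<open>cnj g\<close>, the multiplication formula shows that
  the inner product of \<open>h\<close> with \<open>cnj f\<close> is the squared norm of
  \<open>g\<close>; as all norms agree, the distance between \<open>h\<close> and
  \<open>cnj f\<close> is 0.\<close>

lemma is_fourier_cnj:
  assumes fg: "is_fourier f g"
  shows "is_fourier (\<lambda>x. cnj (g x)) (\<lambda>x. cnj (f x))"
proof -
  have f: "f \<in> L2_fun" and g: "g \<in> L2_fun" using is_fourier_L2[OF fg] by auto
  note cg = L2_fun_cnj[OF g] and cf = L2_fun_cnj[OF f]
  obtain h where h: "is_fourier (\<lambda>x. cnj (g x)) h" using is_fourier_exists[OF cg] by blast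
  have hL2: "h \<in> L2_fun" using is_fourier_L2[OF h] by auto
  have "(\<integral>x. h x * cnj (cnj (f x)) \<partial>lebesgue) = (\<integral>x. cnj (g x) * g x \<partial>lebesgue)"
    using is_fourier_mult_formula[OF h fg] by simp
  also have "\<dots> = of_real ((L2_nrm g)\<^sup>2)" using integral_mult_cnj_L2[OF g] by (simp add: mult.commute)
  finally have "(L2_nrm (\<lambda>x. h x - cnj (f x)))\<^sup>2 = (L2_nrm h)\<^sup>2 - 2 * (L2_nrm g)\<^sup>2 + (L2_nrm (\<lambda>x. cnj (f x)))\<^sup>2"
    by (simp add: L2_nrm_diff_sq[OF hL2 cf])
  moreover have "L2_nrm h = L2_nrm g" using is_fourier_isometry[OF h] L2_nrm_cong_norm[of "\<lambda>x. cnj (g x)" g] by simp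
  moreover have "L2_nrm (\<lambda>x. cnj (f x)) = L2_nrm g" using is_fourier_isometry[OF fg] L2_nrm_cong_norm[of "\<lambda>x. cnj (f x)" f] by simp
  ultimately have "L2_nrm (\<lambda>x. h x - cnj (f x)) = 0" by simp
  then have "AE x in lebesgue. h x = cnj (f x)" by (simp add: L2_nrm_0_iff[OF L2_fun_diff[OF hL2 cf]])
  then show ?thesis by (intro is_fourier_cong_AE[OF h cg cf]) auto
qed

lemma is_fourier_exists_inv:
  assumes g: "g \<in> L2_fun"
  obtains f where "is_fourier f g"
proof -
  obtain h where "is_fourier (\<lambda>x. cnj (g x)) h" using is_fourier_exists[OF L2_fun_cnj[OF g]] by blast
  from is_fourier_cnj[OF this] show ?thesis by (intro that) simp
qed

lemma is_fourier_fourier: "f \<in> L2_fun \<Longrightarrow> is_fourier f (fourier f)"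
  unfolding fourier_def using is_fourier_exists by (metis someI)

lemma is_fourier_fourier_inv: "g \<in> L2_fun \<Longrightarrow> is_fourier (fourier_inv g) g"
  unfolding fourier_inv_def using is_fourier_exists_inv by (metis someI)

definition ift :: "('a::euclidean_space \<Rightarrow> complex) \<Rightarrow> 'a \<Rightarrow> complex" where
  "ift g x = (\<integral>\<xi>. cis (2 * pi * (x \<bullet> \<xi>)) * g \<xi> \<partial>lborel)"

lemma ift_cnj: "ift g x = cnj (ft (\<lambda>\<xi>. cnj (g \<xi>)) x)"
proof -
  have "cnj (ft (\<lambda>\<xi>. cnj (g \<xi>)) x) = (\<integral>\<xi>. cnj (cis (- 2 * pi * (\<xi> \<bullet> x)) * cnj (g \<xi>)) \<partial>lborel)"
    unfolding ft_def by (rule Bochner_Integration.integral_cnj[symmetric])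
  then show ?thesis unfolding ift_def by (simp add: cis_cnj inner_commute)
qed

lemma is_fourier_ift:
  assumes [measurable]: "g \<in> borel_measurable borel" and "g \<in> L2_fun" "integrable lborel g"
  shows "is_fourier (ift g) g"
proof -
  have m: "(\<lambda>\<xi>. cnj (g \<xi>)) \<in> borel_measurable borel" by measurable
  have "integrable lborel (\<lambda>\<xi>. cnj (g \<xi>))" using assms by simp
  then have "integrable lebesgue (\<lambda>\<xi>. cnj (g \<xi>))" using m by (simp add: integrable_completion)
  from is_fourier_fourier_int[OF L2_fun_cnj[OF assms(2)] this]
  have "is_fourier (\<lambda>\<xi>. cnj (g \<xi>)) (ft (\<lambda>\<xi>. cnj (g \<xi>)))" unfolding fourier_int_eq_ft[OF m] .
  from is_fourier_cnj[OF this] show ?thesis by (simp add: ift_cnj[abs_def])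
qed

section \<open>Powers and convolutions\<close>

lemma nn_integral_reflect_euclidean:
  fixes f :: "'a::euclidean_space \<Rightarrow> ennreal"
  assumes [measurable]: "f \<in> borel_measurable borel"
  shows "(\<integral>\<^sup>+y. f (x - y) \<partial>lborel) = (\<integral>\<^sup>+y. f y \<partial>lborel)"
proof -
  have "(\<integral>\<^sup>+y. f y \<partial>lborel) = (\<integral>\<^sup>+y. f y \<partial>density (distr lborel borel (\<lambda>y. x + (-1) *\<^sub>R y)) (\<lambda>_. ennreal (\<bar>-1\<bar> ^ DIM('a))))"
    using lborel_affine[of "-1" x] by simp
  also have "\<dots> = (\<integral>\<^sup>+y. f (x - y) \<partial>lborel)"
    by (subst nn_integral_density) (auto simp: nn_integral_distr)
  finally show ?thesis by simp
qed

lemma AE_reflect: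
  assumes "AE z in lborel. P (z :: 'a::euclidean_space)"
  shows "AE y in lborel. P (x - y)"
proof -
  obtain N where N: "N \<in> null_sets lborel" "{z. \<not> P z} \<subseteq> N"
    using assms by (auto simp: eventually_ae_filter)
  then have [measurable]: "N \<in> sets borel" by auto
  have "emeasure lborel {y. x - y \<in> N} = (\<integral>\<^sup>+y. indicator {y. x - y \<in> N} y \<partial>lborel)" by simp
  also have "\<dots> = (\<integral>\<^sup>+y. indicator N (x - y) \<partial>lborel)" by (intro nn_integral_cong) (auto simp: indicator_def)
  also have "\<dots> = 0" using N by (subst nn_integral_reflect_euclidean) auto
  finally have "{y. x - y \<in> N} \<in> null_sets lborel" by (simp add: null_sets_def)
  then show ?thesis by (rule AE_I') (use N in auto)
qed

definition enorm :: "('a \<Rightarrow> complex) \<Rightarrow> 'a \<Rightarrow> ennreal" where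
  "enorm g x = ennreal (cmod (g x))"

lemma enorm_measurable[measurable]: "g \<in> borel_measurable M \<Longrightarrow> enorm g \<in> borel_measurable M"
  unfolding enorm_def by measurable

definition cconv :: "('a::euclidean_space \<Rightarrow> complex) \<Rightarrow> ('a \<Rightarrow> complex) \<Rightarrow> 'a \<Rightarrow> complex" where
  "cconv f g x = (\<integral>y. f y * g (x - y) \<partial>lborel)"

lemma cconv_measurable[measurable]:
  assumes [measurable]: "f \<in> borel_measurable borel" "g \<in> borel_measurable borel"
  shows "cconv f g \<in> borel_measurable borel"
  unfolding cconv_def by measurable

text \<open>Valid at every point: where the integrand is not integrable the Bochner integral takes
  the value 0.\<close>

lemma enorm_cconv_le:
  assumes [measurable]: "f \<in> borel_measurable borel" "g \<in> borel_measurable borel"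
  shows "enorm (cconv f g) x \<le> conv (enorm f) (enorm g) x"
proof (cases "integrable lborel (\<lambda>y. f y * g (x - y))")
  case True
  show ?thesis unfolding enorm_def cconv_def conv_def
    using integral_norm_bound_ennreal[OF True] by (simp add: norm_mult ennreal_mult)
next
  case False
  then show ?thesis by (simp add: enorm_def cconv_def not_integrable_integral_eq)
qed

lemma conv_mono:
  "(\<And>x. f x \<le> f' x) \<Longrightarrow> (\<And>x. g x \<le> g' x) \<Longrightarrow> conv f g x \<le> conv f' g' x"
  unfolding conv_def by (intro nn_integral_mono mult_mono) auto

lemma nn_integral_conv:
  fixes f g :: "'a::euclidean_space \<Rightarrow> ennreal"
  assumes [measurable]: "f \<in> borel_measurable borel" "g \<in> borel_measurable borel"
  shows "(\<integral>\<^sup>+x. conv f g x \<partial>lborel) = (\<integral>\<^sup>+x. f x \<partial>lborel) * (\<integral>\<^sup>+x. g x \<partial>lborel)"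
proof -
  have "(\<integral>\<^sup>+x. conv f g x \<partial>lborel) = (\<integral>\<^sup>+y. \<integral>\<^sup>+x. f y * g (x - y) \<partial>lborel \<partial>lborel)"
    unfolding conv_def by (rule lborel_pair.Fubini') measurable
  also have "\<dots> = (\<integral>\<^sup>+y. f y * (\<integral>\<^sup>+x. g x \<partial>lborel) \<partial>lborel)"
    using nn_integral_translate[of g "- y" for y] by (simp add: nn_integral_cmult)
  also have "\<dots> = (\<integral>\<^sup>+x. f x \<partial>lborel) * (\<integral>\<^sup>+x. g x \<partial>lborel)" by (rule nn_integral_multc) measurable
  finally show ?thesis .
qed

lemma integrable_cconv:
  assumes f: "integrable lborel f" and g: "integrable lborel g"
  shows "integrable lborel (cconv f g)"
proof (rule integrableI_bounded)
  have [measurable]: "f \<in> borel_measurable borel" "g \<in> borel_measurable borel" using f g by auto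
  show "cconv f g \<in> borel_measurable lborel" by measurable
  have "(\<integral>\<^sup>+x. ennreal (norm (cconv f g x)) \<partial>lborel) \<le> (\<integral>\<^sup>+x. conv (enorm f) (enorm g) x \<partial>lborel)"
    using enorm_cconv_le[of f g] unfolding enorm_def[of "cconv f g"] by (intro nn_integral_mono) auto
  also have "\<dots> = (\<integral>\<^sup>+x. enorm f x \<partial>lborel) * (\<integral>\<^sup>+x. enorm g x \<partial>lborel)" by (rule nn_integral_conv) measurable
  also have "\<dots> < \<infinity>" using f g by (auto simp: integrable_iff_bounded enorm_def ennreal_mult_less_top)
  finally show "(\<integral>\<^sup>+x. ennreal (norm (cconv f g x)) \<partial>lborel) < \<infinity>" .
qed

lemma ift_cconv:
  assumes f: "integrable lborel f" and g: "integrable lborel g"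
  shows "ift (cconv f g) x = ift f x * ift g x"
proof -
  have [measurable]: "f \<in> borel_measurable borel" "g \<in> borel_measurable borel" using f g by auto
  let ?h = "\<lambda>\<xi> y. cis (2 * pi * (x \<bullet> \<xi>)) * (f y * g (\<xi> - y))"
  have tr: "integrable lborel (\<lambda>\<xi>. g (\<xi> - y))" "(\<integral>\<xi>. cmod (g (\<xi> - y)) \<partial>lborel) = (\<integral>\<xi>. cmod (g \<xi>) \<partial>lborel)" for y
    using integrable_affine[of g 1 "- y"] g integral_affine[of "\<lambda>\<xi>. cmod (g \<xi>)" 1 "- y"] by auto
  have int: "integrable (lborel \<Otimes>\<^sub>M lborel) (\<lambda>(y, \<xi>). ?h \<xi> y)"
  proof (rule lborel_pair.Fubini_integrable)
    show "AE y in lborel. integrable lborel (\<lambda>\<xi>. case (y, \<xi>) of (y, \<xi>) \<Rightarrow> ?h \<xi> y)"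
      using tr by (auto intro!: integrable_cis_mult integrable_mult_right)
    show "integrable lborel (\<lambda>y. \<integral>\<xi>. norm (case (y, \<xi>) of (y, \<xi>) \<Rightarrow> ?h \<xi> y) \<partial>lborel)"
      using f by (simp add: norm_mult tr)
  qed measurable
  have "ift (cconv f g) x = (\<integral>\<xi>. \<integral>y. ?h \<xi> y \<partial>lborel \<partial>lborel)"
    unfolding ift_def cconv_def by simp
  also have "\<dots> = (\<integral>y. \<integral>\<xi>. ?h \<xi> y \<partial>lborel \<partial>lborel)"
    using lborel_pair.Fubini_integral[of "\<lambda>y \<xi>. ?h \<xi> y"] int by simp
  also have "\<dots> = (\<integral>y. cis (2 * pi * (x \<bullet> y)) * f y * ift g x \<partial>lborel)"
  proof (intro Bochner_Integration.integral_cong refl)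
    fix y
    have "(\<integral>\<xi>. ?h \<xi> y \<partial>lborel) = (\<integral>\<xi>. ?h (y + 1 *\<^sub>R \<xi>) y \<partial>lborel)"
      using integral_affine[of "\<lambda>\<xi>. ?h \<xi> y" 1 y] by simp
    also have "\<dots> = (\<integral>\<xi>. (cis (2 * pi * (x \<bullet> y)) * f y) * (cis (2 * pi * (x \<bullet> \<xi>)) * g \<xi>) \<partial>lborel)"
      by (intro Bochner_Integration.integral_cong refl) (simp add: inner_add_right distrib_left flip: cis_mult)
    finally show "(\<integral>\<xi>. ?h \<xi> y \<partial>lborel) = cis (2 * pi * (x \<bullet> y)) * f y * ift g x" by (simp add: ift_def)
  qed
  also have "\<dots> = ift f x * ift g x" by (simp add: ift_def)
  finally show ?thesis .
qed

primrec cconv_pow :: "('a::euclidean_space \<Rightarrow> complex) \<Rightarrow> nat \<Rightarrow> 'a \<Rightarrow> complex" where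
  "cconv_pow g 0 = g"
| "cconv_pow g (Suc k) = cconv g (cconv_pow g k)"

lemma cconv_pow_measurable[measurable]:
  assumes [measurable]: "g \<in> borel_measurable borel"
  shows "cconv_pow g k \<in> borel_measurable borel"
  by (induction k) auto

lemma enorm_cconv_pow_le:
  assumes [measurable]: "g \<in> borel_measurable borel"
  shows "enorm (cconv_pow g k) x \<le> conv_pow (enorm g) k x"
proof (induction k arbitrary: x)
  case (Suc k)
  have "enorm (cconv_pow g (Suc k)) x \<le> conv (enorm g) (enorm (cconv_pow g k)) x"
    by (simp add: enorm_cconv_le)
  also have "\<dots> \<le> conv (enorm g) (conv_pow (enorm g) k) x" by (intro conv_mono Suc) simp
  finally show ?case by simp
qed simp

lemma conv_pow_mono: "(\<And>x. f x \<le> g x) \<Longrightarrow> conv_pow f k x \<le> conv_pow g k x"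
  by (induction k arbitrary: x) (auto intro: conv_mono)

lemma integrable_cconv_pow: "integrable lborel g \<Longrightarrow> integrable lborel (cconv_pow g k)"
  by (induction k) (auto intro: integrable_cconv)

lemma ift_cconv_pow: "integrable lborel g \<Longrightarrow> ift (cconv_pow g k) x = ift g x ^ Suc k"
  by (induction k) (auto simp: ift_cconv integrable_cconv_pow)

text \<open>Cutting the transform off makes both it and its inverse transform integrable; the general case
  follows by dominated convergence on the Fourier side.\<close>

theorem is_fourier_power:
  fixes u g :: "(real, 'n::finite) vec \<Rightarrow> complex"
  assumes ug: "is_fourier u g" and g[measurable]: "g \<in> borel_measurable borel"
    and fin: "\<And>k. (\<integral>\<^sup>+x. (conv_pow (enorm g) k x)\<^sup>2 \<partial>lborel) < \<infinity>"
  shows "is_fourier (\<lambda>x. u x ^ Suc k) (cconv_pow g k)"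
proof -
  have gL2: "g \<in> L2_fun" and uL2: "u \<in> L2_fun" using is_fourier_L2[OF ug] by auto
  define G where "G n = truncate (real n) g" for n
  have [measurable]: "G n \<in> borel_measurable borel" for n unfolding G_def by (rule truncate_measurable) measurable
  have G_L1: "integrable lborel (G n)" for n unfolding G_def by (rule integrable_truncate) measurable
  have G_le: "enorm (G n) x \<le> enorm g x" for n x by (simp add: G_def truncate_def enorm_def)
  have pow_le: "enorm (cconv_pow (G n) k) x \<le> conv_pow (enorm g) k x" for n k x
    using enorm_cconv_pow_le[of "G n" k x] conv_pow_mono[of "enorm (G n)" "enorm g" k x, OF G_le] by auto
  have dom_L2: "h \<in> L2_fun" if [measurable]: "h \<in> borel_measurable borel" and "\<And>x. enorm h x \<le> conv_pow (enorm g) k x" for h k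
  proof (rule L2_fun_borelI)
    have "l2sq h \<le> (\<integral>\<^sup>+x. (conv_pow (enorm g) k x)\<^sup>2 \<partial>lborel)"
      unfolding l2sq_lborel enorm_def[symmetric] by (intro nn_integral_mono power_mono that) auto
    then show "l2sq h < \<infinity>" using fin[of k] by (rule le_less_trans)
  qed measurable
  have GP: "cconv_pow (G n) k \<in> L2_fun" for n k by (rule dom_L2[OF _ pow_le]) measurable
  have gP: "cconv_pow g k \<in> L2_fun" for k by (rule dom_L2[OF _ enorm_cconv_pow_le]) measurable
  have AEfin: "AE x in lborel. conv_pow (enorm g) k x < \<infinity>" for k
  proof -
    have "AE x in lborel. (conv_pow (enorm g) k x)\<^sup>2 \<noteq> \<infinity>" using fin[of k] by (intro nn_integral_PInf_AE) auto
    then show ?thesis by eventually_elim (auto simp: power2_eq_square ennreal_mult_eq_top_iff less_top[symmetric])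
  qed
  \<comment> \<open>At a point where the convolution power of the moduli is finite, its own
    integrand dominates the integrands of the truncated convolutions. Almost everywhere convergence
    of one power thus passes to the next.\<close>
  have conv_AE: "AE x in lborel. (\<lambda>n. cconv_pow (G n) k x) \<longlonglongrightarrow> cconv_pow g k x" for k
  proof (induction k)
    case 0
    show ?case
    proof (intro AE_I2)
      fix x
      obtain N :: nat where N: "max (cmod (g x)) (norm x) \<le> real N" using real_arch_simple by blast
      have "\<forall>\<^sub>F n in sequentially. G n x = g x"
        using eventually_ge_at_top[of N] by eventually_elim (use N in \<open>auto simp: truncate_def G_def\<close>)
      then show "(\<lambda>n. cconv_pow (G n) 0 x) \<longlonglongrightarrow> cconv_pow g 0 x" by (simp add: tendsto_eventually)
    qed
  next
    case (Suc k)
    show ?case using AEfin[of "Suc k"]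
    proof eventually_elim
      fix x assume finx: "conv_pow (enorm g) (Suc k) x < \<infinity>"
      let ?w = "\<lambda>y. enn2real (enorm g y * conv_pow (enorm g) k (x - y))"
      have AEw: "AE y in lborel. enorm g y * conv_pow (enorm g) k (x - y) \<noteq> \<infinity>"
        using finx by (intro nn_integral_PInf_AE) (auto simp: conv_def)
      show "(\<lambda>n. cconv_pow (G n) (Suc k) x) \<longlonglongrightarrow> cconv_pow g (Suc k) x"
        unfolding cconv_pow.simps cconv_def
      proof (rule integral_dominated_convergence[where w="?w"])
        show "integrable lborel ?w"
        proof (rule integrableI_bounded)
          have "(\<integral>\<^sup>+y. ennreal (norm (?w y)) \<partial>lborel) = (\<integral>\<^sup>+y. enorm g y * conv_pow (enorm g) k (x - y) \<partial>lborel)"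
            using AEw by (intro nn_integral_cong_AE) (auto elim!: eventually_mono simp: less_top)
          then show "(\<integral>\<^sup>+y. ennreal (norm (?w y)) \<partial>lborel) < \<infinity>" using finx by (simp add: conv_def)
        qed measurable
        show "AE y in lborel. (\<lambda>n. G n y * cconv_pow (G n) k (x - y)) \<longlonglongrightarrow> g y * cconv_pow g k (x - y)"
          using AE_reflect[OF Suc.IH, of x]
        proof eventually_elim
          fix y assume c: "(\<lambda>n. cconv_pow (G n) k (x - y)) \<longlonglongrightarrow> cconv_pow g k (x - y)"
          obtain N :: nat where N: "max (cmod (g y)) (norm y) \<le> real N" using real_arch_simple by blast
          have "\<forall>\<^sub>F n in sequentially. G n y = g y"
            using eventually_ge_at_top[of N] by eventually_elim (use N in \<open>auto simp: truncate_def G_def\<close>)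
          then have "(\<lambda>n. G n y) \<longlonglongrightarrow> g y" by (simp add: tendsto_eventually)
          then show "(\<lambda>n. G n y * cconv_pow (G n) k (x - y)) \<longlonglongrightarrow> g y * cconv_pow g k (x - y)" using c by (rule tendsto_mult)
        qed
        show "AE y in lborel. norm (G n y * cconv_pow (G n) k (x - y)) \<le> ?w y" for n
          using AEw
        proof eventually_elim
          fix y assume nf: "enorm g y * conv_pow (enorm g) k (x - y) \<noteq> \<infinity>"
          have "ennreal (norm (G n y * cconv_pow (G n) k (x - y))) = enorm (G n) y * enorm (cconv_pow (G n) k) (x - y)"
            by (simp add: enorm_def norm_mult ennreal_mult)
          also have "\<dots> \<le> enorm g y * conv_pow (enorm g) k (x - y)" by (intro mult_mono G_le pow_le) auto
          also have "\<dots> = ennreal (?w y)" using nf by (simp add: less_top)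
          finally show "norm (G n y * cconv_pow (G n) k (x - y)) \<le> ?w y" by (simp add: enn2real_nonneg)
        qed
      qed measurable
    qed
  qed
  have conv_L2: "(\<lambda>n. L2_nrm (\<lambda>x. cconv_pow (G n) k x - cconv_pow g k x)) \<longlonglongrightarrow> 0" for k
  proof -
    have dL2: "(\<lambda>x. cconv_pow (G n) k x - cconv_pow g k x) \<in> L2_fun" for n by (intro L2_fun_diff GP gP)
    have "(\<lambda>n. \<integral>\<^sup>+x. (enorm (\<lambda>x. cconv_pow (G n) k x - cconv_pow g k x) x)\<^sup>2 \<partial>lborel) \<longlonglongrightarrow> (\<integral>\<^sup>+x. 0 \<partial>(lborel::(real,'n) vec measure))"
    \<comment> \<open>Both the truncated and the full power are bounded by
      \<open>conv_pow (enorm g) k\<close>; the square of their difference is at most four times its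
      square.\<close>
    proof (rule nn_integral_dominated_convergence[where w="\<lambda>x. 4 * (conv_pow (enorm g) k x)\<^sup>2"])
      show "(\<integral>\<^sup>+x. 4 * (conv_pow (enorm g) k x)\<^sup>2 \<partial>lborel) < \<infinity>"
        using fin[of k] by (subst nn_integral_cmult) (auto simp: ennreal_mult_less_top)
      show "AE x in lborel. (enorm (\<lambda>x. cconv_pow (G n) k x - cconv_pow g k x) x)\<^sup>2 \<le> 4 * (conv_pow (enorm g) k x)\<^sup>2" for n
      proof (intro AE_I2)
        fix x
        have "enorm (\<lambda>x. cconv_pow (G n) k x - cconv_pow g k x) x \<le> enorm (cconv_pow (G n) k) x + enorm (cconv_pow g k) x"
          unfolding enorm_def by (simp flip: ennreal_plus add: ennreal_leI norm_triangle_ineq4)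
        also have "\<dots> \<le> 2 * conv_pow (enorm g) k x"
          unfolding mult_2 by (intro add_mono pow_le enorm_cconv_pow_le) measurable
        finally have "(enorm (\<lambda>x. cconv_pow (G n) k x - cconv_pow g k x) x)\<^sup>2 \<le> (2 * conv_pow (enorm g) k x)\<^sup>2"
          by (rule power_mono) simp
        then show "(enorm (\<lambda>x. cconv_pow (G n) k x - cconv_pow g k x) x)\<^sup>2 \<le> 4 * (conv_pow (enorm g) k x)\<^sup>2"
          by (simp add: power_mult_distrib)
      qed
      show "AE x in lborel. (\<lambda>n. (enorm (\<lambda>x. cconv_pow (G n) k x - cconv_pow g k x) x)\<^sup>2) \<longlonglongrightarrow> 0"
        using conv_AE[of k]
      proof eventually_elim
        fix x assume "(\<lambda>n. cconv_pow (G n) k x) \<longlonglongrightarrow> cconv_pow g k x"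
        then have "(\<lambda>n. (cmod (cconv_pow (G n) k x - cconv_pow g k x))\<^sup>2) \<longlonglongrightarrow> (cmod (cconv_pow g k x - cconv_pow g k x))\<^sup>2"
          by (intro tendsto_intros)
        then have "(\<lambda>n. ennreal ((cmod (cconv_pow (G n) k x - cconv_pow g k x))\<^sup>2)) \<longlonglongrightarrow> ennreal 0"
          by (intro tendsto_ennrealI) simp
        then show "(\<lambda>n. (enorm (\<lambda>x. cconv_pow (G n) k x - cconv_pow g k x) x)\<^sup>2) \<longlonglongrightarrow> 0"
          by (simp add: enorm_def ennreal_power)
      qed
    qed measurable
    then have "(\<lambda>n. l2sq (\<lambda>x. cconv_pow (G n) k x - cconv_pow g k x)) \<longlonglongrightarrow> 0" by (simp add: l2sq_lborel enorm_def)
    then have "(\<lambda>n. sqrt (enn2real (l2sq (\<lambda>x. cconv_pow (G n) k x - cconv_pow g k x)))) \<longlonglongrightarrow> sqrt (enn2real 0)"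
      by (intro tendsto_intros) auto
    then show ?thesis using L2_nrm_enn2real[OF L2_funD[OF dL2]] by simp
  qed
  define U where "U n = ift (G n)" for n
  have isU: "is_fourier (\<lambda>x. U n x ^ Suc k) (cconv_pow (G n) k)" for n k
    using is_fourier_ift[OF _ GP integrable_cconv_pow[OF G_L1], of n k]
    by (simp add: U_def ift_cconv_pow[OF G_L1, abs_def] del: power_Suc)
  have toL2: "(\<lambda>n. L2_nrm (\<lambda>x. U n x ^ Suc k - w x)) \<longlonglongrightarrow> 0" if "is_fourier w (cconv_pow g k)" for w k
    using conv_L2[of k] is_fourier_isometry[OF is_fourier_diff[OF isU that]] by simp
  have u0: "is_fourier u (cconv_pow g 0)" using ug by simp
  obtain w where w: "is_fourier w (cconv_pow g k)" using is_fourier_exists_inv[OF gP] by blast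
  have U_L2: "(\<lambda>x. U n x ^ Suc k) \<in> L2_fun" for n k using is_fourier_L2[OF isU] by auto
  \<comment> \<open>Taking powers is not continuous in L2, so the inverse transform \<open>w\<close>
    of the convolution power is identified pointwise: one subsequence makes \<open>U\<close>
    converge to \<open>u\<close> almost everywhere, a further one makes its powers converge to
    \<open>w\<close>.\<close>
  obtain r :: "nat \<Rightarrow> nat" where r: "strict_mono r" "AE x in lebesgue. (\<lambda>n. U (r n) x ^ Suc 0) \<longlonglongrightarrow> u x"
    using L2_tendsto_AE_subseq[OF U_L2 uL2 toL2[OF u0]] by blast
  have "(\<lambda>n. L2_nrm (\<lambda>x. U (r n) x ^ Suc k - w x)) \<longlonglongrightarrow> 0"
    using LIMSEQ_subseq_LIMSEQ[OF toL2[OF w] r(1)] by (simp add: comp_def)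
  then obtain s :: "nat \<Rightarrow> nat" where s: "strict_mono s" "AE x in lebesgue. (\<lambda>n. U (r (s n)) x ^ Suc k) \<longlonglongrightarrow> w x"
    using L2_tendsto_AE_subseq[of "\<lambda>n x. U (r n) x ^ Suc k" w] U_L2 is_fourier_L2[OF w] by blast
  have eq: "AE x in lebesgue. w x = u x ^ Suc k"
    using r(2) s(2)
  proof eventually_elim
    fix x assume 1: "(\<lambda>n. U (r n) x ^ Suc 0) \<longlonglongrightarrow> u x" and 2: "(\<lambda>n. U (r (s n)) x ^ Suc k) \<longlonglongrightarrow> w x"
    have "(\<lambda>n. U (r (s n)) x) \<longlonglongrightarrow> u x" using LIMSEQ_subseq_LIMSEQ[OF 1 s(1)] by (simp add: comp_def)
    then have "(\<lambda>n. U (r (s n)) x ^ Suc k) \<longlonglongrightarrow> u x ^ Suc k" by (rule tendsto_power)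
    then show "w x = u x ^ Suc k" using 2 LIMSEQ_unique by blast
  qed
  have "(\<lambda>x. u x ^ Suc k) \<in> borel_measurable lebesgue" using L2_funD[OF uL2] by measurable
  moreover have "l2sq w = l2sq (\<lambda>x. u x ^ Suc k)"
    unfolding l2sq_def by (rule nn_integral_cong_AE) (use eq in \<open>auto elim!: eventually_mono\<close>)
  ultimately have "(\<lambda>x. u x ^ Suc k) \<in> L2_fun" using L2_fun_l2sq[OF is_fourier_L2(1)[OF w]] by (simp add: L2_fun_iff)
  then show ?thesis by (intro is_fourier_cong_AE[OF w _ gP eq]) auto
qed

section \<open>Trudinger bounds\<close>

text \<open>The weight of the Sobolev norm on the Fourier side: 1 for the L2 part, plus the square
  of the multiplier of order d / 2. Its reciprocal just fails to be integrable, which is the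
  critical case and forces the losses in the estimates below.\<close>

definition wt :: "'a::euclidean_space \<Rightarrow> real" where
  "wt x = 1 + (2 * pi * norm x) ^ DIM('a)"

lemma wt_ge_1: "wt x \<ge> 1" and wt_pos: "wt x > 0"
proof -
  have "(2 * pi * norm x) ^ DIM('a) \<ge> 0" by simp
  then show "wt x \<ge> 1" "wt x > 0" unfolding wt_def by linarith+
qed

lemma wt_measurable[measurable]: "wt \<in> borel_measurable borel"
  unfolding wt_def by measurable

lemma wt_strict_mono: "norm x < norm y \<Longrightarrow> wt x < wt y" for x y :: "'a::euclidean_space"
  unfolding wt_def by (simp add: power_strict_mono mult_strict_left_mono)

definition iwt :: "real \<Rightarrow> 'a::euclidean_space \<Rightarrow> real" where
  "iwt s x = wt x powr (- s)"

lemma iwt_measurable[measurable]: "iwt s \<in> borel_measurable borel"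
  unfolding iwt_def by measurable

lemma iwt_pos: "iwt s x > 0"
  unfolding iwt_def using wt_pos[of x] by simp

lemma iwt_0[simp]: "iwt 0 x = 1"
  unfolding iwt_def using wt_pos[of x] by simp

lemma iwt_1: "iwt 1 x = 1 / wt x"
  unfolding iwt_def using wt_pos[of x] by (simp add: powr_minus_divide)

text \<open>Layer cake formula: as \<open>wt x\<close> exceeds |x|^d, the superlevel set at height t
  < 1 lies in a ball of volume V t^(-1/(1 + \<delta>)), with V the volume of the unit ball. The
  exponent stays above -1, and integration over (0, 1) gives V (1 + \<delta>) / \<delta>, at most 2
  V / \<delta>.\<close>

lemma nn_integral_iwt:
  assumes \<delta>: "0 < \<delta>" "\<delta> \<le> 1"
  shows "(\<integral>\<^sup>+x. ennreal (iwt (1 + \<delta>) (x::'a::euclidean_space)) \<partial>lborel) \<le> ennreal (2 * unit_ball_vol (DIM('a)) / \<delta>)"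
proof -
  let ?V = "unit_ball_vol (DIM('a))" and ?a = "1 / (1 + \<delta>)"
  have "(\<integral>\<^sup>+x. ennreal (iwt (1 + \<delta>) (x::'a)) \<partial>lborel) = (\<integral>\<^sup>+x. \<integral>\<^sup>+t. layer (iwt (1 + \<delta>) (x::'a)) t \<partial>lborel \<partial>lborel)"
    by simp
  also have "\<dots> = (\<integral>\<^sup>+t. \<integral>\<^sup>+x. layer (iwt (1 + \<delta>) (x::'a)) t \<partial>lborel \<partial>lborel)"
    by (rule lborel_pair.Fubini') measurable
  also have "\<dots> \<le> (\<integral>\<^sup>+t. ennreal ?V * (ennreal (t powr (- ?a)) * indicator {0..1} t) \<partial>lborel)"
  proof (rule nn_integral_mono)
    fix t :: real
    show "(\<integral>\<^sup>+x. layer (iwt (1 + \<delta>) (x::'a)) t \<partial>lborel) \<le> ennreal ?V * (ennreal (t powr (- ?a)) * indicator {0..1} t)"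
    proof (cases "0 < t \<and> t < 1")
      case False
      have le: "iwt (1 + \<delta>) x \<le> 1" for x :: 'a
        unfolding iwt_def using wt_ge_1[of x] \<delta> powr_mono[of "- (1 + \<delta>)" 0 "wt x"] by simp
      have "layer (iwt (1 + \<delta>) (x::'a)) t = 0" for x
        using False le[of x] by (auto simp: layer_def ennreal_less_iff)
      then show ?thesis by simp
    next
      case True
      define R where "R = t powr (- ?a / real DIM('a))"
      have "(\<integral>\<^sup>+x. layer (iwt (1 + \<delta>) (x::'a)) t \<partial>lborel) \<le> (\<integral>\<^sup>+x. indicator (ball (0::'a) R) x \<partial>lborel)"
      proof (rule nn_integral_mono)
        fix x :: 'a
        show "layer (iwt (1 + \<delta>) x) t \<le> indicator (ball 0 R) x"
        proof (cases "t < iwt (1 + \<delta>) x")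
          case less: True
          have e: "- (1 + \<delta>) * - ?a = 1" using \<delta> by (simp add: field_simps)
          have "wt x = (wt x powr (- (1 + \<delta>))) powr (- ?a)"
            unfolding powr_powr e using wt_pos[of x] by simp
          also have "\<dots> < t powr (- ?a)"
            using less True \<delta> unfolding iwt_def by (intro powr_less_mono2_neg) auto
          finally have "wt x < R ^ DIM('a)"
            unfolding R_def using True by (simp add: powr_powr flip: powr_realpow)
          moreover have "norm x ^ DIM('a) \<le> (2 * pi * norm x) ^ DIM('a)"
          proof (rule power_mono)
            have "1 * norm x \<le> (2 * pi) * norm x" using pi_gt3 by (intro mult_right_mono) auto
            then show "norm x \<le> 2 * pi * norm x" by simp
          qed simp
          ultimately have "norm x ^ DIM('a) < R ^ DIM('a)" unfolding wt_def by linarith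
          then have "norm x < R" by (rule power_less_imp_less_base) (simp add: R_def)
          then show ?thesis by (simp add: layer_def)
        next
          case False
          then show ?thesis using True by (simp add: layer_def ennreal_less_iff)
        qed
      qed
      also have "\<dots> = emeasure lborel (ball (0::'a) R)" by simp
      also have "\<dots> = ennreal (?V * R ^ DIM('a))" by (rule emeasure_ball) (simp add: R_def)
      also have "R ^ DIM('a) = t powr (- ?a)" unfolding R_def using True by (simp add: powr_powr flip: powr_realpow)
      also have "ennreal (?V * t powr (- ?a)) = ennreal ?V * ennreal (t powr (- ?a))" by (simp add: ennreal_mult)
      finally show ?thesis using True by simp
    qed
  qed
  also have "\<dots> = ennreal ?V * (\<integral>\<^sup>+t. ennreal (t powr (- ?a)) * indicator {0..1} t \<partial>lborel)"
    by (rule nn_integral_cmult) measurable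
  also have "(\<integral>\<^sup>+t. ennreal (t powr (- ?a)) * indicator {0..1} t \<partial>lborel) = ennreal (1 powr (- ?a + 1) / (- ?a + 1))"
    using \<delta> by (intro nn_integral_has_integral_lebesgue' has_integral_powr_from_0) (auto simp: field_simps)
  also have "1 powr (- ?a + 1) / (- ?a + 1) = (1 + \<delta>) / \<delta>" using \<delta> by (simp add: field_simps)
  also have "ennreal ?V * ennreal ((1 + \<delta>) / \<delta>) = ennreal (?V * ((1 + \<delta>) / \<delta>))" using \<delta> by (intro ennreal_mult[symmetric]) auto
  also have "\<dots> \<le> ennreal (2 * ?V / \<delta>)"
  proof (rule ennreal_leI)
    have "?V * (1 + \<delta>) \<le> ?V * 2" using \<delta> by (intro mult_left_mono) auto
    then show "?V * ((1 + \<delta>) / \<delta>) \<le> 2 * ?V / \<delta>" using \<delta> by (simp add: field_simps)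
  qed
  finally show ?thesis .
qed

lemma wt_quasi_triangle: "wt (x + y :: 'a::euclidean_space) \<le> 2 ^ DIM('a) * max (wt x) (wt y)"
proof -
  let ?d = "DIM('a)" and ?M = "max (norm x) (norm y)"
  have "norm (x + y) \<le> 2 * ?M" using norm_triangle_ineq[of x y] by linarith
  then have "2 * pi * norm (x + y) \<le> 2 * pi * (2 * ?M)" by (rule mult_left_mono) simp
  then have "(2 * pi * norm (x + y)) ^ ?d \<le> (2 * (2 * pi * ?M)) ^ ?d" by (intro power_mono) (auto simp: mult_ac)
  then have "wt (x + y) \<le> 1 + 2 ^ ?d * (2 * pi * ?M) ^ ?d"
    unfolding wt_def power_mult_distrib[of 2 "2 * pi * ?M", symmetric] by linarith
  also have "\<dots> \<le> 2 ^ ?d * (1 + (2 * pi * ?M) ^ ?d)" by (simp add: distrib_left)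
  also have "1 + (2 * pi * ?M) ^ ?d = max (wt x) (wt y)"
    using wt_strict_mono[of x y] wt_strict_mono[of y x] by (auto simp: max_def wt_def)
  finally show ?thesis .
qed

lemma powr_mixed_le:
  fixes a b s t :: real
  assumes "a > 0" "b > 0" "s \<ge> 0" "t \<ge> 0"
  shows "a powr s * b powr t \<le> a powr (s + t) + b powr (s + t)"
proof (cases "a \<le> b")
  case True
  then have "a powr s * b powr t \<le> b powr s * b powr t" using assms by (intro mult_right_mono powr_mono2) auto
  then show ?thesis by (simp add: powr_add add_increasing)
next
  case False
  then have "a powr s * b powr t \<le> a powr s * a powr t" using assms by (intro mult_left_mono powr_mono2) auto
  then show ?thesis by (simp add: powr_add add_increasing2)
qed

text \<open>Each convolution with \<open>1 / wt\<close> costs an arbitrarily small loss \<open>\<delta>\<close> in the decay exponent and a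
  factor proportional to \<open>1 / \<delta>\<close>.\<close>

lemma conv_iwt_le:
  fixes \<eta> :: "'a::euclidean_space"
  assumes \<delta>: "0 < \<delta>" "\<delta> \<le> s" "s \<le> 1"
  shows "conv (\<lambda>x. ennreal (iwt 1 x)) (\<lambda>x. ennreal (iwt s x)) \<eta>
    \<le> ennreal (8 * 2 ^ DIM('a) * unit_ball_vol (DIM('a)) / \<delta>) * ennreal (iwt (s - \<delta>) \<eta>)"
proof -
  \<comment> \<open>The 8 in the statement is 2 * 2 * 2: one factor for the two mixed terms in the
    pointwise bound, one for the two equal integrals over \<open>y\<close> and
    \<open>\<eta> - y\<close>, and one from the integral of
    \<open>iwt (1 + \<delta>)\<close>.\<close>
  let ?c = "2 * 2 ^ DIM('a) * iwt (s - \<delta>) \<eta>" and ?X = "2 * unit_ball_vol (DIM('a)) / \<delta>"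
  \<comment> \<open>By the quasi-triangle inequality the power s - \<delta> of the weight at
    \<open>\<eta>\<close> is bounded by the powers at \<open>y\<close> and at
    \<open>\<eta> - y\<close>. Either way it uses up part of the decay of the product, and the
    exponents that remain add up to 1 + \<delta>, just enough for integrability.\<close>
  have pw: "iwt 1 y * iwt s (\<eta> - y) \<le> ?c * (iwt (1 + \<delta>) y + iwt (1 + \<delta>) (\<eta> - y))" for y
  proof -
    let ?p = "s - \<delta>"
    define a where "a = iwt 1 y"
    define b where "b = iwt 1 (\<eta> - y)"
    have ab: "a > 0" "b > 0" by (auto simp: a_def b_def iwt_pos)
    have pa: "iwt r y = a powr r" for r unfolding a_def iwt_def by (simp only: powr_powr) simp
    have pb: "iwt r (\<eta> - y) = b powr r" for r unfolding b_def iwt_def by (simp only: powr_powr) simp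
    have "wt \<eta> powr ?p \<le> (2 ^ DIM('a) * max (wt y) (wt (\<eta> - y))) powr ?p"
      using wt_quasi_triangle[of y "\<eta> - y"] wt_pos[of \<eta>] \<delta> by (intro powr_mono2) auto
    also have "\<dots> = (2 ^ DIM('a)) powr ?p * max (wt y) (wt (\<eta> - y)) powr ?p"
      using wt_pos by (intro powr_mult)
    also have "\<dots> \<le> (2 ^ DIM('a)) powr 1 * max (wt y) (wt (\<eta> - y)) powr ?p"
      using \<delta> by (intro mult_right_mono powr_mono) auto
    also have "max (wt y) (wt (\<eta> - y)) powr ?p \<le> wt y powr ?p + wt (\<eta> - y) powr ?p"
      by (simp add: max_def)
    also have "wt y powr ?p + wt (\<eta> - y) powr ?p = a powr (- ?p) + b powr (- ?p)"
      unfolding a_def b_def iwt_def by (simp only: powr_powr) simp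
    finally have w: "wt \<eta> powr ?p \<le> 2 ^ DIM('a) * (a powr (- ?p) + b powr (- ?p))" by simp
    have "wt \<eta> powr ?p * (a powr 1 * b powr s) \<le> (2 ^ DIM('a) * (a powr (- ?p) + b powr (- ?p))) * (a powr 1 * b powr s)"
      using w by (intro mult_right_mono) auto
    also have "\<dots> = 2 ^ DIM('a) * (a powr (1 - ?p) * b powr s + a powr 1 * b powr \<delta>)"
    proof -
      have gen: "(K * (A + B)) * (C * D) = K * ((A * C) * D + C * (B * D))" for A B C D K :: real
        by (simp add: algebra_simps)
      have e: "- ?p + 1 = 1 - ?p" "- ?p + s = \<delta>" by simp_all
      show ?thesis unfolding gen powr_add[symmetric] e ..
    qed
    also have "\<dots> \<le> 2 ^ DIM('a) * ((a powr (1 + \<delta>) + b powr (1 + \<delta>)) + (a powr (1 + \<delta>) + b powr (1 + \<delta>)))"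
      using powr_mixed_le[OF ab, of "1 - ?p" s] powr_mixed_le[OF ab, of 1 \<delta>] \<delta>
      by (intro mult_left_mono add_mono) (auto simp: algebra_simps)
    finally have "wt \<eta> powr ?p * (a powr 1 * b powr s) \<le> 2 * 2 ^ DIM('a) * (a powr (1 + \<delta>) + b powr (1 + \<delta>))" by (simp add: algebra_simps)
    then have "iwt ?p \<eta> * (wt \<eta> powr ?p * (a powr 1 * b powr s)) \<le> iwt ?p \<eta> * (2 * 2 ^ DIM('a) * (a powr (1 + \<delta>) + b powr (1 + \<delta>)))"
      by (rule mult_left_mono) (simp add: less_imp_le iwt_pos)
    also have "\<dots> = ?c * (a powr (1 + \<delta>) + b powr (1 + \<delta>))" by (simp only: mult_ac)
    finally have "(iwt ?p \<eta> * wt \<eta> powr ?p) * (a powr 1 * b powr s) \<le> ?c * (a powr (1 + \<delta>) + b powr (1 + \<delta>))"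
      by (simp only: mult.assoc)
    moreover have "iwt ?p \<eta> * wt \<eta> powr ?p = 1"
      unfolding iwt_def using wt_pos[of \<eta>] by (simp flip: powr_add)
    ultimately show ?thesis unfolding pa pb by simp
  qed
  have c0: "?c \<ge> 0" using iwt_pos[of "s - \<delta>" \<eta>] by simp
  have "conv (\<lambda>x. ennreal (iwt 1 x)) (\<lambda>x. ennreal (iwt s x)) \<eta> \<le> (\<integral>\<^sup>+y. ennreal ?c * (ennreal (iwt (1 + \<delta>) y) + ennreal (iwt (1 + \<delta>) (\<eta> - y))) \<partial>lborel)"
    unfolding conv_def
  proof (rule nn_integral_mono)
    fix y
    have "ennreal (iwt 1 y) * ennreal (iwt s (\<eta> - y)) = ennreal (iwt 1 y * iwt s (\<eta> - y))"
      using iwt_pos[of 1 y] iwt_pos[of s "\<eta> - y"] by (simp add: ennreal_mult)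
    also have "\<dots> \<le> ennreal (?c * (iwt (1 + \<delta>) y + iwt (1 + \<delta>) (\<eta> - y)))" by (rule ennreal_leI[OF pw])
    also have "\<dots> = ennreal ?c * (ennreal (iwt (1 + \<delta>) y) + ennreal (iwt (1 + \<delta>) (\<eta> - y)))"
      using c0 iwt_pos[of "1 + \<delta>" y] iwt_pos[of "1 + \<delta>" "\<eta> - y"] by (subst ennreal_mult) auto
    finally show "ennreal (iwt 1 y) * ennreal (iwt s (\<eta> - y)) \<le> ennreal ?c * (ennreal (iwt (1 + \<delta>) y) + ennreal (iwt (1 + \<delta>) (\<eta> - y)))" .
  qed
  also have "\<dots> = ennreal ?c * (\<integral>\<^sup>+y. ennreal (iwt (1 + \<delta>) y) + ennreal (iwt (1 + \<delta>) (\<eta> - y)) \<partial>lborel)"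
    by (rule nn_integral_cmult) measurable
  also have "(\<integral>\<^sup>+y. ennreal (iwt (1 + \<delta>) y) + ennreal (iwt (1 + \<delta>) (\<eta> - y)) \<partial>lborel)
    = (\<integral>\<^sup>+y. ennreal (iwt (1 + \<delta>) (y::'a)) \<partial>lborel) + (\<integral>\<^sup>+y. ennreal (iwt (1 + \<delta>) (\<eta> - y)) \<partial>lborel)"
    by (rule nn_integral_add) measurable
  also have "(\<integral>\<^sup>+y. ennreal (iwt (1 + \<delta>) (\<eta> - y)) \<partial>lborel) = (\<integral>\<^sup>+y. ennreal (iwt (1 + \<delta>) (y::'a)) \<partial>lborel)"
    by (rule nn_integral_reflect_euclidean) measurable
  also have "(\<integral>\<^sup>+y. ennreal (iwt (1 + \<delta>) (y::'a)) \<partial>lborel) + (\<integral>\<^sup>+y. ennreal (iwt (1 + \<delta>) (y::'a)) \<partial>lborel)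
    = 2 * (\<integral>\<^sup>+y. ennreal (iwt (1 + \<delta>) (y::'a)) \<partial>lborel)"
    by (simp only: mult_2)
  also have "ennreal ?c * (2 * (\<integral>\<^sup>+y. ennreal (iwt (1 + \<delta>) (y::'a)) \<partial>lborel)) \<le> ennreal ?c * (2 * ennreal ?X)"
    using \<delta> by (intro mult_left_mono nn_integral_iwt) auto
  also have "\<dots> = ennreal (?c * (2 * ?X))"
  proof -
    have "ennreal (?c * (2 * ?X)) = ennreal ?c * ennreal (2 * ?X)" using c0 \<delta> by (intro ennreal_mult) auto
    also have "ennreal (2 * ?X) = ennreal 2 * ennreal ?X" using \<delta> by (intro ennreal_mult) auto
    finally show ?thesis by simp
  qed
  also have "?c * (2 * ?X) = (8 * 2 ^ DIM('a) * unit_ball_vol (DIM('a)) / \<delta>) * iwt (s - \<delta>) \<eta>"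
    by simp
  also have "ennreal \<dots> = ennreal (8 * 2 ^ DIM('a) * unit_ball_vol (DIM('a)) / \<delta>) * ennreal (iwt (s - \<delta>) \<eta>)"
    using \<delta> less_imp_le[OF iwt_pos] by (intro ennreal_mult) auto
  finally show ?thesis .
qed

text \<open>The decay exponent 1 is spent in \<open>k\<close> equal losses of 1 / k, so that after
  \<open>k\<close> convolutions the exponent is 0 and the bound is constant. Each loss costs a
  factor proportional to \<open>k\<close>, whence the growth k^k, which a factorial can still
  absorb.\<close>

lemma conv_pow_iwt_le:
  fixes x :: "'a::euclidean_space"
  assumes k: "k > 0"
  shows "conv_pow (\<lambda>x. ennreal (iwt 1 x)) k x \<le> ennreal ((8 * 2 ^ DIM('a) * unit_ball_vol (DIM('a)) * real k) ^ k)"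
proof -
  let ?C = "8 * 2 ^ DIM('a) * unit_ball_vol (DIM('a)) * real k"
  have "conv_pow (\<lambda>x. ennreal (iwt 1 x)) j x \<le> ennreal (?C ^ j) * ennreal (iwt (1 - real j / real k) x)" if "j \<le> k" for j and x :: 'a
    using that
  proof (induction j arbitrary: x)
    case (Suc j)
    let ?s = "1 - real j / real k"
    have s: "1 / real k \<le> ?s" using Suc.prems k by (simp add: field_simps)
    have "conv_pow (\<lambda>x. ennreal (iwt 1 x)) (Suc j) x \<le> conv (\<lambda>x. ennreal (iwt 1 x)) (\<lambda>x::'a. ennreal (?C ^ j) * ennreal (iwt ?s x)) x"
      using Suc by (auto intro!: conv_mono)
    also have "\<dots> = ennreal (?C ^ j) * conv (\<lambda>x. ennreal (iwt 1 x)) (\<lambda>x. ennreal (iwt ?s x)) x"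
      unfolding conv_def by (subst nn_integral_cmult[symmetric]) (auto simp: mult_ac)
    also have "\<dots> \<le> ennreal (?C ^ j) * (ennreal (8 * 2 ^ DIM('a) * unit_ball_vol (DIM('a)) / (1 / real k)) * ennreal (iwt (?s - 1 / real k) x))"
      using s k by (intro mult_left_mono conv_iwt_le) auto
    also have "\<dots> = ennreal (?C ^ j) * ennreal ?C * ennreal (iwt (?s - 1 / real k) x)" by (simp add: mult.assoc)
    also have "ennreal (?C ^ j) * ennreal ?C = ennreal (?C ^ Suc j)" by (simp add: mult.commute flip: ennreal_mult)
    also have "?s - 1 / real k = 1 - real (Suc j) / real k" by (simp add: add_divide_distrib)
    finally show ?case .
  qed simp
  from this[of k x] k show ?thesis by simp
qed

definition esqrt :: "ennreal \<Rightarrow> ennreal" where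
  "esqrt x = (if x = \<infinity> then \<infinity> else ennreal (sqrt (enn2real x)))"

lemma esqrt_measurable[measurable]: "esqrt \<in> borel_measurable borel"
  unfolding esqrt_def by measurable

lemma esqrt_sq[simp]: "(esqrt x)\<^sup>2 = x"
  by (cases x) (auto simp: esqrt_def ennreal_power)

lemma ennreal_power2_le_imp_le: "x\<^sup>2 \<le> y\<^sup>2 \<Longrightarrow> x \<le> (y::ennreal)"
proof (cases x; cases y)
  fix r s assume "x\<^sup>2 \<le> y\<^sup>2" "0 \<le> r" "x = ennreal r" "0 \<le> s" "y = ennreal s"
  then show "x \<le> y" by (auto simp: ennreal_power intro!: ennreal_leI power2_le_imp_le)
qed (auto simp: power2_eq_square top_unique ennreal_mult_eq_top_iff)

text \<open>Cauchy-Schwarz at each convolution. The square roots are distributed so that each of the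
  two resulting integrals is again a convolution, and the induction closes.\<close>

lemma conv_pow_Cauchy_Schwarz:
  fixes a b c :: "'a::euclidean_space \<Rightarrow> ennreal"
  assumes [measurable]: "a \<in> borel_measurable borel" "b \<in> borel_measurable borel" "c \<in> borel_measurable borel"
    and c: "\<And>x. (c x)\<^sup>2 \<le> a x * b x"
  shows "(conv_pow c k x)\<^sup>2 \<le> conv_pow a k x * conv_pow b k x"
proof (induction k arbitrary: x)
  case 0
  show ?case using c[of x] by simp
next
  case (Suc k)
  have "conv_pow c (Suc k) x \<le> (\<integral>\<^sup>+y. esqrt (a y * conv_pow a k (x - y)) * esqrt (b y * conv_pow b k (x - y)) \<partial>lborel)"
    unfolding conv_pow.simps conv_def
  proof (rule nn_integral_mono, rule ennreal_power2_le_imp_le)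
    fix y
    have "(c y * conv_pow c k (x - y))\<^sup>2 \<le> (a y * b y) * (conv_pow a k (x - y) * conv_pow b k (x - y))"
      unfolding power_mult_distrib by (rule mult_mono[OF c Suc.IH]) simp_all
    also have "\<dots> = (a y * conv_pow a k (x - y)) * (b y * conv_pow b k (x - y))" by (simp only: mult_ac)
    also have "\<dots> = (esqrt (a y * conv_pow a k (x - y)) * esqrt (b y * conv_pow b k (x - y)))\<^sup>2"
      unfolding power_mult_distrib[of "esqrt _"] esqrt_sq ..
    finally show "(c y * conv_pow c k (x - y))\<^sup>2 \<le> (esqrt (a y * conv_pow a k (x - y)) * esqrt (b y * conv_pow b k (x - y)))\<^sup>2" .
  qed
  then have "(conv_pow c (Suc k) x)\<^sup>2 \<le> (\<integral>\<^sup>+y. esqrt (a y * conv_pow a k (x - y)) * esqrt (b y * conv_pow b k (x - y)) \<partial>lborel)\<^sup>2"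
    by (rule power_mono) simp
  also have "\<dots> \<le> (\<integral>\<^sup>+y. (esqrt (a y * conv_pow a k (x - y)))\<^sup>2 \<partial>lborel) * (\<integral>\<^sup>+y. (esqrt (b y * conv_pow b k (x - y)))\<^sup>2 \<partial>lborel)"
    by (rule Cauchy_Schwarz_nn_integral) measurable
  also have "\<dots> = conv_pow a (Suc k) x * conv_pow b (Suc k) x" by (simp add: conv_def)
  finally show ?case .
qed

lemma nn_integral_conv_pow:
  assumes [measurable]: "(f :: 'a::euclidean_space \<Rightarrow> ennreal) \<in> borel_measurable borel"
  shows "(\<integral>\<^sup>+x. conv_pow f k x \<partial>lborel) = (\<integral>\<^sup>+x. f x \<partial>lborel) ^ Suc k"
  by (induction k) (auto simp: nn_integral_conv)

definition trudinger_const :: "'a::euclidean_space itself \<Rightarrow> real" where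
  "trudinger_const _ = 8 * 2 ^ DIM('a) * unit_ball_vol (DIM('a))"

lemma trudinger_const_nonneg: "trudinger_const TYPE('a::euclidean_space) \<ge> 0"
  by (simp add: trudinger_const_def)

text \<open>The square of \<open>f\<close> is factored as (wt f^2) (1 / wt). After Cauchy-Schwarz
  the powers of 1 / wt are bounded uniformly, and the convolution powers of wt f^2 integrate to
  powers of its integral. For k = 0 the constant is 0^0 = 1, and it suffices that the weight is at
  least 1.\<close>

lemma conv_pow_L2_le:
  fixes f :: "'a::euclidean_space \<Rightarrow> ennreal"
  assumes [measurable]: "f \<in> borel_measurable borel"
  shows "(\<integral>\<^sup>+x. (conv_pow f k x)\<^sup>2 \<partial>lborel)
    \<le> (\<integral>\<^sup>+x. ennreal (wt x) * (f x)\<^sup>2 \<partial>lborel) ^ Suc k * ennreal ((trudinger_const TYPE('a) * real k) ^ k)"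
proof (cases "k = 0")
  case True
  have "(f x)\<^sup>2 \<le> ennreal (wt x) * (f x)\<^sup>2" for x
    using mult_right_mono[of 1 "ennreal (wt x)" "(f x)\<^sup>2"] ennreal_leI[OF wt_ge_1[of x]] by simp
  then show ?thesis using True by (simp add: nn_integral_mono)
next
  case False
  let ?a = "\<lambda>x. ennreal (wt x) * (f x)\<^sup>2"
  have "(\<integral>\<^sup>+x. (conv_pow f k x)\<^sup>2 \<partial>lborel) \<le> (\<integral>\<^sup>+x. conv_pow ?a k x * ennreal ((trudinger_const TYPE('a) * real k) ^ k) \<partial>lborel)"
  proof (rule nn_integral_mono)
    fix x
    have "(f x)\<^sup>2 \<le> ?a x * ennreal (iwt 1 x)" for x
    proof -
      have "ennreal (wt x) * ennreal (iwt 1 x) = 1" using wt_pos[of x] by (simp add: iwt_1 flip: ennreal_mult)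
      then have "?a x * ennreal (iwt 1 x) = (f x)\<^sup>2" by (metis mult.commute mult.left_commute mult_1)
      then show ?thesis by simp
    qed
    then have "(conv_pow f k x)\<^sup>2 \<le> conv_pow ?a k x * conv_pow (\<lambda>x. ennreal (iwt 1 x)) k x"
      by (intro conv_pow_Cauchy_Schwarz) auto
    also have "\<dots> \<le> conv_pow ?a k x * ennreal ((trudinger_const TYPE('a) * real k) ^ k)"
      using False unfolding trudinger_const_def by (intro mult_left_mono conv_pow_iwt_le) auto
    finally show "(conv_pow f k x)\<^sup>2 \<le> conv_pow ?a k x * ennreal ((trudinger_const TYPE('a) * real k) ^ k)" .
  qed
  also have "\<dots> = (\<integral>\<^sup>+x. conv_pow ?a k x \<partial>lborel) * ennreal ((trudinger_const TYPE('a) * real k) ^ k)"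
    by (rule nn_integral_multc) measurable
  finally show ?thesis by (subst (asm) nn_integral_conv_pow) auto
qed

section \<open>The Sobolev norm and the exponential series on the Fourier side\<close>

definition hsq :: "('a::euclidean_space \<Rightarrow> complex) \<Rightarrow> ennreal" where
  "hsq g = (\<integral>\<^sup>+x. ennreal (wt x) * (enorm g x)\<^sup>2 \<partial>lborel)"

lemma l2sq_enorm: "l2sq g = (\<integral>\<^sup>+x. (enorm g x)\<^sup>2 \<partial>lborel)"
  by (simp add: l2sq_lborel enorm_def)

lemma l2sq_le_hsq: "l2sq g \<le> hsq g"
  unfolding l2sq_enorm hsq_def
proof (rule nn_integral_mono)
  fix x
  show "(enorm g x)\<^sup>2 \<le> ennreal (wt x) * (enorm g x)\<^sup>2"
    using mult_right_mono[of 1 "ennreal (wt x)" "(enorm g x)\<^sup>2"] ennreal_leI[OF wt_ge_1[of x]] by simp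
qed

lemma l2sq_is_fourier: "is_fourier u g \<Longrightarrow> l2sq u = l2sq g"
  by (metis L2_nrm_sq is_fourier_L2 is_fourier_isometry)

lemma l2sq_cong_AE: "AE x in lebesgue. f x = g x \<Longrightarrow> l2sq f = l2sq g"
  unfolding l2sq_def by (rule nn_integral_cong_AE) (auto elim!: eventually_mono)

lemma frac_symbol_sq:
  fixes \<xi> :: "(real, 'n::finite) vec"
  shows "(norm ((2 * pi) *\<^sub>R \<xi>) powr (real CARD('n) / 2))\<^sup>2 = (2 * pi * norm \<xi>) ^ CARD('n)"
proof (cases "\<xi> = 0")
  case True
  then show ?thesis by (simp add: power_0_left)
next
  case False
  then have "2 * pi * norm \<xi> > 0" by simp
  then have "((2 * pi * norm \<xi>) powr (real CARD('n) / 2))\<^sup>2 = (2 * pi * norm \<xi>) ^ CARD('n)"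
    by (simp add: power2_eq_square powr_realpow flip: powr_add)
  then show ?thesis by simp
qed

text \<open>Plancherel adds the weights 1 and |2 \<pi> \<xi>|^d of the two parts of the norm. The
  identity for the norm presupposes membership, because \<open>fourier_inv\<close> of a function
  outside L2 is an arbitrary choice.\<close>

lemma
  fixes u g :: "(real, 'n::finite) vec \<Rightarrow> complex"
  assumes ug: "is_fourier u g" and g[measurable]: "g \<in> borel_measurable borel"
  shows sobolev_iff_hsq: "u \<in> sobolev (real CARD('n) / 2) \<longleftrightarrow> hsq g < \<infinity>"
    and sobolev_nrm_hsq: "u \<in> sobolev (real CARD('n) / 2) \<Longrightarrow> ennreal ((sobolev_nrm (real CARD('n) / 2) u)\<^sup>2) = hsq g"
proof -
  let ?s = "real CARD('n) / 2"
  have u: "u \<in> L2_fun" using is_fourier_L2[OF ug] by auto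
  have fu: "is_fourier u (fourier u)" by (rule is_fourier_fourier[OF u])
  have ae: "AE \<xi> in lebesgue. fourier u \<xi> = g \<xi>"
    using is_fourier_AE_eq_iff[OF fu ug] by simp
  let ?f = "\<lambda>\<xi>. of_real (norm ((2 * pi) *\<^sub>R \<xi>) powr ?s) * g \<xi>"
  have [measurable]: "?f \<in> borel_measurable borel" by measurable
  have m1: "(\<lambda>\<xi>::(real,'n) vec. complex_of_real (norm ((2 * pi) *\<^sub>R \<xi>) powr ?s)) \<in> borel_measurable lebesgue"
    by (intro measurable_completion) simp
  have m: "frac_symbol ?s u \<in> borel_measurable lebesgue"
    unfolding frac_symbol_def by (intro borel_measurable_times m1 L2_funD is_fourier_L2(2)[OF fu])
  have "l2sq (frac_symbol ?s u) = l2sq ?f"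
    by (rule l2sq_cong_AE) (use ae in \<open>auto simp: frac_symbol_def elim!: eventually_mono\<close>)
  also have "\<dots> = (\<integral>\<^sup>+\<xi>. ennreal ((2 * pi * norm \<xi>) ^ CARD('n)) * (enorm g \<xi>)\<^sup>2 \<partial>lborel)"
    unfolding l2sq_lborel
  proof (rule nn_integral_cong)
    fix \<xi>
    have "(ennreal (cmod (?f \<xi>)))\<^sup>2 = (ennreal (norm ((2 * pi) *\<^sub>R \<xi>) powr ?s) * ennreal (cmod (g \<xi>)))\<^sup>2"
      by (simp only: norm_mult norm_of_real abs_of_nonneg[OF powr_ge_zero] ennreal_mult[OF powr_ge_zero norm_ge_zero])
    also have "\<dots> = (ennreal (norm ((2 * pi) *\<^sub>R \<xi>) powr ?s))\<^sup>2 * (enorm g \<xi>)\<^sup>2"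
      by (simp only: power_mult_distrib enorm_def)
    also have "(ennreal (norm ((2 * pi) *\<^sub>R \<xi>) powr ?s))\<^sup>2 = ennreal ((2 * pi * norm \<xi>) ^ CARD('n))"
      by (simp only: ennreal_power[OF powr_ge_zero] frac_symbol_sq)
    finally show "(ennreal (cmod (?f \<xi>)))\<^sup>2 = ennreal ((2 * pi * norm \<xi>) ^ CARD('n)) * (enorm g \<xi>)\<^sup>2" .
  qed
  finally have s: "l2sq (frac_symbol ?s u) = (\<integral>\<^sup>+\<xi>. ennreal ((2 * pi * norm \<xi>) ^ CARD('n)) * (enorm g \<xi>)\<^sup>2 \<partial>lborel)" .
  have "hsq g = (\<integral>\<^sup>+\<xi>. (enorm g \<xi>)\<^sup>2 + ennreal ((2 * pi * norm \<xi>) ^ CARD('n)) * (enorm g \<xi>)\<^sup>2 \<partial>lborel)"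
    unfolding hsq_def wt_def by (simp add: ennreal_plus distrib_right)
  also have "\<dots> = l2sq g + l2sq (frac_symbol ?s u)"
    unfolding s l2sq_enorm[of g] by (rule nn_integral_add) measurable
  finally have hsq: "hsq g = l2sq u + l2sq (frac_symbol ?s u)" by (simp add: l2sq_is_fourier[OF ug])
  show "u \<in> sobolev ?s \<longleftrightarrow> hsq g < \<infinity>"
    using u m L2_fun_l2sq[OF u] by (auto simp: sobolev_def hsq L2_fun_iff)
  assume "u \<in> sobolev ?s"
  then have sL2: "frac_symbol ?s u \<in> L2_fun" by (simp add: sobolev_def)
  have "L2_nrm (frac_laplacian ?s u) = L2_nrm (frac_symbol ?s u)"
    unfolding frac_laplacian_def using is_fourier_isometry[OF is_fourier_fourier_inv[OF sL2]] by simp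
  then have "(sobolev_nrm ?s u)\<^sup>2 = (L2_nrm (frac_symbol ?s u))\<^sup>2 + (L2_nrm u)\<^sup>2"
    by (simp add: sobolev_nrm_def)
  then show "ennreal ((sobolev_nrm ?s u)\<^sup>2) = hsq g"
    by (simp add: ennreal_plus L2_nrm_sq[OF sL2] L2_nrm_sq[OF u] hsq add.commute)
qed

lemma admissible_iff_hsq:
  fixes u g :: "(real, 'n::finite) vec \<Rightarrow> complex"
  assumes ug: "is_fourier u g" and g: "g \<in> borel_measurable borel"
  shows "u \<in> admissible \<longleftrightarrow> hsq g \<le> 1"
proof -
  let ?n = "sobolev_nrm (real CARD('n) / 2) u"
  have nn: "?n \<ge> 0" by (simp add: sobolev_nrm_def)
  show ?thesis
  proof
    assume "u \<in> admissible"
    then have u: "u \<in> sobolev (real CARD('n) / 2)" and "?n \<le> 1" by (auto simp: admissible_def)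
    then have "?n\<^sup>2 \<le> 1" using nn by (simp add: power_le_one)
    then show "hsq g \<le> 1" using sobolev_nrm_hsq[OF ug g u] by (metis ennreal_1 ennreal_leI)
  next
    assume le: "hsq g \<le> 1"
    then have u: "u \<in> sobolev (real CARD('n) / 2)"
      unfolding sobolev_iff_hsq[OF ug g] using le_less_trans[OF le, of \<infinity>] by simp
    have "ennreal (?n\<^sup>2) \<le> 1" using le sobolev_nrm_hsq[OF ug g u] by simp
    then have "?n\<^sup>2 \<le> 1\<^sup>2" by simp
    then have "?n \<le> 1" by (rule power2_le_imp_le) simp
    then show "u \<in> admissible" using u by (simp add: admissible_def)
  qed
qed

lemma conv_pow_finite:
  assumes [measurable]: "g \<in> borel_measurable borel" and "hsq g < \<infinity>"
  shows "(\<integral>\<^sup>+x. (conv_pow (enorm g) k x)\<^sup>2 \<partial>lborel) < \<infinity>"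
proof -
  have "(\<integral>\<^sup>+x. (conv_pow (enorm g) k x)\<^sup>2 \<partial>lborel) \<le> hsq g ^ Suc k * ennreal ((trudinger_const TYPE('a) * real k) ^ k)"
    unfolding hsq_def by (rule conv_pow_L2_le) measurable
  also have "\<dots> < \<infinity>" using assms(2) by (auto simp: ennreal_mult_less_top power_less_top_ennreal)
  finally show ?thesis .
qed

lemma l2sq_power_eq:
  assumes ug: "is_fourier u g" and g: "g \<in> borel_measurable borel" "hsq g < \<infinity>"
  shows "l2sq (\<lambda>x. u x ^ Suc k) = l2sq (cconv_pow g k)"
  using is_fourier_power[OF ug g(1) conv_pow_finite[OF g]] by (rule l2sq_is_fourier)

lemma l2sq_cconv_pow_le:
  assumes [measurable]: "g \<in> borel_measurable borel"
  shows "l2sq (cconv_pow g k) \<le> (\<integral>\<^sup>+x. (conv_pow (enorm g) k x)\<^sup>2 \<partial>lborel)"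
  unfolding l2sq_enorm by (intro nn_integral_mono power_mono enorm_cconv_pow_le) auto

text \<open>Subtracting 1 removes the constant term, so the term of index \<open>k\<close> belongs
  to the power k + 1, in step with the shifted index of \<open>cconv_pow\<close>. All terms are
  nonnegative, and sum and integral may be exchanged even if the value is infinite.\<close>

lemma exp_functional_series:
  assumes u: "u \<in> borel_measurable lebesgue" and \<alpha>: "\<alpha> \<ge> 0"
  shows "exp_functional \<alpha> u = (\<Sum>k. ennreal (\<alpha> ^ Suc k / fact (Suc k)) * l2sq (\<lambda>x. u x ^ Suc k))"
proof -
  note [measurable] = u
  have "ennreal (exp (\<alpha> * (cmod (u x))\<^sup>2) - 1) = (\<Sum>k. ennreal (\<alpha> ^ Suc k / fact (Suc k)) * (ennreal (cmod (u x ^ Suc k)))\<^sup>2)" for x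
  proof -
    let ?t = "\<alpha> * (cmod (u x))\<^sup>2"
    have "(\<lambda>k. ?t ^ k /\<^sub>R fact k) sums exp ?t" by (rule exp_converges)
    then have "(\<lambda>k. ?t ^ Suc k /\<^sub>R fact (Suc k)) sums (exp ?t - 1)"
      by (subst sums_Suc_iff) simp
    then have "(\<lambda>k. ennreal (?t ^ Suc k /\<^sub>R fact (Suc k))) sums ennreal (exp ?t - 1)"
      using \<alpha> by (subst sums_ennreal) (auto intro!: mult_nonneg_nonneg)
    then have "ennreal (exp ?t - 1) = (\<Sum>k. ennreal (?t ^ Suc k /\<^sub>R fact (Suc k)))" by (rule sums_unique)
    also have "\<dots> = (\<Sum>k. ennreal (\<alpha> ^ Suc k / fact (Suc k)) * (ennreal (cmod (u x ^ Suc k)))\<^sup>2)"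
    proof (rule suminf_cong)
      fix k
      have "?t ^ Suc k /\<^sub>R fact (Suc k) = (\<alpha> ^ Suc k / fact (Suc k)) * (cmod (u x ^ Suc k))\<^sup>2"
      proof -
        have "(cmod (u x ^ Suc k))\<^sup>2 = ((cmod (u x))\<^sup>2) ^ Suc k"
          by (simp only: norm_power power_mult[symmetric] mult.commute[of 2])
        then show ?thesis by (simp only: power_mult_distrib real_scaleR_def divide_inverse mult_ac)
      qed
      then show "ennreal (?t ^ Suc k /\<^sub>R fact (Suc k)) = ennreal (\<alpha> ^ Suc k / fact (Suc k)) * (ennreal (cmod (u x ^ Suc k)))\<^sup>2"
        using \<alpha> by (simp only: ennreal_power[OF norm_ge_zero]) (intro ennreal_mult; simp)
    qed
    finally show ?thesis .
  qed
  then have "exp_functional \<alpha> u = (\<integral>\<^sup>+x. (\<Sum>k. ennreal (\<alpha> ^ Suc k / fact (Suc k)) * (ennreal (cmod (u x ^ Suc k)))\<^sup>2) \<partial>lebesgue)"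
    unfolding exp_functional_def by simp
  also have "\<dots> = (\<Sum>k. \<integral>\<^sup>+x. ennreal (\<alpha> ^ Suc k / fact (Suc k)) * (ennreal (cmod (u x ^ Suc k)))\<^sup>2 \<partial>lebesgue)"
    by (rule nn_integral_suminf) measurable
  also have "\<dots> = (\<Sum>k. ennreal (\<alpha> ^ Suc k / fact (Suc k)) * l2sq (\<lambda>x. u x ^ Suc k))"
    unfolding l2sq_def by (intro suminf_cong nn_integral_cmult) measurable
  finally show ?thesis .
qed

lemma power_le_fact_exp: "real k ^ k / fact k \<le> exp 1 ^ k"
proof -
  have "real k ^ k / fact k \<le> exp (real k)"
  proof -
    have sm: "(\<lambda>i. real k ^ i /\<^sub>R fact i) sums exp (real k)" by (rule exp_converges)
    have "(\<Sum>i\<in>{k}. real k ^ i /\<^sub>R fact i) \<le> (\<Sum>i. real k ^ i /\<^sub>R fact i)"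
      by (rule sum_le_suminf[OF sums_summable[OF sm]]) auto
    also have "\<dots> = exp (real k)" using sums_unique[OF sm] by simp
    finally have "(\<Sum>i\<in>{k}. real k ^ i /\<^sub>R fact i) \<le> exp (real k)" .
    then show ?thesis by (simp add: divide_inverse mult.commute)
  qed
  also have "\<dots> = exp 1 ^ k" by (simp flip: exp_of_nat_mult)
  finally show ?thesis .
qed

text \<open>Comparison with a geometric series: dividing k^k by the factorial leaves at most e^k, so
  consecutive terms have the ratio \<alpha> h C e, with C the Trudinger constant. Only a small
  product of \<alpha> and h is covered.\<close>

lemma exp_functional_finite_small:
  fixes u g :: "(real, 'n::finite) vec \<Rightarrow> complex"
  assumes ug: "is_fourier u g" and g[measurable]: "g \<in> borel_measurable borel" and \<alpha>: "\<alpha> \<ge> 0"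
    and h: "hsq g \<le> ennreal h" "h \<ge> 0" and small: "\<alpha> * h * (trudinger_const TYPE((real, 'n) vec) * exp 1) < 1"
  shows "exp_functional \<alpha> u < \<infinity>"
proof -
  let ?C = "trudinger_const TYPE((real, 'n) vec)"
  let ?q = "\<alpha> * h * (?C * exp 1)"
  note C = trudinger_const_nonneg[where 'a="(real, 'n) vec"]
  have hfin: "hsq g < \<infinity>" using h(1) by (rule le_less_trans) simp
  have u: "u \<in> borel_measurable lebesgue" using is_fourier_L2(1)[OF ug] by (rule L2_funD)
  have "exp_functional \<alpha> u = (\<Sum>k. ennreal (\<alpha> ^ Suc k / fact (Suc k)) * l2sq (\<lambda>x. u x ^ Suc k))"
    by (rule exp_functional_series[OF u \<alpha>])
  also have "\<dots> \<le> (\<Sum>k. ennreal (\<alpha> * h * ?q ^ k))"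
  proof (rule suminf_le)
    fix k
    have "l2sq (\<lambda>x. u x ^ Suc k) \<le> (\<integral>\<^sup>+x. (conv_pow (enorm g) k x)\<^sup>2 \<partial>lborel)"
      unfolding l2sq_power_eq[OF ug g hfin] by (rule l2sq_cconv_pow_le[OF g])
    also have "\<dots> \<le> hsq g ^ Suc k * ennreal ((?C * real k) ^ k)"
      unfolding hsq_def by (rule conv_pow_L2_le) measurable
    also have "\<dots> \<le> (ennreal h) ^ Suc k * ennreal ((?C * real k) ^ k)"
      by (intro mult_right_mono power_mono h) auto
    also have "\<dots> = ennreal (h ^ Suc k * (?C * real k) ^ k)"
      using h(2) C by (simp only: ennreal_power) (intro ennreal_mult[symmetric]; simp)
    finally have le: "l2sq (\<lambda>x. u x ^ Suc k) \<le> ennreal (h ^ Suc k * (?C * real k) ^ k)" .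
    have "ennreal (\<alpha> ^ Suc k / fact (Suc k)) * l2sq (\<lambda>x. u x ^ Suc k)
      \<le> ennreal (\<alpha> ^ Suc k / fact (Suc k)) * ennreal (h ^ Suc k * (?C * real k) ^ k)"
      by (intro mult_left_mono le) simp
    also have "\<dots> = ennreal (\<alpha> ^ Suc k / fact (Suc k) * (h ^ Suc k * (?C * real k) ^ k))"
      using \<alpha> h(2) C by (intro ennreal_mult[symmetric]) auto
    also have "\<dots> \<le> ennreal (\<alpha> * h * ?q ^ k)"
    proof (rule ennreal_leI)
      have "\<alpha> ^ Suc k / fact (Suc k) * (h ^ Suc k * (?C * real k) ^ k) = (\<alpha> * h) ^ Suc k * ?C ^ k * (real k ^ k / fact (Suc k))"
        by (simp add: power_mult_distrib)
      also have "\<dots> \<le> (\<alpha> * h) ^ Suc k * ?C ^ k * exp 1 ^ k"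
      proof (rule mult_left_mono)
        have "real k ^ k / fact (Suc k) \<le> real k ^ k / fact k"
          by (intro divide_left_mono fact_mono) auto
        also have "\<dots> \<le> exp 1 ^ k" by (rule power_le_fact_exp)
        finally show "real k ^ k / fact (Suc k) \<le> exp 1 ^ k" .
      qed (use \<alpha> h(2) C in auto)
      also have "\<dots> = \<alpha> * h * ?q ^ k" by (simp add: power_mult_distrib)
      finally show "\<alpha> ^ Suc k / fact (Suc k) * (h ^ Suc k * (?C * real k) ^ k) \<le> \<alpha> * h * ?q ^ k" .
    qed
    finally show "ennreal (\<alpha> ^ Suc k / fact (Suc k)) * l2sq (\<lambda>x. u x ^ Suc k) \<le> ennreal (\<alpha> * h * ?q ^ k)" .
  qed auto
  also have "\<dots> < \<infinity>"
  proof -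
    have q: "0 \<le> ?q" using \<alpha> h(2) C by simp
    have "summable (\<lambda>k. \<alpha> * h * ?q ^ k)" using small q by (intro summable_mult summable_geometric) simp
    then have "(\<Sum>k. ennreal (\<alpha> * h * ?q ^ k)) = ennreal (\<Sum>k. \<alpha> * h * ?q ^ k)"
      using \<alpha> h(2) q by (intro suminf_ennreal2) auto
    then show ?thesis by simp
  qed
  finally show ?thesis .
qed

text \<open>With a = 2 \<alpha> |v|^2 and b = 2 \<alpha> |w|^2, exp (a + b) - 1 = exp a (exp b - 1)
  + (exp a - 1). Boundedness of \<open>v\<close> controls exp a and bounds exp a - 1 by a multiple
  of |v|^2, which is integrable. The price is the doubled exponent for \<open>w\<close>.\<close>

lemma exp_functional_split:
  assumes v: "v \<in> L2_fun" "\<And>x. cmod (v x) \<le> B" and w: "w \<in> borel_measurable lebesgue" and \<alpha>: "\<alpha> \<ge> 0"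
    and fin: "exp_functional (2 * \<alpha>) w < \<infinity>" and u: "\<And>x. u x = v x + w x"
  shows "exp_functional \<alpha> u < \<infinity>"
proof -
  note [measurable] = L2_funD[OF v(1)] w
  let ?K = "exp (2 * \<alpha> * B\<^sup>2)"
  have "exp_functional \<alpha> u \<le> (\<integral>\<^sup>+x. ennreal ?K * ennreal (exp (2 * \<alpha> * (cmod (w x))\<^sup>2) - 1) + ennreal (2 * \<alpha> * ?K) * (ennreal (cmod (v x)))\<^sup>2 \<partial>lebesgue)"
    unfolding exp_functional_def
  proof (rule nn_integral_mono)
    fix x
    let ?a = "2 * \<alpha> * (cmod (v x))\<^sup>2" and ?b = "2 * \<alpha> * (cmod (w x))\<^sup>2"
    have a: "0 \<le> ?a" and b: "0 \<le> ?b" using \<alpha> by auto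
    have "(cmod (v x))\<^sup>2 \<le> B\<^sup>2" using v(2)[of x] by (intro power_mono) auto
    then have aK: "exp ?a \<le> ?K" using \<alpha> by (simp add: mult_left_mono)
    have "(cmod (u x))\<^sup>2 \<le> (cmod (v x) + cmod (w x))\<^sup>2" unfolding u by (intro power_mono norm_triangle_ineq) auto
    also have "\<dots> \<le> 2 * (cmod (v x))\<^sup>2 + 2 * (cmod (w x))\<^sup>2"
      using sum_squares_ge_zero[of "cmod (v x) - cmod (w x)" 0] by (simp add: power2_eq_square algebra_simps)
    finally have "\<alpha> * (cmod (u x))\<^sup>2 \<le> \<alpha> * (2 * (cmod (v x))\<^sup>2 + 2 * (cmod (w x))\<^sup>2)" using \<alpha> by (rule mult_left_mono)
    then have "exp (\<alpha> * (cmod (u x))\<^sup>2) \<le> exp (?a + ?b)" by (simp add: algebra_simps)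
    then have "exp (\<alpha> * (cmod (u x))\<^sup>2) - 1 \<le> exp ?a * (exp ?b - 1) + (exp ?a - 1)" by (simp add: exp_add algebra_simps)
    also have "exp ?a - 1 \<le> ?a * exp ?a"
    proof -
      have "1 - ?a \<le> exp (- ?a)" using exp_ge_add_one_self[of "- ?a"] by simp
      then have "(1 - ?a) * exp ?a \<le> exp (- ?a) * exp ?a" by (rule mult_right_mono) simp
      then show ?thesis by (simp add: left_diff_distrib flip: exp_add)
    qed
    also have "exp ?a * (exp ?b - 1) + ?a * exp ?a \<le> ?K * (exp ?b - 1) + ?a * ?K"
      using aK a b by (intro add_mono mult_right_mono mult_left_mono) auto
    finally have "exp (\<alpha> * (cmod (u x))\<^sup>2) - 1 \<le> ?K * (exp ?b - 1) + (2 * \<alpha> * ?K) * (cmod (v x))\<^sup>2" by (simp add: mult_ac)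
    then have "ennreal (exp (\<alpha> * (cmod (u x))\<^sup>2) - 1) \<le> ennreal (?K * (exp ?b - 1) + (2 * \<alpha> * ?K) * (cmod (v x))\<^sup>2)" by (rule ennreal_leI)
    also have "\<dots> = ennreal (?K * (exp ?b - 1)) + ennreal ((2 * \<alpha> * ?K) * (cmod (v x))\<^sup>2)"
      using b \<alpha> by (intro ennreal_plus) auto
    also have "\<dots> = ennreal ?K * ennreal (exp ?b - 1) + ennreal (2 * \<alpha> * ?K) * (ennreal (cmod (v x)))\<^sup>2"
      using b \<alpha> by (simp only: ennreal_power[OF norm_ge_zero]) (intro arg_cong2[where f="(+)"] ennreal_mult; simp)
    finally show "ennreal (exp (\<alpha> * (cmod (u x))\<^sup>2) - 1) \<le> ennreal ?K * ennreal (exp ?b - 1) + ennreal (2 * \<alpha> * ?K) * (ennreal (cmod (v x)))\<^sup>2" .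
  qed
  also have "\<dots> = (\<integral>\<^sup>+x. ennreal ?K * ennreal (exp (2 * \<alpha> * (cmod (w x))\<^sup>2) - 1) \<partial>lebesgue) + (\<integral>\<^sup>+x. ennreal (2 * \<alpha> * ?K) * (ennreal (cmod (v x)))\<^sup>2 \<partial>lebesgue)"
    by (rule nn_integral_add) measurable
  also have "\<dots> = ennreal ?K * exp_functional (2 * \<alpha>) w + ennreal (2 * \<alpha> * ?K) * l2sq v"
    unfolding exp_functional_def l2sq_def by (intro arg_cong2[where f="(+)"] nn_integral_cmult) measurable
  also have "\<dots> < \<infinity>" using fin L2_fun_l2sq[OF v(1)] by (auto simp: ennreal_mult_less_top)
  finally show ?thesis .
qed

lemma hsq_truncate_tendsto:
  fixes g :: "'a::euclidean_space \<Rightarrow> complex"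
  assumes [measurable]: "g \<in> borel_measurable borel" and fin: "hsq g < \<infinity>"
  shows "(\<lambda>n::nat. hsq (\<lambda>x. g x - truncate (real n) g x)) \<longlonglongrightarrow> 0"
proof -
  have [measurable]: "truncate M g \<in> borel_measurable borel" for M by (rule truncate_measurable) measurable
  have "(\<lambda>n. \<integral>\<^sup>+x. ennreal (wt x) * (enorm (\<lambda>x. g x - truncate (real n) g x) x)\<^sup>2 \<partial>lborel) \<longlonglongrightarrow> (\<integral>\<^sup>+x. 0 \<partial>(lborel::'a measure))"
  proof (rule nn_integral_dominated_convergence[where w="\<lambda>x. ennreal (wt x) * (enorm g x)\<^sup>2"])
    show "(\<integral>\<^sup>+x. ennreal (wt x) * (enorm g x)\<^sup>2 \<partial>lborel) < \<infinity>" using fin by (simp add: hsq_def)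
    show "AE x in lborel. ennreal (wt x) * (enorm (\<lambda>x. g x - truncate (real j) g x) x)\<^sup>2 \<le> ennreal (wt x) * (enorm g x)\<^sup>2" for j
      by (intro AE_I2) (simp add: truncate_def enorm_def)
    show "AE x in lborel. (\<lambda>i. ennreal (wt x) * (enorm (\<lambda>x. g x - truncate (real i) g x) x)\<^sup>2) \<longlonglongrightarrow> 0"
    proof (intro AE_I2)
      fix x
      obtain N :: nat where N: "max (cmod (g x)) (norm x) \<le> real N" using real_arch_simple by blast
      have "\<forall>\<^sub>F n in sequentially. truncate (real n) g x = g x"
        using eventually_ge_at_top[of N] by eventually_elim (use N in \<open>auto simp: truncate_def\<close>)
      then show "(\<lambda>i. ennreal (wt x) * (enorm (\<lambda>x. g x - truncate (real i) g x) x)\<^sup>2) \<longlonglongrightarrow> 0"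
        by (intro tendsto_eventually, elim eventually_mono) (simp add: enorm_def)
    qed
  qed measurable
  then show ?thesis by (simp add: hsq_def)
qed

text \<open>The supremum may be infinite, but every single function in the Sobolev space has a finite
  value: up to a bounded part its norm is as small as we like.\<close>

theorem exp_functional_finite:
  fixes u g :: "(real, 'n::finite) vec \<Rightarrow> complex"
  assumes ug: "is_fourier u g" and g[measurable]: "g \<in> borel_measurable borel" and \<alpha>: "\<alpha> \<ge> 0" and fin: "hsq g < \<infinity>"
  shows "exp_functional \<alpha> u < \<infinity>"
proof -
  let ?C = "trudinger_const TYPE((real, 'n) vec)"
  note C = trudinger_const_nonneg[where 'a="(real, 'n) vec"]
  \<comment> \<open>Small enough that the geometric series for the remainder converges with 2
    \<alpha>, the exponent left by the splitting; the summand 1 keeps the denominator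
    positive.\<close>
  define h where "h = 1 / (2 * \<alpha> * (?C * exp 1) + 1)"
  have D: "2 * \<alpha> * (?C * exp 1) \<ge> 0" using \<alpha> C by simp
  have h: "h > 0" "2 * \<alpha> * h * (?C * exp 1) < 1"
    unfolding h_def using D by (auto simp: field_simps)
  have "\<forall>\<^sub>F n in sequentially. hsq (\<lambda>x. g x - truncate (real n) g x) < ennreal h"
    using h by (intro order_tendstoD(2)[OF hsq_truncate_tendsto[OF g fin]]) auto
  then obtain n :: nat where n: "hsq (\<lambda>x. g x - truncate (real n) g x) < ennreal h" by (auto simp: eventually_sequentially)
  define g1 where "g1 = truncate (real n) g"
  have g1m[measurable]: "g1 \<in> borel_measurable borel" unfolding g1_def by (rule truncate_measurable[OF g])
  have g1L2: "g1 \<in> L2_fun" unfolding g1_def by (rule L2_fun_truncate[OF g is_fourier_L2(2)[OF ug]])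
  have g1L1: "integrable lborel g1" unfolding g1_def by (rule integrable_truncate[OF g])
  have v: "is_fourier (ift g1) g1" by (rule is_fourier_ift[OF g1m g1L2 g1L1])
  have wm: "(\<lambda>x. g x - g1 x) \<in> borel_measurable borel" by measurable
  have w: "is_fourier (\<lambda>x. u x - ift g1 x) (\<lambda>x. g x - g1 x)" by (rule is_fourier_diff[OF ug v])
  show ?thesis
  proof (rule exp_functional_split[where v="ift g1" and w="\<lambda>x. u x - ift g1 x" and B="\<integral>x. cmod (g1 x) \<partial>lborel"])
    show "ift g1 \<in> L2_fun" using is_fourier_L2[OF v] by auto
    show "cmod (ift g1 x) \<le> (\<integral>x. cmod (g1 x) \<partial>lborel)" for x
      unfolding ift_cnj using ft_norm_le[of "\<lambda>\<xi>. cnj (g1 \<xi>)" x] by simp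
    show "(\<lambda>x. u x - ift g1 x) \<in> borel_measurable lebesgue" using is_fourier_L2(1)[OF w] by (rule L2_funD)
    show "exp_functional (2 * \<alpha>) (\<lambda>x. u x - ift g1 x) < \<infinity>"
      by (rule exp_functional_finite_small[OF w wm, where h=h]) (use n h \<alpha> in \<open>auto simp: g1_def\<close>)
  qed (use \<alpha> in auto)
qed

section \<open>The modulus of the transform of a maximizer\<close>

lemma enorm_of_real: "(\<And>x. h x \<ge> 0) \<Longrightarrow> enorm (\<lambda>x. complex_of_real (h x)) = (\<lambda>x. ennreal (h x))"
  by (simp add: enorm_def fun_eq_iff)

text \<open>For nonnegative functions the two kinds of convolution could differ only where the
  extended one is infinite and the Bochner integral falls back to 0. Finiteness of the L2 norms
  confines this to null sets.\<close>

lemma cconv_pow_of_real: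
  fixes h :: "'a::euclidean_space \<Rightarrow> real"
  assumes [measurable]: "h \<in> borel_measurable borel" and h: "\<And>x. h x \<ge> 0"
    and fin: "\<And>k. (\<integral>\<^sup>+x. (conv_pow (\<lambda>x. ennreal (h x)) k x)\<^sup>2 \<partial>lborel) < \<infinity>"
  shows "AE x in lborel. cconv_pow (\<lambda>x. complex_of_real (h x)) k x = of_real (enn2real (conv_pow (\<lambda>x. ennreal (h x)) k x))
    \<and> conv_pow (\<lambda>x. ennreal (h x)) k x < \<infinity>"
proof (induction k)
  case 0
  show ?case using h by simp
next
  case (Suc k)
  let ?h = "\<lambda>x. ennreal (h x)"
  let ?P = "conv_pow ?h k"
  have "AE x in lborel. (conv_pow ?h (Suc k) x)\<^sup>2 \<noteq> \<infinity>" using fin[of "Suc k"] by (intro nn_integral_PInf_AE) auto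
  then show ?case
  proof eventually_elim
    fix x assume "(conv_pow ?h (Suc k) x)\<^sup>2 \<noteq> \<infinity>"
    then have finx: "conv_pow ?h (Suc k) x < \<infinity>"
      by (auto simp: power2_eq_square ennreal_mult_eq_top_iff less_top[symmetric])
    have AEy: "AE y in lborel. cconv_pow (\<lambda>x. complex_of_real (h x)) k (x - y) = of_real (enn2real (?P (x - y))) \<and> ?P (x - y) < \<infinity>"
      using AE_reflect[OF Suc, of x] .
    have "cconv_pow (\<lambda>x. complex_of_real (h x)) (Suc k) x = (\<integral>y. complex_of_real (h y) * cconv_pow (\<lambda>x. complex_of_real (h x)) k (x - y) \<partial>lborel)"
      by (simp add: cconv_def)
    also have "\<dots> = (\<integral>y. complex_of_real (h y * enn2real (?P (x - y))) \<partial>lborel)"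
      by (rule integral_cong_AE) (use AEy in \<open>auto elim!: eventually_mono\<close>)
    also have "\<dots> = complex_of_real (\<integral>y. h y * enn2real (?P (x - y)) \<partial>lborel)" by (rule integral_complex_of_real)
    also have "(\<integral>y. h y * enn2real (?P (x - y)) \<partial>lborel) = enn2real (\<integral>\<^sup>+y. ennreal (h y * enn2real (?P (x - y))) \<partial>lborel)"
      using h by (intro integral_eq_nn_integral) auto
    also have "(\<integral>\<^sup>+y. ennreal (h y * enn2real (?P (x - y))) \<partial>lborel) = conv_pow ?h (Suc k) x"
      unfolding conv_pow.simps conv_def
    proof (rule nn_integral_cong_AE, use AEy in eventually_elim)
      fix y assume "cconv_pow (\<lambda>x. complex_of_real (h x)) k (x - y) = of_real (enn2real (?P (x - y))) \<and> ?P (x - y) < \<infinity>"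
      then show "ennreal (h y * enn2real (?P (x - y))) = ennreal (h y) * ?P (x - y)"
        using h by (simp add: ennreal_mult)
    qed
    finally show "cconv_pow (\<lambda>x. complex_of_real (h x)) (Suc k) x = of_real (enn2real (conv_pow ?h (Suc k) x)) \<and> conv_pow ?h (Suc k) x < \<infinity>"
      using finx by simp
  qed
qed

lemma l2sq_cconv_pow_of_real:
  fixes h :: "'a::euclidean_space \<Rightarrow> real"
  assumes [measurable]: "h \<in> borel_measurable borel" and h: "\<And>x. h x \<ge> 0" and fin: "hsq (\<lambda>x. complex_of_real (h x)) < \<infinity>"
  shows "l2sq (cconv_pow (\<lambda>x. complex_of_real (h x)) k) = (\<integral>\<^sup>+x. (conv_pow (\<lambda>x. ennreal (h x)) k x)\<^sup>2 \<partial>lborel)"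
proof -
  have "(\<integral>\<^sup>+x. (conv_pow (\<lambda>x. ennreal (h x)) k x)\<^sup>2 \<partial>lborel) < \<infinity>" for k
    using conv_pow_finite[OF _ fin, of k] by (simp add: enorm_of_real[OF h])
  note ae = cconv_pow_of_real[OF assms(1) h this, of k]
  show ?thesis unfolding l2sq_lborel
  proof (rule nn_integral_cong_AE, use ae in eventually_elim)
    fix x assume *: "cconv_pow (\<lambda>x. complex_of_real (h x)) k x = of_real (enn2real (conv_pow (\<lambda>x. ennreal (h x)) k x))
      \<and> conv_pow (\<lambda>x. ennreal (h x)) k x < \<infinity>"
    then have "cmod (cconv_pow (\<lambda>x. complex_of_real (h x)) k x) = enn2real (conv_pow (\<lambda>x. ennreal (h x)) k x)"
      by (simp add: enn2real_nonneg)
    then show "(ennreal (cmod (cconv_pow (\<lambda>x. complex_of_real (h x)) k x)))\<^sup>2 = (conv_pow (\<lambda>x. ennreal (h x)) k x)\<^sup>2"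
      using * by simp
  qed
qed

text \<open>Equality of integrals for the counting measure, whose only null set is the empty
  one.\<close>

lemma suminf_ennreal_eq_terms:
  fixes a b :: "nat \<Rightarrow> ennreal"
  assumes le: "\<And>k. a k \<le> b k" and ge: "suminf b \<le> suminf a" and fin: "suminf a < \<infinity>"
  shows "a k = b k"
proof -
  have "AE k in count_space UNIV. a k = b k"
    by (rule AE_eq_of_nn_integral_le) (use assms in \<open>auto simp: nn_integral_count_space_nat\<close>)
  then show ?thesis by (simp add: AE_count_space)
qed

context
  fixes \<alpha> :: real and Q g :: "(real, 'n::finite) vec \<Rightarrow> complex"
  assumes \<alpha>: "\<alpha> > 0" and Q: "maximizer \<alpha> Q" and Qg: "is_fourier Q g" and g[measurable]: "g \<in> borel_measurable borel"
begin

lemma maximizer_hsq: "hsq g \<le> 1" "hsq g < \<infinity>"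
proof -
  show le: "hsq g \<le> 1" using Q admissible_iff_hsq[OF Qg g] by (simp add: maximizer_def)
  show "hsq g < \<infinity>" using le_less_trans[OF le, of \<infinity>] by simp
qed

lemma maximizer_ge:
  fixes v h :: "(real, 'n) vec \<Rightarrow> complex"
  assumes "is_fourier v h" "h \<in> borel_measurable borel" "hsq h \<le> 1"
  shows "exp_functional \<alpha> v \<le> exp_functional \<alpha> Q"
proof -
  have "v \<in> admissible" using admissible_iff_hsq[OF assms(1,2)] assms(3) by simp
  then have "exp_functional \<alpha> v \<le> S_sup TYPE('n) \<alpha>" unfolding S_sup_def by (rule SUP_upper)
  then show ?thesis using Q by (simp add: maximizer_def)
qed

lemma maximizer_finite: "exp_functional \<alpha> Q < \<infinity>"
  using exp_functional_finite[OF Qg g _ maximizer_hsq(2)] \<alpha> by simp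

text \<open>Passing to moduli can only increase the norms of the convolution powers of
  \<open>g\<close> and changes nothing for the nonnegative \<open>h\<close>. A comparison of moduli
  thus becomes a comparison of the terms in the exponential series.\<close>

lemma power_terms_le:
  assumes v: "is_fourier v (\<lambda>x. complex_of_real (h x))" and [measurable]: "h \<in> borel_measurable borel" and h: "\<And>x. h x \<ge> 0"
    and hfin: "hsq (\<lambda>x. complex_of_real (h x)) < \<infinity>"
    and le: "\<And>k. (\<integral>\<^sup>+x. (conv_pow (enorm g) k x)\<^sup>2 \<partial>lborel) \<le> (\<integral>\<^sup>+x. (conv_pow (\<lambda>x. ennreal (h x)) k x)\<^sup>2 \<partial>lborel)"
  shows "l2sq (\<lambda>x. Q x ^ Suc k) \<le> l2sq (\<lambda>x. v x ^ Suc k)"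
proof -
  have "l2sq (\<lambda>x. Q x ^ Suc k) \<le> (\<integral>\<^sup>+x. (conv_pow (enorm g) k x)\<^sup>2 \<partial>lborel)"
    unfolding l2sq_power_eq[OF Qg g maximizer_hsq(2)] by (rule l2sq_cconv_pow_le[OF g])
  also have "\<dots> \<le> (\<integral>\<^sup>+x. (conv_pow (\<lambda>x. ennreal (h x)) k x)\<^sup>2 \<partial>lborel)" by (rule le)
  also have "\<dots> = l2sq (\<lambda>x. v x ^ Suc k)"
    by (subst l2sq_power_eq[OF v _ hfin]) (auto simp: l2sq_cconv_pow_of_real[OF _ h hfin])
  finally show ?thesis .
qed

text \<open>If symmetrizing the modulus of the transform changed it, the norm would drop strictly, and
  rescaling the symmetrized function back to the unit ball would beat the maximizer.\<close>

lemma maximizer_steiner: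
  assumes e: "norm e = 1"
  shows "AE x in lborel. enorm g x = steiner e (enorm g) x"
proof (rule ccontr)
  assume neq: "\<not> ?thesis"
  let ?f = "enorm g"
  note st = steiner_weighted_norm[of ?f "\<lambda>x. ennreal (wt x)" e]
  have mono: "ennreal (wt x) < ennreal (wt y)" if "norm x < norm y" for x y :: "(real,'n) vec"
    using wt_strict_mono[OF that] wt_pos[of x] by (intro ennreal_lessI) (auto intro: less_trans)
  have even: "ennreal (wt x) = ennreal (wt y)" if "norm x = norm y" for x y :: "(real,'n) vec"
    using that by (simp add: wt_def)
  have ge1: "1 \<le> ennreal (wt x)" for x :: "(real,'n) vec" using ennreal_leI[OF wt_ge_1[of x]] by simp
  let ?I = "\<integral>\<^sup>+x. ennreal (wt x) * (steiner e ?f x)\<^sup>2 \<partial>lborel"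
  have less: "?I < hsq g"
  proof (rule ccontr)
    assume "\<not> ?I < hsq g"
    then have "hsq g \<le> ?I" by simp
    then show False
      using st(2)[OF _ _ e _ ge1 mono even] neq maximizer_hsq(2) unfolding hsq_def by auto
  qed
  \<comment> \<open>A Fourier transform has to be complex valued, while the symmetrization may be
    infinite; the finite weighted norm confines infinite values to a null set.\<close>
  define h where "h x = enn2real (steiner e ?f x)" for x
  have [measurable]: "h \<in> borel_measurable borel" unfolding h_def by measurable
  have h0: "h x \<ge> 0" for x by (simp add: h_def enn2real_nonneg)
  have "AE x in lborel. ennreal (wt x) * (steiner e ?f x)\<^sup>2 \<noteq> \<infinity>"
    using less maximizer_hsq(2) by (intro nn_integral_PInf_AE) auto
  then have ae: "AE x in lborel. ennreal (h x) = steiner e ?f x"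
  proof eventually_elim
    fix x assume "ennreal (wt x) * (steiner e ?f x)\<^sup>2 \<noteq> \<infinity>"
    then have "steiner e ?f x \<noteq> \<infinity>" using wt_pos[of x] by (auto simp: power2_eq_square ennreal_mult_eq_top_iff)
    then show "ennreal (h x) = steiner e ?f x" by (simp add: h_def less_top)
  qed
  \<comment> \<open>Restricted to k > 0: a convolution does not see the null set on which
    \<open>h\<close> and the symmetrization differ, whereas the functions themselves agree almost
    everywhere only.\<close>
  have conv_cong: "conv_pow (\<lambda>x. ennreal (h x)) k x = conv_pow (steiner e ?f) k x" if "k > 0" for k x
    using that
  proof (induction k arbitrary: x)
    case (Suc k)
    have "AE y in lborel. ennreal (h y) * conv_pow (\<lambda>x. ennreal (h x)) k (x - y) = steiner e ?f y * conv_pow (steiner e ?f) k (x - y)"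
    proof (cases "k > 0")
      case True
      show ?thesis using ae by eventually_elim (simp add: Suc.IH[OF True])
    next
      case False
      show ?thesis using ae AE_reflect[OF ae, of x] by eventually_elim (use False in simp)
    qed
    then show ?case unfolding conv_pow.simps conv_def by (rule nn_integral_cong_AE)
  qed simp
  have le: "(\<integral>\<^sup>+x. (conv_pow ?f k x)\<^sup>2 \<partial>lborel) \<le> (\<integral>\<^sup>+x. (conv_pow (\<lambda>x. ennreal (h x)) k x)\<^sup>2 \<partial>lborel)" for k
  proof -
    have "(\<integral>\<^sup>+x. (conv_pow ?f k x)\<^sup>2 \<partial>lborel) \<le> (\<integral>\<^sup>+x. (conv_pow (steiner e ?f) k x)\<^sup>2 \<partial>lborel)"
      by (rule conv_pow_steiner_L2_le[OF _ e]) measurable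
    also have "\<dots> = (\<integral>\<^sup>+x. (conv_pow (\<lambda>x. ennreal (h x)) k x)\<^sup>2 \<partial>lborel)"
    proof (cases "k > 0")
      case False
      then show ?thesis by (intro nn_integral_cong_AE) (use ae in \<open>auto elim!: eventually_mono\<close>)
    qed (simp add: conv_cong)
    finally show ?thesis .
  qed
  define H where "H = hsq (\<lambda>x. complex_of_real (h x))"
  have H_eq: "H = ?I" unfolding H_def hsq_def enorm_of_real[OF h0]
    by (rule nn_integral_cong_AE) (use ae in \<open>auto elim!: eventually_mono\<close>)
  have H_less: "H < hsq g" using less by (simp add: H_eq)
  then have H_fin: "H < \<infinity>" using maximizer_hsq(2) by (rule less_trans)
  obtain r where r: "H = ennreal r" "r \<ge> 0" using H_fin by (cases H) auto
  have "H < 1" using H_less maximizer_hsq(1) by (rule less_le_trans)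
  then have r1: "r < 1" using r by (simp add: ennreal_less_one_iff)
  have hL2: "(\<lambda>x. complex_of_real (h x)) \<in> L2_fun"
    using le_less_trans[OF l2sq_le_hsq H_fin[unfolded H_def]] by (intro L2_fun_borelI) auto
  obtain v where v: "is_fourier v (\<lambda>x. complex_of_real (h x))" using is_fourier_exists_inv[OF hL2] by blast
  note terms = power_terms_le[OF v _ h0 H_fin[unfolded H_def] le]
  have vm: "v \<in> borel_measurable lebesgue" and Qm: "Q \<in> borel_measurable lebesgue"
    using is_fourier_L2(1)[OF v] is_fourier_L2(1)[OF Qg] by (auto dest: L2_funD)
  \<comment> \<open>Any factor above 1 that keeps the norm in the unit ball will do, and c^2 r = 2 r
    / (1 + r) is at most 1 because r < 1. Unlike 1 / sqrt r this choice is also defined for r =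
    0.\<close>
  define c where "c = sqrt (2 / (1 + r))"
  have c2: "c\<^sup>2 = 2 / (1 + r)" using r by (simp add: c_def)
  have c1: "c > 1" unfolding c_def using r r1 by (simp add: field_simps)
  have cL2: "(\<lambda>x. complex_of_real c * complex_of_real (h x)) \<in> L2_fun" by (rule L2_fun_cmult[OF hL2])
  obtain w where w: "is_fourier w (\<lambda>x. complex_of_real c * complex_of_real (h x))" using is_fourier_exists_inv[OF cL2] by blast
  have "hsq (\<lambda>x. complex_of_real c * complex_of_real (h x)) = ennreal (c\<^sup>2) * H"
    unfolding H_def hsq_def using c1
    by (subst nn_integral_cmult[symmetric]) (auto intro!: nn_integral_cong simp: enorm_def norm_mult power_mult_distrib ennreal_mult ennreal_power mult_ac)
  also have "\<dots> = ennreal (2 * r / (1 + r))" unfolding r c2 using r by (simp flip: ennreal_mult)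
  also have "\<dots> \<le> ennreal 1" using r r1 by (intro ennreal_leI) (simp add: field_simps)
  finally have hw: "hsq (\<lambda>x. complex_of_real c * complex_of_real (h x)) \<le> 1" by simp
  have wm[measurable]: "(\<lambda>x. complex_of_real c * complex_of_real (h x)) \<in> borel_measurable borel" by measurable
  have hm[measurable]: "(\<lambda>x. complex_of_real (h x)) \<in> borel_measurable borel" by measurable
  have Jw: "exp_functional \<alpha> w \<le> exp_functional \<alpha> Q" by (rule maximizer_ge[OF w wm hw])
  have w_fin: "hsq (\<lambda>x. complex_of_real c * complex_of_real (h x)) < \<infinity>" using le_less_trans[OF hw, of \<infinity>] by simp
  have wv: "l2sq (\<lambda>x. w x ^ Suc k) \<ge> ennreal (c\<^sup>2) * l2sq (\<lambda>x. v x ^ Suc k)" for k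
  proof -
    have pow: "cconv_pow (\<lambda>x. complex_of_real c * complex_of_real (h x)) k x = complex_of_real c ^ Suc k * cconv_pow (\<lambda>x. complex_of_real (h x)) k x" for k x
    proof (induction k arbitrary: x)
      case (Suc k)
      have "cconv_pow (\<lambda>x. complex_of_real c * complex_of_real (h x)) (Suc k) x
        = (\<integral>y. complex_of_real c ^ Suc (Suc k) * (complex_of_real (h y) * cconv_pow (\<lambda>x. complex_of_real (h x)) k (x - y)) \<partial>lborel)"
        by (simp add: cconv_def Suc mult_ac)
      then show ?case by (simp add: cconv_def)
    qed simp
    have "l2sq (\<lambda>x. w x ^ Suc k) = l2sq (cconv_pow (\<lambda>x. complex_of_real c * complex_of_real (h x)) k)"
      by (rule l2sq_power_eq[OF w wm w_fin])
    also have "\<dots> = (ennreal (c ^ Suc k))\<^sup>2 * l2sq (cconv_pow (\<lambda>x. complex_of_real (h x)) k)"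
      unfolding l2sq_lborel pow using c1
      by (subst nn_integral_cmult[symmetric]) (auto intro!: nn_integral_cong simp: norm_mult norm_power power_mult_distrib ennreal_mult)
    also have "l2sq (cconv_pow (\<lambda>x. complex_of_real (h x)) k) = l2sq (\<lambda>x. v x ^ Suc k)"
      by (rule l2sq_power_eq[OF v hm H_fin[unfolded H_def], symmetric])
    finally have eq: "l2sq (\<lambda>x. w x ^ Suc k) = (ennreal (c ^ Suc k))\<^sup>2 * l2sq (\<lambda>x. v x ^ Suc k)" .
    have "c ^ 1 \<le> c ^ Suc k" using c1 by (intro power_increasing) auto
    then have "c\<^sup>2 \<le> (c ^ Suc k)\<^sup>2" using c1 by (intro power_mono) auto
    then have "ennreal (c\<^sup>2) \<le> (ennreal (c ^ Suc k))\<^sup>2" using c1 by (simp add: ennreal_power ennreal_leI del: power_Suc)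
    then show ?thesis unfolding eq by (rule mult_right_mono) simp
  qed
  have \<alpha>0: "\<alpha> \<ge> 0" using \<alpha> by simp
  let ?a = "\<lambda>k. ennreal (\<alpha> ^ Suc k / fact (Suc k))"
  have JQv: "exp_functional \<alpha> Q \<le> exp_functional \<alpha> v"
    unfolding exp_functional_series[OF Qm \<alpha>0] exp_functional_series[OF vm \<alpha>0]
    by (intro suminf_le mult_left_mono terms) auto
  have "ennreal (c\<^sup>2) * exp_functional \<alpha> v \<le> exp_functional \<alpha> w"
  proof -
    have wm': "w \<in> borel_measurable lebesgue" using is_fourier_L2(1)[OF w] by (rule L2_funD)
    have "ennreal (c\<^sup>2) * exp_functional \<alpha> v = (\<Sum>k. ennreal (c\<^sup>2) * (?a k * l2sq (\<lambda>x. v x ^ Suc k)))"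
      unfolding exp_functional_series[OF vm \<alpha>0] by (rule ennreal_suminf_cmult[symmetric])
    also have "\<dots> = (\<Sum>k. ?a k * (ennreal (c\<^sup>2) * l2sq (\<lambda>x. v x ^ Suc k)))" by (simp only: mult.left_commute)
    also have "\<dots> \<le> (\<Sum>k. ?a k * l2sq (\<lambda>x. w x ^ Suc k))" by (intro suminf_le mult_left_mono wv) auto
    finally show ?thesis unfolding exp_functional_series[OF wm' \<alpha>0] .
  qed
  also note Jw
  also note JQv
  finally have cv: "ennreal (c\<^sup>2) * exp_functional \<alpha> v \<le> exp_functional \<alpha> v" .
  have vfin: "exp_functional \<alpha> v < \<infinity>" by (rule exp_functional_finite[OF v hm \<alpha>0 H_fin[unfolded H_def]])
  obtain j where j: "exp_functional \<alpha> v = ennreal j" "j \<ge> 0" using vfin by (cases "exp_functional \<alpha> v") auto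
  \<comment> \<open>With c^2 > 1 the finite value \<open>j\<close> must be 0. Then Q vanishes almost
    everywhere, and so does \<open>g\<close>, which leaves no room for the strict drop of the
    norm.\<close>
  have "c\<^sup>2 * j \<le> j" using cv j by (simp flip: ennreal_mult)
  moreover have "c\<^sup>2 > 1" using c1 by (simp add: one_less_power)
  ultimately have "j = 0" using j(2) mult_strict_right_mono[of 1 "c\<^sup>2" j] by fastforce
  then have JQ0: "exp_functional \<alpha> Q = 0" using JQv j by simp
  have "?a 0 * l2sq (\<lambda>x. Q x ^ Suc 0) = 0"
  proof -
    have "(\<lambda>k. ?a k * l2sq (\<lambda>x. Q x ^ Suc k)) 0 \<le> (\<Sum>k. ?a k * l2sq (\<lambda>x. Q x ^ Suc k))"
      using sum_le_suminf[of "\<lambda>k. ?a k * l2sq (\<lambda>x. Q x ^ Suc k)" "{0}"] by simp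
    then show ?thesis using JQ0 unfolding exp_functional_series[OF Qm \<alpha>0] by simp
  qed
  then have "l2sq Q = 0" using \<alpha> by simp
  then have "l2sq g = 0" using l2sq_is_fourier[OF Qg] by simp
  then have "AE x in lborel. enorm g x = 0" unfolding l2sq_enorm by (subst (asm) nn_integral_0_iff_AE) auto
  then have "hsq g = 0" unfolding hsq_def by (subst nn_integral_0_iff_AE) (auto elim!: eventually_mono)
  then show False using H_less by simp
qed

text \<open>Replacing \<open>g\<close> by |g| keeps the norm and lowers no term of the series.
  Maximality and finiteness then give equality term by term, and the term of Q^2 says that g * g and
  |g| * |g| have the same finite L2 norm; the pointwise inequality between them is therefore an
  equality almost everywhere.\<close>

lemma maximizer_self_conv: "AE x in lborel. enorm (cconv g g) x = conv (enorm g) (enorm g) x"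
proof -
  let ?h = "\<lambda>x. cmod (g x)"
  have h0: "?h x \<ge> 0" for x by simp
  have hm: "?h \<in> borel_measurable borel" by measurable
  have en: "(\<lambda>x. ennreal (?h x)) = enorm g" by (simp add: enorm_def fun_eq_iff)
  have H: "hsq (\<lambda>x. complex_of_real (?h x)) = hsq g" by (simp add: hsq_def enorm_def)
  have hL2: "(\<lambda>x. complex_of_real (?h x)) \<in> L2_fun"
    using le_less_trans[OF l2sq_le_hsq maximizer_hsq(2)[folded H]] by (intro L2_fun_borelI) auto
  obtain v where v: "is_fourier v (\<lambda>x. complex_of_real (?h x))" using is_fourier_exists_inv[OF hL2] by blast
  note terms = power_terms_le[OF v hm h0 maximizer_hsq(2)[folded H], unfolded en, OF order_refl]
  have vm: "v \<in> borel_measurable lebesgue" and Qm: "Q \<in> borel_measurable lebesgue"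
    using is_fourier_L2(1)[OF v] is_fourier_L2(1)[OF Qg] by (auto dest: L2_funD)
  have \<alpha>0: "\<alpha> \<ge> 0" using \<alpha> by simp
  let ?a = "\<lambda>k. ennreal (\<alpha> ^ Suc k / fact (Suc k))"
  have "exp_functional \<alpha> v \<le> exp_functional \<alpha> Q"
    by (rule maximizer_ge[OF v]) (use H maximizer_hsq(1) in auto)
  then have "?a 1 * l2sq (\<lambda>x. Q x ^ Suc 1) = ?a 1 * l2sq (\<lambda>x. v x ^ Suc 1)"
    using maximizer_finite unfolding exp_functional_series[OF Qm \<alpha>0] exp_functional_series[OF vm \<alpha>0]
    by (intro suminf_ennreal_eq_terms[where k=1] mult_left_mono terms) auto
  then have eq: "l2sq (\<lambda>x. Q x ^ Suc 1) = l2sq (\<lambda>x. v x ^ Suc 1)"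
    using \<alpha> by (simp add: ennreal_mult_cancel_left)
  have v2: "l2sq (\<lambda>x. v x ^ Suc 1) = (\<integral>\<^sup>+x. (conv_pow (enorm g) 1 x)\<^sup>2 \<partial>lborel)"
    using l2sq_power_eq[OF v _ maximizer_hsq(2)[folded H], of 1] l2sq_cconv_pow_of_real[OF hm h0 maximizer_hsq(2)[folded H], of 1]
    by (simp add: en)
  have Q2: "l2sq (\<lambda>x. Q x ^ Suc 1) = l2sq (cconv_pow g 1)" by (rule l2sq_power_eq[OF Qg g maximizer_hsq(2)])
  have "AE x in lborel. (enorm (cconv_pow g 1) x)\<^sup>2 = (conv_pow (enorm g) 1 x)\<^sup>2"
  proof (rule AE_eq_of_nn_integral_le)
    show "AE x in lborel. (enorm (cconv_pow g 1) x)\<^sup>2 \<le> (conv_pow (enorm g) 1 x)\<^sup>2"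
      by (intro AE_I2 power_mono enorm_cconv_pow_le) auto
    show "(\<integral>\<^sup>+x. (conv_pow (enorm g) 1 x)\<^sup>2 \<partial>lborel) \<le> (\<integral>\<^sup>+x. (enorm (cconv_pow g 1) x)\<^sup>2 \<partial>lborel)"
      using eq v2 Q2 by (simp add: l2sq_enorm)
    show "(\<integral>\<^sup>+x. (enorm (cconv_pow g 1) x)\<^sup>2 \<partial>lborel) < \<infinity>"
      using le_less_trans[OF l2sq_cconv_pow_le[OF g] conv_pow_finite[OF g maximizer_hsq(2)], of 1] by (simp add: l2sq_enorm)
  qed measurable
  then show ?thesis
  proof eventually_elim
    fix x assume eq: "(enorm (cconv_pow g 1) x)\<^sup>2 = (conv_pow (enorm g) 1 x)\<^sup>2"
    have "enorm (cconv_pow g 1) x = conv_pow (enorm g) 1 x"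
      by (rule antisym; rule ennreal_power2_le_imp_le) (simp_all only: eq order_refl)
    then show "enorm (cconv g g) x = conv (enorm g) (enorm g) x" by simp
  qed
qed

end

section \<open>From symmetry in every direction to the radial rearrangement\<close>

lemma AE_translate:
  assumes "AE z in lborel. P (z :: 'a::euclidean_space)"
  shows "AE y in lborel. P (y + a)"
  using AE_reflect[OF AE_reflect[OF assms, of 0], of "- a"] by (simp add: algebra_simps)

text \<open>The radius of the ball of volume \<open>c\<close>. An infinite \<open>c\<close> gives
  radius 0, the default of \<open>enn2real\<close>.\<close>

definition ball_radius :: "'a::euclidean_space itself \<Rightarrow> ennreal \<Rightarrow> real" where
  "ball_radius _ c = root DIM('a) (enn2real c / unit_ball_vol (DIM('a)))"

lemma ball_radius_measurable[measurable]: "ball_radius TYPE('a::euclidean_space) \<in> borel_measurable borel"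
proof -
  have "continuous_on UNIV (root DIM('a))" by (intro continuous_intros)
  then have [measurable]: "root DIM('a) \<in> borel_measurable borel" by (rule borel_measurable_continuous_onI)
  show ?thesis unfolding ball_radius_def by measurable
qed

lemma ball_radius_nonneg: "ball_radius TYPE('a::euclidean_space) c \<ge> 0"
  unfolding ball_radius_def by (simp add: enn2real_nonneg)

lemma emeasure_ball_radius:
  assumes "c < \<infinity>"
  shows "emeasure lborel (ball (0::'a::euclidean_space) (ball_radius TYPE('a) c)) = c"
proof -
  have V: "unit_ball_vol (DIM('a)) > 0" by simp
  have "emeasure lborel (ball (0::'a) (ball_radius TYPE('a) c)) = ennreal (unit_ball_vol (DIM('a)) * ball_radius TYPE('a) c ^ DIM('a))"
    by (rule emeasure_ball[OF ball_radius_nonneg])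
  also have "unit_ball_vol (DIM('a)) * ball_radius TYPE('a) c ^ DIM('a) = enn2real c"
    unfolding ball_radius_def using less_imp_neq[OF V, symmetric] by (simp add: real_root_pow_pos2 enn2real_nonneg)
  finally show ?thesis using assms by simp
qed

lemma rearr_set_ball:
  fixes A :: "(real, 'n::finite) vec set"
  assumes "emeasure lebesgue A < \<infinity>"
  shows "rearr_set A = ball 0 (ball_radius TYPE((real, 'n) vec) (emeasure lebesgue A))"
proof -
  let ?c = "emeasure lebesgue A" and ?r = "ball_radius TYPE((real, 'n) vec)"
  let ?V = "unit_ball_vol (DIM((real, 'n) vec))"
  have V: "?V > 0" by simp
  have "(THE R. R \<ge> 0 \<and> emeasure lebesgue (ball (0 :: (real, 'n) vec) R) = ?c) = ?r ?c"
  proof (rule the_equality)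
    show "?r ?c \<ge> 0 \<and> emeasure lebesgue (ball (0 :: (real, 'n) vec) (?r ?c)) = ?c"
      using ball_radius_nonneg emeasure_ball_radius[OF assms] by auto
    fix R assume R: "R \<ge> 0 \<and> emeasure lebesgue (ball (0 :: (real, 'n) vec) R) = ?c"
    then have "ennreal (?V * R ^ DIM((real, 'n) vec)) = ?c"
      using emeasure_ball[of R "0 :: (real, 'n) vec"] by simp
    moreover have "ennreal (?V * (?r ?c) ^ DIM((real, 'n) vec)) = ?c"
      using emeasure_ball_radius[OF assms, where 'a="(real, 'n) vec"] emeasure_ball[OF ball_radius_nonneg[where 'a="(real, 'n) vec" and c="?c"], of "0 :: (real, 'n) vec"] by simp
    ultimately have "ennreal (?V * R ^ DIM((real, 'n) vec)) = ennreal (?V * (?r ?c) ^ DIM((real, 'n) vec))" by simp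
    then have "?V * R ^ DIM((real, 'n) vec) = ?V * (?r ?c) ^ DIM((real, 'n) vec)"
      using R ball_radius_nonneg[where 'a="(real, 'n) vec" and c="?c"] by (subst (asm) ennreal_inj) auto
    then have "R ^ DIM((real, 'n) vec) = (?r ?c) ^ DIM((real, 'n) vec)" using less_imp_neq[OF V, symmetric] by simp
    then show "R = ?r ?c" using R ball_radius_nonneg[where 'a="(real, 'n) vec" and c="?c"] by (intro power_eq_imp_eq_base[of R _ "?r ?c"]) auto
  qed
  then show ?thesis by (simp add: rearr_set_def)
qed

context
  fixes f :: "'a::euclidean_space \<Rightarrow> ennreal"
  assumes f[measurable]: "f \<in> borel_measurable borel"
    and st: "\<And>e. norm e = 1 \<Longrightarrow> AE x in lborel. f x = steiner e f x"
begin

text \<open>The two points lie on a line in the direction of \<open>v\<close>, and on this line a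
  larger norm means a larger distance from the center, where the symmetrization is largest. The
  exceptional null set depends on \<open>v\<close>.\<close>

lemma steiner_invariant_shift: "AE \<xi> in lborel. norm \<xi> < norm (\<xi> + v) \<longrightarrow> f (\<xi> + v) \<le> f \<xi>"
proof (cases "v = 0")
  case False
  define e where "e = v /\<^sub>R norm v"
  have e: "norm e = 1" using False by (simp add: e_def)
  have ee: "e \<bullet> e = 1" using e by (simp add: norm_eq_1)
  have v: "v = norm v *\<^sub>R e" using False by (simp add: e_def)
  note ld = line_dominated_steiner[OF f e]
  show ?thesis using st[OF e] AE_translate[OF st[OF e], of v]
  proof eventually_elim
    fix \<xi> assume 1: "f \<xi> = steiner e f \<xi>" and 2: "f (\<xi> + v) = steiner e f (\<xi> + v)"
    show "norm \<xi> < norm (\<xi> + v) \<longrightarrow> f (\<xi> + v) \<le> f \<xi>"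
    proof
      assume less: "norm \<xi> < norm (\<xi> + v)"
      have hv: "hproj e v = 0" unfolding hproj_def by (subst (1 2) v) (simp add: ee)
      have h: "hproj e (\<xi> + v) = hproj e \<xi>" using hv by (simp add: hproj_def algebra_simps)
      have d1: "\<xi> = hproj e \<xi> + (\<xi> \<bullet> e) *\<^sub>R e" by (simp add: hproj_decomp)
      have d2: "\<xi> + v = hproj e \<xi> + ((\<xi> + v) \<bullet> e) *\<^sub>R e" using hproj_decomp[of e "\<xi> + v"] h by simp
      have "(norm \<xi>)\<^sup>2 < (norm (\<xi> + v))\<^sup>2" using less by (intro power_strict_mono) auto
      moreover have "(norm \<xi>)\<^sup>2 = (norm (hproj e \<xi>))\<^sup>2 + (\<xi> \<bullet> e)\<^sup>2" using norm_line[OF e, of \<xi> "\<xi> \<bullet> e"] d1 by simp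
      moreover have "(norm (\<xi> + v))\<^sup>2 = (norm (hproj e \<xi>))\<^sup>2 + ((\<xi> + v) \<bullet> e)\<^sup>2" using norm_line[OF e, of \<xi> "(\<xi> + v) \<bullet> e"] d2 by simp
      ultimately have "(\<xi> \<bullet> e)\<^sup>2 \<le> ((\<xi> + v) \<bullet> e)\<^sup>2" by simp
      then have "\<bar>\<xi> \<bullet> e\<bar> \<le> \<bar>(\<xi> + v) \<bullet> e\<bar>" by (simp add: abs_le_square_iff)
      moreover have "symdec (\<lambda>s. steiner e f (hproj e \<xi> + s *\<^sub>R e))" using ld by (simp add: line_dominated_def)
      ultimately have "steiner e f (hproj e \<xi> + ((\<xi> + v) \<bullet> e) *\<^sub>R e) \<le> steiner e f (hproj e \<xi> + (\<xi> \<bullet> e) *\<^sub>R e)"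
        by (intro symdecD[of "\<lambda>s. steiner e f (hproj e \<xi> + s *\<^sub>R e)"])
      then show "f (\<xi> + v) \<le> f \<xi>" using 1 2 d1 d2 by simp
    qed
  qed
qed simp

text \<open>Fubini exchanges the quantifiers over the point and the shift, so the null sets of the
  uncountably many directions never have to be united.\<close>

lemma steiner_invariant_AE_decreasing: "AE \<xi> in lborel. AE \<eta> in lborel. norm \<xi> < norm \<eta> \<longrightarrow> f \<eta> \<le> f \<xi>"
proof -
  have "AE v in lborel. AE \<xi> in lborel. norm \<xi> < norm (\<xi> + v) \<longrightarrow> f (\<xi> + v) \<le> f \<xi>"
    by (intro AE_I2 steiner_invariant_shift)
  then have "AE \<xi> in lborel. AE v in lborel. norm \<xi> < norm (\<xi> + v) \<longrightarrow> f (\<xi> + v) \<le> f \<xi>"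
    by (subst lborel_pair.AE_commute) measurable
  then show ?thesis
  proof eventually_elim
    fix \<xi> assume "AE v in lborel. norm \<xi> < norm (\<xi> + v) \<longrightarrow> f (\<xi> + v) \<le> f \<xi>"
    from AE_translate[OF this, of "- \<xi>"] show "AE \<eta> in lborel. norm \<xi> < norm \<eta> \<longrightarrow> f \<eta> \<le> f \<xi>" by simp
  qed
qed

text \<open>The superlevel set and the ball have equal finite measure, so if one difference has
  positive measure, both have. Then almost every point of the ball outside the superlevel set has a
  smaller norm and a smaller value than all superlevel points outside the ball, against the almost
  everywhere monotonicity of \<open>f\<close>.\<close>

lemma steiner_invariant_level_ball:
  assumes fin: "emeasure lborel {x. c < f x} < \<infinity>"
  shows "AE x in lborel. x \<in> ball 0 (ball_radius TYPE('a) (emeasure lborel {x. c < f x})) \<longleftrightarrow> c < f x"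
proof -
  let ?E = "{x. c < f x}" and ?B = "ball (0::'a) (ball_radius TYPE('a) (emeasure lborel {x. c < f x}))"
  have Em: "?E \<in> sets lborel" by measurable
  have Bm: "?B \<in> sets lborel" by simp
  have eq: "emeasure lborel ?B = emeasure lborel ?E" by (rule emeasure_ball_radius[OF fin])
  have s1: "emeasure lborel ?E = emeasure lborel (?E \<inter> ?B) + emeasure lborel (?E - ?B)" by (rule emeasure_Int_Diff[OF Em Bm])
  have s2: "emeasure lborel ?B = emeasure lborel (?E \<inter> ?B) + emeasure lborel (?B - ?E)"
    using emeasure_Int_Diff[OF Bm Em] by (simp only: Int_commute)
  have "emeasure lborel (?E \<inter> ?B) \<le> emeasure lborel ?E" using Em by (intro emeasure_mono) auto
  then have "emeasure lborel (?E \<inter> ?B) < \<infinity>" using fin by (rule le_less_trans)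
  moreover have "emeasure lborel (?E \<inter> ?B) + emeasure lborel (?E - ?B) = emeasure lborel (?E \<inter> ?B) + emeasure lborel (?B - ?E)"
    by (simp only: s1[symmetric] s2[symmetric] eq)
  ultimately have D: "emeasure lborel (?E - ?B) = emeasure lborel (?B - ?E)" by (auto simp: ennreal_add_left_cancel)
  have nE: "?E - ?B \<in> null_sets lborel"
  proof (rule ccontr)
    assume non: "?E - ?B \<notin> null_sets lborel"
    then have "?B - ?E \<notin> null_sets lborel" using D Em Bm by (auto simp: null_sets_def)
    then have "\<not> (AE x in lborel. x \<notin> ?B - ?E)" using Em Bm by (simp add: AE_iff_null_sets sets.Diff)
    then obtain \<xi> where \<xi>: "\<xi> \<in> ?B - ?E" "AE \<eta> in lborel. norm \<xi> < norm \<eta> \<longrightarrow> f \<eta> \<le> f \<xi>"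
      using steiner_invariant_AE_decreasing by (metis (mono_tags, lifting) eventually_mono)
    from \<xi>(2) have "AE \<eta> in lborel. \<eta> \<notin> ?E - ?B"
      by eventually_elim (use \<xi>(1) in auto)
    then have "?E - ?B \<in> null_sets lborel" using Em Bm by (simp add: AE_iff_null_sets sets.Diff)
    with non show False ..
  qed
  then have nB: "?B - ?E \<in> null_sets lborel" using D Em Bm by (auto simp: null_sets_def)
  show ?thesis using AE_not_in[OF nE] AE_not_in[OF nB] by eventually_elim auto
qed

end

lemma LINT_layer:
  assumes "c \<ge> 0"
  shows "(\<integral>t. indicator {0<..} t * (if t < c then 1 else 0 :: real) \<partial>lborel) = c"
proof -
  have "(\<integral>t. indicator {0<..} t * (if t < c then 1 else 0 :: real) \<partial>lborel) = (\<integral>t. indicator {0<..<c} t \<partial>lborel)"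
    by (intro Bochner_Integration.integral_cong) (auto simp: indicator_def)
  then show ?thesis using assms by simp
qed

text \<open>Changing a function on a null set does not change the measure of its superlevel sets,
  and those at positive heights have finite measure. The rearrangement thus has this formula in
  terms of a Borel representative at every \<open>x\<close>, from which exact radiality and
  measurability can be read off.\<close>

lemma
  fixes G g :: "(real, 'n::finite) vec \<Rightarrow> complex"
  assumes g[measurable]: "g \<in> borel_measurable borel" and gL2: "l2sq g < \<infinity>"
    and Gm: "G \<in> borel_measurable lebesgue" and Gg: "AE x in lebesgue. G x = g x"
  shows rearr_eq: "rearr G x = (\<integral>t. indicator {0<..} t * (if norm x < ball_radius TYPE((real, 'n) vec) (emeasure lborel {y. ennreal t < enorm g y}) then 1 else 0) \<partial>lborel)"
    and level_finite: "t > 0 \<Longrightarrow> emeasure lborel {y. ennreal t < enorm g y} < \<infinity>"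
proof -
  have fin: "emeasure lborel {y. ennreal t < enorm g y} < \<infinity>" if "t > 0" for t
  proof -
    have "emeasure lborel {y. ennreal t < enorm g y} = (\<integral>\<^sup>+y. indicator {y. ennreal t < enorm g y} y \<partial>lborel)" by simp
    also have "\<dots> \<le> (\<integral>\<^sup>+y. ennreal (1 / t\<^sup>2) * (enorm g y)\<^sup>2 \<partial>lborel)"
    proof (rule nn_integral_mono)
      fix y
      show "indicator {y. ennreal t < enorm g y} y \<le> ennreal (1 / t\<^sup>2) * (enorm g y)\<^sup>2"
      proof (cases "ennreal t < enorm g y")
        case True
        have "1 = ennreal (1 / t\<^sup>2) * (ennreal t)\<^sup>2"
          using that by (simp add: ennreal_power flip: ennreal_mult)
        also have "\<dots> \<le> ennreal (1 / t\<^sup>2) * (enorm g y)\<^sup>2"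
          using True by (intro mult_left_mono power_mono) auto
        finally show ?thesis using True by simp
      qed simp
    qed
    also have "\<dots> = ennreal (1 / t\<^sup>2) * l2sq g" unfolding l2sq_enorm by (rule nn_integral_cmult) measurable
    also have "\<dots> < \<infinity>" using gL2 by (simp add: ennreal_mult_less_top)
    finally show ?thesis .
  qed
  then show "t > 0 \<Longrightarrow> emeasure lborel {y. ennreal t < enorm g y} < \<infinity>" by blast
  have lev: "emeasure lebesgue {y. cmod (G y) > t} = emeasure lborel {y. ennreal t < enorm g y}" if "t > 0" for t
  proof -
    have m: "{y. ennreal t < enorm g y} \<in> sets borel" by measurable
    have "emeasure lebesgue {y. cmod (G y) > t} = emeasure lebesgue {y. ennreal t < enorm g y}"
    proof (rule emeasure_eq_AE)
      show "AE y in lebesgue. (y \<in> {y. t < cmod (G y)}) = (y \<in> {y. ennreal t < enorm g y})"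
        using Gg by eventually_elim (use that in \<open>simp add: enorm_def ennreal_less_iff\<close>)
      have "{y \<in> space lebesgue. t < cmod (G y)} \<in> sets lebesgue" using Gm by measurable
      then show "{y. t < cmod (G y)} \<in> sets lebesgue" by simp
      show "{y. ennreal t < enorm g y} \<in> sets lebesgue" using m by simp
    qed
    also have "\<dots> = emeasure lborel {y. ennreal t < enorm g y}" using m by (simp add: emeasure_completion)
    finally show ?thesis .
  qed
  show "rearr G x = (\<integral>t. indicator {0<..} t * (if norm x < ball_radius TYPE((real, 'n) vec) (emeasure lborel {y. ennreal t < enorm g y}) then 1 else 0) \<partial>lborel)"
    unfolding rearr_def set_lebesgue_integral_def
  proof (rule Bochner_Integration.integral_cong)
    fix t :: real
    show "indicator {0<..} t *\<^sub>R indicator (rearr_set {y. t < cmod (G y)}) x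
      = indicator {0<..} t * (if norm x < ball_radius TYPE((real, 'n) vec) (emeasure lborel {y. ennreal t < enorm g y}) then 1 else 0 :: real)"
    proof (cases "t > 0")
      case True
      show ?thesis using fin[OF True] lev[OF True] rearr_set_ball[of "{y. t < cmod (G y)}"] True
        by (simp add: indicator_def)
    qed simp
  qed simp
qed

text \<open>At each height the superlevel set is a ball up to a null set. Fubini makes this hold,
  for almost every \<open>x\<close>, at almost every height, and integration over the heights
  recovers |g|.\<close>

lemma rearr_steiner_invariant:
  fixes G g :: "(real, 'n::finite) vec \<Rightarrow> complex"
  assumes g[measurable]: "g \<in> borel_measurable borel" and gL2: "l2sq g < \<infinity>"
    and Gm: "G \<in> borel_measurable lebesgue" and Gg: "AE x in lebesgue. G x = g x"
    and st: "\<And>e. norm e = 1 \<Longrightarrow> AE x in lborel. enorm g x = steiner e (enorm g) x"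
  shows "AE x in lborel. rearr G x = cmod (g x)"
proof -
  let ?r = "\<lambda>t. ball_radius TYPE((real, 'n) vec) (emeasure lborel {y. ennreal t < enorm g y})"
  have "AE x in lborel. t > 0 \<longrightarrow> (norm x < ?r t \<longleftrightarrow> ennreal t < enorm g x)" for t
  proof (cases "t > 0")
    case True
    show ?thesis using steiner_invariant_level_ball[OF _ st level_finite[OF assms(1-4) True]]
      by (auto elim!: eventually_mono)
  qed simp
  then have "AE t in lborel. AE x in lborel. t > 0 \<longrightarrow> (norm x < ?r t \<longleftrightarrow> ennreal t < enorm g x)" by simp
  then have "AE x in lborel. AE t in lborel. t > 0 \<longrightarrow> (norm x < ?r t \<longleftrightarrow> ennreal t < enorm g x)"
    by (subst lborel_pair.AE_commute) measurable
  then show ?thesis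
  proof eventually_elim
    fix x assume ae: "AE t in lborel. t > 0 \<longrightarrow> (norm x < ?r t \<longleftrightarrow> ennreal t < enorm g x)"
    have "rearr G x = (\<integral>t. indicator {0<..} t * (if norm x < ?r t then 1 else 0) \<partial>lborel)"
      by (rule rearr_eq[OF assms(1-4)])
    also have "\<dots> = (\<integral>t. indicator {0<..} t * (if t < cmod (g x) then 1 else 0) \<partial>lborel)"
    proof (rule integral_cong_AE)
      show "AE t in lborel. indicator {0<..} t * (if norm x < ?r t then 1 else 0) = (indicator {0<..} t * (if t < cmod (g x) then 1 else 0) :: real)"
        using ae by eventually_elim (auto simp: indicator_def enorm_def ennreal_less_iff)
    qed measurable
    also have "\<dots> = cmod (g x)" by (rule LINT_layer) simp
    finally show "rearr G x = cmod (g x)" .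
  qed
qed

lemma rearr_measurable:
  assumes g[measurable]: "g \<in> borel_measurable borel" and gL2: "l2sq g < \<infinity>"
    and Gm: "G \<in> borel_measurable lebesgue" and Gg: "AE x in lebesgue. G x = g x"
  shows "rearr G \<in> borel_measurable borel"
  unfolding rearr_eq[OF assms, abs_def] by measurable

lemma rearr_radial:
  assumes "g \<in> borel_measurable borel" "l2sq g < \<infinity>" "G \<in> borel_measurable lebesgue" "AE x in lebesgue. G x = g x" "norm x = norm y"
  shows "rearr G x = rearr G y"
  unfolding rearr_eq[OF assms(1-4)] using assms(5) by simp

section \<open>The phase of the transform\<close>

text \<open>Averaging over a short interval shows that \<open>v\<close> is differentiable and solves \<open>v' = l v\<close>.\<close>

lemma local_character:
  fixes v :: "real \<Rightarrow> complex"
  assumes \<rho>: "\<rho> > 0" and cont: "continuous_on {-\<rho><..<\<rho>} v" and v0: "v 0 = 1"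
    and mult: "\<And>s t. \<bar>s\<bar> < \<rho> \<Longrightarrow> \<bar>t\<bar> < \<rho> \<Longrightarrow> \<bar>s + t\<bar> < \<rho> \<Longrightarrow> v (s + t) = v s * v t"
    and norm: "\<And>s. \<bar>s\<bar> < \<rho> \<Longrightarrow> cmod (v s) = 1"
  obtains a where "\<And>s. \<bar>s\<bar> < \<rho> / 2 \<Longrightarrow> v s = cis (a * s)"
proof -
  have "isCont v 0" using cont \<rho> by (simp add: continuous_on_eq_continuous_at)
  then have "\<exists>d>0. \<forall>s. norm (s - 0) < d \<longrightarrow> norm (v s - v 0) < 1 / 2"
    unfolding continuous_at_eps_delta by (rule allE[of _ "1/2"]) (simp add: dist_norm)
  then obtain \<delta> where \<delta>: "\<delta> > 0" "\<And>s. \<bar>s\<bar> < \<delta> \<Longrightarrow> cmod (v s - 1) < 1 / 2"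
    using v0 by auto
  \<comment> \<open>On [0, r] the function \<open>v\<close> stays within 1 / 2 of 1, so its integral
    there is not 0; and s + r remains inside the domain for |s| < \<rho> / 2.\<close>
  define r where "r = min \<delta> \<rho> / 4"
  have r: "r > 0" "r < \<delta>" "r < \<rho> / 4 + \<rho> / 8" using \<delta> \<rho> by (auto simp: r_def)
  have sub: "{a..b} \<subseteq> {-\<rho><..<\<rho>}" if "-\<rho> < a" "b < \<rho>" for a b using that by auto
  have int: "v integrable_on {a..b}" if "-\<rho> < a" "b < \<rho>" for a b
    using continuous_on_subset[OF cont sub[OF that]] by (rule integrable_continuous_interval)
  define I where "I = integral {0..r} v"
  have "I \<noteq> 0"
  proof
    assume "I = 0"
    have "((\<lambda>t. v t - 1) has_integral (I - r *\<^sub>R 1)) {0..r}"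
    proof -
      have "(v has_integral I) {0..r}" unfolding I_def using int[of 0 r] r \<rho> by (simp add: integrable_integral)
      moreover have "((\<lambda>t. 1 :: complex) has_integral (r *\<^sub>R 1)) {0..r}" using has_integral_const_real[of "1::complex" 0 r] r by simp
      ultimately show ?thesis by (rule has_integral_diff)
    qed
    then have "norm (I - r *\<^sub>R 1) \<le> 1 / 2 * measure lborel {0..r}"
      by (rule has_integral_bound_real[of _ "{}", rotated 2]) (use \<delta> r in \<open>auto intro: less_imp_le\<close>)
    then show False using \<open>I = 0\<close> r by simp
  qed
  \<comment> \<open>A primitive of \<open>v\<close>. By multiplicativity \<open>v s\<close> times
    the integral of \<open>v\<close> over [0, r] is F (s + r) - F s, which is differentiable
    although \<open>v\<close> is only known to be continuous. The range up to 7 \<rho> / 8 has room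
    for s + r, since r < 3 \<rho> / 8.\<close>
  define F where "F x = integral {-\<rho>/2..x} v" for x
  have F_deriv: "(F has_vector_derivative v x) (at x)" if "-\<rho>/2 < x" "x < 7 * \<rho> / 8" for x
  proof -
    have "((\<lambda>u. integral {-\<rho>/2..u} v) has_vector_derivative v x) (at x within {-\<rho>/2..7*\<rho>/8})"
      by (rule integral_has_vector_derivative[OF continuous_on_subset[OF cont]]) (use that \<rho> in auto)
    then have "(F has_vector_derivative v x) (at x within {-\<rho>/2..7*\<rho>/8})" by (simp add: F_def[abs_def])
    then have "(F has_vector_derivative v x) (at x within {-\<rho>/2<..<7*\<rho>/8})"
      by (rule has_vector_derivative_within_subset) auto
    then show ?thesis
      by (rule iffD1[OF has_vector_derivative_within_open, rotated 2]) (use that in auto)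
  qed
  have vF: "v s = (F (s + r) - F s) / I" if "\<bar>s\<bar> < \<rho> / 2" for s
  proof -
    have "integral {0..r} (\<lambda>t. v s * v t) = integral {0..r} (v \<circ> (\<lambda>t. t + s))"
      by (rule integral_cong) (use mult[of s] that r \<rho> in \<open>auto simp: add.commute\<close>)
    also have "\<dots> = integral {0 + s..r + s} v"
      by (rule integral_shift, rule continuous_on_subset[OF cont]) (use that r \<rho> in auto)
    also have "\<dots> = F (s + r) - F s"
    proof -
      have "integral {-\<rho>/2..s} v + integral {s..s + r} v = integral {-\<rho>/2..s + r} v"
        by (rule Henstock_Kurzweil_Integration.integral_combine) (use that r \<rho> in \<open>auto intro!: int\<close>)
      then show ?thesis by (simp add: F_def add.commute algebra_simps)
    qed
    finally have "v s * I = F (s + r) - F s" by (simp add: I_def)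
    then show ?thesis using \<open>I \<noteq> 0\<close> by (simp add: field_simps)
  qed
  define l where "l = (v r - 1) / I"
  have v_deriv: "(v has_vector_derivative l * v s) (at s)" if "\<bar>s\<bar> < \<rho> / 2" for s
  proof -
    have "((\<lambda>s. F (s + r)) has_vector_derivative v (s + r)) (at s)"
    proof -
      have "(F has_vector_derivative v (s + r)) (at (s + r))" using that r \<rho> by (intro F_deriv) auto
      moreover have "((\<lambda>s. s + r) has_vector_derivative 1) (at s)" by (auto intro!: derivative_eq_intros)
      ultimately have "(F \<circ> (\<lambda>s. s + r) has_vector_derivative 1 *\<^sub>R v (s + r)) (at s)"
        by (intro vector_diff_chain_at) auto
      then show ?thesis by (simp add: comp_def)
    qed
    then have "((\<lambda>s. (F (s + r) - F s) * inverse I) has_vector_derivative (v (s + r) - v s) * inverse I) (at s)"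
      using F_deriv[of s] that \<rho> by (intro has_vector_derivative_mult_left has_vector_derivative_diff) auto
    moreover have "(v (s + r) - v s) * inverse I = l * v s"
    proof -
      have "v (s + r) = v s * v r" using that r \<rho> by (intro mult) auto
      then show ?thesis by (simp add: l_def divide_inverse algebra_simps)
    qed
    ultimately have "((\<lambda>s. (F (s + r) - F s) * inverse I) has_vector_derivative l * v s) (at s)" by simp
    then show ?thesis
    proof (rule has_vector_derivative_transform_within_open[where S="{-\<rho>/2<..<\<rho>/2}"])
      fix x assume "x \<in> {-\<rho>/2<..<\<rho>/2}"
      then have "\<bar>x\<bar> < \<rho> / 2" by auto
      from vF[OF this, symmetric] show "(F (x + r) - F x) * inverse I = v x" by (simp only: divide_inverse)
    qed (use that in auto)
  qed
  define w where "w s = v s * exp (- l * of_real s)" for s :: real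
  have w_deriv: "(w has_derivative (\<lambda>_. 0)) (at s within {-\<rho>/2<..<\<rho>/2})" if "s \<in> {-\<rho>/2<..<\<rho>/2}" for s
  proof -
    have e: "((\<lambda>s::real. exp (- l * of_real s)) has_vector_derivative exp (- l * of_real s) * - l) (at s)"
      by (rule has_vector_derivative_real_field) (auto intro!: derivative_eq_intros)
    have "(w has_vector_derivative (v s * (exp (- l * of_real s) * - l) + l * v s * exp (- l * of_real s))) (at s)"
      unfolding w_def using that by (intro has_vector_derivative_mult v_deriv e) auto
    then have "(w has_vector_derivative 0) (at s)" by (simp add: algebra_simps)
    then show ?thesis by (auto simp: has_vector_derivative_def intro: has_derivative_at_withinI)
  qed
  have "\<exists>c. \<forall>s\<in>{-\<rho>/2<..<\<rho>/2}. w s = c"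
    by (rule has_derivative_zero_constant[OF _ w_deriv]) auto
  then obtain c where c: "\<And>s. s \<in> {-\<rho>/2<..<\<rho>/2} \<Longrightarrow> w s = c" by blast
  have "c = 1" using c[of 0] \<rho> v0 by (simp add: w_def)
  have ve: "v s = exp (l * of_real s)" if "\<bar>s\<bar> < \<rho> / 2" for s
  proof -
    have "s \<in> {-\<rho>/2<..<\<rho>/2}" using that by auto
    from c[OF this] have "v s * exp (- l * of_real s) = 1" unfolding w_def \<open>c = 1\<close> .
    then have "v s * exp (- l * of_real s) * exp (l * of_real s) = exp (l * of_real s)" by simp
    then show ?thesis by (simp add: mult.assoc flip: exp_add)
  qed
  have "Re l = 0"
  proof -
    have "cmod (v (\<rho> / 4)) = 1" using \<rho> by (intro norm) auto
    then have "exp (Re l * (\<rho> / 4)) = 1" using ve[of "\<rho>/4"] \<rho> by simp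
    then show ?thesis using \<rho> by simp
  qed
  then have l: "l = \<i> * of_real (Im l)" by (simp add: complex_eq_iff)
  show ?thesis
  proof (rule that)
    fix s assume "\<bar>s\<bar> < \<rho> / 2"
    from ve[OF this] have "v s = exp (\<i> * of_real (Im l) * of_real s)" using l by simp
    then show "v s = cis (Im l * s)" by (simp add: cis_conv_exp mult.assoc)
  qed
qed

text \<open>The characters along the coordinate axes determine \<open>a\<close>, and
  multiplicativity assembles them near 0. A general \<open>x\<close> in \<open>D\<close> is reached
  in \<open>n\<close> equal steps along its segment from 0; all intermediate points stay in
  \<open>D\<close>, because \<open>D\<close> contains every point of smaller norm.\<close>

lemma continuous_character:
  fixes v :: "'a::euclidean_space \<Rightarrow> complex"
  assumes D: "open D" "0 \<in> D" "\<And>x y. x \<in> D \<Longrightarrow> norm y \<le> norm x \<Longrightarrow> y \<in> D"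
    and cont: "continuous_on UNIV v" and v0: "v 0 = 1"
    and mult: "\<And>x y. x \<in> D \<Longrightarrow> y \<in> D \<Longrightarrow> x + y \<in> D \<Longrightarrow> v (x + y) = v x * v y"
    and norm: "\<And>x. x \<in> D \<Longrightarrow> cmod (v x) = 1"
  obtains a where "\<And>x. x \<in> D \<Longrightarrow> v x = cis (a \<bullet> x)"
proof -
  obtain \<epsilon> where \<epsilon>: "\<epsilon> > 0" "ball 0 \<epsilon> \<subseteq> D" using D(1,2) open_contains_ball by blast
  have "\<exists>a. \<forall>s. \<bar>s\<bar> < \<epsilon> / 2 \<longrightarrow> v (s *\<^sub>R b) = cis (a * s)" if b: "b \<in> Basis" for b
  proof -
    have inD: "s *\<^sub>R b \<in> D" if "\<bar>s\<bar> < \<epsilon>" for s using \<epsilon> that b by auto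
    obtain a where "\<And>s. \<bar>s\<bar> < \<epsilon> / 2 \<Longrightarrow> v (s *\<^sub>R b) = cis (a * s)"
    proof (rule local_character[of \<epsilon> "\<lambda>s. v (s *\<^sub>R b)"])
      show "continuous_on {-\<epsilon><..<\<epsilon>} (\<lambda>s. v (s *\<^sub>R b))"
        by (rule continuous_on_compose2[OF cont]) (auto intro!: continuous_intros)
      show "v ((s + t) *\<^sub>R b) = v (s *\<^sub>R b) * v (t *\<^sub>R b)" if "\<bar>s\<bar> < \<epsilon>" "\<bar>t\<bar> < \<epsilon>" "\<bar>s + t\<bar> < \<epsilon>" for s t
        using mult[OF inD[OF that(1)] inD[OF that(2)]] inD[OF that(3)] by (simp add: scaleR_add_left)
    qed (use \<epsilon> v0 norm inD in auto)
    then show ?thesis by blast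
  qed
  then obtain a where a: "\<And>b s. b \<in> Basis \<Longrightarrow> \<bar>s\<bar> < \<epsilon> / 2 \<Longrightarrow> v (s *\<^sub>R b) = cis (a b * s)" by metis
  define A where "A = (\<Sum>b\<in>Basis. a b *\<^sub>R b)"
  have Ax: "A \<bullet> x = (\<Sum>b\<in>Basis. a b * (x \<bullet> b))" for x
    unfolding A_def by (simp add: inner_sum_right inner_commute[of _ x])
  let ?d = "real DIM('a)"
  have d: "?d \<ge> 1" using DIM_positive[where 'a='a] by linarith
  \<comment> \<open>The radius is divided by the dimension so that each partial sum of the
    coordinate expansion has norm below \<epsilon> / 2 and thus stays in \<open>D\<close>, where
    multiplicativity is available.\<close>
  have small: "v x = cis (A \<bullet> x)" if x: "norm x < \<epsilon> / (2 * ?d)" for x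
  proof -
    have xb: "\<bar>x \<bullet> b\<bar> < \<epsilon> / 2" if "b \<in> Basis" for b
    proof -
      have "\<bar>x \<bullet> b\<bar> \<le> norm x" using that by (rule Basis_le_norm)
      also have "\<dots> < \<epsilon> / (2 * ?d)" by (rule x)
      also have "\<dots> \<le> \<epsilon> / 2" using d \<epsilon> by (intro divide_left_mono) auto
      finally show ?thesis .
    qed
    have "v (\<Sum>b\<in>B. (x \<bullet> b) *\<^sub>R b) = cis (\<Sum>b\<in>B. a b * (x \<bullet> b)) \<and> (\<Sum>b\<in>B. (x \<bullet> b) *\<^sub>R b) \<in> D" if "B \<subseteq> Basis" for B
    proof -
      have "finite B" using that finite_Basis finite_subset by blast
      then show ?thesis using that
      proof (induction B)
        case empty
        show ?case using v0 D(2) by simp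
      next
        case (insert b B)
        have inD: "(\<Sum>b\<in>insert b B. (x \<bullet> b) *\<^sub>R b) \<in> D"
        proof -
          have "norm ((x \<bullet> c) *\<^sub>R c) \<le> norm x" if "c \<in> Basis" for c
            using that Basis_le_norm[OF that, of x] by simp
          then have "norm (\<Sum>b\<in>insert b B. (x \<bullet> b) *\<^sub>R b) \<le> (\<Sum>b\<in>insert b B. norm x)"
            using insert.prems by (intro sum_norm_le) blast
          also have "\<dots> \<le> (\<Sum>b\<in>(Basis::'a set). norm x)" using insert.prems by (intro sum_mono2) auto
          also have "\<dots> = ?d * norm x" by simp
          also have "\<dots> < ?d * (\<epsilon> / (2 * ?d))" using x d by (intro mult_strict_left_mono) auto
          also have "\<dots> < \<epsilon>" using d \<epsilon> by simp
          finally show ?thesis using \<epsilon> by auto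
        qed
        have b: "b \<in> Basis" using insert.prems by auto
        have bD: "(x \<bullet> b) *\<^sub>R b \<in> D" using xb[OF b] b \<epsilon> by auto
        have "v (\<Sum>b\<in>insert b B. (x \<bullet> b) *\<^sub>R b) = v ((x \<bullet> b) *\<^sub>R b) * v (\<Sum>b\<in>B. (x \<bullet> b) *\<^sub>R b)"
        proof -
          have e: "(\<Sum>b\<in>insert b B. (x \<bullet> b) *\<^sub>R b) = (x \<bullet> b) *\<^sub>R b + (\<Sum>b\<in>B. (x \<bullet> b) *\<^sub>R b)"
            using insert.hyps by (rule sum.insert)
          have "(\<Sum>b\<in>B. (x \<bullet> b) *\<^sub>R b) \<in> D" using insert by auto
          then show ?thesis using mult[OF bD] inD unfolding e by blast
        qed
        also have "\<dots> = cis (a b * (x \<bullet> b)) * cis (\<Sum>b\<in>B. a b * (x \<bullet> b))"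
          using insert a[OF b xb[OF b]] by auto
        also have "\<dots> = cis (\<Sum>b\<in>insert b B. a b * (x \<bullet> b))" using insert by (simp add: cis_mult)
        finally show ?case using inD by blast
      qed
    qed
    from this[of Basis] show ?thesis by (simp add: euclidean_representation Ax)
  qed
  show ?thesis
  proof (rule that)
    fix x assume xD: "x \<in> D"
    obtain n :: nat where n: "norm x * (2 * ?d) / \<epsilon> < real n" using reals_Archimedean2 by blast
    have "0 \<le> norm x * (2 * ?d) / \<epsilon>" using \<epsilon> by auto
    then have n0: "real n > 0" using n by linarith
    define y where "y = x /\<^sub>R real n"
    have "norm y < \<epsilon> / (2 * ?d)" using n n0 \<epsilon> d by (simp add: y_def field_simps)
    then have vy: "v y = cis (A \<bullet> y)" by (rule small)
    have kD: "real k *\<^sub>R y \<in> D" if "k \<le> n" for k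
    proof (rule D(3)[OF xD])
      have "real k / real n \<le> 1" using that n0 by simp
      then have "real k / real n * norm x \<le> 1 * norm x" by (intro mult_right_mono) auto
      then show "norm (real k *\<^sub>R y) \<le> norm x" by (simp add: y_def divide_inverse mult_ac)
    qed
    have "v (real k *\<^sub>R y) = v y ^ k" if "k \<le> n" for k
      using that
    proof (induction k)
      case (Suc k)
      have "v (real (Suc k) *\<^sub>R y) = v (y + real k *\<^sub>R y)" by (simp add: scaleR_add_left)
      also have "\<dots> = v y * v (real k *\<^sub>R y)"
        using kD[of 1] kD[of k] kD[of "Suc k"] Suc.prems by (intro mult) (auto simp: scaleR_add_left)
      finally show ?case using Suc by simp
    qed (simp add: v0)
    from this[of n] have "v x = cis (A \<bullet> y) ^ n" using n0 by (simp add: y_def vy[unfolded y_def])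
    also have "\<dots> = cis (real n * (A \<bullet> y))" by (simp add: Complex.DeMoivre)
    also have "real n * (A \<bullet> y) = A \<bullet> x" using n0 by (simp add: y_def)
    finally show "v x = cis (A \<bullet> x)" .
  qed
qed

text \<open>For the integral defining \<open>g * g\<close> at \<open>\<eta>\<close> this makes the phase of \<open>g y * g (\<eta> - y)\<close>
  independent of \<open>y\<close>.\<close>

lemma integral_norm_eq_phase:
  fixes F :: "'a \<Rightarrow> complex"
  assumes F: "integrable M F" and eq: "cmod (\<integral>x. F x \<partial>M) = (\<integral>x. cmod (F x) \<partial>M)"
  shows "AE x in M. F x = sgn (\<integral>x. F x \<partial>M) * cmod (F x)"
proof -
  let ?I = "\<integral>x. F x \<partial>M"
  let ?c = "sgn ?I"
  have c1: "cmod ?c \<le> 1" by (simp add: norm_sgn)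
  have le: "Re (cnj ?c * F x) \<le> cmod (F x)" for x
  proof -
    have "Re (cnj ?c * F x) \<le> cmod (cnj ?c * F x)" by (rule complex_Re_le_cmod)
    also have "\<dots> \<le> 1 * cmod (F x)" using c1 unfolding norm_mult by (intro mult_right_mono) auto
    finally show ?thesis by simp
  qed
  have i: "integrable M (\<lambda>x. cmod (F x) - Re (cnj ?c * F x))" using F by auto
  have "(\<integral>x. cmod (F x) - Re (cnj ?c * F x) \<partial>M) = cmod ?I - Re (cnj ?c * ?I)"
    using F by (simp add: eq)
  also have "Re (cnj ?c * ?I) = cmod ?I"
  proof (cases "?I = 0")
    case False
    have "cnj ?c * ?I = complex_of_real ((cmod ?I)\<^sup>2 / cmod ?I)"
      unfolding sgn_div_norm using complex_norm_square[of ?I] by (simp add: scaleR_conv_of_real divide_inverse mult_ac)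
    then show ?thesis using False by (simp add: power2_eq_square)
  qed simp
  finally have "(\<integral>x. cmod (F x) - Re (cnj ?c * F x) \<partial>M) = 0" by simp
  then have "AE x in M. cmod (F x) - Re (cnj ?c * F x) = 0"
    by (subst (asm) integral_nonneg_eq_0_iff_AE[OF i]) (use le in auto)
  then show ?thesis
  proof eventually_elim
    fix x assume *: "cmod (F x) - Re (cnj ?c * F x) = 0"
    show "F x = ?c * cmod (F x)"
    proof (cases "F x = 0 \<or> ?I = 0")
      case True
      then show ?thesis using * by auto
    next
      case False
      then have cc: "cmod ?c = 1" by (simp add: norm_sgn)
      let ?z = "cnj ?c * F x"
      have "cmod ?z = cmod (F x)" using cc by (simp add: norm_mult)
      then have "Re ?z = cmod ?z" using * by simp
      have "z = complex_of_real (cmod z)" if "Re z = cmod z" for z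
        using cmod_power2[of z] that by (intro complex_eqI) auto
      from this[OF \<open>Re ?z = cmod ?z\<close>] have "?z = complex_of_real (cmod (F x))"
        unfolding \<open>cmod ?z = cmod (F x)\<close> .
      then have "?c * ?z = ?c * cmod (F x)" by simp
      moreover have "?c * ?z = F x" using cc complex_norm_square[of ?c] by (simp add: mult.assoc[symmetric])
      ultimately show ?thesis by simp
    qed
  qed
qed

text \<open>A nonempty open set has positive measure. This turns almost everywhere identities
  between continuous functions into identities at every point.\<close>

lemma open_AE_imp_all:
  fixes S C :: "'a::euclidean_space set"
  assumes "open S" "closed C" "AE x in lborel. x \<in> S \<longrightarrow> x \<in> C" "x \<in> S"
  shows "x \<in> C"
proof (rule ccontr)
  assume "x \<notin> C"
  have op: "open (S - C)" using assms by (intro open_Diff)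
  have "AE x in lborel. x \<notin> S - C" using assms(3) by eventually_elim auto
  then have "S - C \<in> null_sets lborel" using op AE_iff_null_sets[of "S - C" lborel] by auto
  then have "negligible (S - C)" by (simp add: negligible_iff_null_sets null_sets_completionI)
  then have "S - C = {}" using open_not_negligible[OF op] by blast
  then show False using assms(4) \<open>x \<notin> C\<close> by auto
qed

text \<open>The phase \<open>\<theta>\<close> is only measurable at the outset. Multiplying \<theta>
  y \<theta> z = C (y + z) by the conjugate of \<theta> z and averaging over a small ball expresses
  \<theta> y as a convolution type integral, which is continuous in \<open>y\<close>. Its continuous
  version satisfies the functional equation at every point of \<open>D\<close> and is, up to a
  constant, a local character.\<close>

theorem phase_is_linear:
  fixes g :: "'a::euclidean_space \<Rightarrow> complex"
  assumes g[measurable]: "g \<in> borel_measurable borel"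
    and D: "open D" "0 \<in> D" "\<And>x y. x \<in> D \<Longrightarrow> norm y \<le> norm x \<Longrightarrow> y \<in> D"
    and gD: "AE x in lborel. g x \<noteq> 0 \<longleftrightarrow> x \<in> D"
    and fin: "AE x in lborel. conv (enorm g) (enorm g) x < \<infinity>"
    and eq: "AE x in lborel. enorm (cconv g g) x = conv (enorm g) (enorm g) x"
  obtains \<beta> a where "AE x in lborel. g x = cis (\<beta> + a \<bullet> x) * cmod (g x)"
proof -
  define \<theta> where "\<theta> y = sgn (g y)" for y
  define C where "C \<eta> = sgn (cconv g g \<eta>)" for \<eta>
  have sgn_m[measurable]: "(sgn :: complex \<Rightarrow> complex) \<in> borel_measurable borel"
    unfolding sgn_div_norm[abs_def] by measurable
  have [measurable]: "\<theta> \<in> borel_measurable borel" "C \<in> borel_measurable borel"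
    unfolding \<theta>_def C_def by measurable
  have [measurable]: "D \<in> sets borel" using D(1) by auto
  have C1: "cmod (C \<eta>) \<le> 1" and \<theta>1: "cmod (\<theta> \<eta>) \<le> 1" for \<eta> by (auto simp: C_def \<theta>_def norm_sgn)
  have \<theta>n: "AE y in lborel. y \<in> D \<longrightarrow> cmod (\<theta> y) = 1"
    using gD by eventually_elim (auto simp: \<theta>_def norm_sgn)
  have "AE \<eta> in lborel. AE y in lborel. g y * g (\<eta> - y) \<noteq> 0 \<longrightarrow> \<theta> y * \<theta> (\<eta> - y) = C \<eta>"
    using fin eq
  proof eventually_elim
    fix \<eta> assume finx: "conv (enorm g) (enorm g) \<eta> < \<infinity>" and eqx: "enorm (cconv g g) \<eta> = conv (enorm g) (enorm g) \<eta>"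
    let ?F = "\<lambda>y. g y * g (\<eta> - y)"
    have nn: "(\<integral>\<^sup>+y. ennreal (cmod (?F y)) \<partial>lborel) = conv (enorm g) (enorm g) \<eta>"
      unfolding conv_def enorm_def by (simp add: norm_mult ennreal_mult)
    have F: "integrable lborel ?F"
    proof (rule integrableI_bounded)
      show "(\<integral>\<^sup>+y. ennreal (norm (?F y)) \<partial>lborel) < \<infinity>" using finx nn by simp
    qed measurable
    have "ennreal (\<integral>y. cmod (?F y) \<partial>lborel) = ennreal (cmod (\<integral>y. ?F y \<partial>lborel))"
      using nn eqx F by (subst nn_integral_eq_integral[symmetric]) (auto simp: enorm_def cconv_def)
    then have "cmod (\<integral>y. ?F y \<partial>lborel) = (\<integral>y. cmod (?F y) \<partial>lborel)"
      by (subst (asm) ennreal_inj) (auto intro: integral_nonneg_AE)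
    from integral_norm_eq_phase[OF F this]
    show "AE y in lborel. g y * g (\<eta> - y) \<noteq> 0 \<longrightarrow> \<theta> y * \<theta> (\<eta> - y) = C \<eta>"
    proof eventually_elim
      fix y assume *: "?F y = sgn (\<integral>y. ?F y \<partial>lborel) * cmod (?F y)"
      show "g y * g (\<eta> - y) \<noteq> 0 \<longrightarrow> \<theta> y * \<theta> (\<eta> - y) = C \<eta>"
      proof
        assume nz: "?F y \<noteq> 0"
        have "?F y = C \<eta> * cmod (?F y)" using * by (simp add: C_def cconv_def)
        moreover have "?F y = sgn (?F y) * cmod (?F y)" using nz by (simp add: sgn_div_norm scaleR_conv_of_real)
        ultimately have "sgn (?F y) * cmod (?F y) = C \<eta> * cmod (?F y)" by simp
        then have "sgn (?F y) = C \<eta>" using nz by simp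
        then show "\<theta> y * \<theta> (\<eta> - y) = C \<eta>" by (simp add: \<theta>_def sgn_mult)
      qed
    qed
  qed
  then have AE1: "AE \<eta> in lborel. AE y in lborel. y \<in> D \<and> \<eta> - y \<in> D \<longrightarrow> \<theta> y * \<theta> (\<eta> - y) = C \<eta>"
  proof eventually_elim
    fix \<eta> assume ae: "AE y in lborel. g y * g (\<eta> - y) \<noteq> 0 \<longrightarrow> \<theta> y * \<theta> (\<eta> - y) = C \<eta>"
    show "AE y in lborel. y \<in> D \<and> \<eta> - y \<in> D \<longrightarrow> \<theta> y * \<theta> (\<eta> - y) = C \<eta>"
      using ae gD AE_reflect[OF gD, of \<eta>] by eventually_elim auto
  qed
  then have "AE y in lborel. AE \<eta> in lborel. y \<in> D \<and> \<eta> - y \<in> D \<longrightarrow> \<theta> y * \<theta> (\<eta> - y) = C \<eta>"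
    by (subst lborel_pair.AE_commute) measurable
  then have AE2: "AE y in lborel. AE z in lborel. y \<in> D \<and> z \<in> D \<longrightarrow> \<theta> y * \<theta> z = C (y + z)"
  proof eventually_elim
    fix y assume "AE \<eta> in lborel. y \<in> D \<and> \<eta> - y \<in> D \<longrightarrow> \<theta> y * \<theta> (\<eta> - y) = C \<eta>"
    from AE_translate[OF this, of y] show "AE z in lborel. y \<in> D \<and> z \<in> D \<longrightarrow> \<theta> y * \<theta> z = C (y + z)"
      by (simp add: add.commute)
  qed
  obtain \<epsilon> where \<epsilon>: "\<epsilon> > 0" "ball 0 \<epsilon> \<subseteq> D" using D(1,2) open_contains_ball by blast
  have [measurable]: "ball (0::'a) \<epsilon> \<in> sets borel" by simp
  define \<phi> where "\<phi> z = indicator (ball 0 \<epsilon>) z * cnj (\<theta> z)" for z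
  have [measurable]: "\<phi> \<in> borel_measurable borel" unfolding \<phi>_def by measurable
  have \<phi>_int: "integrable lborel \<phi>"
  proof (rule integrableI_bounded_set[where A="ball 0 \<epsilon>" and B=1])
    show "AE x in lborel. x \<in> ball 0 \<epsilon> \<longrightarrow> norm (\<phi> x) \<le> 1" using \<theta>1 by (auto simp: \<phi>_def norm_mult)
  qed (auto simp: \<phi>_def emeasure_lborel_ball_finite[unfolded infinity_ennreal_def])
  define K where "K = measure lborel (ball (0::'a) \<epsilon>)"
  have K: "K > 0"
  proof -
    have "emeasure lborel (ball (0::'a) \<epsilon>) = ennreal (unit_ball_vol (DIM('a)) * \<epsilon> ^ DIM('a))" using \<epsilon> by (intro emeasure_ball) auto
    then have "K = unit_ball_vol (DIM('a)) * \<epsilon> ^ DIM('a)" using \<epsilon> by (simp add: K_def measure_def)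
    then show ?thesis using \<epsilon> by simp
  qed
  define \<Psi> where "\<Psi> y = (\<integral>z. \<phi> z * C (y + z) \<partial>lborel)" for y
  have \<phi>C: "integrable lborel (\<lambda>z. \<phi> (z + a) * C z)" for a
  proof (rule Bochner_Integration.integrable_bound)
    show "integrable lborel (\<lambda>z. \<phi> (z + a))" using integrable_affine[of \<phi> 1 a] \<phi>_int by (simp add: add.commute)
    show "AE z in lborel. norm (\<phi> (z + a) * C z) \<le> norm (\<phi> (z + a))"
      using C1 by (auto simp: norm_mult intro!: mult_left_le)
  qed measurable
  \<comment> \<open>The substitution moves the dependence on \<open>y\<close> onto the integrable
    \<open>\<phi>\<close>. Continuity then follows from that of translations in L1; the factor
    \<open>C\<close> only needs to be bounded.\<close>
  have \<Psi>_eq: "\<Psi> y = (\<integral>w. \<phi> (w + - y) * C w \<partial>lborel)" for y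
    unfolding \<Psi>_def using integral_affine[of "\<lambda>z. \<phi> (z + - y) * C z" 1 y] by simp
  have \<Psi>_cont: "continuous_on UNIV \<Psi>"
    unfolding continuous_on_sequentially
  proof (intro allI ballI impI, elim conjE)
    fix x :: "nat \<Rightarrow> 'a" and y assume "x \<longlonglongrightarrow> y"
    then have z: "(\<lambda>n. y - x n) \<longlonglongrightarrow> 0" using tendsto_diff[OF tendsto_const[of y], of x y] by simp
    have L: "(\<lambda>n. \<integral>\<^sup>+w. cmod (\<phi> (w + (y - x n)) - \<phi> w) \<partial>lborel) \<longlonglongrightarrow> 0"
      by (rule translation_continuous_L1[OF \<phi>_int z])
    have bound: "ennreal (cmod (\<Psi> (x n) - \<Psi> y)) \<le> (\<integral>\<^sup>+w. cmod (\<phi> (w + (y - x n)) - \<phi> w) \<partial>lborel)" for n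
    proof -
      have "\<Psi> (x n) - \<Psi> y = (\<integral>w. \<phi> (w + - x n) * C w - \<phi> (w + - y) * C w \<partial>lborel)"
        unfolding \<Psi>_eq by (rule Bochner_Integration.integral_diff[symmetric, OF \<phi>C \<phi>C])
      then have "ennreal (cmod (\<Psi> (x n) - \<Psi> y)) \<le> (\<integral>\<^sup>+w. cmod (\<phi> (w + - x n) * C w - \<phi> (w + - y) * C w) \<partial>lborel)"
        using integral_norm_bound_ennreal[OF Bochner_Integration.integrable_diff[OF \<phi>C[of "- x n"] \<phi>C[of "- y"]]] by simp
      also have "\<dots> \<le> (\<integral>\<^sup>+w. cmod (\<phi> (w + - x n) - \<phi> (w + - y)) \<partial>lborel)"
      proof (intro nn_integral_mono ennreal_leI)
        fix w
        have "cmod (\<phi> (w + - x n) * C w - \<phi> (w + - y) * C w) = cmod (\<phi> (w + - x n) - \<phi> (w + - y)) * cmod (C w)"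
          by (simp only: left_diff_distrib[symmetric] norm_mult)
        then show "cmod (\<phi> (w + - x n) * C w - \<phi> (w + - y) * C w) \<le> cmod (\<phi> (w + - x n) - \<phi> (w + - y))"
          using C1[of w] by (simp add: mult_left_le)
      qed
      also have "\<dots> = (\<integral>\<^sup>+w. cmod (\<phi> ((y + w) + - x n) - \<phi> ((y + w) + - y)) \<partial>lborel)"
        by (rule nn_integral_shift[symmetric]) measurable
      finally show ?thesis by (simp add: algebra_simps)
    qed
    have "(\<lambda>n. ennreal (cmod (\<Psi> (x n) - \<Psi> y))) \<longlonglongrightarrow> 0"
      by (rule tendsto_sandwich[OF _ _ tendsto_const L]) (auto intro!: always_eventually bound)
    then have "(\<lambda>n. cmod (\<Psi> (x n) - \<Psi> y)) \<longlonglongrightarrow> 0"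
      using tendsto_enn2real[of "\<lambda>n. ennreal (cmod (\<Psi> (x n) - \<Psi> y))" 0 sequentially] by simp
    then show "(\<Psi> \<circ> x) \<longlonglongrightarrow> \<Psi> y" by (simp add: comp_def tendsto_norm_zero_iff LIM_zero_iff)
  qed
  define \<Theta> where "\<Theta> y = \<Psi> y / of_real K" for y
  have \<Theta>_cont: "continuous_on UNIV \<Theta>" unfolding \<Theta>_def using K by (intro continuous_intros \<Psi>_cont) auto
  have \<Theta>\<theta>: "AE y in lborel. y \<in> D \<longrightarrow> \<Theta> y = \<theta> y"
    using AE2
  proof eventually_elim
    fix y assume ae: "AE z in lborel. y \<in> D \<and> z \<in> D \<longrightarrow> \<theta> y * \<theta> z = C (y + z)"
    show "y \<in> D \<longrightarrow> \<Theta> y = \<theta> y"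
    proof
      assume y: "y \<in> D"
      have "\<Psi> y = (\<integral>z. \<theta> y * indicator (ball (0::'a) \<epsilon>) z \<partial>lborel)"
        unfolding \<Psi>_def
      proof (rule integral_cong_AE)
        show "AE z in lborel. \<phi> z * C (y + z) = \<theta> y * indicator (ball 0 \<epsilon>) z"
          using ae \<theta>n
        proof eventually_elim
          fix z assume 1: "y \<in> D \<and> z \<in> D \<longrightarrow> \<theta> y * \<theta> z = C (y + z)" and 2: "z \<in> D \<longrightarrow> cmod (\<theta> z) = 1"
          show "\<phi> z * C (y + z) = \<theta> y * indicator (ball 0 \<epsilon>) z"
          proof (cases "z \<in> ball 0 \<epsilon>")
            case True
            then have z: "z \<in> D" using \<epsilon> by auto
            have "\<phi> z * C (y + z) = cnj (\<theta> z) * (\<theta> y * \<theta> z)" using True 1 y z by (simp add: \<phi>_def)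
            also have "\<dots> = \<theta> y * (\<theta> z * cnj (\<theta> z))" by (simp only: mult_ac)
            also have "\<theta> z * cnj (\<theta> z) = 1" using 2 z complex_norm_square[of "\<theta> z"] by simp
            finally show ?thesis using True by simp
          qed (simp add: \<phi>_def)
        qed
      qed measurable
      also have "\<dots> = \<theta> y * of_real K"
      proof -
        have "(\<integral>z. indicator (ball (0::'a) \<epsilon>) z \<partial>lborel) = complex_of_real K"
        proof -
          have "(\<integral>z. indicator (ball (0::'a) \<epsilon>) z \<partial>lborel) = (\<integral>z. complex_of_real (indicator (ball (0::'a) \<epsilon>) z) \<partial>lborel)"
            by (simp only: of_real_indicator)
          also have "\<dots> = complex_of_real (\<integral>z. indicator (ball (0::'a) \<epsilon>) z \<partial>lborel)"
            by (rule integral_complex_of_real)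
          finally show ?thesis unfolding K_def by simp
        qed
        then show ?thesis by simp
      qed
      finally show "\<Theta> y = \<theta> y" using K by (simp add: \<Theta>_def)
    qed
  qed
  have \<Theta>1: "cmod (\<Theta> x) = 1" if "x \<in> D" for x
  proof -
    have "x \<in> {x. cmod (\<Theta> x) = 1}"
    proof (rule open_AE_imp_all[OF D(1) _ _ that])
      show "closed {x. cmod (\<Theta> x) = 1}" by (intro closed_Collect_eq continuous_intros \<Theta>_cont)
      show "AE x in lborel. x \<in> D \<longrightarrow> x \<in> {x. cmod (\<Theta> x) = 1}" using \<Theta>\<theta> \<theta>n by eventually_elim auto
    qed
    then show ?thesis by simp
  qed
  have cont_refl: "continuous_on UNIV (\<lambda>y. \<Theta> (\<eta> - y))" "continuous_on UNIV (\<lambda>\<eta>. \<Theta> (\<eta> - y))" for \<eta> y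
  proof -
    show "continuous_on UNIV (\<lambda>y. \<Theta> (\<eta> - y))"
      by (rule continuous_on_compose2[OF \<Theta>_cont]) (auto intro!: continuous_intros)
    show "continuous_on UNIV (\<lambda>\<eta>. \<Theta> (\<eta> - y))"
      by (rule continuous_on_compose2[OF \<Theta>_cont]) (auto intro!: continuous_intros)
  qed
  have op: "open {\<eta>. \<eta> - y \<in> D}" for y
  proof -
    have "{\<eta>. \<eta> - y \<in> D} = (\<lambda>x. y + x) ` D" by (auto simp: image_iff intro!: bexI[of _ "_ - y"])
    then show ?thesis using D(1) by (simp add: open_translation)
  qed
  have D_minus: "x \<in> D \<Longrightarrow> - x \<in> D" for x using D(3)[of x "- x"] by simp
  have op': "open {y. \<eta> - y \<in> D}" for \<eta>
  proof -
    have "{y. \<eta> - y \<in> D} = {y. y - \<eta> \<in> D}" using D_minus by (metis minus_diff_eq)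
    then show ?thesis using op by simp
  qed
  \<comment> \<open>For fixed \<open>\<eta>\<close> both sides are continuous in \<open>y\<close>,
    so the identity extends to all admissible \<open>y\<close>. It is still restricted to almost
    every \<open>\<eta>\<close>, because \<open>C\<close> is merely measurable.\<close>
  have good: "AE \<eta> in lborel. \<forall>y. y \<in> D \<and> \<eta> - y \<in> D \<longrightarrow> \<Theta> y * \<Theta> (\<eta> - y) = C \<eta>"
    using AE1
  proof eventually_elim
    fix \<eta> assume ae: "AE y in lborel. y \<in> D \<and> \<eta> - y \<in> D \<longrightarrow> \<theta> y * \<theta> (\<eta> - y) = C \<eta>"
    have ae': "AE y in lborel. y \<in> D \<inter> {y. \<eta> - y \<in> D} \<longrightarrow> y \<in> {y. \<Theta> y * \<Theta> (\<eta> - y) = C \<eta>}"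
      using ae \<Theta>\<theta> AE_reflect[OF \<Theta>\<theta>, of \<eta>] by eventually_elim auto
    have cl: "closed {y. \<Theta> y * \<Theta> (\<eta> - y) = C \<eta>}" by (intro closed_Collect_eq continuous_intros \<Theta>_cont cont_refl)
    show "\<forall>y. y \<in> D \<and> \<eta> - y \<in> D \<longrightarrow> \<Theta> y * \<Theta> (\<eta> - y) = C \<eta>"
      using open_AE_imp_all[OF open_Int[OF D(1) op'] cl ae'] by auto
  qed
  \<comment> \<open>The splittings of \<open>\<eta>\<close> into y + (\<eta> - y) and into 0 +
    \<eta> both yield \<open>C \<eta>\<close>. Equating them eliminates \<open>C\<close>; what
    remains is continuous in \<open>\<eta>\<close> and hence holds everywhere on the open
    set.\<close>
  have fe: "\<Theta> y * \<Theta> z = \<Theta> 0 * \<Theta> (y + z)" if y: "y \<in> D" and z: "z \<in> D" and yz: "y + z \<in> D" for y z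
  proof -
    have "y + z \<in> {\<eta>. \<Theta> y * \<Theta> (\<eta> - y) = \<Theta> 0 * \<Theta> \<eta>}"
    proof (rule open_AE_imp_all[OF open_Int[OF D(1) op[of y]]])
      show "closed {\<eta>. \<Theta> y * \<Theta> (\<eta> - y) = \<Theta> 0 * \<Theta> \<eta>}" by (intro closed_Collect_eq continuous_intros \<Theta>_cont cont_refl)
      show "AE \<eta> in lborel. \<eta> \<in> D \<inter> {\<eta>. \<eta> - y \<in> D} \<longrightarrow> \<eta> \<in> {\<eta>. \<Theta> y * \<Theta> (\<eta> - y) = \<Theta> 0 * \<Theta> \<eta>}"
        using good
      proof eventually_elim
        fix \<eta> assume G: "\<forall>y. y \<in> D \<and> \<eta> - y \<in> D \<longrightarrow> \<Theta> y * \<Theta> (\<eta> - y) = C \<eta>"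
        show "\<eta> \<in> D \<inter> {\<eta>. \<eta> - y \<in> D} \<longrightarrow> \<eta> \<in> {\<eta>. \<Theta> y * \<Theta> (\<eta> - y) = \<Theta> 0 * \<Theta> \<eta>}"
          using G[rule_format, of y] G[rule_format, of 0] y D(2) by auto
      qed
      show "y + z \<in> D \<inter> {\<eta>. \<eta> - y \<in> D}" using z yz by simp
    qed
    then show ?thesis by simp
  qed
  have \<Theta>0: "cmod (\<Theta> 0) = 1" by (rule \<Theta>1[OF D(2)])
  then have \<Theta>00: "\<Theta> 0 \<noteq> 0" by auto
  obtain a where a: "\<And>x. x \<in> D \<Longrightarrow> \<Theta> x / \<Theta> 0 = cis (a \<bullet> x)"
  proof (rule continuous_character[OF D, where v = "\<lambda>x. \<Theta> x / \<Theta> 0"])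
    show "continuous_on UNIV (\<lambda>x. \<Theta> x / \<Theta> 0)" using \<Theta>00 by (intro continuous_intros \<Theta>_cont) auto
    show "\<Theta> (x + y) / \<Theta> 0 = \<Theta> x / \<Theta> 0 * (\<Theta> y / \<Theta> 0)" if "x \<in> D" "y \<in> D" "x + y \<in> D" for x y
      using fe[OF that] \<Theta>00 by (simp add: field_simps)
  qed (use \<Theta>0 \<Theta>00 \<Theta>1 in \<open>auto simp: norm_divide\<close>)
  obtain \<beta> where \<beta>: "\<Theta> 0 = cis \<beta>" using \<Theta>0 by (metis cis_Arg norm_zero sgn_eq zero_neq_one div_by_1 of_real_1)
  show ?thesis
  proof (rule that)
    show "AE x in lborel. g x = cis (\<beta> + a \<bullet> x) * cmod (g x)"
      using \<Theta>\<theta> gD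
    proof eventually_elim
      fix x assume 1: "x \<in> D \<longrightarrow> \<Theta> x = \<theta> x" and 2: "g x \<noteq> 0 \<longleftrightarrow> x \<in> D"
      show "g x = cis (\<beta> + a \<bullet> x) * cmod (g x)"
      proof (cases "g x = 0")
        case False
        then have "x \<in> D" using 2 by simp
        then have "\<theta> x = \<Theta> 0 * cis (a \<bullet> x)" using 1 a[of x] \<Theta>00 by (simp add: field_simps)
        then have "\<theta> x = cis (\<beta> + a \<bullet> x)" by (simp add: \<beta> cis_mult)
        moreover have "g x = \<theta> x * cmod (g x)" using False by (simp add: \<theta>_def sgn_div_norm scaleR_conv_of_real)
        ultimately show ?thesis by simp
      qed simp
    qed
  qed
qed

section \<open>Inverse transforms of radial functions\<close>

text \<open>On each line in direction \<open>e\<close> the reflection is s -> -s.\<close>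

lemma nn_integral_hyperplane_reflection:
  assumes [measurable]: "F \<in> borel_measurable borel" and e: "norm (e::'a::euclidean_space) = 1"
  shows "(\<integral>\<^sup>+x. F (x - (2 * (x \<bullet> e)) *\<^sub>R e) \<partial>lborel) = (\<integral>\<^sup>+x. F x \<partial>lborel)"
proof -
  have *: "hproj e y + s *\<^sub>R e - (2 * ((hproj e y + s *\<^sub>R e) \<bullet> e)) *\<^sub>R e = hproj e y + (0 - s) *\<^sub>R e" for y s
    unfolding hproj_line(1)[OF e] by (simp add: scaleR_left_diff_distrib[symmetric] algebra_simps)
      (simp add: scaleR_2[symmetric])
  have "(\<integral>\<^sup>+x. F (x - (2 * (x \<bullet> e)) *\<^sub>R e) \<partial>lborel)
      = (\<integral>\<^sup>+y. indicator {0<..<1} (y \<bullet> e) * (\<integral>\<^sup>+s. F (hproj e y + (0 - s) *\<^sub>R e) \<partial>lborel) \<partial>lborel)"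
    by (subst nn_integral_lines[OF _ e]) (simp_all only: *, measurable)
  also have "\<dots> = (\<integral>\<^sup>+y. indicator {0<..<1} (y \<bullet> e) * (\<integral>\<^sup>+s. F (hproj e y + s *\<^sub>R e) \<partial>lborel) \<partial>lborel)"
    by (subst nn_integral_reflect[where f="\<lambda>s. F (hproj e y + s *\<^sub>R e)" for y]) auto
  also have "\<dots> = (\<integral>\<^sup>+x. F x \<partial>lborel)" by (rule nn_integral_lines[OF _ e, symmetric]) measurable
  finally show ?thesis .
qed

lemma integral_hyperplane_reflection:
  fixes F :: "'a::euclidean_space \<Rightarrow> complex"
  assumes [measurable]: "F \<in> borel_measurable borel" and e: "norm e = 1"
  shows "(\<integral>x. F (x - (2 * (x \<bullet> e)) *\<^sub>R e) \<partial>lborel) = (\<integral>x. F x \<partial>lborel)"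
proof -
  have "distr lborel borel (\<lambda>x::'a. x - (2 * (x \<bullet> e)) *\<^sub>R e) = lborel"
  proof (rule measure_eqI)
    fix A :: "'a set" assume "A \<in> sets (distr lborel borel (\<lambda>x. x - (2 * (x \<bullet> e)) *\<^sub>R e))"
    then have [measurable]: "A \<in> sets borel" by simp
    have "emeasure (distr lborel borel (\<lambda>x. x - (2 * (x \<bullet> e)) *\<^sub>R e)) A
        = (\<integral>\<^sup>+x. indicator A x \<partial>distr lborel borel (\<lambda>x. x - (2 * (x \<bullet> e)) *\<^sub>R e))" by simp
    also have "\<dots> = (\<integral>\<^sup>+x. indicator A (x - (2 * (x \<bullet> e)) *\<^sub>R e) \<partial>lborel)" by (rule nn_integral_distr) measurable
    also have "\<dots> = (\<integral>\<^sup>+x. indicator A x \<partial>lborel)" by (rule nn_integral_hyperplane_reflection[OF _ e]) measurable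
    finally show "emeasure (distr lborel borel (\<lambda>x. x - (2 * (x \<bullet> e)) *\<^sub>R e)) A = emeasure lborel A" by simp
  qed simp
  then have "(\<integral>x. F x \<partial>lborel) = (\<integral>x. F x \<partial>distr lborel borel (\<lambda>x::'a. x - (2 * (x \<bullet> e)) *\<^sub>R e))" by simp
  also have "\<dots> = (\<integral>x. F (x - (2 * (x \<bullet> e)) *\<^sub>R e) \<partial>lborel)" by (rule integral_distr) measurable
  finally show ?thesis by simp
qed

text \<open>Points of equal norm are exchanged by the reflection in the hyperplane between them.\<close>

lemma ift_radial:
  fixes h :: "'a::euclidean_space \<Rightarrow> complex"
  assumes [measurable]: "h \<in> borel_measurable borel" and h: "\<And>\<xi> \<eta>. norm \<xi> = norm \<eta> \<Longrightarrow> h \<xi> = h \<eta>"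
    and xy: "norm x = norm y"
  shows "ift h x = ift h y"
proof (cases "x = y")
  case False
  define e where "e = (x - y) /\<^sub>R norm (x - y)"
  have e: "norm e = 1" using False by (simp add: e_def)
  then have ee: "e \<bullet> e = 1" by (simp add: norm_eq_1)
  let ?R = "\<lambda>\<xi>. \<xi> - (2 * (\<xi> \<bullet> e)) *\<^sub>R e"
  have norm_R: "norm (?R \<xi>) = norm \<xi>" for \<xi>
  proof -
    have "?R \<xi> \<bullet> ?R \<xi> = \<xi> \<bullet> \<xi>" using ee by (simp add: inner_diff_left inner_diff_right inner_commute algebra_simps)
    then show ?thesis by (simp add: norm_eq_sqrt_inner)
  qed
  have "?R x = y"
  proof -
    have xx: "x \<bullet> x = y \<bullet> y" using xy by (simp add: norm_eq_sqrt_inner)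
    have n: "(norm (x - y))\<^sup>2 = 2 * (x \<bullet> (x - y))"
      unfolding power2_norm_eq_inner by (simp add: inner_diff_left inner_diff_right inner_commute xx)
    have "(2 * (x \<bullet> e)) *\<^sub>R e = (2 * (x \<bullet> (x - y)) / (norm (x - y))\<^sup>2) *\<^sub>R (x - y)"
      by (simp add: e_def power2_eq_square divide_inverse)
    also have "\<dots> = x - y" unfolding n[symmetric] using False by simp
    finally show ?thesis by simp
  qed
  then have in_R: "x \<bullet> ?R \<xi> = y \<bullet> \<xi>" for \<xi>
  proof -
    have "x \<bullet> ?R \<xi> = ?R x \<bullet> \<xi>" by (simp add: inner_diff_left inner_diff_right inner_commute[of e \<xi>])
    then show ?thesis unfolding \<open>?R x = y\<close> .
  qed
  have "ift h x = (\<integral>\<xi>. cis (2 * pi * (x \<bullet> ?R \<xi>)) * h (?R \<xi>) \<partial>lborel)"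
    unfolding ift_def by (rule integral_hyperplane_reflection[OF _ e, symmetric]) measurable
  also have "\<dots> = ift h y" unfolding in_R ift_def using h[OF norm_R] by simp
  finally show ?thesis .
qed simp

text \<open>For real \<open>h\<close> conjugation changes \<open>x\<close> to \<open>- x\<close>, a
  point of the same norm.\<close>

lemma ift_real:
  fixes h :: "'a::euclidean_space \<Rightarrow> complex"
  assumes [measurable]: "h \<in> borel_measurable borel" and h: "\<And>\<xi> \<eta>. norm \<xi> = norm \<eta> \<Longrightarrow> h \<xi> = h \<eta>"
    and hr: "\<And>\<xi>. h \<xi> \<in> \<real>"
  shows "ift h x \<in> \<real>"
proof -
  have "cnj (ift h x) = (\<integral>\<xi>. cnj (cis (2 * pi * (x \<bullet> \<xi>)) * h \<xi>) \<partial>lborel)"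
    unfolding ift_def by (rule Bochner_Integration.integral_cnj[symmetric])
  also have "\<dots> = ift h (- x)"
  proof -
    have "cnj (h \<xi>) = h \<xi>" for \<xi> using hr[of \<xi>] Reals_cnj_iff by blast
    then show ?thesis unfolding ift_def by (simp add: cis_cnj)
  qed
  also have "\<dots> = ift h x" by (rule ift_radial[OF assms(1) h]) auto
  finally show ?thesis using Reals_cnj_iff by blast
qed

lemma ift_truncate_tendsto:
  fixes q h :: "(real, 'n::finite) vec \<Rightarrow> complex"
  assumes qh: "is_fourier q h" and h[measurable]: "h \<in> borel_measurable borel"
  shows "ift (truncate (real n) h) \<in> L2_fun"
    and "(\<lambda>n. L2_nrm (\<lambda>x. ift (truncate (real n) h) x - q x)) \<longlonglongrightarrow> 0"
proof -
  have hL: "h \<in> L2_fun" using is_fourier_L2(2)[OF qh] .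
  have F: "is_fourier (ift (truncate (real n) h)) (truncate (real n) h)" for n
    by (rule is_fourier_ift[OF truncate_measurable[OF h] L2_fun_truncate[OF h hL] integrable_truncate[OF h]])
  show "ift (truncate (real n) h) \<in> L2_fun" using is_fourier_L2(1)[OF F] .
  show "(\<lambda>n. L2_nrm (\<lambda>x. ift (truncate (real n) h) x - q x)) \<longlonglongrightarrow> 0"
    using truncate_tendsto_L2[OF h hL] unfolding is_fourier_isometry[OF is_fourier_diff[OF F qh]] .
qed

text \<open>Truncation preserves dependence on the norm alone, so the inverse integral transforms of
  the truncations are radial and real at every point. Both properties survive the almost everywhere
  limit along a subsequence; the profile is read off on the ray through one unit vector.\<close>

lemma is_fourier_radial_real:
  fixes q h :: "(real, 'n::finite) vec \<Rightarrow> complex"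
  assumes qh: "is_fourier q h" and [measurable]: "h \<in> borel_measurable borel"
    and h: "\<And>\<xi> \<eta>. norm \<xi> = norm \<eta> \<Longrightarrow> h \<xi> = h \<eta>" and hr: "\<And>\<xi>. h \<xi> \<in> \<real>"
  obtains \<phi> where "AE x in lebesgue. q x = \<phi> (norm x) \<and> q x \<in> \<real>"
proof -
  note m = truncate_measurable[OF assms(2)]
  let ?F = "\<lambda>n. ift (truncate (real n) h)"
  have trunc: "truncate (real n) h \<xi> = truncate (real n) h \<eta>" if "norm \<xi> = norm \<eta>" for n \<xi> \<eta>
    unfolding truncate_def h[OF that] that ..
  have rad: "?F n x = ?F n y" if "norm x = norm y" for n x y
    by (rule ift_radial[OF m trunc that])
  have re: "?F n x \<in> \<real>" for n x
    by (rule ift_real[OF m trunc]) (simp_all add: truncate_def hr)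
  obtain r :: "nat \<Rightarrow> nat" where r: "AE x in lebesgue. (\<lambda>n. ?F (r n) x) \<longlonglongrightarrow> q x"
    using L2_tendsto_AE_subseq[OF ift_truncate_tendsto(1)[OF qh assms(2)] is_fourier_L2(1)[OF qh] ift_truncate_tendsto(2)[OF qh assms(2)]]
    by blast
  obtain e :: "(real, 'n) vec" where e: "norm e = 1" using vector_choose_size[of 1] by auto
  show ?thesis
  proof (rule that[of "\<lambda>\<rho>. lim (\<lambda>n. ?F (r n) (\<rho> *\<^sub>R e))"])
    show "AE x in lebesgue. q x = lim (\<lambda>n. ?F (r n) (norm x *\<^sub>R e)) \<and> q x \<in> \<real>"
      using r
    proof eventually_elim
      fix x assume *: "(\<lambda>n. ?F (r n) x) \<longlonglongrightarrow> q x"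
      have "?F (r n) (norm x *\<^sub>R e) = ?F (r n) x" for n by (rule rad) (simp add: e)
      then show "q x = lim (\<lambda>n. ?F (r n) (norm x *\<^sub>R e)) \<and> q x \<in> \<real>"
        using limI[OF *] closed_sequentially[OF closed_complex_Reals _ *] re by simp
    qed
  qed
qed

text \<open>The factor has modulus 1, so truncation cuts both functions at the same points and
  commutes with modulation. For the truncations the identity holds exactly, and a common subsequence
  carries it to the limit.\<close>

lemma is_fourier_modulate:
  fixes q h w :: "(real, 'n::finite) vec \<Rightarrow> complex"
  assumes qh: "is_fourier q h" and h[measurable]: "h \<in> borel_measurable borel"
    and w: "is_fourier w (\<lambda>\<xi>. c * cis (2 * pi * (v \<bullet> \<xi>)) * h \<xi>)" and c: "cmod c = 1"
  shows "AE x in lebesgue. w x = c * q (x + v)"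
proof -
  let ?m = "\<lambda>\<xi>. c * cis (2 * pi * (v \<bullet> \<xi>)) * h \<xi>"
  have m: "?m \<in> borel_measurable borel" by measurable
  have ift_m: "ift (truncate (real n) ?m) x = c * ift (truncate (real n) h) (x + v)" for n x
  proof -
    have "truncate (real n) ?m \<xi> = c * cis (2 * pi * (v \<bullet> \<xi>)) * truncate (real n) h \<xi>" for \<xi>
      using c by (simp add: truncate_def norm_mult)
    then have "ift (truncate (real n) ?m) x = (\<integral>\<xi>. c * (cis (2 * pi * ((x + v) \<bullet> \<xi>)) * truncate (real n) h \<xi>) \<partial>lborel)"
      unfolding ift_def by (intro Bochner_Integration.integral_cong) (simp_all add: inner_add_left distrib_left cis_mult[symmetric])
    then show ?thesis by (simp add: ift_def)
  qed
  obtain r where r: "strict_mono r" "AE x in lebesgue. (\<lambda>n. ift (truncate (real (r n)) h) x) \<longlonglongrightarrow> q x"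
    using L2_tendsto_AE_subseq[OF ift_truncate_tendsto(1)[OF qh h] is_fourier_L2(1)[OF qh] ift_truncate_tendsto(2)[OF qh h]] by blast
  obtain s where s: "strict_mono s" "AE x in lebesgue. (\<lambda>n. ift (truncate (real (r (s n))) ?m) x) \<longlonglongrightarrow> w x"
    using L2_tendsto_AE_subseq[OF ift_truncate_tendsto(1)[OF w m] is_fourier_L2(1)[OF w]
      LIMSEQ_subseq_LIMSEQ[OF ift_truncate_tendsto(2)[OF w m] r(1), unfolded comp_def]] by blast
  have "AE x in lborel. (\<lambda>n. ift (truncate (real (r n)) h) x) \<longlonglongrightarrow> q x" using r(2) by (simp add: AE_completion_iff)
  then have "AE x in lebesgue. (\<lambda>n. ift (truncate (real (r n)) h) (x + v)) \<longlonglongrightarrow> q (x + v)"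
    unfolding AE_completion_iff by (rule AE_translate)
  then show ?thesis using s(2)
  proof eventually_elim
    fix x assume 1: "(\<lambda>n. ift (truncate (real (r n)) h) (x + v)) \<longlonglongrightarrow> q (x + v)"
      and 2: "(\<lambda>n. ift (truncate (real (r (s n))) ?m) x) \<longlonglongrightarrow> w x"
    have "(\<lambda>n. c * ift (truncate (real (r (s n))) h) (x + v)) \<longlonglongrightarrow> c * q (x + v)"
      using LIMSEQ_subseq_LIMSEQ[OF 1 s(1)] by (intro tendsto_mult_left) (simp add: comp_def)
    with 2 show "w x = c * q (x + v)" unfolding ift_m by (rule LIMSEQ_unique)
  qed
qed

theorem theorem4:
  fixes \<alpha> :: real and Q :: "(real, 'n::finite) vec \<Rightarrow> complex"
  assumes "\<alpha> > 0" and "maximizer \<alpha> Q"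
  shows "\<exists>(\<beta> :: real) (x0 :: (real, 'n) vec).
           (AE x in lebesgue. Q x = cis \<beta> * fourier_rearr Q (x - x0)) \<and>
           radially_symmetric (\<lambda>x. cis (- \<beta>) * Q (x + x0)) \<and>
           real_valued (\<lambda>x. cis (- \<beta>) * Q (x + x0))"
proof -
  have QL: "Q \<in> L2_fun" using assms(2) by (simp add: maximizer_def admissible_def sobolev_def)
  note FQ = is_fourier_fourier[OF QL]
  note GL = is_fourier_L2(2)[OF FQ]
  obtain g :: "(real, 'n) vec \<Rightarrow> complex" where g[measurable]: "g \<in> borel_measurable borel"
    and Gg: "AE x in lebesgue. fourier Q x = g x" using L2_borel_rep[OF L2_funD[OF GL]] by blast
  have gL: "g \<in> L2_fun" by (rule L2_fun_cong_AE_borel[OF GL g Gg])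
  have Qg: "is_fourier Q g" by (rule is_fourier_cong_AE[OF FQ QL gL _ Gg]) simp
  note st = maximizer_steiner[OF assms Qg g]
  note rprems = g L2_fun_l2sq[OF gL] L2_funD[OF GL] Gg
  let ?r = "\<lambda>t. ball_radius TYPE((real, 'n) vec) (emeasure lborel {y. ennreal t < enorm g y})"
  \<comment> \<open>The rearrangement agrees with |g| almost everywhere but depends on the norm at
    every point, as the transform of a radial function requires.\<close>
  define h where "h = rearr (fourier Q)"
  have hg: "AE x in lborel. h x = cmod (g x)" unfolding h_def by (rule rearr_steiner_invariant[OF rprems st])
  have h[measurable]: "h \<in> borel_measurable borel" unfolding h_def by (rule rearr_measurable[OF rprems])
  have hrad: "norm x = norm y \<Longrightarrow> h x = h y" for x y unfolding h_def by (rule rearr_radial[OF rprems])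
  have phase: "\<exists>\<beta> a. AE x in lborel. g x = cis (\<beta> + a \<bullet> x) * cmod (g x)"
  proof -
    \<comment> \<open>The superlevel balls at the heights 1 / (n + 1) exhaust the set where
      \<open>g\<close> does not vanish, up to a null set; their union is open and contains with each
      point all points of smaller norm.\<close>
    define D where "D = (\<Union>n. ball (0::(real, 'n) vec) (?r (1 / real (Suc n))))"
    have "AE x in lborel. x \<in> ball 0 (?r (1 / real (Suc n))) \<longleftrightarrow> ennreal (1 / real (Suc n)) < enorm g x" for n
      by (rule steiner_invariant_level_ball[OF _ st level_finite[OF rprems]]) auto
    then have "AE x in lborel. \<forall>n. x \<in> ball 0 (?r (1 / real (Suc n))) \<longleftrightarrow> ennreal (1 / real (Suc n)) < enorm g x"
      by (simp only: AE_all_countable) blast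
    then have gD: "AE x in lborel. g x \<noteq> 0 \<longleftrightarrow> x \<in> D"
    proof eventually_elim
      fix x assume *: "\<forall>n. x \<in> ball 0 (?r (1 / real (Suc n))) \<longleftrightarrow> ennreal (1 / real (Suc n)) < enorm g x"
      have "g x \<noteq> 0 \<longleftrightarrow> (\<exists>n. 1 / real (Suc n) < cmod (g x))"
        using nat_approx_posE[of "cmod (g x)"] by (metis norm_zero of_nat_0_le_iff zero_less_norm_iff divide_nonneg_nonneg zero_le_one not_less)
      also have "\<dots> \<longleftrightarrow> x \<in> D" using * by (auto simp: D_def enorm_def ennreal_less_iff)
      finally show "g x \<noteq> 0 \<longleftrightarrow> x \<in> D" .
    qed
    show ?thesis
    proof (cases "D = {}")
      \<comment> \<open>Here \<open>g\<close> vanishes almost everywhere and any phase will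
        do.\<close>
      case True
      have "AE x in lborel. g x = cis (0 + 0 \<bullet> x) * cmod (g x)" using gD True by (auto elim!: eventually_mono)
      then show ?thesis by blast
    next
      case False
      have oD: "open D" unfolding D_def by auto
      have D_down: "y \<in> D" if "x \<in> D" "norm y \<le> norm x" for x y
        using that unfolding D_def by (auto intro: le_less_trans)
      have "0 \<in> D" using False D_down by (metis all_not_in_conv norm_ge_zero norm_zero)
      have "(\<integral>\<^sup>+x. (conv_pow (enorm g) 1 x)\<^sup>2 \<partial>lborel) < \<infinity>"
        by (rule conv_pow_finite[OF g maximizer_hsq(2)[OF assms Qg g]])
      then have "AE x in lborel. (conv_pow (enorm g) 1 x)\<^sup>2 \<noteq> \<infinity>" by (intro nn_integral_PInf_AE) auto
      then have fin: "AE x in lborel. conv (enorm g) (enorm g) x < \<infinity>"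
        by eventually_elim (auto simp: power2_eq_square ennreal_mult_eq_top_iff less_top[symmetric])
      show ?thesis
        by (rule phase_is_linear[OF g oD \<open>0 \<in> D\<close> _ gD fin maximizer_self_conv[OF assms Qg g]]) (use D_down in blast)+
    qed
  qed
  then obtain \<beta> a where ph: "AE x in lborel. g x = cis (\<beta> + a \<bullet> x) * cmod (g x)" by blast
  \<comment> \<open>The linear phase \<open>a \<bullet> x\<close> is rewritten as a frequency
    modulation, which is a translation of the function; the resulting center is
    \<open>x0 = - v\<close>.\<close>
  define v where "v = (1 / (2 * pi)) *\<^sub>R a"
  have a: "a \<bullet> x = 2 * pi * (v \<bullet> x)" for x by (simp add: v_def)
  have gm: "AE \<xi> in lebesgue. g \<xi> = cis \<beta> * cis (2 * pi * (v \<bullet> \<xi>)) * complex_of_real (h \<xi>)"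
    using ph hg by (auto simp: AE_completion_iff a cis_mult elim!: eventually_elim2)
  define q where "q = fourier_rearr Q"
  have "l2sq (\<lambda>\<xi>. complex_of_real (h \<xi>)) = l2sq g"
    using hg unfolding l2sq_lborel by (intro nn_integral_cong_AE) (auto elim!: eventually_mono)
  then have hL: "(\<lambda>\<xi>. complex_of_real (h \<xi>)) \<in> L2_fun" using L2_fun_l2sq[OF gL] by (intro L2_fun_borelI) auto
  have qh: "is_fourier q (\<lambda>\<xi>. complex_of_real (h \<xi>))"
    unfolding q_def fourier_rearr_def h_def[symmetric] by (rule is_fourier_fourier_inv[OF hL])
  have mL: "(\<lambda>\<xi>. cis \<beta> * cis (2 * pi * (v \<bullet> \<xi>)) * complex_of_real (h \<xi>)) \<in> L2_fun"
    by (rule L2_fun_cong_AE_borel[OF gL _ gm]) measurable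
  have "is_fourier Q (\<lambda>\<xi>. cis \<beta> * cis (2 * pi * (v \<bullet> \<xi>)) * complex_of_real (h \<xi>))"
    by (rule is_fourier_cong_AE[OF Qg QL mL _ gm]) simp
  from is_fourier_modulate[OF qh _ this] have Qq: "AE x in lebesgue. Q x = cis \<beta> * q (x + v)" by simp
  have "AE x in lborel. Q x = cis \<beta> * q (x + v)" using Qq by (simp add: AE_completion_iff)
  from AE_translate[OF this, of "- v"] have "AE x in lebesgue. Q (x + - v) = cis \<beta> * q x"
    by (simp add: AE_completion_iff)
  then have qQ: "AE x in lebesgue. cis (- \<beta>) * Q (x + - v) = q x"
    by (rule eventually_mono) (simp add: mult.assoc[symmetric] cis_mult)
  obtain \<phi> where \<phi>: "AE x in lebesgue. q x = \<phi> (norm x) \<and> q x \<in> \<real>"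
  proof (rule is_fourier_radial_real[OF qh])
    show "complex_of_real (h \<xi>) = complex_of_real (h \<eta>)" if "norm \<xi> = norm \<eta>" for \<xi> \<eta> using hrad[OF that] by simp
  qed (measurable, auto)
  show ?thesis
  proof (intro exI conjI)
    show "AE x in lebesgue. Q x = cis \<beta> * fourier_rearr Q (x - - v)" using Qq by (simp add: q_def)
    show "radially_symmetric (\<lambda>x. cis (- \<beta>) * Q (x + - v))"
      unfolding radially_symmetric_def using qQ \<phi> by (intro exI[of _ \<phi>]) (auto elim!: eventually_elim2)
    show "real_valued (\<lambda>x. cis (- \<beta>) * Q (x + - v))"
      unfolding real_valued_def using qQ \<phi> by (auto elim!: eventually_elim2)
  qed
qed

end
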